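(* Let $t\in[0,T]$ and $m\in\mathcal M$, and let $(\mathbf m^*,\mathbf u^* )\in\mathcal U^{s}_{m}[t,T]$ be the optimal pair given by the feedback law, i.e. $\mathbf m^*$ is the pathwise unique $\mathcal M$-valued solution of $$d\mathbf m^*(s)=\mathbf f\big(\mathbf m^*(s),\bar{\mathbf u}(s,\mathbf m^*(s))\big)\,ds+\nu\,\boldsymbol\sigma(\mathbf m^*(s))\circ d\mathbf W(s)\quad(t<s\le T),\qquad \mathbf m^*(t)=m,$$ and $\mathbf u^*(s)=\bar{\mathbf u}(s,\mathbf m^*(s))$, with $$\bar{\mathbf u}(s,m)=\frac{C_{\rm ext}}{\lambda}\Big(m\times\nabla_{\mathcal M}W(s,m)-\alpha\,\nabla_{\mathcal M}W(s,m)\Big).$$ Then $(\mathbf m^*,\mathbf u^* )$ is the unique minimizer of $\mathcal J\big(t,m;(\cdot,\cdot)\big)$ over $\mathcal U^{s}_{m}[t,T]$, in the sense that if there exists any other optimal pair $(\mathbf m_1^*,\mathbf u_1^* )\in\mathcal U^{s}_{m}[t,T]$, then $\mathbf m^*(s)=\mathbf m_1^*(s)$ and $\mathbf u^*(s)=\mathbf u_1^*(s)$ for a.e. $s\in[t,T]$, $\mathbb P$-a.s.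
   Context: Let $N\in\mathbb N$, $T>0$, $\lambda>0$, $\nu\ge 0$, $\alpha\ge 0$, $\delta\ge 0$, and let $C_{\rm ext}$ be a real constant. Let $\mathcal M=(\mathbb S^2)^N\subset(\mathbb R^3)^N$ with the product Riemannian metric induced from $(\mathbb R^3)^N$; $\Delta_{\mathcal M}$ is the Laplace-Beltrami operator and $\nabla_{\mathcal M}$ the tangential gradient in the space variable, regarded as a vector in $T_m\mathcal M\subset(\mathbb R^3)^N$. Cross products of elements of $(\mathbb R^3)^N$ are taken componentwise: $(a\times b)_i=a_i\times b_i$, $i=1,\dots,N$. Let $\mathbf J\in\mathbb R^{3N\times 3N}$ be symmetric positive semi-definite, $\mathbf D\in\mathbb R^{3N\times 3N}$ diagonal, and $\mathbf Q=\mathbf J+\mathbf D$. Let $\boldsymbol\sigma(m)\in\mathbb R^{3N\times3N}$ be the matrix with $\boldsymbol\sigma(m)v=m\times v$, $\boldsymbol\Sigma(m)=(\mathbf{Id}-\alpha\boldsymbol\sigma(m))\boldsymbol\sigma(m)$, and $$\mathbf f(m,u)=\boldsymbol\Sigma(m)\big(-\mathbf Qm+C_{\rm ext}u\big)\quad (m\in\mathcal M,\ u\in(\mathbb R^3)^N).$$ Let $h\in C^2(\mathcal M;\mathbb R)$ and $\widetilde{\mathbf m}\in C^2([0,T];\mathcal M)$ be given. State equation. Fix a filtered probability space $(\Omega,\mathcal F,\{\mathcal F_s\},\mathbb P)$ satisfying the usual conditions and on it an $(\mathbb R^3)^N$-valued $\{\mathcal F_s\}$-adapted Wiener process $\mathbf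 W$. For $t\in[0,T]$, $m\in\mathcal M$ and $\mathbf u\in L^2_{\{\mathcal F_s\}}(\Omega;L^2(t,T;(\mathbb R^3)^N))$ (adapted, square-integrable controls) consider the Stratonovich SDE (stochastic Landau-Lifschitz-Gilbert equation) $$d\mathbf m(s)=\mathbf f(\mathbf m(s),\mathbf u(s))\,ds+\nu\,\boldsymbol\sigma(\mathbf m(s))\circ d\mathbf W(s)\quad(t<s\le T),\qquad \mathbf m(t)=m,$$ which has a unique strong solution, with values in $\mathcal M$. The set $\mathcal U^{s}_{m}[t,T]$ of admissible pairs consists of all $(\mathbf m,\mathbf u)$ with such $\mathbf u$ and $\mathbf m$ the corresponding unique $\{\mathcal F_s\}$-adapted $\mathcal M$-valued strong solution on the given filtered probability space. Cost functional: $$\mathcal J\big(t,m;(\mathbf m,\mathbf u)\big)=\mathbb E\Big[\int_t^T\Big(\delta\|\mathbf m(r)-\widetilde{\mathbf m}(r)\|^2_{(\mathbb R^3)^N}+\frac\lambda2\|\mathbf u(r)\|^2_{(\mathbb R^3)^N}\Big)dr+h(\mathbf m(T))\Big].$$ An optimal pair is an element of $\mathcal U^{s}_{m}[t,T]$ at which $\mathcal J(t,m;\cdot)$ attains its infimum over $\mathcal U^{s}_{m}[t,T]$. $W\in C^{1,2}([0,T]\times\mathcal M)$ denotes the unique classical solution of the Hamilton-Jacobi-Bellman equation $$-\partial_t W+\mathcal H W=0\ \text{ in }[0,T)\times\mathcal M,\qquad W(T,\cdot)=h\ \text{ on }\mathcal M,$$ where, for $\psi\in C^2(\mathcal M)$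 (at time $t$), $$\mathcal H\psi(m)=-\frac{\nu^2}{2}\Delta_{\mathcal M}\psi(m)-\delta\|m-\widetilde{\mathbf m}(t)\|^2_{(\mathbb R^3)^N}+\sup_{u\in(\mathbb R^3)^N}\Big(-\mathbf f(m,u)\cdot\nabla_{\mathcal M}\psi(m)-\frac\lambda2\|u\|^2_{(\mathbb R^3)^N}\Big).$$ $W$ coincides with the value function $(t,m)\mapsto\inf_{(\mathbf m,\mathbf u)\in\mathcal U^{s}_{m}[t,T]}\mathcal J(t,m;(\mathbf m,\mathbf u))$. *)

theory Defs
  imports "HOL-Probability.Probability"
begin

section \<open>Spin configurations\<close>

text \<open>
  Both \<open>(R^3)^N\<close> and \<open>R^(3N)\<close> are the type \<open>real ^ ('n \<times> 3)\<close> with \<open>N = CARD('n)\<close>;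
  the coordinate \<open>(i, k)\<close> is the \<open>k\<close>-th component of the \<open>i\<close>-th spin.
\<close>

type_synonym 'n spins = "(real, 'n \<times> 3) vec"
type_synonym 'n spin_mat = "((real, 'n \<times> 3) vec, 'n \<times> 3) vec"

definition spin :: "'n::finite spins \<Rightarrow> 'n \<Rightarrow> real ^ 3" where
  "spin m i = (\<chi> k. m $ (i, k))"

definition cprod :: "'n::finite spins \<Rightarrow> 'n spins \<Rightarrow> 'n spins" where
  "cprod a b = (\<chi> p. cross3 (spin a (fst p)) (spin b (fst p)) $ snd p)"

definition sphere_prod :: "'n::finite spins set" where
  "sphere_prod = {m. \<forall>i. norm (spin m i) = 1}"

definition sigma_mat :: "'n::finite spins \<Rightarrow> 'n spin_mat" where
  "sigma_mat m = matrix (cprod m)"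

lemma sigma_mat_mult: "sigma_mat m *v v = cprod m v"
proof -
  have "linear (cprod m)"
    by (rule linearI)
      (simp_all add: cprod_def spin_def vec_eq_iff cross3_def vector_def algebra_simps)
  then show ?thesis
    by (simp add: sigma_mat_def)
qed

definition Sigma_mat :: "real \<Rightarrow> 'n::finite spins \<Rightarrow> 'n spin_mat" where
  "Sigma_mat \<alpha> m = (mat 1 - \<alpha> *\<^sub>R sigma_mat m) ** sigma_mat m"

definition llg_drift ::
  "real \<Rightarrow> real \<Rightarrow> 'n::finite spin_mat \<Rightarrow> 'n spins \<Rightarrow> 'n spins \<Rightarrow> 'n spins" where
  "llg_drift \<alpha> Cext Q m u = Sigma_mat \<alpha> m *v (- (Q *v m) + Cext *\<^sub>R u)"

definition symmetric_psd :: "real ^ 'k ^ 'k \<Rightarrow> bool" where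
  "symmetric_psd A \<longleftrightarrow> transpose A = A \<and> (\<forall>x. 0 \<le> x \<bullet> (A *v x))"

definition diagonal_mat :: "real ^ 'k ^ 'k \<Rightarrow> bool" where
  "diagonal_mat A \<longleftrightarrow> (\<forall>p q. p \<noteq> q \<longrightarrow> A $ p $ q = 0)"


section \<open>Calculus on the product of spheres\<close>

definition tangent_space :: "'n::finite spins \<Rightarrow> 'n spins set" where
  "tangent_space m = {v. \<forall>i. spin v i \<bullet> spin m i = 0}"

text \<open>
  A derivative within the submanifold only sees the values of \<open>\<psi>\<close> on it. It is determined by its
  restriction to the tangent space, so the tangential gradient is its representative there
  (the Riemannian gradient for the induced metric).
\<close>

definition mgrad :: "('n::finite spins \<Rightarrow> real) \<Rightarrow> 'n spins \<Rightarrow> 'n spins" where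
  "mgrad \<psi> m =
    (THE g. g \<in> tangent_space m \<and> (\<psi> has_derivative (\<lambda>v. g \<bullet> v)) (at m within sphere_prod))"

text \<open>
  The Riemannian divergence of a tangent vector field \<open>X\<close> is the trace over the tangent space of the
  covariant derivative. The latter is the tangential projection of the ambient derivative, so the
  trace is the sum over \<open>p\<close> of the \<open>p\<close>-th component of the tangential gradient of the
  \<open>p\<close>-th component of \<open>X\<close>.
\<close>

definition mdiv :: "('n::finite spins \<Rightarrow> 'n spins) \<Rightarrow> 'n spins \<Rightarrow> real" where
  "mdiv X m = (\<Sum>p\<in>UNIV. mgrad (\<lambda>x. X x $ p) m $ p)"

definition laplace_beltrami :: "('n::finite spins \<Rightarrow> real) \<Rightarrow> 'n spins \<Rightarrow> real" where
  "laplace_beltrami \<psi> m = mdiv (mgrad \<psi>) m"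

definition twice_differentiable_M :: "('n::finite spins \<Rightarrow> real) \<Rightarrow> bool" where
  "twice_differentiable_M \<psi> \<longleftrightarrow>
     \<psi> differentiable_on sphere_prod \<and> mgrad \<psi> differentiable_on sphere_prod"

text \<open>The vectors \<open>mgrad (\<lambda>x. mgrad \<psi> x $ p) m\<close> are the rows of the tangential second derivative.\<close>

definition C2_M :: "('n::finite spins \<Rightarrow> real) \<Rightarrow> bool" where
  "C2_M \<psi> \<longleftrightarrow> twice_differentiable_M \<psi> \<and>
     (\<forall>p. continuous_on sphere_prod (\<lambda>m. mgrad (\<lambda>x. mgrad \<psi> x $ p) m))"

definition dt_on :: "real \<Rightarrow> (real \<Rightarrow> 'n::finite spins \<Rightarrow> real) \<Rightarrow> real \<Rightarrow> 'n spins \<Rightarrow> real" where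
  "dt_on T W s m = vector_derivative (\<lambda>r. W r m) (at s within {0..T})"

definition C12_M :: "real \<Rightarrow> (real \<Rightarrow> 'n::finite spins \<Rightarrow> real) \<Rightarrow> bool" where
  "C12_M T W \<longleftrightarrow>
     (\<forall>m\<in>sphere_prod. (\<lambda>s. W s m) differentiable_on {0..T}) \<and>
     (\<forall>s\<in>{0..T}. twice_differentiable_M (W s)) \<and>
     continuous_on ({0..T} \<times> sphere_prod) (\<lambda>(s, m). W s m) \<and>
     continuous_on ({0..T} \<times> sphere_prod) (\<lambda>(s, m). dt_on T W s m) \<and>
     continuous_on ({0..T} \<times> sphere_prod) (\<lambda>(s, m). mgrad (W s) m) \<and>
     (\<forall>p. continuous_on ({0..T} \<times> sphere_prod) (\<lambda>(s, m). mgrad (\<lambda>x. mgrad (W s) x $ p) m))"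

definition C2_curve :: "real \<Rightarrow> (real \<Rightarrow> 'n::finite spins) \<Rightarrow> bool" where
  "C2_curve T c \<longleftrightarrow> c ` {0..T} \<subseteq> sphere_prod \<and>
     (\<exists>c' c''. (\<forall>s\<in>{0..T}. (c has_vector_derivative c' s) (at s within {0..T})) \<and>
               (\<forall>s\<in>{0..T}. (c' has_vector_derivative c'' s) (at s within {0..T})) \<and>
               continuous_on {0..T} c'')"


section \<open>Stochastic integration with respect to a Wiener process\<close>

text \<open>
  Processes are functions of time and sample point, in this order; only times in the interval
  at hand (\<open>{0..T}\<close> or \<open>{t..T}\<close>) matter.
\<close>

definition usual_filtration :: "'a measure \<Rightarrow> (real \<Rightarrow> 'a measure) \<Rightarrow> real \<Rightarrow> bool" where
  "usual_filtration P F T \<longleftrightarrow>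
     filtration (space P) F \<and> (\<forall>s. subalgebra P (F s)) \<and>
     complete_measure P \<and> null_sets P \<subseteq> sets (F 0) \<and>
     (\<forall>s\<in>{0..<T}. sets (F s) = (\<Inter>r\<in>{s<..T}. sets (F r)))"

definition adapted ::
  "(real \<Rightarrow> 'a measure) \<Rightarrow> real set \<Rightarrow> (real \<Rightarrow> 'a \<Rightarrow> 'b::topological_space) \<Rightarrow> bool" where
  "adapted F I X \<longleftrightarrow> (\<forall>s\<in>I. X s \<in> borel_measurable (F s))"

definition wiener_process ::
  "'a measure \<Rightarrow> (real \<Rightarrow> 'a measure) \<Rightarrow> real \<Rightarrow> (real \<Rightarrow> 'a \<Rightarrow> real ^ 'k::finite) \<Rightarrow> bool" where
  "wiener_process P F T B \<longleftrightarrow>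
     adapted F {0..T} B \<and>
     (AE \<omega> in P. B 0 \<omega> = 0 \<and> continuous_on {0..T} (\<lambda>s. B s \<omega>)) \<and>
     (\<forall>r s. 0 \<le> r \<and> r < s \<and> s \<le> T \<longrightarrow>
        prob_space.indep_set P (sets (F r))
          {(\<lambda>\<omega>. B s \<omega> - B r \<omega>) -` A \<inter> space P |A. A \<in> sets borel} \<and>
        prob_space.indep_vars P (\<lambda>_. borel) (\<lambda>p \<omega>. (B s \<omega> - B r \<omega>) $ p) UNIV \<and>
        (\<forall>p. distributed P lborel (\<lambda>\<omega>. (B s \<omega> - B r \<omega>) $ p)
               (\<lambda>x. ennreal (normal_density 0 (sqrt (s - r)) x))))"

definition is_partition :: "real \<Rightarrow> real \<Rightarrow> nat \<Rightarrow> (nat \<Rightarrow> real) \<Rightarrow> bool" where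
  "is_partition a b n p \<longleftrightarrow> p 0 = a \<and> p n = b \<and> (\<forall>i<n. p i \<le> p (Suc i))"

definition bounded_variation_on_Icc ::
  "real \<Rightarrow> real \<Rightarrow> (real \<Rightarrow> 'b::real_normed_vector) \<Rightarrow> bool" where
  "bounded_variation_on_Icc a b f \<longleftrightarrow>
     (\<exists>c. \<forall>n p. is_partition a b n p \<longrightarrow> (\<Sum>i<n. norm (f (p (Suc i)) - f (p i))) \<le> c)"

text \<open>
  Elementary integrands on \<open>[a, b]\<close>: a partition together with bounded matrix-valued \<open>\<xi> i\<close>,
  known at the left end point of the \<open>i\<close>-th interval.
\<close>

definition elementary ::
  "'a measure \<Rightarrow> (real \<Rightarrow> 'a measure) \<Rightarrow> real \<Rightarrow> real \<Rightarrow>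
   nat \<Rightarrow> (nat \<Rightarrow> real) \<Rightarrow> (nat \<Rightarrow> 'a \<Rightarrow> real ^ 'k::finite ^ 'l::finite) \<Rightarrow> bool" where
  "elementary P F a b n p \<xi> \<longleftrightarrow> is_partition a b n p \<and>
     (\<forall>i<n. \<xi> i \<in> borel_measurable (F (p i)) \<and> (\<exists>c. \<forall>\<omega>\<in>space P. norm (\<xi> i \<omega>) \<le> c))"

definition elementary_process ::
  "nat \<Rightarrow> (nat \<Rightarrow> real) \<Rightarrow> (nat \<Rightarrow> 'a \<Rightarrow> real ^ 'k::finite ^ 'l::finite) \<Rightarrow>
   real \<Rightarrow> 'a \<Rightarrow> real ^ 'k ^ 'l" where
  "elementary_process n p \<xi> r \<omega> = (\<Sum>i<n. indicat_real {p i<..p (Suc i)} r *\<^sub>R \<xi> i \<omega>)"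

definition elementary_integral ::
  "(real \<Rightarrow> 'a \<Rightarrow> real ^ 'k::finite) \<Rightarrow> nat \<Rightarrow> (nat \<Rightarrow> real) \<Rightarrow>
   (nat \<Rightarrow> 'a \<Rightarrow> real ^ 'k ^ 'l::finite) \<Rightarrow> 'a \<Rightarrow> real ^ 'l" where
  "elementary_integral B n p \<xi> \<omega> = (\<Sum>i<n. \<xi> i \<omega> *v (B (p (Suc i)) \<omega> - B (p i) \<omega>))"

text \<open>
  The Ito integral of a square-integrable integrand \<open>Y\<close> over \<open>[a, b]\<close>: the \<open>L^2(P)\<close>-limit of the
  integrals of elementary processes that converge to \<open>Y\<close> in \<open>L^2(P \<otimes> dr)\<close>.
\<close>

definition has_ito_integral ::
  "'a measure \<Rightarrow> (real \<Rightarrow> 'a measure) \<Rightarrow> (real \<Rightarrow> 'a \<Rightarrow> real ^ 'k::finite) \<Rightarrow> real \<Rightarrow> real \<Rightarrow>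
   (real \<Rightarrow> 'a \<Rightarrow> real ^ 'k ^ 'l::finite) \<Rightarrow> ('a \<Rightarrow> real ^ 'l) \<Rightarrow> bool" where
  "has_ito_integral P F B a b Y X \<longleftrightarrow>
     X \<in> borel_measurable P \<and>
     set_borel_measurable (P \<Otimes>\<^sub>M lborel) (space P \<times> {a..b}) (\<lambda>(\<omega>, r). Y r \<omega>) \<and>
     (\<exists>n p \<xi>. (\<forall>j. elementary P F a b (n j) (p j) (\<xi> j)) \<and>
        (\<lambda>j. set_nn_integral (P \<Otimes>\<^sub>M lborel) (space P \<times> {a..b}) (\<lambda>(\<omega>, r).
               ennreal ((norm (elementary_process (n j) (p j) (\<xi> j) r \<omega> - Y r \<omega>))\<^sup>2)))
          \<longlonglongrightarrow> 0 \<and>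
        (\<lambda>j. \<integral>\<^sup>+ \<omega>. ennreal ((norm (elementary_integral B (n j) (p j) (\<xi> j) \<omega> - X \<omega>))\<^sup>2) \<partial>P)
          \<longlonglongrightarrow> 0)"

text \<open>
  The quadratic covariation of \<open>Y\<close> and \<open>B\<close> on \<open>[t, T]\<close>, with component \<open>k\<close> the sum over \<open>j\<close> of
  the brackets of \<open>Y $ k $ j\<close> and \<open>B $ j\<close>: a continuous adapted process of bounded variation that is
  the limit in probability of the sums of products of increments as the mesh tends to zero.
\<close>

definition has_covariation ::
  "'a measure \<Rightarrow> (real \<Rightarrow> 'a measure) \<Rightarrow> (real \<Rightarrow> 'a \<Rightarrow> real ^ 'k::finite) \<Rightarrow> real \<Rightarrow> real \<Rightarrow>
   (real \<Rightarrow> 'a \<Rightarrow> real ^ 'k ^ 'l::finite) \<Rightarrow> (real \<Rightarrow> 'a \<Rightarrow> real ^ 'l) \<Rightarrow> bool" where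
  "has_covariation P F B t T Y C \<longleftrightarrow>
     adapted F {t..T} Y \<and> adapted F {t..T} C \<and>
     (AE \<omega> in P. continuous_on {t..T} (\<lambda>s. C s \<omega>) \<and> bounded_variation_on_Icc t T (\<lambda>s. C s \<omega>)) \<and>
     (\<forall>s\<in>{t..T}. \<forall>\<epsilon>>0. \<exists>\<eta>>0. \<forall>n p.
        is_partition t s n p \<and> (\<forall>i<n. p (Suc i) - p i < \<eta>) \<longrightarrow>
        measure P {\<omega> \<in> space P. \<epsilon> \<le> norm
          ((\<Sum>i<n. (Y (p (Suc i)) \<omega> - Y (p i) \<omega>) *v (B (p (Suc i)) \<omega> - B (p i) \<omega>)) - C s \<omega>)}
        \<le> \<epsilon>)"

definition has_stratonovich_integral ::
  "'a measure \<Rightarrow> (real \<Rightarrow> 'a measure) \<Rightarrow> (real \<Rightarrow> 'a \<Rightarrow> real ^ 'k::finite) \<Rightarrow> real \<Rightarrow> real \<Rightarrow>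
   (real \<Rightarrow> 'a \<Rightarrow> real ^ 'k ^ 'l::finite) \<Rightarrow> (real \<Rightarrow> 'a \<Rightarrow> real ^ 'l) \<Rightarrow> bool" where
  "has_stratonovich_integral P F B t T Y S \<longleftrightarrow>
     (\<exists>I C. (\<forall>s\<in>{t..T}. has_ito_integral P F B t s Y (I s)) \<and> has_covariation P F B t T Y C \<and>
        (\<forall>s\<in>{t..T}. AE \<omega> in P. S s \<omega> = I s \<omega> + (1/2) *\<^sub>R C s \<omega>))"


section \<open>The control problem\<close>

text \<open>Solutions are taken with all paths continuous and in the manifold (a modification on a null
  set, which preserves adaptedness by completeness of the filtration).\<close>

definition solves_sllg ::
  "'a measure \<Rightarrow> (real \<Rightarrow> 'a measure) \<Rightarrow> (real \<Rightarrow> 'a \<Rightarrow> 'n::finite spins) \<Rightarrow> real \<Rightarrow>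
   real \<Rightarrow> real \<Rightarrow> 'n spin_mat \<Rightarrow> real \<Rightarrow> real \<Rightarrow> 'n spins \<Rightarrow>
   (real \<Rightarrow> 'a \<Rightarrow> 'n spins) \<Rightarrow> (real \<Rightarrow> 'a \<Rightarrow> 'n spins) \<Rightarrow> bool" where
  "solves_sllg P F B T \<alpha> Cext Q \<nu> t m0 u m \<longleftrightarrow>
     adapted F {t..T} m \<and>
     (\<forall>\<omega>\<in>space P. continuous_on {t..T} (\<lambda>s. m s \<omega>) \<and> (\<forall>s\<in>{t..T}. m s \<omega> \<in> sphere_prod)) \<and>
     (\<exists>S. has_stratonovich_integral P F B t T (\<lambda>s \<omega>. sigma_mat (m s \<omega>)) S \<and>
        (AE \<omega> in P. \<forall>s\<in>{t..T}.
           m s \<omega> = m0 + (LINT r:{t..s}|lborel. llg_drift \<alpha> Cext Q (m r \<omega>) (u r \<omega>)) + \<nu> *\<^sub>R S s \<omega>))"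

definition admissible_control ::
  "'a measure \<Rightarrow> (real \<Rightarrow> 'a measure) \<Rightarrow> real \<Rightarrow> real \<Rightarrow> (real \<Rightarrow> 'a \<Rightarrow> 'n::finite spins) \<Rightarrow> bool" where
  "admissible_control P F t T u \<longleftrightarrow>
     adapted F {t..T} u \<and>
     set_borel_measurable (P \<Otimes>\<^sub>M lborel) (space P \<times> {t..T}) (\<lambda>(\<omega>, r). u r \<omega>) \<and>
     set_integrable (P \<Otimes>\<^sub>M lborel) (space P \<times> {t..T}) (\<lambda>(\<omega>, r). (norm (u r \<omega>))\<^sup>2)"

definition admissible_pairs ::
  "'a measure \<Rightarrow> (real \<Rightarrow> 'a measure) \<Rightarrow> (real \<Rightarrow> 'a \<Rightarrow> 'n::finite spins) \<Rightarrow> real \<Rightarrow>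
   real \<Rightarrow> real \<Rightarrow> 'n spin_mat \<Rightarrow> real \<Rightarrow> real \<Rightarrow> 'n spins \<Rightarrow>
   ((real \<Rightarrow> 'a \<Rightarrow> 'n spins) \<times> (real \<Rightarrow> 'a \<Rightarrow> 'n spins)) set" where
  "admissible_pairs P F B T \<alpha> Cext Q \<nu> t m0 =
     {(m, u). admissible_control P F t T u \<and> solves_sllg P F B T \<alpha> Cext Q \<nu> t m0 u m}"

definition cost ::
  "'a measure \<Rightarrow> real \<Rightarrow> real \<Rightarrow> real \<Rightarrow> (real \<Rightarrow> 'n::finite spins) \<Rightarrow> ('n spins \<Rightarrow> real) \<Rightarrow> real \<Rightarrow>
   (real \<Rightarrow> 'a \<Rightarrow> 'n spins) \<times> (real \<Rightarrow> 'a \<Rightarrow> 'n spins) \<Rightarrow> real" where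
  "cost P T \<delta> lam mt h t = (\<lambda>(m, u).
     LINT \<omega>|P. (LINT r:{t..T}|lborel.
         \<delta> * (norm (m r \<omega> - mt r))\<^sup>2 + lam / 2 * (norm (u r \<omega>))\<^sup>2) + h (m T \<omega>))"

definition optimal_pair :: "('c \<Rightarrow> real) \<Rightarrow> 'c set \<Rightarrow> 'c \<Rightarrow> bool" where
  "optimal_pair J U x \<longleftrightarrow> x \<in> U \<and> (\<forall>y\<in>U. J x \<le> J y)"

definition hamiltonian ::
  "real \<Rightarrow> real \<Rightarrow> 'n::finite spin_mat \<Rightarrow> real \<Rightarrow> real \<Rightarrow> real \<Rightarrow> (real \<Rightarrow> 'n spins) \<Rightarrow>
   real \<Rightarrow> ('n spins \<Rightarrow> real) \<Rightarrow> 'n spins \<Rightarrow> real" where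
  "hamiltonian \<alpha> Cext Q \<nu> \<delta> lam mt t \<psi> m =
     - (\<nu>\<^sup>2 / 2) * laplace_beltrami \<psi> m - \<delta> * (norm (m - mt t))\<^sup>2
     + (SUP u. - (llg_drift \<alpha> Cext Q m u \<bullet> mgrad \<psi> m) - lam / 2 * (norm u)\<^sup>2)"

definition hjb_solution ::
  "real \<Rightarrow> real \<Rightarrow> real \<Rightarrow> 'n::finite spin_mat \<Rightarrow> real \<Rightarrow> real \<Rightarrow> real \<Rightarrow> (real \<Rightarrow> 'n spins) \<Rightarrow>
   ('n spins \<Rightarrow> real) \<Rightarrow> (real \<Rightarrow> 'n spins \<Rightarrow> real) \<Rightarrow> bool" where
  "hjb_solution T \<alpha> Cext Q \<nu> \<delta> lam mt h W \<longleftrightarrow> C12_M T W \<and>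
     (\<forall>s\<in>{0..<T}. \<forall>m\<in>sphere_prod.
        - dt_on T W s m + hamiltonian \<alpha> Cext Q \<nu> \<delta> lam mt s (W s) m = 0) \<and>
     (\<forall>m\<in>sphere_prod. W T m = h m)"

definition feedback ::
  "real \<Rightarrow> real \<Rightarrow> real \<Rightarrow> (real \<Rightarrow> 'n::finite spins \<Rightarrow> real) \<Rightarrow> real \<Rightarrow> 'n spins \<Rightarrow> 'n spins" where
  "feedback \<alpha> Cext lam W s m =
     (Cext / lam) *\<^sub>R (cprod m (mgrad (W s) m) - \<alpha> *\<^sub>R mgrad (W s) m)"

end

theory Submission
  imports Defs
begin

text \<open>
  Verification argument. For an admissible pair, Ito's formula in expectation for \<open>W\<close> along \<open>m\<close>, the
  Hamilton-Jacobi-Bellman equation and completion of the square in the control give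
  \<open>J(t, m) = W(t, m) + (\<lambda>/2) E \<integral> |u(s) - v(s, m(s))|^2 ds\<close> with the feedback law \<open>v\<close>. Hence the feedback pair is
  optimal, and every optimal pair solves the closed loop equation, whose coefficients are Lipschitz in
  the state; pathwise uniqueness then follows from the Ito isometry and Gronwall's lemma.

  Ito's formula is obtained from a second order Taylor expansion of \<open>W\<close> along a uniform grid, where the
  radial correction of the sphere chords and the Stratonovich term \<open>(\<nu>/2) C\<close>, identified as
  \<open>- \<nu>^2 \<integral> m ds\<close>, are normal to the manifold and drop out against tangential gradients.
\<close>

section \<open>Algebra of the cross product\<close>

text \<open>The integral \<open>I s\<close> is given for each end time separately, as an
  \<open>L^2\<close> limit, so no path regularity of \<open>I\<close> is available and every
  identity is used at finitely many fixed times only. This is why the expansion runs along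
  deterministic grids and why only expectations are taken. The covariation \<open>C\<close> is
  merely continuous, adapted and of bounded variation, without any moment bound; it has to be
  identified by convergence in probability before the increments of \<open>m\<close> can be
  estimated in mean square. The control is only square-integrable, so the drift is not bounded
  pointwise either; on a cell of length \<open>\<Delta>\<close> its integral has mean square at most
  \<open>\<Delta>\<close> times the energy of the drift there, and the sum of these still vanishes
  in the limit. As \<open>W\<close> lives on the manifold alone, all derivatives are taken along
  curves in the product of spheres. The noise directions \<open>cprod x b\<close>, for
  \<open>b\<close> in an orthonormal basis, resolve the identity of the tangent space at
  \<open>x\<close>; this turns the second order term into the Laplace-Beltrami operator.\<close>

lemma spin_simps [simp]:
  "spin (a + b) i = spin a i + spin b i" "spin (a - b) i = spin a i - spin b i"
  "spin (- a) i = - spin a i" "spin (c *\<^sub>R a) i = c *\<^sub>R spin a i" "spin 0 i = 0"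
  by (simp_all add: spin_def vec_eq_iff)

lemma spin_eqI: "(\<And>i. spin a i = spin b i) \<Longrightarrow> a = b"
  by (simp add: spin_def vec_eq_iff)

lemma spin_cprod [simp]: "spin (cprod a b) i = cross3 (spin a i) (spin b i)"
  by (simp add: cprod_def spin_def vec_eq_iff)

lemma inner_spins: "a \<bullet> b = (\<Sum>i\<in>UNIV. spin a i \<bullet> spin b i)"
  by (simp add: inner_vec_def spin_def sum.cartesian_product UNIV_Times_UNIV[symmetric]
      del: UNIV_Times_UNIV)

lemma norm_spins_sq: "(norm a)\<^sup>2 = (\<Sum>i\<in>UNIV. (norm (spin a i))\<^sup>2)"
  by (simp add: power2_norm_eq_inner inner_spins)

lemma norm_spin_le: "norm (spin a i) \<le> norm a"
proof -
  have "(norm (spin a i))\<^sup>2 \<le> (norm a)\<^sup>2"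
    unfolding norm_spins_sq by (rule member_le_sum) auto
  then show ?thesis by simp
qed

lemma norm_le_sum_spins: "norm a \<le> (\<Sum>i\<in>UNIV. norm (spin a i))"
proof -
  have "(norm a)\<^sup>2 \<le> (\<Sum>i\<in>UNIV. norm (spin a i))\<^sup>2"
    unfolding norm_spins_sq L2_set_def[symmetric]
    using power_mono[OF L2_set_le_sum[of UNIV "\<lambda>i. norm (spin a i)"], of 2]
    by (simp add: L2_set_def sum_nonneg)
  then show ?thesis by (rule power2_le_imp_le) (simp add: sum_nonneg)
qed

lemma bounded_bilinear_cprod: "bounded_bilinear (cprod :: 'n::finite spins \<Rightarrow> _)"
proof -
  have "bilinear (cprod :: 'n spins \<Rightarrow> _)"
    unfolding bilinear_def
    by (auto intro!: linearI spin_eqI simp: cross3_def vec_eq_iff vector_def algebra_simps)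
  then show ?thesis by (simp add: bilinear_conv_bounded_bilinear)
qed

interpretation cprod: bounded_bilinear "cprod :: 'n::finite spins \<Rightarrow> _"
  by (rule bounded_bilinear_cprod)

text \<open>Lagrange's identity in each spin; estimating the second factor by its full norm before
  summing keeps the constant 1 for every number of spins.\<close>

lemma norm_cprod_le: "norm (cprod a b) \<le> norm a * norm b"
proof -
  have "(norm (cprod a b))\<^sup>2 \<le> (\<Sum>i\<in>UNIV. (norm (spin a i))\<^sup>2 * (norm (spin b i))\<^sup>2)"
    unfolding norm_spins_sq
  proof (intro sum_mono)
    fix i
    show "(norm (spin (cprod a b) i))\<^sup>2 \<le> (norm (spin a i))\<^sup>2 * (norm (spin b i))\<^sup>2"
      using norm_cross[of "spin a i" "spin b i"]
        zero_le_power2[of "spin a i \<bullet> spin b i"]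
      by (simp add: power_mult_distrib)
  qed
  also have "\<dots> \<le> (\<Sum>i\<in>UNIV. (norm (spin a i))\<^sup>2 * (norm b)\<^sup>2)"
    by (intro sum_mono mult_left_mono power_mono norm_spin_le) auto
  also have "\<dots> = (norm a * norm b)\<^sup>2"
    by (simp add: norm_spins_sq[of a] sum_distrib_right power_mult_distrib)
  finally show ?thesis by (rule power2_le_imp_le) simp
qed

text \<open>The scalar triple product is alternating. This moves \<open>cprod m\<close> from the
  noise or from the control onto the gradient, which is where both the Laplacian and the feedback
  law come from.\<close>

lemma cprod_skew: "cprod m a \<bullet> b = - (a \<bullet> cprod m b)"
proof -
  have "spin (cprod m a) i \<bullet> spin b i = - (spin a i \<bullet> spin (cprod m b) i)" for i
    by (simp add: cross3_def inner_vec_def sum_3 vector_def algebra_simps)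
  then show ?thesis by (simp add: inner_spins sum_negf)
qed

text \<open>The vector triple product with a unit first factor: \<open>- cprod m (cprod m a)\<close>
  is the orthogonal projection of \<open>a\<close> onto the tangent space at
  \<open>m\<close>.\<close>

lemma cprod_cprod_spin:
  assumes "m \<in> sphere_prod"
  shows "spin (cprod m (cprod m a)) i = (spin m i \<bullet> spin a i) *\<^sub>R spin m i - spin a i"
  using assms by (simp add: Lagrange sphere_prod_def inner_commute flip: power2_norm_eq_inner)

text \<open>On tangent vectors \<open>cprod m\<close> acts as a quarter turn in each sphere.\<close>

lemma cprod_cprod_tangent:
  assumes "m \<in> sphere_prod" "g \<in> tangent_space m"
  shows "cprod m (cprod m g) = - g"
  using assms by (intro spin_eqI) (simp add: cprod_cprod_spin tangent_space_def inner_commute del: spin_cprod)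

lemma cprod_tangent: "cprod m a \<in> tangent_space m"
  by (simp add: tangent_space_def dot_cross_self)

lemma subspace_tangent_space: "subspace (tangent_space m)"
  by (simp add: subspace_def tangent_space_def inner_left_distrib)

lemma tangent_inner_base: "g \<in> tangent_space m \<Longrightarrow> g \<bullet> m = 0"
  by (simp add: tangent_space_def inner_spins)

lemma inner_as_sum_axis: "(\<Sum>q\<in>UNIV. (x \<bullet> axis q 1) * (y \<bullet> axis q 1)) = x \<bullet> (y :: real^'k)"
  by (simp add: inner_axis) (simp add: inner_vec_def)

text \<open>The vectors \<open>cprod m (axis q 1)\<close> form a Parseval frame of the tangent
  space: the sum of their dyads is the tangential projection. Hence a bilinear form with tangent
  rows, symmetric or not, has the same trace over the noise directions as over the
  coordinates.\<close>

lemma tangential_trace: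
  fixes H :: "'n::finite \<times> 3 \<Rightarrow> 'n spins"
  assumes m: "m \<in> sphere_prod" and H: "\<And>p. H p \<in> tangent_space m"
  shows "(\<Sum>q\<in>UNIV. \<Sum>p\<in>UNIV. (H p \<bullet> cprod m (axis q 1)) * cprod m (axis q 1) $ p) = (\<Sum>p\<in>UNIV. H p $ p)"
proof -
  have "(\<Sum>q\<in>UNIV. (H p \<bullet> cprod m (axis q 1)) * cprod m (axis q 1) $ p) = H p $ p" for p
  proof -
    have "(\<Sum>q\<in>UNIV. (H p \<bullet> cprod m (axis q 1)) * cprod m (axis q 1) $ p)
        = (\<Sum>q\<in>UNIV. (cprod m (H p) \<bullet> axis q 1) * (cprod m (axis p 1) \<bullet> axis q 1))"
    proof (intro sum.cong refl)
      fix q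
      have "cprod m (axis q 1) $ p = cprod m (axis q 1) \<bullet> axis p 1" by (simp add: inner_axis)
      also have "\<dots> = - (cprod m (axis p 1) \<bullet> axis q 1)" using cprod_skew[of m "axis q 1" "axis p 1"] by (simp only: inner_commute)
      finally have 1: "cprod m (axis q 1) $ p = - (cprod m (axis p 1) \<bullet> axis q 1)" .
      have "H p \<bullet> cprod m (axis q 1) = - (cprod m (H p) \<bullet> axis q 1)" by (simp add: cprod_skew)
      with 1 show "(H p \<bullet> cprod m (axis q 1)) * cprod m (axis q 1) $ p =
        (cprod m (H p) \<bullet> axis q 1) * (cprod m (axis p 1) \<bullet> axis q 1)" by simp
    qed
    also have "\<dots> = cprod m (H p) \<bullet> cprod m (axis p 1)" by (rule inner_as_sum_axis)
    also have "\<dots> = - (cprod m (cprod m (H p)) \<bullet> axis p 1)" by (simp add: cprod_skew)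
    also have "\<dots> = H p $ p" using cprod_cprod_tangent[OF m H] by (simp add: inner_axis)
    finally show ?thesis .
  qed
  then show ?thesis by (subst sum.swap) simp
qed

text \<open>In three dimensions the sum over \<open>k\<close> of \<open>(a x e_k) x e_k\<close> is
  \<open>- 2 a\<close>, and only the axes belonging to spin \<open>i\<close> act on spin
  \<open>i\<close>. The identity gives the mean of the quadratic noise term, hence the Stratonovich
  correction, and it also recovers \<open>m\<close> from \<open>sigma_mat m\<close>.\<close>

lemma sum_cprod_cprod_axis: "(\<Sum>q\<in>UNIV. cprod (cprod m (axis q 1)) (axis q 1)) = - 2 *\<^sub>R (m :: 'n::finite spins)"
proof (rule spin_eqI)
  fix i
  have ax: "spin (axis (j, k) 1 :: 'n spins) i = (if i = j then axis k 1 else 0)" for j k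
    by (simp add: spin_def axis_def vec_eq_iff)
  have sp: "spin (\<Sum>q\<in>A. g q) i = (\<Sum>q\<in>A. spin (g q) i)" for g :: "'n \<times> 3 \<Rightarrow> 'n spins" and A
    by (simp add: spin_def vec_eq_iff)
  have "spin (\<Sum>q\<in>UNIV. cprod (cprod m (axis q 1)) (axis q 1)) i
      = (\<Sum>j\<in>UNIV. \<Sum>k\<in>UNIV. cross3 (cross3 (spin m i) (spin (axis (j, k) 1) i)) (spin (axis (j, k) 1) i))"
    unfolding sp by (simp add: sum.cartesian_product UNIV_Times_UNIV[symmetric] del: UNIV_Times_UNIV)
  also have "\<dots> = (\<Sum>j\<in>UNIV. if j = i then (\<Sum>k\<in>UNIV. cross3 (cross3 (spin m i) (axis k 1)) (axis k 1)) else 0)"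
    by (intro sum.cong refl) (auto simp: ax)
  also have "\<dots> = (\<Sum>k\<in>UNIV. cross3 (cross3 (spin m i) (axis k 1)) (axis k 1))" by simp
  also have "\<dots> = - 2 *\<^sub>R spin m i"
    by (simp add: sum_3 cross3_def vec_eq_iff forall_3 vector_def axis_def)
  finally show "spin (\<Sum>q\<in>UNIV. cprod (cprod m (axis q 1)) (axis q 1)) i = spin (- 2 *\<^sub>R m) i"
    by simp
qed

lemma compact_sphere_prod: "compact (sphere_prod :: 'n::finite spins set)"
proof -
  have "continuous_on UNIV (\<lambda>m :: 'n spins. spin m i)" for i
    unfolding spin_def by (intro continuous_intros)
  then have "closed (sphere_prod :: 'n spins set)"
    unfolding sphere_prod_def
    by (intro closed_Collect_all closed_Collect_eq continuous_on_norm continuous_on_const)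
  moreover have "norm m \<le> real CARD('n)" if "m \<in> sphere_prod" for m :: "'n spins"
    using norm_le_sum_spins[of m] that by (simp add: sphere_prod_def)
  then have "bounded (sphere_prod :: 'n spins set)" by (auto simp: bounded_iff)
  ultimately show ?thesis by (simp add: compact_eq_bounded_closed)
qed

lemma norm_sphere_prod: "m \<in> sphere_prod \<Longrightarrow> norm (m::'n::finite spins) \<le> real CARD('n)"
  using norm_le_sum_spins[of m] by (simp add: sphere_prod_def)

lemma llg_drift_eq:
  "llg_drift \<alpha> Cext Q m u = (let x = - (Q *v m) + Cext *\<^sub>R u in cprod m x - \<alpha> *\<^sub>R cprod m (cprod m x))"
proof -
  have "Sigma_mat \<alpha> m *v x = cprod m x - \<alpha> *\<^sub>R cprod m (cprod m x)" for x
    by (simp add: Sigma_mat_def matrix_vector_mul_assoc[symmetric] matrix_vector_mult_diff_rdistrib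
        scaleR_matrix_vector_assoc[symmetric] sigma_mat_mult)
  then show ?thesis by (simp add: llg_drift_def Let_def)
qed

section \<open>Tangential gradients\<close>

text \<open>A configuration is the sum of its spins embedded by the linear maps
  \<open>emb i\<close>, so the derivative can be taken summand by summand.\<close>

lemma has_vector_derivative_spins:
  fixes \<gamma> :: "real \<Rightarrow> 'n::finite spins"
  assumes "\<And>i. ((\<lambda>\<tau>. spin (\<gamma> \<tau>) i) has_vector_derivative spin \<gamma>' i) (at \<tau> within S)"
  shows "(\<gamma> has_vector_derivative \<gamma>') (at \<tau> within S)"
proof -
  define emb :: "'n \<Rightarrow> real^3 \<Rightarrow> 'n spins" where "emb i v = (\<chi> p. if fst p = i then v $ snd p else 0)" for i v
  have "linear (emb i)" for i
    by (rule linearI) (auto simp: emb_def vec_eq_iff)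
  then have bl: "bounded_linear (emb i)" for i by (rule linear_conv_bounded_linear[THEN iffD1])
  have dec: "v = (\<Sum>i\<in>UNIV. emb i (spin v i))" for v
    by (simp add: vec_eq_iff emb_def spin_def)
  have "((\<lambda>\<tau>. \<Sum>i\<in>UNIV. emb i (spin (\<gamma> \<tau>) i)) has_vector_derivative (\<Sum>i\<in>UNIV. emb i (spin \<gamma>' i))) (at \<tau> within S)"
    by (intro has_vector_derivative_sum bounded_linear.has_vector_derivative[OF bl] assms)
  then show ?thesis by (simp flip: dec)
qed

lemma sphere_prod_spin: "m \<in> sphere_prod \<Longrightarrow> spin m i \<bullet> spin m i = 1"
  by (simp add: sphere_prod_def flip: power2_norm_eq_inner)

text \<open>Great circles in each factor, run through with speed \<open>norm (spin w i)\<close>. In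
  a factor where \<open>w\<close> vanishes the angle stays zero and the spin does not move.\<close>

lemma tangent_curve:
  fixes m :: "'n::finite spins"
  assumes m: "m \<in> sphere_prod" and w: "w \<in> tangent_space m"
  shows "\<exists>\<gamma>. (\<forall>\<tau>. \<gamma> \<tau> \<in> sphere_prod) \<and> \<gamma> 0 = m \<and> (\<gamma> has_vector_derivative w) (at 0)"
proof -
  define c where "c i \<tau> = cos (\<tau> * norm (spin w i)) *\<^sub>R spin m i + sin (\<tau> * norm (spin w i)) *\<^sub>R sgn (spin w i)" for i \<tau>
  define \<gamma> :: "real \<Rightarrow> 'n spins" where "\<gamma> \<tau> = (\<chi> p. c (fst p) \<tau> $ snd p)" for \<tau>
  have sg: "spin (\<gamma> \<tau>) i = c i \<tau>" for \<tau> i by (simp add: \<gamma>_def spin_def vec_eq_iff)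
  have wm: "spin w i \<bullet> spin m i = 0" for i using w by (simp add: tangent_space_def)
  have "norm (c i \<tau>) = 1" for i \<tau>
  proof -
    have "c i \<tau> \<bullet> c i \<tau> = 1"
    proof -
      let ?r = "norm (spin w i)" and ?a = "\<tau> * norm (spin w i)"
      have "c i \<tau> \<bullet> c i \<tau> = cos ?a * cos ?a + sin ?a * sin ?a * (sgn (spin w i) \<bullet> sgn (spin w i))"
        using sphere_prod_spin[OF m, of i] wm[of i]
        by (simp add: c_def sgn_div_norm inner_add_left inner_add_right inner_commute)
      also have "\<dots> = 1"
        using sin_cos_squared_add3[of ?a] by (cases "spin w i = 0") (simp_all add: norm_sgn flip: power2_norm_eq_inner)
      finally show ?thesis .
    qed
    then show ?thesis by (simp add: norm_eq_1)
  qed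
  then have "\<forall>\<tau>. \<gamma> \<tau> \<in> sphere_prod" by (simp add: sphere_prod_def sg)
  moreover have "\<gamma> 0 = m" by (rule spin_eqI) (simp add: sg c_def)
  moreover have "(\<gamma> has_vector_derivative w) (at 0)"
  proof (rule has_vector_derivative_spins)
    fix i
    have "((\<lambda>\<tau>. c i \<tau>) has_vector_derivative norm (spin w i) *\<^sub>R sgn (spin w i)) (at 0)"
      unfolding c_def has_vector_derivative_def
      by (auto intro!: derivative_eq_intros simp: algebra_simps)
    then show "((\<lambda>\<tau>. spin (\<gamma> \<tau>) i) has_vector_derivative spin w i) (at 0)"
      by (cases "spin w i = 0") (simp_all add: sg sgn_div_norm)
  qed
  ultimately show ?thesis by blast
qed

text \<open>The normal part of an ambient derivative is invisible within the manifold: for unit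
  vectors \<open>m_i . (y_i - m_i) = - |y_i - m_i|^2 / 2\<close>, so a functional that is normal at
  \<open>m\<close> varies only to second order along the spheres.\<close>

lemma tangential_derivative_exists:
  fixes m :: "'n::finite spins" and \<psi> :: "'n spins \<Rightarrow> real"
  assumes m: "m \<in> sphere_prod" and D: "(\<psi> has_derivative D) (at m within sphere_prod)"
  shows "\<exists>g. g \<in> tangent_space m \<and> (\<psi> has_derivative (\<lambda>v. g \<bullet> v)) (at m within sphere_prod)"
proof -
  \<comment> \<open>The adjoint of the functional \<open>D\<close>, applied to 1, is its Riesz
    representative.\<close>
  define a where "a = adjoint D 1"
  have "linear D" using D by (rule has_derivative_linear)
  then have Da: "D v = a \<bullet> v" for v using adjoint_works[of D v 1] by (simp add: a_def inner_commute)
  define g where "g = - cprod m (cprod m a)"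
  have g: "g \<in> tangent_space m"
    unfolding g_def using subspace_neg[OF subspace_tangent_space cprod_tangent] .
  define L where "L y = (a - g) \<bullet> (y - m)" for y
  have L_le: "\<bar>L y\<bar> \<le> norm a * (norm (y - m))\<^sup>2" if y: "y \<in> sphere_prod" for y
  proof -
    have mi: "spin m i \<bullet> (spin y i - spin m i) = - ((norm (spin (y - m) i))\<^sup>2) / 2" for i
      using sphere_prod_spin[OF m, of i] sphere_prod_spin[OF y, of i]
      by (simp add: power2_norm_eq_inner inner_diff_left inner_diff_right inner_commute)
    have 1: "spin (a - g) i = (spin m i \<bullet> spin a i) *\<^sub>R spin m i" for i
      using m by (simp add: g_def cprod_cprod_spin del: spin_cprod)
    have "L y = (\<Sum>i\<in>UNIV. (spin m i \<bullet> spin a i) * (spin m i \<bullet> (spin y i - spin m i)))"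
      unfolding L_def inner_spins[of "a - g"] 1 by simp
    then have "\<bar>L y\<bar> \<le> (\<Sum>i\<in>UNIV. \<bar>(spin m i \<bullet> spin a i) * (spin m i \<bullet> (spin y i - spin m i))\<bar>)"
      by simp
    also have "\<dots> \<le> (\<Sum>i\<in>UNIV. norm a * (norm (spin (y - m) i))\<^sup>2)"
    proof (intro sum_mono)
      fix i
      have "\<bar>spin m i \<bullet> spin a i\<bar> \<le> norm (spin m i) * norm (spin a i)" by (rule Cauchy_Schwarz_ineq2)
      also have "\<dots> \<le> norm a" using m norm_spin_le[of a i] by (simp add: sphere_prod_def)
      finally show "\<bar>(spin m i \<bullet> spin a i) * (spin m i \<bullet> (spin y i - spin m i))\<bar> \<le> norm a * (norm (spin (y - m) i))\<^sup>2"
        unfolding mi abs_mult by (intro mult_mono) auto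
    qed
    also have "\<dots> = norm a * (norm (y - m))\<^sup>2"
      by (simp add: norm_spins_sq[of "y - m"] sum_distrib_left)
    finally show ?thesis .
  qed
  have L0: "(L has_derivative (\<lambda>v. 0)) (at m within sphere_prod)"
  proof (rule has_derivativeI_sandwich[of 1])
    fix y assume y: "y \<in> sphere_prod" "y \<noteq> m"
    have "\<bar>L y\<bar> / norm (y - m) \<le> (norm a * (norm (y - m))\<^sup>2) / norm (y - m)"
      by (intro divide_right_mono L_le y) simp
    also have "\<dots> = norm a * norm (y - m)" using y by (simp add: power2_eq_square)
    finally show "norm (L y - L m - 0) / norm (y - m) \<le> norm a * norm (y - m)" by (simp add: L_def)
  next
    show "((\<lambda>y. norm a * norm (y - m)) \<longlongrightarrow> 0) (at m within sphere_prod)"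
      by (rule tendsto_eq_intros | simp)+
  qed auto
  have L1: "(L has_derivative (\<lambda>v. (a - g) \<bullet> v)) (at m within sphere_prod)"
    unfolding L_def by (auto intro!: derivative_eq_intros)
  \<comment> \<open>Within the manifold \<open>L\<close> has both its own linear form and
    \<open>0\<close> as derivative. Subtracting it with the first and adding it back with the second
    replaces \<open>a\<close> by its tangential part \<open>g\<close>.\<close>
  have "((\<lambda>y. \<psi> y - L y + L y) has_derivative (\<lambda>v. D v - (a - g) \<bullet> v + 0)) (at m within sphere_prod)"
    by (intro has_derivative_add has_derivative_diff D L0 L1)
  then have "(\<psi> has_derivative (\<lambda>v. g \<bullet> v)) (at m within sphere_prod)"
    by (simp add: Da inner_diff_left)
  with g show ?thesis by blast
qed

text \<open>Along a curve with velocity \<open>g - g'\<close> the two candidate derivatives of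
  \<open>\<psi>\<close> differ by the squared norm of \<open>g - g'\<close>. A curve is required
  because a derivative within a set of empty interior need not be unique as a linear map.\<close>

lemma tangential_derivative_unique:
  fixes m :: "'n::finite spins" and \<psi> :: "'n spins \<Rightarrow> real"
  assumes m: "m \<in> sphere_prod" and g: "g \<in> tangent_space m" "g' \<in> tangent_space m"
    and D: "(\<psi> has_derivative (\<lambda>v. g \<bullet> v)) (at m within sphere_prod)"
      "(\<psi> has_derivative (\<lambda>v. g' \<bullet> v)) (at m within sphere_prod)"
  shows "g = g'"
proof -
  have w: "g - g' \<in> tangent_space m" using g by (rule subspace_diff[OF subspace_tangent_space])
  from tangent_curve[OF m w] obtain \<gamma> where
    \<gamma>: "\<forall>\<tau>. \<gamma> \<tau> \<in> sphere_prod" "\<gamma> 0 = m" "(\<gamma> has_vector_derivative (g - g')) (at 0)"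
    by (elim exE conjE)
  have comp: "((\<lambda>\<tau>. \<psi> (\<gamma> \<tau>)) has_derivative (\<lambda>h. k \<bullet> (h *\<^sub>R (g - g')))) (at 0)"
    if "(\<psi> has_derivative (\<lambda>v. k \<bullet> v)) (at m within sphere_prod)" for k
  proof -
    have "(\<psi> has_derivative (\<lambda>v. k \<bullet> v)) (at (\<gamma> 0) within range \<gamma>)"
      unfolding \<gamma>(2) by (rule has_derivative_subset[OF that]) (use \<gamma>(1) in auto)
    from has_derivative_in_compose[OF \<gamma>(3)[unfolded has_vector_derivative_def] this]
    show ?thesis .
  qed
  have "(\<lambda>h. g \<bullet> (h *\<^sub>R (g - g'))) = (\<lambda>h. g' \<bullet> (h *\<^sub>R (g - g')))"
    by (rule has_derivative_unique[OF comp[OF D(1)] comp[OF D(2)]])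
  from fun_cong[OF this, of 1] have "(g - g') \<bullet> (g - g') = 0"
    by (simp add: inner_diff_left)
  then show ?thesis by simp
qed

lemma mgrad_works:
  assumes "m \<in> sphere_prod" and "\<psi> differentiable (at m within sphere_prod)"
  shows "mgrad \<psi> m \<in> tangent_space m"
    and "(\<psi> has_derivative (\<lambda>v. mgrad \<psi> m \<bullet> v)) (at m within sphere_prod)"
proof -
  obtain D where "(\<psi> has_derivative D) (at m within sphere_prod)" using assms(2) by (auto simp: differentiable_def)
  from tangential_derivative_exists[OF assms(1) this] obtain g where
    "g \<in> tangent_space m \<and> (\<psi> has_derivative (\<lambda>v. g \<bullet> v)) (at m within sphere_prod)" by blast
  from theI[of "\<lambda>g. g \<in> tangent_space m \<and> (\<psi> has_derivative (\<lambda>v. g \<bullet> v)) (at m within sphere_prod)", OF this]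
    tangential_derivative_unique[OF assms(1)] this
  have "mgrad \<psi> m \<in> tangent_space m \<and> (\<psi> has_derivative (\<lambda>v. mgrad \<psi> m \<bullet> v)) (at m within sphere_prod)"
    unfolding mgrad_def by blast
  then show "mgrad \<psi> m \<in> tangent_space m"
    and "(\<psi> has_derivative (\<lambda>v. mgrad \<psi> m \<bullet> v)) (at m within sphere_prod)" by auto
qed

text \<open>The chord from \<open>x\<close> to \<open>y\<close>, projected radially to the unit sphere, differs from the chord only to
  second order.\<close>

lemma unit_sphere_path:
  fixes x y :: "'a::real_inner"
  assumes x: "norm x = 1" and y: "norm y = 1" and d1: "norm (y - x) \<le> 1"
  shows "\<exists>c c'. c 0 = x \<and> c 1 = y \<and> (\<forall>\<tau>\<in>{0..1}. norm (c \<tau>) = 1 \<and>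
    (c has_vector_derivative c' \<tau>) (at \<tau> within {0..1}) \<and>
    norm (c' \<tau> - (y - x)) \<le> (norm (y - x))\<^sup>2 \<and> norm (c \<tau> - x - \<tau> *\<^sub>R (y - x)) \<le> (norm (y - x))\<^sup>2)"
proof -
  define d where "d = y - x"
  \<comment> \<open>\<open>N \<tau>\<close> is the squared length of the chord point
    \<open>x + \<tau> d\<close>; since \<open>x . d = - |d|^2 / 2\<close>, it depends on
    \<open>d\<close> through its length only.\<close>
  define N where "N \<tau> = 1 - \<tau> * (1 - \<tau>) * (norm d)\<^sup>2" for \<tau>
  define c where "c \<tau> = (1 / sqrt (N \<tau>)) *\<^sub>R (x + \<tau> *\<^sub>R d)" for \<tau>
  define c' where "c' \<tau> = (1 / sqrt (N \<tau>)) *\<^sub>R d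
    + ((1 - 2 * \<tau>) * (norm d)\<^sup>2 / (2 * N \<tau> * sqrt (N \<tau>))) *\<^sub>R (x + \<tau> *\<^sub>R d)" for \<tau>
  have xd: "x \<bullet> d = - (norm d)\<^sup>2 / 2"
    using x y unfolding d_def norm_eq_1
    by (simp add: power2_norm_eq_inner inner_diff_left inner_diff_right inner_commute)
  have nN: "(norm (x + \<tau> *\<^sub>R d))\<^sup>2 = N \<tau>" for \<tau>
  proof -
    have "(norm (x + \<tau> *\<^sub>R d))\<^sup>2 = x \<bullet> x + 2 * \<tau> * (x \<bullet> d) + \<tau>\<^sup>2 * (d \<bullet> d)"
      unfolding power2_norm_eq_inner power2_eq_square[of \<tau>]
      by (simp add: inner_add_left inner_add_right inner_commute algebra_simps)
    also have "\<dots> = N \<tau>" using x unfolding norm_eq_1 xd N_def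
      by (simp add: dot_square_norm field_simps power2_eq_square)
    finally show ?thesis .
  qed
  have dsq: "(norm d)\<^sup>2 \<le> 1" using d1 by (simp add: d_def power_le_one)
  have *: "norm (c \<tau>) = 1 \<and> (c has_vector_derivative c' \<tau>) (at \<tau> within {0..1}) \<and>
    norm (c' \<tau> - d) \<le> (norm d)\<^sup>2 \<and> norm (c \<tau> - x - \<tau> *\<^sub>R d) \<le> (norm d)\<^sup>2" if \<tau>: "\<tau> \<in> {0..1}" for \<tau>
  proof -
    have t4: "\<tau> * (1 - \<tau>) \<le> 1 / 4" "0 \<le> \<tau> * (1 - \<tau>)"
      using \<tau> zero_le_power2[of "\<tau> - 1 / 2"] by (auto simp: power2_eq_square algebra_simps mult_left_le)
    have N1: "1 - N \<tau> \<le> (norm d)\<^sup>2 / 4" "0 \<le> 1 - N \<tau>"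
      using mult_right_mono[OF t4(1), of "(norm d)\<^sup>2"] mult_nonneg_nonneg[OF t4(2), of "(norm d)\<^sup>2"] by (auto simp: N_def)
    \<comment> \<open>The bounds \<open>|d| \<le> 1\<close> and
      \<open>\<tau> (1 - \<tau>) \<le> 1/4\<close> keep the chord away from the centre, which is
      what makes the projection estimates explicit.\<close>
    then have N34: "3 / 4 \<le> N \<tau>" using dsq by simp
    define q where "q = sqrt (N \<tau>)"
    have qq: "q * q = N \<tau>" "0 < q" using N34 by (auto simp: q_def)
    have q1: "q \<le> 1" using N1 by (simp add: q_def)
    have Nq: "N \<tau> \<le> q" using mult_left_mono[OF q1, of q] qq by simp
    have nq: "norm (x + \<tau> *\<^sub>R d) = q" unfolding q_def nN[symmetric] by simp
    have "norm (c \<tau>) = 1" using qq nq by (simp add: c_def flip: q_def)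
    moreover have "(c has_vector_derivative c' \<tau>) (at \<tau> within {0..1})"
    proof -
      have "(N has_real_derivative - ((1 - 2 * \<tau>) * (norm d)\<^sup>2)) (at \<tau> within {0..1})"
        unfolding N_def by (auto intro!: derivative_eq_intros simp: algebra_simps)
      then have "((\<lambda>\<tau>. inverse (sqrt (N \<tau>))) has_real_derivative
          - (inverse (sqrt (N \<tau>)) * (inverse (sqrt (N \<tau>)) / 2 * (- ((1 - 2 * \<tau>) * (norm d)\<^sup>2))) * inverse (sqrt (N \<tau>)))) (at \<tau> within {0..1})"
        using N34 unfolding q_def by (intro DERIV_inverse' DERIV_chain2[OF DERIV_real_sqrt]) auto
      moreover have "- (inverse (sqrt (N \<tau>)) * (inverse (sqrt (N \<tau>)) / 2 * (- ((1 - 2 * \<tau>) * (norm d)\<^sup>2))) * inverse (sqrt (N \<tau>)))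
          = (1 - 2 * \<tau>) * (norm d)\<^sup>2 / (2 * N \<tau> * q)"
        using qq(2) unfolding q_def[symmetric] qq(1)[symmetric] by (simp add: field_simps)
      ultimately have "((\<lambda>\<tau>. 1 / sqrt (N \<tau>)) has_real_derivative (1 - 2 * \<tau>) * (norm d)\<^sup>2 / (2 * N \<tau> * q)) (at \<tau> within {0..1})"
        by (simp only: inverse_eq_divide)
      moreover have "((\<lambda>\<tau>. x + \<tau> *\<^sub>R d) has_vector_derivative d) (at \<tau> within {0..1})"
        by (auto intro!: derivative_eq_intros simp: has_vector_derivative_def)
      ultimately show ?thesis
        unfolding c_def c'_def q_def by (rule has_vector_derivative_scaleR)
    qed
    moreover have "norm (c' \<tau> - d) \<le> (norm d)\<^sup>2"
    proof -
      have "c' \<tau> - d = ((1 - q) / q) *\<^sub>R d + ((1 - 2 * \<tau>) * (norm d)\<^sup>2 / (2 * N \<tau> * q)) *\<^sub>R (x + \<tau> *\<^sub>R d)"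
        using qq by (simp add: c'_def q_def[symmetric] diff_divide_distrib scaleR_diff_left)
      then have "norm (c' \<tau> - d) \<le> (1 - q) / q * norm d + \<bar>1 - 2 * \<tau>\<bar> * (norm d)\<^sup>2 / (2 * N \<tau> * q) * q"
        using norm_triangle_ineq[of "((1 - q) / q) *\<^sub>R d" "((1 - 2 * \<tau>) * (norm d)\<^sup>2 / (2 * N \<tau> * q)) *\<^sub>R (x + \<tau> *\<^sub>R d)"]
          q1 qq N34 by (simp add: nq abs_mult)
      \<comment> \<open>One third comes from \<open>(1 - q) / q\<close>, with numerator at most a
        quarter of \<open>|d|^2\<close> and denominator at least 3/4; two thirds come from
        \<open>1 / (2 * 3/4)\<close>. They add up to the constant 1.\<close>
      also have "\<dots> \<le> (norm d)\<^sup>2 / 3 * 1 + 1 * (norm d)\<^sup>2 * (2 / 3)"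
      proof (rule add_mono)
        have "(1 - q) / q \<le> ((norm d)\<^sup>2 / 4) / (3 / 4)"
          using N1 Nq N34 qq q1 by (intro frac_le) auto
        then have "(1 - q) / q \<le> (norm d)\<^sup>2 / 3" by simp
        then show "(1 - q) / q * norm d \<le> (norm d)\<^sup>2 / 3 * 1"
          by (rule mult_mono) (use d1 in \<open>auto simp: d_def\<close>)
        have "\<bar>1 - 2 * \<tau>\<bar> * (norm d)\<^sup>2 / (2 * N \<tau> * q) * q = \<bar>1 - 2 * \<tau>\<bar> * (norm d)\<^sup>2 * (1 / (2 * N \<tau>))"
          using qq by simp
        also have "\<dots> \<le> 1 * (norm d)\<^sup>2 * (1 / (2 * (3 / 4)))"
          using \<tau> N34 by (intro mult_mono frac_le) auto
        finally show "\<bar>1 - 2 * \<tau>\<bar> * (norm d)\<^sup>2 / (2 * N \<tau> * q) * q \<le> 1 * (norm d)\<^sup>2 * (2 / 3)" by simp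
      qed
      finally show ?thesis by simp
    qed
    moreover have "norm (c \<tau> - x - \<tau> *\<^sub>R d) \<le> (norm d)\<^sup>2"
    proof -
      have "c \<tau> - x - \<tau> *\<^sub>R d = (1 / q - 1) *\<^sub>R (x + \<tau> *\<^sub>R d)"
        by (simp add: c_def q_def[symmetric] scaleR_diff_left)
      then have "norm (c \<tau> - x - \<tau> *\<^sub>R d) = \<bar>1 / q - 1\<bar> * q"
        by (simp only: norm_scaleR nq)
      also have "\<dots> = 1 - q" using qq(2) q1 by (simp add: field_simps)
      finally have "norm (c \<tau> - x - \<tau> *\<^sub>R d) = 1 - q" .
      also have "\<dots> \<le> (norm d)\<^sup>2" using N1 Nq zero_le_power2[of "norm d"] by linarith
      finally show ?thesis .
    qed
    ultimately show ?thesis by blast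
  qed
  have "c 0 = x" "c 1 = y" by (auto simp: c_def N_def d_def)
  with * show ?thesis unfolding d_def by blast
qed

text \<open>Project the chord in every sphere separately. The errors in the spins are bounded by
  \<open>|spin (y - x) i|^2\<close>, and these sum exactly to \<open>|y - x|^2\<close>, so no factor
  depending on the number of spins appears.\<close>

lemma sphere_prod_path:
  fixes x y :: "'n::finite spins"
  assumes x: "x \<in> sphere_prod" and y: "y \<in> sphere_prod" and d1: "norm (y - x) \<le> 1"
  obtains \<gamma> \<gamma>' where "\<gamma> 0 = x" "\<gamma> 1 = y" "\<And>\<tau>. \<tau> \<in> {0..1} \<Longrightarrow> \<gamma> \<tau> \<in> sphere_prod"
    "\<And>\<tau>. \<tau> \<in> {0..1} \<Longrightarrow> (\<gamma> has_vector_derivative \<gamma>' \<tau>) (at \<tau> within {0..1})"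
    "\<And>\<tau>. \<tau> \<in> {0..1} \<Longrightarrow> norm (\<gamma>' \<tau> - (y - x)) \<le> (norm (y - x))\<^sup>2"
    "\<And>\<tau>. \<tau> \<in> {0..1} \<Longrightarrow> norm (\<gamma> \<tau> - x - \<tau> *\<^sub>R (y - x)) \<le> (norm (y - x))\<^sup>2"
proof -
  have "\<forall>i. \<exists>c c'. c 0 = spin x i \<and> c 1 = spin y i \<and> (\<forall>\<tau>\<in>{0..1}. norm (c \<tau>) = 1 \<and>
    (c has_vector_derivative c' \<tau>) (at \<tau> within {0..1}) \<and>
    norm (c' \<tau> - (spin y i - spin x i)) \<le> (norm (spin y i - spin x i))\<^sup>2 \<and>
    norm (c \<tau> - spin x i - \<tau> *\<^sub>R (spin y i - spin x i)) \<le> (norm (spin y i - spin x i))\<^sup>2)"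
    using x y d1 norm_spin_le[of "y - x"] by (intro allI unit_sphere_path) (auto simp: sphere_prod_def intro: order_trans)
  then obtain c c' where c: "\<And>i. c i 0 = spin x i" "\<And>i. c i 1 = spin y i"
    "\<And>i \<tau>. \<tau> \<in> {0..1} \<Longrightarrow> norm (c i \<tau>) = 1"
    "\<And>i \<tau>. \<tau> \<in> {0..1} \<Longrightarrow> (c i has_vector_derivative c' i \<tau>) (at \<tau> within {0..1})"
    "\<And>i \<tau>. \<tau> \<in> {0..1} \<Longrightarrow> norm (c' i \<tau> - spin (y - x) i) \<le> (norm (spin (y - x) i))\<^sup>2"
    "\<And>i \<tau>. \<tau> \<in> {0..1} \<Longrightarrow> norm (c i \<tau> - spin x i - \<tau> *\<^sub>R spin (y - x) i) \<le> (norm (spin (y - x) i))\<^sup>2"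
    unfolding spin_simps by metis
  define \<gamma> :: "real \<Rightarrow> 'n spins" where "\<gamma> \<tau> = (\<chi> p. c (fst p) \<tau> $ snd p)" for \<tau>
  define \<gamma>' :: "real \<Rightarrow> 'n spins" where "\<gamma>' \<tau> = (\<chi> p. c' (fst p) \<tau> $ snd p)" for \<tau>
  have s: "spin (\<gamma> \<tau>) i = c i \<tau>" "spin (\<gamma>' \<tau>) i = c' i \<tau>" for \<tau> i
    by (simp_all add: \<gamma>_def \<gamma>'_def spin_def vec_eq_iff)
  show ?thesis
  proof (rule that)
    show "\<gamma> 0 = x" "\<gamma> 1 = y" by (auto intro!: spin_eqI simp: s c)
    fix \<tau> :: real assume \<tau>: "\<tau> \<in> {0..1}"
    show "\<gamma> \<tau> \<in> sphere_prod" using \<tau> by (simp add: sphere_prod_def s c)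
    show "(\<gamma> has_vector_derivative \<gamma>' \<tau>) (at \<tau> within {0..1})"
      by (rule has_vector_derivative_spins) (use \<tau> in \<open>simp add: s c(4)\<close>)
    have "norm (\<gamma>' \<tau> - (y - x)) \<le> (\<Sum>i\<in>UNIV. norm (spin (\<gamma>' \<tau> - (y - x)) i))" by (rule norm_le_sum_spins)
    also have "\<dots> \<le> (\<Sum>i\<in>UNIV. (norm (spin (y - x) i))\<^sup>2)"
      using c(5)[OF \<tau>] by (intro sum_mono) (simp add: s)
    finally show "norm (\<gamma>' \<tau> - (y - x)) \<le> (norm (y - x))\<^sup>2" unfolding norm_spins_sq .
    have "norm (\<gamma> \<tau> - x - \<tau> *\<^sub>R (y - x)) \<le> (\<Sum>i\<in>UNIV. norm (spin (\<gamma> \<tau> - x - \<tau> *\<^sub>R (y - x)) i))" by (rule norm_le_sum_spins)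
    also have "\<dots> \<le> (\<Sum>i\<in>UNIV. (norm (spin (y - x) i))\<^sup>2)"
      using c(6)[OF \<tau>] by (intro sum_mono) (simp add: s)
    finally show "norm (\<gamma> \<tau> - x - \<tau> *\<^sub>R (y - x)) \<le> (norm (y - x))\<^sup>2" unfolding norm_spins_sq .
  qed
qed

lemma mean_value_unit_interval:
  fixes f :: "real \<Rightarrow> real"
  assumes "\<And>\<tau>. \<tau> \<in> {0..1} \<Longrightarrow> (f has_vector_derivative f' \<tau>) (at \<tau> within {0..1})"
  obtains \<tau> where "\<tau> \<in> {0..1}" "f 1 - f 0 = f' \<tau>"
proof -
  have "\<exists>x\<in>{0<..<1}. f 1 - f 0 = (\<lambda>h. h *\<^sub>R f' x) (1 - 0)"
    by (rule mvt_simple) (use assms in \<open>auto simp: has_vector_derivative_def\<close>)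
  then obtain x where "x \<in> {0<..<1}" "f 1 - f 0 = f' x" by auto
  then show ?thesis using that[of x] by simp
qed

lemma mgrad_path_derivative:
  assumes \<gamma>: "\<And>\<tau>. \<tau> \<in> {0..1} \<Longrightarrow> \<gamma> \<tau> \<in> sphere_prod"
    and d\<gamma>: "(\<gamma> has_vector_derivative \<gamma>') (at \<tau> within {0..1})" and \<tau>: "\<tau> \<in> {0..1}"
    and \<psi>: "\<psi> differentiable_on sphere_prod"
  shows "((\<lambda>\<tau>. \<psi> (\<gamma> \<tau>)) has_vector_derivative mgrad \<psi> (\<gamma> \<tau>) \<bullet> \<gamma>') (at \<tau> within {0..1})"
proof -
  have "(\<psi> has_derivative (\<lambda>v. mgrad \<psi> (\<gamma> \<tau>) \<bullet> v)) (at (\<gamma> \<tau>) within \<gamma> ` {0..1})"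
    using \<gamma> \<tau> \<psi> by (intro has_derivative_subset[OF mgrad_works(2)]) (auto simp: differentiable_on_def)
  from has_derivative_in_compose[OF d\<gamma>[unfolded has_vector_derivative_def] this]
  show ?thesis by (simp add: has_vector_derivative_def)
qed

section \<open>Second order expansion on the manifold\<close>

text \<open>Matrices carry the norm of a vector of rows, i.e. the Frobenius norm, so Cauchy-Schwarz
  in each row suffices.\<close>

lemma norm_matrix_vector_mult_le: "norm (A *v v) \<le> norm (A :: real^'k^'l) * norm v"
proof -
  have "norm (A *v v) = L2_set (\<lambda>i. \<bar>A $ i \<bullet> v\<bar>) UNIV"
    by (simp add: norm_vec_def matrix_vector_mult_def inner_vec_def)
  also have "\<dots> \<le> L2_set (\<lambda>i. norm (A $ i) * norm v) UNIV"
    by (intro L2_set_mono Cauchy_Schwarz_ineq2) auto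
  also have "\<dots> = norm A * norm v"
    by (simp add: L2_set_left_distrib norm_vec_def)
  finally show ?thesis .
qed

text \<open>This is the ambient derivative of the gradient field along the manifold, not the
  covariant Hessian: its rows are tangent, but its values may have a normal component and the matrix
  need not be symmetric.\<close>

definition mhess :: "('n::finite spins \<Rightarrow> real) \<Rightarrow> 'n spins \<Rightarrow> 'n spin_mat" where
  "mhess \<psi> x = (\<chi> p. mgrad (\<lambda>z. mgrad \<psi> z $ p) x)"

lemma mhess_mult: "(mhess \<psi> x *v v) $ p = mgrad (\<lambda>z. mgrad \<psi> z $ p) x \<bullet> v"
  by (simp add: mhess_def matrix_vector_mult_def inner_vec_def)

lemma differentiable_on_vec_nth:
  fixes f :: "'a::real_normed_vector \<Rightarrow> real ^ 'k"
  shows "f differentiable_on S \<Longrightarrow> (\<lambda>z. f z $ p) differentiable_on S"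
  unfolding differentiable_on_def
  by (auto simp: differentiable_def intro!: bounded_linear.has_derivative[OF bounded_linear_vec_nth])

text \<open>The rows of \<open>mhess\<close> are tangent, so the frame identity for the noise
  directions reduces their sum to the coordinate trace, which is how the divergence is
  defined.\<close>

lemma laplace_trace:
  assumes "twice_differentiable_M \<psi>" "m \<in> sphere_prod"
  shows "(\<Sum>q\<in>UNIV. (mhess \<psi> m *v cprod m (axis q 1)) \<bullet> cprod m (axis q 1)) = laplace_beltrami \<psi> m"
proof -
  have "mgrad (\<lambda>z. mgrad \<psi> z $ p) m \<in> tangent_space m" for p
    using assms differentiable_on_vec_nth[of "mgrad \<psi>" sphere_prod p]
    by (intro mgrad_works) (auto simp: twice_differentiable_M_def differentiable_on_def)
  from tangential_trace[OF assms(2), of "\<lambda>p. mgrad (\<lambda>z. mgrad \<psi> z $ p) m", OF this]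
  show ?thesis
    by (simp add: inner_vec_def[of "_ *v _"] mhess_mult laplace_beltrami_def mdiv_def)
qed

context
  fixes T :: real and W :: "real \<Rightarrow> 'n::finite spins \<Rightarrow> real"
  assumes W: "C12_M T W"
begin

lemma C12_diff:
  assumes "s \<in> {0..T}"
  shows "W s differentiable_on sphere_prod" "(\<lambda>z. mgrad (W s) z $ p) differentiable_on sphere_prod"
    "twice_differentiable_M (W s)"
  using W assms by (auto simp: C12_M_def twice_differentiable_M_def intro: differentiable_on_vec_nth)

lemma C12_tangent: "s \<in> {0..T} \<Longrightarrow> x \<in> sphere_prod \<Longrightarrow> mgrad (W s) x \<in> tangent_space x"
  using C12_diff(1) by (intro mgrad_works) (auto simp: differentiable_on_def)

lemma continuous_on_mhess: "continuous_on ({0..T} \<times> sphere_prod) (\<lambda>(s, x). mhess (W s) x)"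
  using W unfolding C12_M_def mhess_def case_prod_unfold by (intro continuous_on_vec_lambda) auto

lemma C12_bounds:
  obtains K where "K \<ge> 0"
    "\<And>s x. s \<in> {0..T} \<Longrightarrow> x \<in> sphere_prod \<Longrightarrow> \<bar>W s x\<bar> \<le> K"
    "\<And>s x. s \<in> {0..T} \<Longrightarrow> x \<in> sphere_prod \<Longrightarrow> \<bar>dt_on T W s x\<bar> \<le> K"
    "\<And>s x. s \<in> {0..T} \<Longrightarrow> x \<in> sphere_prod \<Longrightarrow> norm (mgrad (W s) x) \<le> K"
    "\<And>s x. s \<in> {0..T} \<Longrightarrow> x \<in> sphere_prod \<Longrightarrow> norm (mhess (W s) x) \<le> K"
proof -
  let ?S = "{0..T} \<times> (sphere_prod :: 'n spins set)"
  have cS: "compact ?S" by (intro compact_Times compact_Icc compact_sphere_prod)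
  have bd: "\<exists>K. \<forall>z\<in>?S. norm (f z) \<le> K" if "continuous_on ?S f" for f :: "_ \<Rightarrow> 'z::real_normed_vector"
    using compact_imp_bounded[OF compact_continuous_image[OF that cS]] by (auto simp: bounded_iff)
  obtain K1 K2 K3 K4 where K:
    "\<forall>z\<in>?S. norm ((\<lambda>(s, x). W s x) z) \<le> K1"
    "\<forall>z\<in>?S. norm ((\<lambda>(s, x). dt_on T W s x) z) \<le> K2"
    "\<forall>z\<in>?S. norm ((\<lambda>(s, x). mgrad (W s) x) z) \<le> K3"
    "\<forall>z\<in>?S. norm ((\<lambda>(s, x). mhess (W s) x) z) \<le> K4"
    using bd[of "\<lambda>(s, x). W s x"] bd[of "\<lambda>(s, x). dt_on T W s x"] bd[of "\<lambda>(s, x). mgrad (W s) x"]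
      bd[OF continuous_on_mhess] W unfolding C12_M_def by blast
  show ?thesis
    by (rule that[of "Max {0, K1, K2, K3, K4}"]) (use K in \<open>force simp: le_max_iff_disj\<close>)+
qed

text \<open>Mean value theorem for each component of the gradient along the projected chord. Uniform
  continuity of \<open>mhess\<close> on the compact set of times and states makes \<open>d\<close>
  independent of \<open>s\<close> and \<open>x\<close>, and replacing the velocity of the path by
  \<open>y - x\<close> costs only second order.\<close>

lemma mgrad_first_order:
  assumes "\<eta> > 0"
  obtains d where "d > 0" "d \<le> 1"
    "\<And>s x y. s \<in> {0..T} \<Longrightarrow> x \<in> sphere_prod \<Longrightarrow> y \<in> sphere_prod \<Longrightarrow> norm (y - x) < d \<Longrightarrow>
      norm (mgrad (W s) y - mgrad (W s) x - mhess (W s) x *v (y - x)) \<le> \<eta> * norm (y - x)"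
proof -
  let ?S = "{0..T} \<times> (sphere_prod :: 'n spins set)"
  obtain K where K: "K \<ge> 0" "\<And>s x. s \<in> {0..T} \<Longrightarrow> x \<in> sphere_prod \<Longrightarrow> norm (mhess (W s) x) \<le> K"
    using C12_bounds by metis
  define c where "c = real CARD('n \<times> 3)"
  have c: "c \<ge> 1" using zero_less_card_finite[where 'a = "'n \<times> 3"] unfolding c_def by linarith
  have "uniformly_continuous_on ?S (\<lambda>(s, x). mhess (W s) x)"
    by (intro compact_uniformly_continuous continuous_on_mhess compact_Times compact_Icc compact_sphere_prod)
  moreover have "\<eta> / (4 * c) > 0" using assms c by simp
  ultimately obtain d0 where d0: "d0 > 0" "\<And>s x s' x'. (s, x) \<in> ?S \<Longrightarrow> (s', x') \<in> ?S \<Longrightarrow> dist (s', x') (s, x) < d0 \<Longrightarrow>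
      dist (mhess (W s') x') (mhess (W s) x) < \<eta> / (4 * c)"
    unfolding uniformly_continuous_on_def by (metis case_prod_conv)
  \<comment> \<open>The path stays within \<open>2 |y - x|\<close> of \<open>x\<close>, hence
    \<open>d0 / 2\<close>. The last bound makes the curvature error \<open>K |y - x|^2\<close> at
    most \<open>\<eta> / (2 c) |y - x|\<close>; here \<open>c\<close> counts the components whose
    errors are finally added.\<close>
  define d where "d = min 1 (min (d0 / 2) (\<eta> / (2 * c * (K + 1))))"
  show ?thesis
  proof (rule that[of d])
    show "d > 0" "d \<le> 1" using d0(1) assms c K(1) by (auto simp: d_def)
    fix s and x y :: "'n spins" assume s: "s \<in> {0..T}" and x: "x \<in> sphere_prod" and y: "y \<in> sphere_prod" and xy: "norm (y - x) < d"
    let ?r = "norm (y - x)"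
    have r1: "?r \<le> 1" using xy by (simp add: d_def)
    have r2: "?r\<^sup>2 \<le> ?r" using r1 by (simp add: power2_eq_square mult_left_le)
    from r1 obtain \<gamma> \<gamma>' where \<gamma>: "\<gamma> 0 = x" "\<gamma> 1 = y" "\<And>\<tau>. \<tau> \<in> {0..1} \<Longrightarrow> \<gamma> \<tau> \<in> sphere_prod"
      "\<And>\<tau>. \<tau> \<in> {0..1} \<Longrightarrow> (\<gamma> has_vector_derivative \<gamma>' \<tau>) (at \<tau> within {0..1})"
      "\<And>\<tau>. \<tau> \<in> {0..1} \<Longrightarrow> norm (\<gamma>' \<tau> - (y - x)) \<le> ?r\<^sup>2"
      "\<And>\<tau>. \<tau> \<in> {0..1} \<Longrightarrow> norm (\<gamma> \<tau> - x - \<tau> *\<^sub>R (y - x)) \<le> ?r\<^sup>2"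
      by (rule sphere_prod_path[OF x y]) blast
    have comp: "\<bar>(mgrad (W s) y - mgrad (W s) x - mhess (W s) x *v (y - x)) $ p\<bar> \<le> \<eta> / c * ?r" for p
    proof -
      let ?H = "\<lambda>z. mgrad (\<lambda>z. mgrad (W s) z $ p) z"
      have "((\<lambda>\<tau>. mgrad (W s) (\<gamma> \<tau>) $ p) has_vector_derivative ?H (\<gamma> \<tau>) \<bullet> \<gamma>' \<tau>) (at \<tau> within {0..1})"
        if "\<tau> \<in> {0..1}" for \<tau>
        using mgrad_path_derivative[OF \<gamma>(3) \<gamma>(4)[OF that] that C12_diff(2)[OF s]] by blast
      then obtain \<tau> where \<tau>: "\<tau> \<in> {0..1}" "mgrad (W s) y $ p - mgrad (W s) x $ p = ?H (\<gamma> \<tau>) \<bullet> \<gamma>' \<tau>"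
        by (rule mean_value_unit_interval[where f = "\<lambda>\<tau>. mgrad (W s) (\<gamma> \<tau>) $ p"]) (use \<gamma> in auto)
      have "norm (\<gamma> \<tau> - x) \<le> norm (\<gamma> \<tau> - x - \<tau> *\<^sub>R (y - x)) + norm (\<tau> *\<^sub>R (y - x))"
        by (metis diff_add_cancel norm_triangle_ineq)
      also have "\<dots> \<le> ?r + ?r"
        using \<gamma>(6)[OF \<tau>(1)] r2 \<tau>(1) by (intro add_mono) (auto simp: mult_left_le_one_le)
      also have "\<dots> < d0" using xy by (simp add: d_def)
      finally have "dist (s, \<gamma> \<tau>) (s, x) < d0" by (simp add: dist_Pair_Pair dist_norm)
      with d0(2)[of s x s "\<gamma> \<tau>"] \<gamma>(3)[OF \<tau>(1)] s x
      have "norm (mhess (W s) (\<gamma> \<tau>) - mhess (W s) x) < \<eta> / (4 * c)" by (simp add: dist_norm)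
      then have H1: "norm (?H (\<gamma> \<tau>) - ?H x) \<le> \<eta> / (4 * c)"
        using Finite_Cartesian_Product.norm_nth_le[of "mhess (W s) (\<gamma> \<tau>) - mhess (W s) x" p] by (simp add: mhess_def)
      have H2: "norm (?H x) \<le> K"
        using Finite_Cartesian_Product.norm_nth_le[of "mhess (W s) x" p] K(2)[OF s x] by (simp add: mhess_def)
      have g2: "norm (\<gamma>' \<tau>) \<le> 2 * ?r"
        using \<gamma>(5)[OF \<tau>(1)] r2 norm_triangle_ineq2[of "\<gamma>' \<tau>" "y - x"] by linarith
      have "(mgrad (W s) y - mgrad (W s) x - mhess (W s) x *v (y - x)) $ p
          = (?H (\<gamma> \<tau>) - ?H x) \<bullet> \<gamma>' \<tau> + ?H x \<bullet> (\<gamma>' \<tau> - (y - x))"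
        using \<tau>(2) by (simp add: mhess_mult inner_diff_left inner_diff_right)
      also have "\<bar>\<dots>\<bar> \<le> norm (?H (\<gamma> \<tau>) - ?H x) * norm (\<gamma>' \<tau>) + norm (?H x) * norm (\<gamma>' \<tau> - (y - x))"
        by (intro order_trans[OF abs_triangle_ineq] add_mono Cauchy_Schwarz_ineq2)
      also have "\<dots> \<le> \<eta> / (4 * c) * (2 * ?r) + K * ?r\<^sup>2"
        using H1 H2 g2 \<gamma>(5)[OF \<tau>(1)] K(1) assms c by (intro add_mono mult_mono) auto
      also have "K * ?r\<^sup>2 \<le> \<eta> / (2 * c) * ?r"
      proof -
        have "K * ?r \<le> (K + 1) * (\<eta> / (2 * c * (K + 1)))"
          using xy K(1) by (intro mult_mono) (auto simp: d_def)
        also have "(K + 1) * (\<eta> / (2 * c * (K + 1))) = \<eta> / (2 * c)" using K(1) by simp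
        finally have "K * ?r \<le> \<eta> / (2 * c)" .
        from mult_right_mono[OF this, of ?r] show ?thesis by (simp add: power2_eq_square mult.assoc)
      qed
      also have "\<eta> / (4 * c) * (2 * ?r) + \<eta> / (2 * c) * ?r = \<eta> / c * ?r" using c by (simp add: field_simps)
      finally show ?thesis by simp
    qed
    have "norm (mgrad (W s) y - mgrad (W s) x - mhess (W s) x *v (y - x))
       \<le> (\<Sum>p\<in>UNIV. \<bar>(mgrad (W s) y - mgrad (W s) x - mhess (W s) x *v (y - x)) $ p\<bar>)"
      by (rule norm_le_l1_cart)
    also have "\<dots> \<le> (\<Sum>p\<in>(UNIV :: ('n \<times> 3) set). \<eta> / c * ?r)" by (intro sum_mono comp)
    also have "\<dots> = \<eta> * ?r" using c unfolding sum_constant c_def[symmetric] by simp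
    finally show "norm (mgrad (W s) y - mgrad (W s) x - mhess (W s) x *v (y - x)) \<le> \<eta> * ?r" .
  qed
qed

section \<open>The second order Taylor remainder on the manifold\<close>

definition taylor_rem :: "real \<Rightarrow> 'n spins \<Rightarrow> 'n spins \<Rightarrow> real" where
  "taylor_rem s x y = W s y - W s x - mgrad (W s) x \<bullet> (y - x) - (mhess (W s) x *v (y - x)) \<bullet> (y - x) / 2"

text \<open>Symmetry of the second derivative is not needed: along the path, position and velocity are parallel
  up to second order, so the antisymmetric part only contributes to third order.\<close>

lemma taylor_rem_small:
  assumes "\<eta> > 0"
  obtains d where "d > 0"
    "\<And>s x y. s \<in> {0..T} \<Longrightarrow> x \<in> sphere_prod \<Longrightarrow> y \<in> sphere_prod \<Longrightarrow> norm (y - x) < d \<Longrightarrow>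
      \<bar>taylor_rem s x y\<bar> \<le> \<eta> * (norm (y - x))\<^sup>2"
proof -
  obtain K where K: "K \<ge> 0" "\<And>s x. s \<in> {0..T} \<Longrightarrow> x \<in> sphere_prod \<Longrightarrow> norm (mhess (W s) x) \<le> K"
    using C12_bounds by metis
  have "\<eta> / 8 > 0" using assms by simp
  from mgrad_first_order[OF this] obtain d0 where d0: "d0 > 0" "d0 \<le> 1"
    "\<And>s x y. s \<in> {0..T} \<Longrightarrow> x \<in> sphere_prod \<Longrightarrow> y \<in> sphere_prod \<Longrightarrow> norm (y - x) < d0 \<Longrightarrow>
      norm (mgrad (W s) y - mgrad (W s) x - mhess (W s) x *v (y - x)) \<le> \<eta> / 8 * norm (y - x)" by blast
  \<comment> \<open>Points of the path are up to \<open>2 |y - x|\<close> away from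
    \<open>x\<close>, hence \<open>d0 / 2\<close>. The second bound gives
    \<open>4 K |y - x| \<le> \<eta> / 2\<close>, which absorbs the four deviation terms
    below.\<close>
  define d where "d = min (d0 / 2) (\<eta> / (8 * (K + 1)))"
  show ?thesis
  proof (rule that[of d])
    show "d > 0" using d0(1) assms K(1) by (auto simp: d_def)
    fix s and x y :: "'n spins" assume s: "s \<in> {0..T}" and x: "x \<in> sphere_prod" and y: "y \<in> sphere_prod" and xy: "norm (y - x) < d"
    let ?r = "norm (y - x)"
    let ?A = "mhess (W s) x"
    have r1: "?r \<le> 1" using xy d0(2) by (simp add: d_def)
    have r2: "?r\<^sup>2 \<le> ?r" using r1 by (simp add: power2_eq_square mult_left_le)
    from r1 obtain \<gamma> \<gamma>' where \<gamma>: "\<gamma> 0 = x" "\<gamma> 1 = y" "\<And>\<tau>. \<tau> \<in> {0..1} \<Longrightarrow> \<gamma> \<tau> \<in> sphere_prod"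
      "\<And>\<tau>. \<tau> \<in> {0..1} \<Longrightarrow> (\<gamma> has_vector_derivative \<gamma>' \<tau>) (at \<tau> within {0..1})"
      "\<And>\<tau>. \<tau> \<in> {0..1} \<Longrightarrow> norm (\<gamma>' \<tau> - (y - x)) \<le> ?r\<^sup>2"
      "\<And>\<tau>. \<tau> \<in> {0..1} \<Longrightarrow> norm (\<gamma> \<tau> - x - \<tau> *\<^sub>R (y - x)) \<le> ?r\<^sup>2"
      by (rule sphere_prod_path[OF x y]) blast
    \<comment> \<open>The function minus its Taylor polynomial, followed along the path: its total
      increment is the remainder. A single mean value step is enough, because the gradient in
      \<open>\<theta>'\<close> can itself be expanded to first order.\<close>
    define \<theta> where "\<theta> \<tau> = W s (\<gamma> \<tau>) - mgrad (W s) x \<bullet> (\<gamma> \<tau> - x) - (?A *v (\<gamma> \<tau> - x)) \<bullet> (\<gamma> \<tau> - x) / 2" for \<tau>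
    define \<theta>' where "\<theta>' \<tau> = mgrad (W s) (\<gamma> \<tau>) \<bullet> \<gamma>' \<tau> - mgrad (W s) x \<bullet> \<gamma>' \<tau>
      - ((?A *v \<gamma>' \<tau>) \<bullet> (\<gamma> \<tau> - x) + (?A *v (\<gamma> \<tau> - x)) \<bullet> \<gamma>' \<tau>) / 2" for \<tau>
    have "(\<theta> has_vector_derivative \<theta>' \<tau>) (at \<tau> within {0..1})" if "\<tau> \<in> {0..1}" for \<tau>
    proof -
      have 1: "((\<lambda>\<tau>. W s (\<gamma> \<tau>)) has_vector_derivative mgrad (W s) (\<gamma> \<tau>) \<bullet> \<gamma>' \<tau>) (at \<tau> within {0..1})"
        using mgrad_path_derivative[OF \<gamma>(3) \<gamma>(4)[OF that] that C12_diff(1)[OF s]] by blast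
      have 2: "((\<lambda>\<tau>. \<gamma> \<tau> - x) has_vector_derivative \<gamma>' \<tau>) (at \<tau> within {0..1})"
        using has_vector_derivative_diff[OF \<gamma>(4)[OF that] has_vector_derivative_const[of x]] by simp
      have 3: "((\<lambda>\<tau>. ?A *v (\<gamma> \<tau> - x)) has_vector_derivative ?A *v \<gamma>' \<tau>) (at \<tau> within {0..1})"
        by (rule bounded_linear.has_vector_derivative[OF matrix_vector_mul_bounded_linear 2])
      have "((\<lambda>\<tau>. (?A *v (\<gamma> \<tau> - x)) \<bullet> (\<gamma> \<tau> - x)) has_vector_derivative
          (?A *v (\<gamma> \<tau> - x)) \<bullet> \<gamma>' \<tau> + (?A *v \<gamma>' \<tau>) \<bullet> (\<gamma> \<tau> - x)) (at \<tau> within {0..1})"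
        by (rule bounded_bilinear.has_vector_derivative[OF bounded_bilinear_inner 3 2])
      from has_vector_derivative_diff[OF has_vector_derivative_diff[OF 1
          bounded_linear.has_vector_derivative[OF bounded_linear_inner_right[of "mgrad (W s) x"] 2]]
          has_vector_derivative_mult_right[OF this, of "1/2"]]
      show ?thesis unfolding \<theta>_def \<theta>'_def by (simp add: add.commute)
    qed
    then obtain \<tau> where \<tau>: "\<tau> \<in> {0..1}" "\<theta> 1 - \<theta> 0 = \<theta>' \<tau>"
      by (rule mean_value_unit_interval)
    define e1 where "e1 = \<gamma> \<tau> - x - \<tau> *\<^sub>R (y - x)"
    define e2 where "e2 = \<gamma>' \<tau> - (y - x)"
    have e: "norm e1 \<le> ?r\<^sup>2" "norm e2 \<le> ?r\<^sup>2" using \<gamma>(5,6)[OF \<tau>(1)] by (auto simp: e1_def e2_def)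
    have e': "norm e1 \<le> ?r" "norm e2 \<le> ?r" using e r2 by auto
    have a_eq: "\<gamma> \<tau> - x = \<tau> *\<^sub>R (y - x) + e1" and b_eq: "\<gamma>' \<tau> = (y - x) + e2"
      by (simp_all add: e1_def e2_def)
    have na: "norm (\<gamma> \<tau> - x) \<le> 2 * ?r"
    proof -
      have "norm (\<gamma> \<tau> - x) \<le> norm (\<tau> *\<^sub>R (y - x)) + norm e1" unfolding a_eq by (rule norm_triangle_ineq)
      also have "norm (\<tau> *\<^sub>R (y - x)) \<le> ?r" using \<tau>(1) by (simp add: mult_left_le_one_le)
      finally show ?thesis using e' by simp
    qed
    have nb: "norm (\<gamma>' \<tau>) \<le> 2 * ?r"
      using norm_triangle_ineq[of "y - x" e2] e' unfolding b_eq by simp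
    have Abd: "\<bar>(?A *v v) \<bullet> w\<bar> \<le> K * (norm v * norm w)" for v w
    proof -
      have "\<bar>(?A *v v) \<bullet> w\<bar> \<le> norm (?A *v v) * norm w" by (rule Cauchy_Schwarz_ineq2)
      also have "\<dots> \<le> (norm ?A * norm v) * norm w" by (intro mult_right_mono norm_matrix_vector_mult_le) simp
      also have "\<dots> \<le> (K * norm v) * norm w" using K(2)[OF s x] by (intro mult_right_mono) auto
      finally show ?thesis by (simp add: mult.assoc)
    qed
    have "\<theta>' \<tau> = (mgrad (W s) (\<gamma> \<tau>) - mgrad (W s) x - ?A *v (\<gamma> \<tau> - x)) \<bullet> \<gamma>' \<tau>
       + ((?A *v (\<gamma> \<tau> - x)) \<bullet> \<gamma>' \<tau> - (?A *v \<gamma>' \<tau>) \<bullet> (\<gamma> \<tau> - x)) / 2"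
      by (simp add: \<theta>'_def inner_diff_left add_divide_distrib diff_divide_distrib)
    \<comment> \<open>Inserting the straight chord and its deviations \<open>e1\<close>,
      \<open>e2\<close>, the leading terms \<open>\<tau> (A d) . d\<close> with
      \<open>d = y - x\<close> cancel although \<open>A\<close> need not be symmetric. Every
      surviving term contains a deviation of second order.\<close>
    also have "(?A *v (\<gamma> \<tau> - x)) \<bullet> \<gamma>' \<tau> - (?A *v \<gamma>' \<tau>) \<bullet> (\<gamma> \<tau> - x)
       = (?A *v (\<tau> *\<^sub>R (y - x))) \<bullet> e2 + (?A *v e1) \<bullet> \<gamma>' \<tau>
         - (?A *v e2) \<bullet> (\<gamma> \<tau> - x) - (?A *v (y - x)) \<bullet> e1"
      unfolding a_eq b_eq
      by (simp add: matrix_vector_right_distrib inner_add_left inner_add_right matrix_vector_mult_scaleR algebra_simps)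
    finally have eq: "\<theta>' \<tau> = (mgrad (W s) (\<gamma> \<tau>) - mgrad (W s) x - ?A *v (\<gamma> \<tau> - x)) \<bullet> \<gamma>' \<tau>
       + ((?A *v (\<tau> *\<^sub>R (y - x))) \<bullet> e2 + (?A *v e1) \<bullet> \<gamma>' \<tau>
         - (?A *v e2) \<bullet> (\<gamma> \<tau> - x) - (?A *v (y - x)) \<bullet> e1) / 2" .
    have "\<bar>(mgrad (W s) (\<gamma> \<tau>) - mgrad (W s) x - ?A *v (\<gamma> \<tau> - x)) \<bullet> \<gamma>' \<tau>\<bar>
        \<le> norm (mgrad (W s) (\<gamma> \<tau>) - mgrad (W s) x - ?A *v (\<gamma> \<tau> - x)) * norm (\<gamma>' \<tau>)"
      by (rule Cauchy_Schwarz_ineq2)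
    also have "\<dots> \<le> (\<eta> / 8 * norm (\<gamma> \<tau> - x)) * norm (\<gamma>' \<tau>)"
      using na xy by (intro mult_right_mono d0(3) s x \<gamma>(3) \<tau>(1)) (auto simp: d_def)
    also have "\<dots> \<le> (\<eta> / 8 * (2 * ?r)) * (2 * ?r)"
      using na nb assms by (intro mult_mono) auto
    finally have t1: "\<bar>(mgrad (W s) (\<gamma> \<tau>) - mgrad (W s) x - ?A *v (\<gamma> \<tau> - x)) \<bullet> \<gamma>' \<tau>\<bar> \<le> \<eta> / 2 * ?r\<^sup>2"
      by (simp add: power2_eq_square)
    have kr: "K * (a * b) \<le> K * (2 * ?r * ?r\<^sup>2)" if "a \<le> 2 * ?r" "b \<le> ?r\<^sup>2" "0 \<le> a" "0 \<le> b" for a b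
      using that K(1) by (intro mult_left_mono mult_mono) auto
    have "\<tau> * ?r \<le> ?r" "0 \<le> ?r" using \<tau>(1) by (auto simp: mult_left_le_one_le)
    then have "\<tau> * ?r \<le> 2 * ?r" by linarith
    then have tr: "norm (\<tau> *\<^sub>R (y - x)) \<le> 2 * ?r" using \<tau>(1) by simp
    have "\<bar>(?A *v (\<tau> *\<^sub>R (y - x))) \<bullet> e2\<bar> \<le> K * (2 * ?r * ?r\<^sup>2)"
      by (rule order_trans[OF Abd kr[OF tr e(2)]]) simp_all
    moreover have "\<bar>(?A *v e1) \<bullet> \<gamma>' \<tau>\<bar> \<le> K * (2 * ?r * ?r\<^sup>2)"
      by (rule order_trans[OF Abd]) (subst mult.commute[of "norm e1"], rule kr[OF nb e(1)], auto)
    moreover have "\<bar>(?A *v e2) \<bullet> (\<gamma> \<tau> - x)\<bar> \<le> K * (2 * ?r * ?r\<^sup>2)"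
      by (rule order_trans[OF Abd]) (subst mult.commute[of "norm e2"], rule kr[OF na e(2)], auto)
    moreover have "\<bar>(?A *v (y - x)) \<bullet> e1\<bar> \<le> K * (2 * ?r * ?r\<^sup>2)"
      by (rule order_trans[OF Abd kr[OF _ e(1)]]) simp_all
    moreover have "\<bar>(a1 + a2 - a3 - a4) / 2\<bar> \<le> 2 * u"
      if "\<bar>a1\<bar> \<le> u" "\<bar>a2\<bar> \<le> u" "\<bar>a3\<bar> \<le> u" "\<bar>a4\<bar> \<le> u" for a1 a2 a3 a4 u :: real
    proof -
      have "\<bar>a1 + a2 - a3 - a4\<bar> \<le> 4 * u" using that by arith
      then show ?thesis by simp
    qed
    ultimately have "\<bar>((?A *v (\<tau> *\<^sub>R (y - x))) \<bullet> e2 + (?A *v e1) \<bullet> \<gamma>' \<tau>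
         - (?A *v e2) \<bullet> (\<gamma> \<tau> - x) - (?A *v (y - x)) \<bullet> e1) / 2\<bar> \<le> 2 * (K * (2 * ?r * ?r\<^sup>2))" by blast
    then have t2: "\<bar>((?A *v (\<tau> *\<^sub>R (y - x))) \<bullet> e2 + (?A *v e1) \<bullet> \<gamma>' \<tau>
         - (?A *v e2) \<bullet> (\<gamma> \<tau> - x) - (?A *v (y - x)) \<bullet> e1) / 2\<bar> \<le> 4 * K * ?r * ?r\<^sup>2"
      by (simp only: mult.assoc mult.left_commute[of K])
    have "K * ?r \<le> (K + 1) * (\<eta> / (8 * (K + 1)))"
      using xy K(1) by (intro mult_mono) (auto simp: d_def)
    also have "\<dots> = \<eta> / 8" using K(1) by (simp del: distrib_left_numeral)
    finally have "4 * K * ?r \<le> \<eta> / 2" by simp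
    then have "4 * K * ?r * ?r\<^sup>2 \<le> \<eta> / 2 * ?r\<^sup>2" by (rule mult_right_mono) simp
    then have "\<bar>\<theta>' \<tau>\<bar> \<le> \<eta> / 2 * ?r\<^sup>2 + \<eta> / 2 * ?r\<^sup>2"
      using t1 t2 unfolding eq by linarith
    moreover have "taylor_rem s x y = \<theta>' \<tau>"
      using \<tau>(2) \<gamma>(1,2) by (simp add: \<theta>_def taylor_rem_def)
    ultimately show "\<bar>taylor_rem s x y\<bar> \<le> \<eta> * ?r\<^sup>2" by simp
  qed
qed

text \<open>For distant points all terms are merely bounded, and \<open>|y - x| \<ge> d\<close>
  trades the missing powers for \<open>|y - x|^2\<close>. The indicator of distant points is kept as
  a factor, since it disappears later by continuity of the paths.\<close>

lemma taylor_rem_bound: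
  assumes "\<eta> > 0"
  obtains C d where "C \<ge> 0" "d > 0"
    "\<And>s x y. s \<in> {0..T} \<Longrightarrow> x \<in> sphere_prod \<Longrightarrow> y \<in> sphere_prod \<Longrightarrow>
      \<bar>taylor_rem s x y\<bar> \<le> (\<eta> + C * (if norm (y - x) \<ge> d then 1 else 0)) * (norm (y - x))\<^sup>2"
proof -
  obtain K where K: "K \<ge> 0" "\<And>s x. s \<in> {0..T} \<Longrightarrow> x \<in> sphere_prod \<Longrightarrow> \<bar>W s x\<bar> \<le> K"
    "\<And>s x. s \<in> {0..T} \<Longrightarrow> x \<in> sphere_prod \<Longrightarrow> norm (mgrad (W s) x) \<le> K"
    "\<And>s x. s \<in> {0..T} \<Longrightarrow> x \<in> sphere_prod \<Longrightarrow> norm (mhess (W s) x) \<le> K"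
    using C12_bounds by metis
  from taylor_rem_small[OF assms] obtain d where d: "d > 0"
    "\<And>s x y. s \<in> {0..T} \<Longrightarrow> x \<in> sphere_prod \<Longrightarrow> y \<in> sphere_prod \<Longrightarrow> norm (y - x) < d \<Longrightarrow>
      \<bar>taylor_rem s x y\<bar> \<le> \<eta> * (norm (y - x))\<^sup>2" by blast
  define C where "C = 2 * K / d\<^sup>2 + K / d + K"
  show ?thesis
  proof (rule that[of C d])
    show "C \<ge> 0" "d > 0" using K(1) d(1) by (auto simp: C_def)
    fix s and x y :: "'n spins" assume s: "s \<in> {0..T}" and x: "x \<in> sphere_prod" and y: "y \<in> sphere_prod"
    let ?r = "norm (y - x)"
    show "\<bar>taylor_rem s x y\<bar> \<le> (\<eta> + C * (if ?r \<ge> d then 1 else 0)) * ?r\<^sup>2"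
    proof (cases "?r \<ge> d")
      case False
      then show ?thesis using d(2)[OF s x y] by simp
    next
      case True
      have rd: "1 \<le> ?r / d" using True d(1) by simp
      have rd2: "1 \<le> ?r\<^sup>2 / d\<^sup>2" using one_le_power[OF rd, of 2] by (simp add: power_divide)
      have "\<bar>mgrad (W s) x \<bullet> (y - x)\<bar> \<le> K * ?r"
        using K(3)[OF s x] by (intro order_trans[OF Cauchy_Schwarz_ineq2] mult_right_mono) auto
      also have "\<dots> \<le> K * ?r * (?r / d)" using rd K(1) mult_left_mono[OF rd, of "K * ?r"] by simp
      finally have 1: "\<bar>mgrad (W s) x \<bullet> (y - x)\<bar> \<le> K / d * ?r\<^sup>2" by (simp add: power2_eq_square)
      have "\<bar>(mhess (W s) x *v (y - x)) \<bullet> (y - x)\<bar> \<le> norm (mhess (W s) x *v (y - x)) * ?r"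
        by (rule Cauchy_Schwarz_ineq2)
      also have "\<dots> \<le> (K * ?r) * ?r"
        using K(4)[OF s x] by (intro mult_right_mono order_trans[OF norm_matrix_vector_mult_le]) auto
      finally have 2: "\<bar>(mhess (W s) x *v (y - x)) \<bullet> (y - x)\<bar> \<le> K * ?r\<^sup>2" by (simp add: power2_eq_square)
      have 3: "\<bar>W s y\<bar> \<le> K / d\<^sup>2 * ?r\<^sup>2" "\<bar>W s x\<bar> \<le> K / d\<^sup>2 * ?r\<^sup>2"
        using K(2)[OF s x] K(2)[OF s y] mult_left_mono[OF rd2 K(1)] by auto
      have 4: "0 \<le> \<eta> * ?r\<^sup>2" using assms by simp
      have "\<bar>taylor_rem s x y\<bar> \<le> \<bar>W s y\<bar> + \<bar>W s x\<bar> + \<bar>mgrad (W s) x \<bullet> (y - x)\<bar> + \<bar>(mhess (W s) x *v (y - x)) \<bullet> (y - x)\<bar>"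
        unfolding taylor_rem_def by linarith
      also have "\<dots> \<le> K / d\<^sup>2 * ?r\<^sup>2 + K / d\<^sup>2 * ?r\<^sup>2 + K / d * ?r\<^sup>2 + K * ?r\<^sup>2"
        by (intro add_mono 1 2 3)
      also have "\<dots> = C * ?r\<^sup>2" by (simp add: C_def algebra_simps add_divide_distrib)
      finally show ?thesis using True 4 by (simp add: distrib_right)
    qed
  qed
qed

text \<open>The increment \<open>y - x\<close> of the state is split into a noise part of size \<open>sqrt \<Delta>\<close> and a remainder \<open>V\<close>
  that is negligible in mean square.\<close>

lemma C12_expansion:
  assumes "\<eta> > 0" "\<nu> \<ge> 0"
  obtains C d where "C \<ge> 0" "d > 0"
    "\<And>s x y V b \<Delta>. s \<in> {0..T} \<Longrightarrow> x \<in> sphere_prod \<Longrightarrow> y \<in> sphere_prod \<Longrightarrow> \<Delta> > 0 \<Longrightarrow>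
      y - x = V + \<nu> *\<^sub>R cprod x b \<Longrightarrow>
      \<bar>W s y - W s x - mgrad (W s) x \<bullet> (y - x) - \<nu>\<^sup>2 / 2 * ((mhess (W s) x *v cprod x b) \<bullet> cprod x b)\<bar>
       \<le> C * (norm V)\<^sup>2 + \<eta> * (norm b)\<^sup>2 + \<eta> * (norm b) ^ 4 / \<Delta> + C * \<Delta> * (if norm (y - x) \<ge> d then 1 else 0)"
proof -
  obtain K where K: "K \<ge> 0" "\<And>s x. s \<in> {0..T} \<Longrightarrow> x \<in> sphere_prod \<Longrightarrow> norm (mhess (W s) x) \<le> K"
    using C12_bounds by metis
  \<comment> \<open>A bound for the norm of the noise map \<open>b\<close> to
    \<open>\<nu> (x \<times> b)\<close>, as \<open>norm x\<close> is at most the number of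
    spins.\<close>
  define \<kappa> where "\<kappa> = \<nu> * real CARD('n)"
  have \<kappa>: "\<kappa> \<ge> 0" using assms by (simp add: \<kappa>_def)
  \<comment> \<open>The budget \<open>\<eta> |b|^2\<close> is split in halves:
    \<open>\<eta>1\<close> serves the Taylor remainder, \<open>c\<close> below the mixed Hessian
    terms of \<open>V\<close> with the noise.\<close>
  define \<eta>1 where "\<eta>1 = \<eta> / (4 * (\<kappa>\<^sup>2 + 1))"
  have \<eta>1: "\<eta>1 > 0" using assms by (auto simp: \<eta>1_def intro!: divide_pos_pos add_nonneg_pos)
  define c where "c = \<eta> / (K * \<kappa>\<^sup>2 + 1)"
  have c: "c > 0" using assms K by (auto simp: c_def intro!: divide_pos_pos add_nonneg_pos)
  obtain C0 d where Cd: "C0 \<ge> 0" "d > 0"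
    "\<And>s x y. s \<in> {0..T} \<Longrightarrow> x \<in> sphere_prod \<Longrightarrow> y \<in> sphere_prod \<Longrightarrow>
      \<bar>taylor_rem s x y\<bar> \<le> (\<eta>1 + C0 * (if norm (y - x) \<ge> d then 1 else 0)) * (norm (y - x))\<^sup>2"
    using taylor_rem_bound[OF \<eta>1] by blast
  define C where "C = 2 * (\<eta>1 + C0) + K / 2 * (1 + 1 / c) + (C0 * \<kappa>\<^sup>2)\<^sup>2 / \<eta>"
  have C1: "(C0 * \<kappa>\<^sup>2)\<^sup>2 / \<eta> \<le> C" "2 * (\<eta>1 + C0) + K / 2 * (1 + 1 / c) \<le> C"
    using assms \<eta>1 Cd(1) K(1) c by (auto simp: C_def)
  show ?thesis
  proof (rule that[of C d])
    show "C \<ge> 0" using C1(1) assms by (meson divide_nonneg_pos order_trans zero_le_power2)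
    show "d > 0" by fact
    fix s \<Delta> :: real and x y V b :: "'n spins"
    assume s: "s \<in> {0..T}" and x: "x \<in> sphere_prod" and y: "y \<in> sphere_prod" and \<Delta>: "\<Delta> > 0"
      and yx: "y - x = V + \<nu> *\<^sub>R cprod x b"
    define Z where "Z = \<nu> *\<^sub>R cprod x b"
    define ind :: real where "ind = (if norm (y - x) \<ge> d then 1 else 0)"
    have ind: "0 \<le> ind" "ind \<le> 1" by (auto simp: ind_def)
    let ?A = "mhess (W s) x"
    have Z: "norm Z \<le> \<kappa> * norm b"
    proof -
      have "norm (cprod x b) \<le> real CARD('n) * norm b"
        using norm_sphere_prod[OF x] by (intro order_trans[OF norm_cprod_le] mult_right_mono) auto
      then have "\<nu> * norm (cprod x b) \<le> \<nu> * (real CARD('n) * norm b)" using assms by (intro mult_left_mono) auto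
      then show ?thesis using assms by (simp add: Z_def \<kappa>_def mult.assoc)
    qed
    have Z2: "(norm Z)\<^sup>2 \<le> \<kappa>\<^sup>2 * (norm b)\<^sup>2"
      using power_mono[OF Z, of 2] by (simp add: power_mult_distrib)
    have yx2: "(norm (y - x))\<^sup>2 \<le> 2 * (norm V)\<^sup>2 + 2 * (\<kappa>\<^sup>2 * (norm b)\<^sup>2)"
    proof -
      have "(norm (y - x))\<^sup>2 \<le> (norm V + norm Z)\<^sup>2"
        unfolding yx Z_def[symmetric] by (intro power_mono norm_triangle_ineq) auto
      also have "\<dots> \<le> 2 * (norm V)\<^sup>2 + 2 * (norm Z)\<^sup>2"
        using zero_le_power2[of "norm V - norm Z"] by (simp add: power2_eq_square algebra_simps)
      finally show ?thesis using Z2 by linarith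
    qed
    have Abd: "\<bar>(?A *v v) \<bullet> w\<bar> \<le> K * (norm v * norm w)" for v w
    proof -
      have "\<bar>(?A *v v) \<bullet> w\<bar> \<le> norm (?A *v v) * norm w" by (rule Cauchy_Schwarz_ineq2)
      also have "\<dots> \<le> (norm ?A * norm v) * norm w" by (intro mult_right_mono norm_matrix_vector_mult_le) simp
      also have "\<dots> \<le> (K * norm v) * norm w" using K(2)[OF s x] by (intro mult_right_mono) auto
      finally show ?thesis by (simp add: mult.assoc)
    qed
    have vz: "2 * (norm V * norm Z) \<le> (norm V)\<^sup>2 / c + c * (\<kappa>\<^sup>2 * (norm b)\<^sup>2)"
    proof -
      have "0 \<le> (norm V - c * norm Z)\<^sup>2 / c" using c by simp
      also have "\<dots> = (norm V)\<^sup>2 / c + c * (norm Z)\<^sup>2 - 2 * (norm V * norm Z)"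
        using c by (simp add: power2_eq_square field_simps)
      finally have "2 * (norm V * norm Z) \<le> (norm V)\<^sup>2 / c + c * (norm Z)\<^sup>2" by simp
      also have "c * (norm Z)\<^sup>2 \<le> c * (\<kappa>\<^sup>2 * (norm b)\<^sup>2)" using Z2 c by (intro mult_left_mono) auto
      finally show ?thesis by simp
    qed
    have hess: "\<bar>(?A *v (V + Z)) \<bullet> (V + Z) - (?A *v Z) \<bullet> Z\<bar> / 2
        \<le> K / 2 * (1 + 1 / c) * (norm V)\<^sup>2 + K / 2 * (c * (\<kappa>\<^sup>2 * (norm b)\<^sup>2))"
    proof -
      have "(?A *v (V + Z)) \<bullet> (V + Z) - (?A *v Z) \<bullet> Z = (?A *v V) \<bullet> V + (?A *v V) \<bullet> Z + (?A *v Z) \<bullet> V"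
        by (simp add: matrix_vector_right_distrib inner_add_left inner_add_right)
      then have "\<bar>(?A *v (V + Z)) \<bullet> (V + Z) - (?A *v Z) \<bullet> Z\<bar> \<le>
          K * (norm V * norm V) + K * (norm V * norm Z) + K * (norm Z * norm V)"
        using Abd[of V V] Abd[of V Z] Abd[of Z V] by linarith
      also have "\<dots> = K * ((norm V)\<^sup>2 + 2 * (norm V * norm Z))"
        by (simp add: power2_eq_square algebra_simps)
      also have "\<dots> \<le> K * ((norm V)\<^sup>2 + ((norm V)\<^sup>2 / c + c * (\<kappa>\<^sup>2 * (norm b)\<^sup>2)))"
        using K(1) vz by (intro mult_left_mono add_left_mono) auto
      also have "\<dots> = 2 * (K / 2 * (1 + 1 / c) * (norm V)\<^sup>2 + K / 2 * (c * (\<kappa>\<^sup>2 * (norm b)\<^sup>2)))"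
        by (simp add: distrib_left distrib_right)
      finally show ?thesis by (subst pos_divide_le_eq) (simp_all only: mult.commute[of _ "2::real"] zero_less_numeral)
    qed
    have "\<bar>taylor_rem s x y\<bar> \<le> (\<eta>1 + C0 * ind) * (2 * (norm V)\<^sup>2 + 2 * (\<kappa>\<^sup>2 * (norm b)\<^sup>2))"
      using Cd(3)[OF s x y] \<eta>1 Cd(1) ind unfolding ind_def[symmetric]
      by (elim order_trans) (intro mult_left_mono yx2 add_nonneg_nonneg mult_nonneg_nonneg, auto)
    also have "\<dots> = 2 * (\<eta>1 + C0 * ind) * (norm V)\<^sup>2 + 2 * \<eta>1 * \<kappa>\<^sup>2 * (norm b)\<^sup>2 + ind * (2 * (C0 * \<kappa>\<^sup>2) * (norm b)\<^sup>2)"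
      by (simp add: algebra_simps)
    also have "2 * (\<eta>1 + C0 * ind) * (norm V)\<^sup>2 \<le> 2 * (\<eta>1 + C0) * (norm V)\<^sup>2"
      using ind Cd(1) by (intro mult_right_mono mult_left_mono add_left_mono mult_left_le) auto
    \<comment> \<open>Young's inequality weighted by \<open>\<Delta>\<close>: the mixed product of
      the indicator with \<open>|b|^2\<close>, whose mean is not directly accessible, is replaced by
      a fourth moment of order \<open>\<Delta>\<close> and by the indicator times
      \<open>\<Delta>\<close>.\<close>
    also have "ind * (2 * (C0 * \<kappa>\<^sup>2) * (norm b)\<^sup>2) \<le> \<eta> * (norm b) ^ 4 / \<Delta> + (C0 * \<kappa>\<^sup>2)\<^sup>2 / \<eta> * \<Delta> * ind"
    proof -
      have "0 \<le> (\<eta> * (norm b)\<^sup>2 - C0 * \<kappa>\<^sup>2 * \<Delta>)\<^sup>2 / (\<eta> * \<Delta>)" using assms \<Delta> by simp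
      also have "\<dots> = \<eta> * (norm b) ^ 4 / \<Delta> + (C0 * \<kappa>\<^sup>2)\<^sup>2 / \<eta> * \<Delta> - 2 * (C0 * \<kappa>\<^sup>2) * (norm b)\<^sup>2"
        using assms \<Delta> by (simp add: power2_eq_square field_simps power4_eq_xxxx)
      finally have "2 * (C0 * \<kappa>\<^sup>2) * (norm b)\<^sup>2 \<le> \<eta> * (norm b) ^ 4 / \<Delta> + (C0 * \<kappa>\<^sup>2)\<^sup>2 / \<eta> * \<Delta>" by simp
      from mult_left_mono[OF this ind(1)] have "ind * (2 * (C0 * \<kappa>\<^sup>2) * (norm b)\<^sup>2) \<le>
          ind * (\<eta> * (norm b) ^ 4 / \<Delta>) + (C0 * \<kappa>\<^sup>2)\<^sup>2 / \<eta> * \<Delta> * ind" by (simp add: algebra_simps)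
      also have "ind * (\<eta> * (norm b) ^ 4 / \<Delta>) \<le> \<eta> * (norm b) ^ 4 / \<Delta>"
        using ind assms \<Delta> by (intro mult_left_le_one_le) auto
      finally show ?thesis by simp
    qed
    finally have rem: "\<bar>taylor_rem s x y\<bar> \<le> 2 * (\<eta>1 + C0) * (norm V)\<^sup>2 + 2 * \<eta>1 * \<kappa>\<^sup>2 * (norm b)\<^sup>2
        + (\<eta> * (norm b) ^ 4 / \<Delta> + (C0 * \<kappa>\<^sup>2)\<^sup>2 / \<eta> * \<Delta> * ind)" by simp
    have b_le: "2 * \<eta>1 * \<kappa>\<^sup>2 + K / 2 * (c * \<kappa>\<^sup>2) \<le> \<eta>"
    proof -
      have "2 * \<eta>1 * \<kappa>\<^sup>2 \<le> 2 * \<eta>1 * (\<kappa>\<^sup>2 + 1)" using \<eta>1 by (intro mult_left_mono) auto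
      also have "\<dots> = \<eta> / 2"
        using add_nonneg_pos[OF zero_le_power2[of \<kappa>] zero_less_one]
        unfolding \<eta>1_def by (simp add: field_simps del: distrib_left_numeral)
      finally have 1: "2 * \<eta>1 * \<kappa>\<^sup>2 \<le> \<eta> / 2" .
      have "K / 2 * (c * \<kappa>\<^sup>2) = c * (K * \<kappa>\<^sup>2) / 2" by simp
      also have "\<dots> \<le> c * (K * \<kappa>\<^sup>2 + 1) / 2" using c by (intro divide_right_mono mult_left_mono) auto
      also have "\<dots> = \<eta> / 2" using add_nonneg_pos[OF mult_nonneg_nonneg[OF K(1) zero_le_power2[of \<kappa>]] zero_less_one] by (simp add: c_def)
      finally show ?thesis using 1 by linarith
    qed
    have "W s y - W s x - mgrad (W s) x \<bullet> (y - x) - \<nu>\<^sup>2 / 2 * ((?A *v cprod x b) \<bullet> cprod x b)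
       = taylor_rem s x y + ((?A *v (V + Z)) \<bullet> (V + Z) - (?A *v Z) \<bullet> Z) / 2"
      unfolding taylor_rem_def yx Z_def[symmetric]
      by (simp add: Z_def[of] matrix_vector_mult_scaleR power2_eq_square diff_divide_distrib)
    then have "\<bar>W s y - W s x - mgrad (W s) x \<bullet> (y - x) - \<nu>\<^sup>2 / 2 * ((?A *v cprod x b) \<bullet> cprod x b)\<bar>
       \<le> \<bar>taylor_rem s x y\<bar> + \<bar>(?A *v (V + Z)) \<bullet> (V + Z) - (?A *v Z) \<bullet> Z\<bar> / 2"
      using abs_triangle_ineq[of "taylor_rem s x y" "((?A *v (V + Z)) \<bullet> (V + Z) - (?A *v Z) \<bullet> Z) / 2"] by simp
    also have "\<dots> \<le> (2 * (\<eta>1 + C0) + K / 2 * (1 + 1 / c)) * (norm V)\<^sup>2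
        + (2 * \<eta>1 * \<kappa>\<^sup>2 + K / 2 * (c * \<kappa>\<^sup>2)) * (norm b)\<^sup>2
        + \<eta> * (norm b) ^ 4 / \<Delta> + (C0 * \<kappa>\<^sup>2)\<^sup>2 / \<eta> * (\<Delta> * ind)"
      using add_mono[OF rem hess] by (simp add: algebra_simps)
    also have "\<dots> \<le> C * (norm V)\<^sup>2 + \<eta> * (norm b)\<^sup>2 + \<eta> * (norm b) ^ 4 / \<Delta> + C * (\<Delta> * ind)"
      using C1 b_le \<Delta> ind by (intro add_mono mult_right_mono order_refl) auto
    finally show "\<bar>W s y - W s x - mgrad (W s) x \<bullet> (y - x) - \<nu>\<^sup>2 / 2 * ((?A *v cprod x b) \<bullet> cprod x b)\<bar>
       \<le> C * (norm V)\<^sup>2 + \<eta> * (norm b)\<^sup>2 + \<eta> * (norm b) ^ 4 / \<Delta> + C * \<Delta> * (if norm (y - x) \<ge> d then 1 else 0)"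
      unfolding ind_def[symmetric] by (simp add: mult.assoc)
  qed
qed

text \<open>Close points by the first order expansion with error constant 1, distant ones by
  boundedness. The constant is uniform in time; this regularity of the feedback law is what pathwise
  uniqueness of the closed loop rests on.\<close>

lemma mgrad_lipschitz:
  obtains L where "L \<ge> 0" "\<And>s x y. s \<in> {0..T} \<Longrightarrow> x \<in> sphere_prod \<Longrightarrow> y \<in> sphere_prod \<Longrightarrow>
    norm (mgrad (W s) y - mgrad (W s) x) \<le> L * norm (y - x)"
proof -
  obtain K where K: "K \<ge> 0"
    "\<And>s x. s \<in> {0..T} \<Longrightarrow> x \<in> sphere_prod \<Longrightarrow> norm (mgrad (W s) x) \<le> K"
    "\<And>s x. s \<in> {0..T} \<Longrightarrow> x \<in> sphere_prod \<Longrightarrow> norm (mhess (W s) x) \<le> K"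
    using C12_bounds by metis
  obtain d where d: "d > 0" "d \<le> 1"
    "\<And>s x y. s \<in> {0..T} \<Longrightarrow> x \<in> sphere_prod \<Longrightarrow> y \<in> sphere_prod \<Longrightarrow> norm (y - x) < d \<Longrightarrow>
      norm (mgrad (W s) y - mgrad (W s) x - mhess (W s) x *v (y - x)) \<le> 1 * norm (y - x)"
    using mgrad_first_order[OF zero_less_one] by blast
  show ?thesis
  proof (rule that[of "1 + K + 2 * K / d"])
    show "0 \<le> 1 + K + 2 * K / d" using K d by auto
    fix s and x y :: "'n spins" assume s: "s \<in> {0..T}" and x: "x \<in> sphere_prod" and y: "y \<in> sphere_prod"
    let ?r = "norm (y - x)"
    show "norm (mgrad (W s) y - mgrad (W s) x) \<le> (1 + K + 2 * K / d) * ?r"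
    proof (cases "?r < d")
      case True
      have "norm (mgrad (W s) y - mgrad (W s) x) \<le>
          norm (mgrad (W s) y - mgrad (W s) x - mhess (W s) x *v (y - x)) + norm (mhess (W s) x *v (y - x))"
        by (metis diff_add_cancel norm_triangle_ineq)
      also have "\<dots> \<le> 1 * ?r + K * ?r"
        using K(3)[OF s x] by (intro add_mono d(3) s x y True order_trans[OF norm_matrix_vector_mult_le] mult_right_mono) auto
      also have "\<dots> \<le> (1 + K + 2 * K / d) * ?r" using K(1) d(1) by (simp add: distrib_right)
      finally show ?thesis .
    next
      case False
      have "norm (mgrad (W s) y - mgrad (W s) x) \<le> K + K"
        using K(2)[OF s x] K(2)[OF s y] by (intro order_trans[OF norm_triangle_ineq4] add_mono)
      also have "\<dots> \<le> 2 * K * (?r / d)" using False d(1) K(1) mult_left_mono[of 1 "?r / d" "2 * K"] by simp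
      also have "\<dots> \<le> (1 + K + 2 * K / d) * ?r" using K(1) by (simp add: distrib_right)
      finally show ?thesis .
    qed
  qed
qed

end

section \<open>Moments of Wiener increments\<close>

lemma borel_measurable_vec_nth' [measurable (raw)]:
  fixes f :: "'a \<Rightarrow> ('b::real_normed_vector) ^ 'k"
  shows "f \<in> borel_measurable M \<Longrightarrow> (\<lambda>x. f x $ p) \<in> borel_measurable M"
  by (rule measurable_compose[OF _ borel_measurable_continuous_onI])
    (auto intro!: continuous_on_component continuous_on_id)

locale filtered_wiener = prob_space P
  for P :: "'a measure" and F :: "real \<Rightarrow> 'a measure" and B :: "real \<Rightarrow> 'a \<Rightarrow> real ^ 'k::finite" and T :: real +
  assumes filt: "usual_filtration P F T" and wiener: "wiener_process P F T B"
begin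

lemma sub_F: "subalgebra P (F s)"
  using filt by (simp add: usual_filtration_def)

lemma space_F: "space (F s) = space P"
  using sub_F by (simp add: subalgebra_def)

lemma sets_F_mono: "r \<le> s \<Longrightarrow> sets (F r) \<subseteq> sets (F s)"
  using filt filtration.sets_F_mono[of "space P" F r s] by (simp add: usual_filtration_def)

lemma measurable_F_mono: "f \<in> measurable (F r) N \<Longrightarrow> r \<le> s \<Longrightarrow> f \<in> measurable (F s) N"
  by (rule measurable_from_subalg[of "F s" "F r"]) (auto simp: subalgebra_def space_F sets_F_mono)

lemma measurable_F_P: "f \<in> measurable (F r) N \<Longrightarrow> f \<in> measurable P N"
  by (rule measurable_from_subalg[OF sub_F])

lemma B_meas: "s \<in> {0..T} \<Longrightarrow> B s \<in> borel_measurable (F s)"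
  using wiener by (simp add: wiener_process_def adapted_def)

lemma B_continuous: "AE \<omega> in P. continuous_on {0..T} (\<lambda>s. B s \<omega>)"
  using wiener by (auto simp: wiener_process_def)

definition dB :: "real \<Rightarrow> real \<Rightarrow> 'a \<Rightarrow> real ^ 'k" where
  "dB r s \<omega> = B s \<omega> - B r \<omega>"

lemma dB_same [simp]: "dB r r = (\<lambda>_. 0)" by (simp add: dB_def fun_eq_iff)

lemma dB_split: "dB r s \<omega> = dB r u \<omega> + dB u s \<omega>" by (simp add: dB_def)

lemma dB_meas_F:
  assumes "0 \<le> r" "r \<le> s" "s \<le> T" shows "dB r s \<in> borel_measurable (F s)"
proof -
  have [measurable]: "B s \<in> borel_measurable (F s)" "B r \<in> borel_measurable (F s)"
    using assms measurable_F_mono[OF B_meas, of r s] B_meas[of s] by auto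
  show ?thesis unfolding dB_def[abs_def] by measurable
qed

lemma dB_meas: "0 \<le> r \<Longrightarrow> r \<le> s \<Longrightarrow> s \<le> T \<Longrightarrow> dB r s \<in> borel_measurable P"
  by (rule measurable_F_P[OF dB_meas_F])

text \<open>The increment is independent of \<open>F r\<close> as families of events. This is
  restricted to the preimages under \<open>X\<close> and under \<open>g\<close> of the increment,
  which are stable under intersection, and then extended to the generated sigma-algebras.\<close>

lemma dB_indep:
  assumes rs: "0 \<le> r" "r < s" "s \<le> T" and X: "X \<in> borel_measurable (F r)" and g: "g \<in> borel_measurable borel"
  shows "indep_var borel (X :: 'a \<Rightarrow> real) borel (\<lambda>\<omega>. g (dB r s \<omega>) :: real)"
proof -
  have indep: "indep_set (sets (F r)) {dB r s -` A \<inter> space P |A. A \<in> sets borel}"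
    using wiener rs unfolding wiener_process_def dB_def[abs_def] by blast
  have dm: "dB r s \<in> borel_measurable P" using rs by (intro dB_meas) auto
  have X1: "{X -` A \<inter> space P |A. A \<in> sets borel} \<subseteq> sets (F r)"
    using measurable_sets[OF X] by (auto simp: space_F)
  have Y1: "{(\<lambda>\<omega>. g (dB r s \<omega>)) -` A \<inter> space P |A. A \<in> sets borel} \<subseteq> {dB r s -` A \<inter> space P |A. A \<in> sets borel}"
  proof safe
    fix A :: "real set" assume "A \<in> sets borel"
    then have "g -` A \<in> sets borel" using measurable_sets[OF g] by simp
    then show "\<exists>A'. (\<lambda>\<omega>. g (dB r s \<omega>)) -` A \<inter> space P = dB r s -` A' \<inter> space P \<and> A' \<in> sets borel"
      by (intro exI[of _ "g -` A"]) auto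
  qed
  have "indep_set {X -` A \<inter> space P |A. A \<in> sets borel} {(\<lambda>\<omega>. g (dB r s \<omega>)) -` A \<inter> space P |A. A \<in> sets borel}"
  proof (rule indep_setI)
    show "{X -` A \<inter> space P |A. A \<in> sets borel} \<subseteq> events"
      using X1 indep_setD_ev1[OF indep] by (rule order_trans)
    show "{(\<lambda>\<omega>. g (dB r s \<omega>)) -` A \<inter> space P |A. A \<in> sets borel} \<subseteq> events"
      using Y1 indep_setD_ev2[OF indep] by (rule order_trans)
    show "prob (a \<inter> b) = prob a * prob b" if "a \<in> {X -` A \<inter> space P |A. A \<in> sets borel}"
      "b \<in> {(\<lambda>\<omega>. g (dB r s \<omega>)) -` A \<inter> space P |A. A \<in> sets borel}" for a b
      by (rule indep_setD[OF indep subsetD[OF X1 that(1)] subsetD[OF Y1 that(2)]])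
  qed
  moreover have "Int_stable {f -` A \<inter> space P |A. A \<in> sets borel}" for f :: "'a \<Rightarrow> real"
    unfolding Int_stable_def
  proof (safe, goal_cases)
    case (1 _ _ A A')
    then show ?case by (intro exI[of _ "A \<inter> A'"]) auto
  qed
  ultimately have "indep_set (sigma_sets (space P) {X -` A \<inter> space P |A. A \<in> sets borel})
      (sigma_sets (space P) {(\<lambda>\<omega>. g (dB r s \<omega>)) -` A \<inter> space P |A. A \<in> sets borel})"
    by (intro indep_set_sigma_sets)
  then show ?thesis
    unfolding indep_var_eq using measurable_F_P[OF X] measurable_compose[OF dm g] by auto
qed

lemma dB_distr:
  assumes rs: "0 \<le> r" "r < s" "s \<le> T"
  shows "distributed P lborel (\<lambda>\<omega>. dB r s \<omega> $ p) (\<lambda>x. ennreal (normal_density 0 (sqrt (s - r)) x))"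
    and "indep_vars (\<lambda>_. borel) (\<lambda>p \<omega>. dB r s \<omega> $ p) UNIV"
  using wiener rs unfolding wiener_process_def dB_def by blast+

lemma dB_moments:
  assumes rs: "0 \<le> r" "r \<le> s" "s \<le> T"
  shows "integrable P (\<lambda>\<omega>. dB r s \<omega> $ p)" "expectation (\<lambda>\<omega>. dB r s \<omega> $ p) = 0"
    "integrable P (\<lambda>\<omega>. (dB r s \<omega> $ p)\<^sup>2)" "expectation (\<lambda>\<omega>. (dB r s \<omega> $ p)\<^sup>2) = s - r"
    "integrable P (\<lambda>\<omega>. (dB r s \<omega> $ p) ^ 4)" "expectation (\<lambda>\<omega>. (dB r s \<omega> $ p) ^ 4) = 3 * (s - r)\<^sup>2"
proof -
  \<comment> \<open>The normal density needs a positive deviation; for \<open>r = s\<close> the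
    increment is zero and the claims are checked separately.\<close>
  have *: "integrable P (\<lambda>\<omega>. (dB r s \<omega> $ p) ^ j) \<and> expectation (\<lambda>\<omega>. (dB r s \<omega> $ p) ^ j) =
      (LINT x|lborel. normal_density 0 (sqrt (s - r)) x * x ^ j)" if "r < s" for j
  proof -
    note D = dB_distr(1)[OF rs(1) that rs(3), of p]
    have "integrable lborel (\<lambda>x. normal_density 0 (sqrt (s - r)) x * x ^ j)"
      using integrable_normal_moment[of "sqrt (s - r)" 0 j] that by simp
    then show ?thesis
      using distributed_integrable[OF D, of "\<lambda>x. x ^ j"] distributed_integral[OF D, of "\<lambda>x. x ^ j"] by simp
  qed
  have m: "0 < sqrt (s - r)" if "r < s" using that by simp
  show "integrable P (\<lambda>\<omega>. dB r s \<omega> $ p)" using *[of 1] rs by (cases "r = s") auto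
  show "integrable P (\<lambda>\<omega>. (dB r s \<omega> $ p)\<^sup>2)" using *[of 2] rs by (cases "r = s") auto
  show "integrable P (\<lambda>\<omega>. (dB r s \<omega> $ p) ^ 4)" using *[of 4] rs by (cases "r = s") auto
  show "expectation (\<lambda>\<omega>. dB r s \<omega> $ p) = 0"
    using *[of 1] integral_normal_moment_nz_1[OF m, of 0] rs by (cases "r = s") auto
  show "expectation (\<lambda>\<omega>. (dB r s \<omega> $ p)\<^sup>2) = s - r"
    using *[of 2] integral_normal_moment_even[OF m, of 0 1] rs
    by (cases "r = s") (auto simp: fact_numeral)
  show "expectation (\<lambda>\<omega>. (dB r s \<omega> $ p) ^ 4) = 3 * (s - r)\<^sup>2"
    using *[of 4] integral_normal_moment_even[OF m, of 0 2] rs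
    by (cases "r = s") (auto simp: fact_numeral power2_eq_square field_simps)
qed

text \<open>On the diagonal this is the variance; off the diagonal the components are independent
  and centred.\<close>

lemma dB_product_moments:
  assumes rs: "0 \<le> r" "r \<le> s" "s \<le> T"
  shows "integrable P (\<lambda>\<omega>. dB r s \<omega> $ p * dB r s \<omega> $ q)"
    "expectation (\<lambda>\<omega>. dB r s \<omega> $ p * dB r s \<omega> $ q) = (if p = q then s - r else 0)"
proof -
  have "integrable P (\<lambda>\<omega>. dB r s \<omega> $ p * dB r s \<omega> $ q) \<and>
    expectation (\<lambda>\<omega>. dB r s \<omega> $ p * dB r s \<omega> $ q) = (if p = q then s - r else 0)"
  proof (cases "p = q \<or> r = s")
    case True
    then show ?thesis using dB_moments[OF rs, of q] by (auto simp: power2_eq_square)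
  next
    case False
    have iv: "indep_vars (\<lambda>_. borel) (\<lambda>p \<omega>. dB r s \<omega> $ p) UNIV" using dB_distr(2)[of r s] rs False by auto
    have "indep_var borel (\<lambda>\<omega>. dB r s \<omega> $ p) borel (\<lambda>\<omega>. dB r s \<omega> $ q)"
      using indep_vars_sum[of "{q}" p "\<lambda>p \<omega>. dB r s \<omega> $ p"] indep_vars_subset[OF iv, of "{p, q}"] False by simp
    from indep_var_integrable[OF this] indep_var_lebesgue_integral[OF this] dB_moments[OF rs]
    show ?thesis using False by simp
  qed
  then show "integrable P (\<lambda>\<omega>. dB r s \<omega> $ p * dB r s \<omega> $ q)"
    "expectation (\<lambda>\<omega>. dB r s \<omega> $ p * dB r s \<omega> $ q) = (if p = q then s - r else 0)" by auto
qed

lemma indep_expectation: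
  assumes rs: "0 \<le> r" "r \<le> s" "s \<le> T" and X: "X \<in> borel_measurable (F r)" "integrable P X"
    and g: "g \<in> borel_measurable borel" "integrable P (\<lambda>\<omega>. g (dB r s \<omega>))"
  shows "integrable P (\<lambda>\<omega>. X \<omega> * g (dB r s \<omega>) :: real)"
    "expectation (\<lambda>\<omega>. X \<omega> * g (dB r s \<omega>)) = expectation X * expectation (\<lambda>\<omega>. g (dB r s \<omega>))"
proof -
  have "integrable P (\<lambda>\<omega>. X \<omega> * g (dB r s \<omega>)) \<and>
    expectation (\<lambda>\<omega>. X \<omega> * g (dB r s \<omega>)) = expectation X * expectation (\<lambda>\<omega>. g (dB r s \<omega>))"
  proof (cases "r = s")
    case True
    then show ?thesis using X(2) by (simp add: prob_space)
  next
    case False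
    then have iv: "indep_var borel X borel (\<lambda>\<omega>. g (dB r s \<omega>))" using rs X g by (intro dB_indep) auto
    show ?thesis using indep_var_integrable[OF iv X(2) g(2)] indep_var_lebesgue_integral[OF iv X(2) g(2)] by simp
  qed
  then show "integrable P (\<lambda>\<omega>. X \<omega> * g (dB r s \<omega>))"
    "expectation (\<lambda>\<omega>. X \<omega> * g (dB r s \<omega>)) = expectation X * expectation (\<lambda>\<omega>. g (dB r s \<omega>))" by auto
qed

lemma expectation_mult_dB:
  assumes rs: "0 \<le> r" "r \<le> s" "s \<le> T" and X: "X \<in> borel_measurable (F r)" "integrable P X"
  shows "integrable P (\<lambda>\<omega>. X \<omega> * dB r s \<omega> $ p)" "expectation (\<lambda>\<omega>. X \<omega> * dB r s \<omega> $ p) = 0"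
  using indep_expectation[OF rs X, of "\<lambda>b. b $ p"] dB_moments[OF rs, of p] by auto

lemma expectation_mult_dB_dB:
  assumes rs: "0 \<le> r" "r \<le> s" "s \<le> T" and X: "X \<in> borel_measurable (F r)" "integrable P X"
  shows "integrable P (\<lambda>\<omega>. X \<omega> * (dB r s \<omega> $ p * dB r s \<omega> $ q))"
    "expectation (\<lambda>\<omega>. X \<omega> * (dB r s \<omega> $ p * dB r s \<omega> $ q)) = expectation X * (if p = q then s - r else 0)"
proof -
  have g: "(\<lambda>b :: real^'k. b $ p * b $ q) \<in> borel_measurable borel" by measurable
  show "integrable P (\<lambda>\<omega>. X \<omega> * (dB r s \<omega> $ p * dB r s \<omega> $ q))"
    "expectation (\<lambda>\<omega>. X \<omega> * (dB r s \<omega> $ p * dB r s \<omega> $ q)) = expectation X * (if p = q then s - r else 0)"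
    using indep_expectation[OF rs X g] dB_product_moments[OF rs, of p q] by auto
qed

text \<open>The fourth moment is only bounded, through
  \<open>(\<Sum> x_p)^2 \<le> k \<Sum> x_p^2\<close> applied to the squared components; its order
  \<open>(s - r)^2\<close> is all that matters.\<close>

lemma norm_dB_moments:
  assumes rs: "0 \<le> r" "r \<le> s" "s \<le> T"
  shows "integrable P (\<lambda>\<omega>. (norm (dB r s \<omega>))\<^sup>2)"
    "expectation (\<lambda>\<omega>. (norm (dB r s \<omega>))\<^sup>2) = real CARD('k) * (s - r)"
    "integrable P (\<lambda>\<omega>. (norm (dB r s \<omega>)) ^ 4)"
    "expectation (\<lambda>\<omega>. (norm (dB r s \<omega>)) ^ 4) \<le> 3 * (real CARD('k))\<^sup>2 * (s - r)\<^sup>2"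
proof -
  have n2: "(norm b)\<^sup>2 = (\<Sum>p\<in>UNIV. (b $ p)\<^sup>2)" for b :: "real^'k"
    by (simp add: power2_norm_eq_inner inner_vec_def flip: power2_eq_square)
  show "integrable P (\<lambda>\<omega>. (norm (dB r s \<omega>))\<^sup>2)"
    "expectation (\<lambda>\<omega>. (norm (dB r s \<omega>))\<^sup>2) = real CARD('k) * (s - r)"
    unfolding n2 using dB_moments[OF rs] by simp_all
  have n4: "(norm b) ^ 4 \<le> real CARD('k) * (\<Sum>p\<in>UNIV. (b $ p) ^ 4)" for b :: "real^'k"
  proof -
    have "(norm b) ^ 4 = (\<Sum>p\<in>UNIV. (b $ p)\<^sup>2)\<^sup>2" unfolding n2[symmetric] by (simp flip: power_mult)
    also have "\<dots> \<le> (\<Sum>p\<in>UNIV. ((b $ p)\<^sup>2)\<^sup>2) * real CARD('k)"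
      by (rule sum_squared_le_sum_of_squares)
    finally show ?thesis by (simp add: mult.commute flip: power_mult)
  qed
  have i4: "integrable P (\<lambda>\<omega>. real CARD('k) * (\<Sum>p\<in>UNIV. (dB r s \<omega> $ p) ^ 4))"
    using dB_moments(5)[OF rs] by simp
  have [measurable]: "dB r s \<in> borel_measurable P" by (rule dB_meas[OF rs])
  show i: "integrable P (\<lambda>\<omega>. (norm (dB r s \<omega>)) ^ 4)"
    by (rule Bochner_Integration.integrable_bound[OF i4])
       (use n4 in \<open>auto intro!: order_trans[OF n4] simp: sum_nonneg\<close>)
  have "expectation (\<lambda>\<omega>. (norm (dB r s \<omega>)) ^ 4) \<le> expectation (\<lambda>\<omega>. real CARD('k) * (\<Sum>p\<in>UNIV. (dB r s \<omega> $ p) ^ 4))"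
    by (rule integral_mono[OF i i4 n4])
  also have "\<dots> = 3 * (real CARD('k))\<^sup>2 * (s - r)\<^sup>2"
    using dB_moments[OF rs] by (simp add: power2_eq_square)
  finally show "expectation (\<lambda>\<omega>. (norm (dB r s \<omega>)) ^ 4) \<le> 3 * (real CARD('k))\<^sup>2 * (s - r)\<^sup>2" .
qed

lemma integrable_bounded_mult:
  fixes X Y :: "'a \<Rightarrow> real"
  assumes X: "X \<in> borel_measurable P" "\<And>\<omega>. \<omega> \<in> space P \<Longrightarrow> \<bar>X \<omega>\<bar> \<le> c" and Y: "integrable P Y"
  shows "integrable P (\<lambda>\<omega>. X \<omega> * Y \<omega>)"
proof (rule Bochner_Integration.integrable_bound[OF integrable_mult_right[of c P "\<lambda>\<omega>. norm (Y \<omega>)"]])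
  show "AE \<omega> in P. norm (X \<omega> * Y \<omega>) \<le> norm (c * norm (Y \<omega>))"
  proof (rule AE_I2)
    fix \<omega> assume "\<omega> \<in> space P"
    then have "\<bar>X \<omega>\<bar> \<le> \<bar>c\<bar>" using X(2) by fastforce
    then show "norm (X \<omega> * Y \<omega>) \<le> norm (c * norm (Y \<omega>))" by (simp add: abs_mult mult_right_mono)
  qed
qed (use X Y in auto)

text \<open>The longer increment is cut at the end of the shorter one; its tail is centred and
  independent of everything before. The case \<open>v < u\<close> follows by exchanging the two
  factors.\<close>

lemma expectation_increments_same_start:
  assumes r: "0 \<le> r" and u: "r \<le> u" "u \<le> T" and v: "r \<le> v" "v \<le> T"
    and X: "X \<in> borel_measurable (F r)" "\<And>\<omega>. \<omega> \<in> space P \<Longrightarrow> \<bar>X \<omega>\<bar> \<le> c"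
  shows "integrable P (\<lambda>\<omega>. X \<omega> * (dB r u \<omega> $ p * dB r v \<omega> $ q))"
    "expectation (\<lambda>\<omega>. X \<omega> * (dB r u \<omega> $ p * dB r v \<omega> $ q)) = (if p = q then expectation X * (min u v - r) else 0)"
proof -
  have *: "integrable P (\<lambda>\<omega>. X \<omega> * (dB r u \<omega> $ p * dB r v \<omega> $ q)) \<and>
    expectation (\<lambda>\<omega>. X \<omega> * (dB r u \<omega> $ p * dB r v \<omega> $ q)) = (if p = q then expectation X * (u - r) else 0)"
    if uv: "u \<le> v" and "r \<le> u" "v \<le> T" for p q u v
  proof -
    have iX: "integrable P X"
      using integrable_bounded_mult[OF measurable_F_P[OF X(1)] X(2), of "\<lambda>_. 1"] by simp
    have s: "X \<omega> * (dB r u \<omega> $ p * dB r v \<omega> $ q) = X \<omega> * (dB r u \<omega> $ p * dB r u \<omega> $ q) + (X \<omega> * dB r u \<omega> $ p) * dB u v \<omega> $ q" for \<omega>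
      by (subst dB_split[of r v \<omega> u]) (simp add: algebra_simps)
    have m: "(\<lambda>\<omega>. X \<omega> * dB r u \<omega> $ p) \<in> borel_measurable (F u)"
    proof -
      have [measurable]: "X \<in> borel_measurable (F u)" "dB r u \<in> borel_measurable (F u)"
        using measurable_F_mono[OF X(1)] dB_meas_F[of r u] that r by auto
      show ?thesis by measurable
    qed
    have ib: "integrable P (\<lambda>\<omega>. X \<omega> * dB r u \<omega> $ p)"
      by (rule expectation_mult_dB) (use r that X iX in auto)
    have 1: "integrable P (\<lambda>\<omega>. (X \<omega> * dB r u \<omega> $ p) * dB u v \<omega> $ q)"
      "expectation (\<lambda>\<omega>. (X \<omega> * dB r u \<omega> $ p) * dB u v \<omega> $ q) = 0"
      using expectation_mult_dB[OF _ _ _ m ib, of v q] r that by auto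
    have 2: "integrable P (\<lambda>\<omega>. X \<omega> * (dB r u \<omega> $ p * dB r u \<omega> $ q))"
      "expectation (\<lambda>\<omega>. X \<omega> * (dB r u \<omega> $ p * dB r u \<omega> $ q)) = expectation X * (if p = q then u - r else 0)"
      using expectation_mult_dB_dB[OF r _ _ X(1) iX, of u p q] that by auto
    show ?thesis unfolding s using 1 2 by simp
  qed
  have "integrable P (\<lambda>\<omega>. X \<omega> * (dB r u \<omega> $ p * dB r v \<omega> $ q)) \<and>
    expectation (\<lambda>\<omega>. X \<omega> * (dB r u \<omega> $ p * dB r v \<omega> $ q)) = (if p = q then expectation X * (min u v - r) else 0)"
  proof (cases "u \<le> v")
    case True
    then show ?thesis using *[OF True u(1) v(2), of p q] by (simp add: min_def)
  next
    case False
    then show ?thesis using *[of v u q p] u v by (auto simp add: min_def mult.commute)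
  qed
  then show "integrable P (\<lambda>\<omega>. X \<omega> * (dB r u \<omega> $ p * dB r v \<omega> $ q))"
    "expectation (\<lambda>\<omega>. X \<omega> * (dB r u \<omega> $ p * dB r v \<omega> $ q)) = (if p = q then expectation X * (min u v - r) else 0)" by auto
qed

text \<open>The Ito isometry for one pair of blocks: weighted increments correlate through the
  overlap of their intervals. Cut the earlier block at the later start \<open>a'\<close>; the part
  before \<open>a'\<close> is known there and is annihilated by the increment from
  \<open>a'\<close>, the rest has a common start.\<close>

lemma expectation_blocks:
  fixes X Y :: "'a \<Rightarrow> real"
  assumes "0 \<le> a" "a \<le> b" "b \<le> T" "0 \<le> a'" "a' \<le> b'" "b' \<le> T"
    and "X \<in> borel_measurable (F a)" "\<And>\<omega>. \<omega> \<in> space P \<Longrightarrow> \<bar>X \<omega>\<bar> \<le> c"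
    and "Y \<in> borel_measurable (F a')" "\<And>\<omega>. \<omega> \<in> space P \<Longrightarrow> \<bar>Y \<omega>\<bar> \<le> c'"
  shows "integrable P (\<lambda>\<omega>. (X \<omega> * Y \<omega>) * (dB a b \<omega> $ p * dB a' b' \<omega> $ q))" (is "?I a b a' b' X Y p q")
    "expectation (\<lambda>\<omega>. (X \<omega> * Y \<omega>) * (dB a b \<omega> $ p * dB a' b' \<omega> $ q)) =
      (if p = q then expectation (\<lambda>\<omega>. X \<omega> * Y \<omega>) * max 0 (min b b' - max a a') else 0)" (is "?E a b a' b' X Y p q")
proof -
  have *: "?I a b a' b' X Y p q \<and> ?E a b a' b' X Y p q"
    if aa: "a \<le> a'" and A: "0 \<le> a" "a \<le> b" "b \<le> T" "0 \<le> a'" "a' \<le> b'" "b' \<le> T"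
    and X: "X \<in> borel_measurable (F a)" "\<And>\<omega>. \<omega> \<in> space P \<Longrightarrow> \<bar>X \<omega>\<bar> \<le> c"
    and Y: "Y \<in> borel_measurable (F a')" "\<And>\<omega>. \<omega> \<in> space P \<Longrightarrow> \<bar>Y \<omega>\<bar> \<le> c'" for a b a' b' X Y c c' p q
  proof -
    have XYm: "(\<lambda>\<omega>. X \<omega> * Y \<omega>) \<in> borel_measurable (F a')"
      using measurable_F_mono[OF X(1) aa] Y(1) by measurable
    have XYb: "\<bar>X \<omega> * Y \<omega>\<bar> \<le> \<bar>c\<bar> * \<bar>c'\<bar>" if "\<omega> \<in> space P" for \<omega>
      unfolding abs_mult using X(2)[OF that] Y(2)[OF that] by (intro mult_mono) auto
    have early: "integrable P (\<lambda>\<omega>. (X \<omega> * Y \<omega>) * (dB a e \<omega> $ p * dB a' b' \<omega> $ q)) \<and>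
        expectation (\<lambda>\<omega>. (X \<omega> * Y \<omega>) * (dB a e \<omega> $ p * dB a' b' \<omega> $ q)) = 0" if e: "a \<le> e" "e \<le> a'" for e
    proof -
      have eT: "e \<le> T" using e A by auto
      have [measurable]: "dB a e \<in> borel_measurable (F a')"
        using measurable_F_mono[OF dB_meas_F[OF A(1) e(1) eT] e(2)] .
      have m: "(\<lambda>\<omega>. (X \<omega> * Y \<omega>) * dB a e \<omega> $ p) \<in> borel_measurable (F a')"
        using XYm by measurable
      have i: "integrable P (\<lambda>\<omega>. (X \<omega> * Y \<omega>) * dB a e \<omega> $ p)"
        by (rule integrable_bounded_mult[OF measurable_F_P[OF XYm] XYb])
          (use dB_moments(1)[OF A(1) e(1) eT] in auto)
      show ?thesis using expectation_mult_dB[OF A(4,5,6) m i, of q] by (simp add: mult.assoc)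
    qed
    show ?thesis
    proof (cases "b \<le> a'")
      case True
      then show ?thesis using early[OF A(2) True] A aa by (auto simp: max_def min_def)
    next
      case False
      have s: "(X \<omega> * Y \<omega>) * (dB a b \<omega> $ p * dB a' b' \<omega> $ q) =
         (X \<omega> * Y \<omega>) * (dB a a' \<omega> $ p * dB a' b' \<omega> $ q) + (X \<omega> * Y \<omega>) * (dB a' b \<omega> $ p * dB a' b' \<omega> $ q)" for \<omega>
        by (subst dB_split[of a b \<omega> a']) (simp add: algebra_simps)
      have 2: "integrable P (\<lambda>\<omega>. (X \<omega> * Y \<omega>) * (dB a' b \<omega> $ p * dB a' b' \<omega> $ q))"
        "expectation (\<lambda>\<omega>. (X \<omega> * Y \<omega>) * (dB a' b \<omega> $ p * dB a' b' \<omega> $ q)) =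
        (if p = q then expectation (\<lambda>\<omega>. X \<omega> * Y \<omega>) * (min b b' - a') else 0)"
        using expectation_increments_same_start[OF A(4) _ A(3) A(5,6) XYm XYb, of p q] False by auto
      have "max a a' = a'" "0 \<le> min b b' - a'" using aa False A by auto
      then show ?thesis unfolding s using 2 early[OF aa order_refl] by simp
    qed
  qed
  have "?I a b a' b' X Y p q \<and> ?E a b a' b' X Y p q"
  proof (cases "a \<le> a'")
    case True
    show ?thesis by (rule *[OF True]) (use assms in auto)
  next
    case False
    have "?I a' b' a b Y X q p \<and> ?E a' b' a b Y X q p"
      by (rule *[of a' a]) (use False assms in auto)
    then show ?thesis by (simp add: mult.commute min.commute max.commute)
  qed
  then show "?I a b a' b' X Y p q" "?E a b a' b' X Y p q" by auto
qed

end

section \<open>The Ito isometry\<close>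

lemma nn_integral_norm_sq_add:
  fixes f g :: "'a \<Rightarrow> 'b::{second_countable_topology, real_normed_vector}"
  assumes [measurable]: "f \<in> borel_measurable M" "g \<in> borel_measurable M"
  shows "(\<integral>\<^sup>+x. ennreal ((norm (f x + g x))\<^sup>2) \<partial>M)
    \<le> 2 * (\<integral>\<^sup>+x. ennreal ((norm (f x))\<^sup>2) \<partial>M) + 2 * (\<integral>\<^sup>+x. ennreal ((norm (g x))\<^sup>2) \<partial>M)"
proof -
  have "(norm (f x + g x))\<^sup>2 \<le> 2 * (norm (f x))\<^sup>2 + 2 * (norm (g x))\<^sup>2" for x
  proof -
    have "(norm (f x + g x))\<^sup>2 \<le> (norm (f x) + norm (g x))\<^sup>2" by (intro power_mono norm_triangle_ineq) auto
    also have "\<dots> \<le> 2 * (norm (f x))\<^sup>2 + 2 * (norm (g x))\<^sup>2"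
      using zero_le_power2[of "norm (f x) - norm (g x)"] by (simp add: power2_eq_square algebra_simps)
    finally show ?thesis .
  qed
  then have "(\<integral>\<^sup>+x. ennreal ((norm (f x + g x))\<^sup>2) \<partial>M) \<le> (\<integral>\<^sup>+x. 2 * ennreal ((norm (f x))\<^sup>2) + 2 * ennreal ((norm (g x))\<^sup>2) \<partial>M)"
    by (intro nn_integral_mono) (simp flip: ennreal_numeral ennreal_mult'' ennreal_plus)
  also have "\<dots> = 2 * (\<integral>\<^sup>+x. ennreal ((norm (f x))\<^sup>2) \<partial>M) + 2 * (\<integral>\<^sup>+x. ennreal ((norm (g x))\<^sup>2) \<partial>M)"
    by (simp add: nn_integral_add nn_integral_cmult)
  finally show ?thesis .
qed

lemma nn_integral_norm_sq_diff:
  fixes f g :: "'a \<Rightarrow> 'b::{second_countable_topology, real_normed_vector}"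
  assumes [measurable]: "f \<in> borel_measurable M" "g \<in> borel_measurable M"
  shows "(\<integral>\<^sup>+x. ennreal ((norm (f x - g x))\<^sup>2) \<partial>M)
    \<le> 2 * (\<integral>\<^sup>+x. ennreal ((norm (f x))\<^sup>2) \<partial>M) + 2 * (\<integral>\<^sup>+x. ennreal ((norm (g x))\<^sup>2) \<partial>M)"
  using nn_integral_norm_sq_add[of f M "\<lambda>x. - g x"] assms by simp

lemma borel_measurable_matrix_vector_mult [measurable (raw)]:
  fixes A :: "'a \<Rightarrow> real^'k^'l"
  assumes [measurable]: "A \<in> borel_measurable M" "v \<in> borel_measurable M"
  shows "(\<lambda>x. A x *v v x) \<in> borel_measurable M"
proof -
  have "continuous_on UNIV (\<lambda>z :: (real^'k^'l) \<times> (real^'k). fst z *v snd z)"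
    unfolding matrix_vector_mult_def by (intro continuous_intros)
  from borel_measurable_continuous_onI[OF this]
  have "(\<lambda>z :: (real^'k^'l) \<times> (real^'k). fst z *v snd z) \<in> borel_measurable borel" .
  from measurable_compose[OF _ this, of "\<lambda>x. (A x, v x)" M] show ?thesis by (simp add: borel_prod[symmetric])
qed

lemma tendsto_zero_ennreal_double:
  fixes f g :: "nat \<Rightarrow> ennreal"
  assumes "f \<longlonglongrightarrow> 0" "g \<longlonglongrightarrow> 0" and "\<And>j. h j \<le> 2 * f j + 2 * g j"
  shows "h \<longlonglongrightarrow> 0"
proof (rule tendsto_sandwich[of "\<lambda>_. 0" h _ "\<lambda>j. 2 * f j + 2 * g j"])
  show "(\<lambda>j. 2 * f j + 2 * g j) \<longlonglongrightarrow> 0"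
    using tendsto_add[OF ennreal_tendsto_cmult[OF _ assms(1), of 2] ennreal_tendsto_cmult[OF _ assms(2), of 2]] by simp
qed (use assms in auto)

section \<open>Simple integrands, their isometry and its extension to limits\<close>

context filtered_wiener
begin

abbreviation PL :: "('a \<times> real) measure" where "PL \<equiv> P \<Otimes>\<^sub>M lborel"

sublocale PL: pair_sigma_finite P lborel
  by standard

text \<open>Integrand and integral are generated together, block by block. The blocks may overlap
  and come in any order, so sums need no common refinement of partitions. The parameter
  \<open>a\<close> is a lower bound for all block starts; it encodes that the integral looks at
  noise after \<open>a\<close> only.\<close>

inductive simple :: "real \<Rightarrow> ('a \<times> real \<Rightarrow> real^'k^'l::finite) \<Rightarrow> ('a \<Rightarrow> real^'l) \<Rightarrow> bool" for a where
  simple_zero: "simple a (\<lambda>_. 0) (\<lambda>_. 0)"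
| simple_add: "simple a Y X \<Longrightarrow> 0 \<le> p \<Longrightarrow> a \<le> p \<Longrightarrow> p \<le> q \<Longrightarrow> q \<le> T \<Longrightarrow> \<xi> \<in> borel_measurable (F p) \<Longrightarrow>
    (\<forall>\<omega>\<in>space P. norm (\<xi> \<omega>) \<le> c) \<Longrightarrow>
    simple a (\<lambda>z. Y z + indicat_real {p<..q} (snd z) *\<^sub>R \<xi> (fst z)) (\<lambda>\<omega>. X \<omega> + \<xi> \<omega> *v dB p q \<omega>)"

lemma simple_plus: "simple a Y X \<Longrightarrow> simple a Y' X' \<Longrightarrow> simple a (\<lambda>z. Y z + Y' z) (\<lambda>\<omega>. X \<omega> + X' \<omega>)"
proof (induction rule: simple.induct)
  case (simple_add Y X p q \<xi> c)
  from simple.simple_add[OF simple_add.IH[OF simple_add.prems] simple_add.hyps(2-7)]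
  show ?case by (simp add: add.assoc add.left_commute add.commute)
qed simp

lemma simple_minus: "simple a Y X \<Longrightarrow> simple a (\<lambda>z. - Y z) (\<lambda>\<omega>. - X \<omega>)"
proof (induction rule: simple.induct)
  case simple_zero
  then show ?case using simple.simple_zero by simp
next
  case (simple_add Y X p q \<xi> c)
  have 1: "(\<lambda>\<omega>. - \<xi> \<omega>) \<in> borel_measurable (F p)" using simple_add.hyps by simp
  have 2: "\<forall>\<omega>\<in>space P. norm (- \<xi> \<omega>) \<le> c" using simple_add.hyps by simp
  have "- \<xi> \<omega> *v dB p q \<omega> = - (\<xi> \<omega> *v dB p q \<omega>)" for \<omega>
    by (simp add: matrix_vector_mult_def sum_negf vec_eq_iff)
  with simple.simple_add[OF simple_add.IH simple_add.hyps(2-5) 1 2]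
  show ?case by simp
qed

lemma simple_diff: "simple a Y X \<Longrightarrow> simple a Y' X' \<Longrightarrow> simple a (\<lambda>z. Y z - Y' z) (\<lambda>\<omega>. X \<omega> - X' \<omega>)"
  using simple_plus[OF _ simple_minus] by fastforce

lemma simple_mono: "simple a Y X \<Longrightarrow> a' \<le> a \<Longrightarrow> simple a' Y X"
proof (induction rule: simple.induct)
  case (simple_add Y X p q \<xi> c)
  then show ?case by (intro simple.simple_add[where c = c]) auto
qed (rule simple.simple_zero)

lemma simple_block:
  assumes "0 \<le> p" "a \<le> p" "p \<le> q" "q \<le> T" "\<xi> \<in> borel_measurable (F p)" "\<And>\<omega>. \<omega> \<in> space P \<Longrightarrow> norm (\<xi> \<omega>) \<le> c"
  shows "simple a (\<lambda>z. indicat_real {p<..q} (snd z) *\<^sub>R \<xi> (fst z)) (\<lambda>\<omega>. \<xi> \<omega> *v dB p q \<omega>)"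
  using simple.simple_add[OF simple.simple_zero assms(1-5), of c] assms(6) by simp

text \<open>Each block start is moved to \<open>max e p\<close>, where its coefficient is still
  measurable as the filtration grows. The value of the integral is left open here; where it is
  needed it is compared through the isometry.\<close>

lemma simple_clip: "simple a Y X \<Longrightarrow> 0 \<le> e \<Longrightarrow> e \<le> T \<Longrightarrow> \<exists>X'. simple e (\<lambda>z. indicat_real {e<..} (snd z) *\<^sub>R Y z) X'"
proof (induction rule: simple.induct)
  case simple_zero
  then show ?case using simple.simple_zero by auto
next
  case (simple_add Y X p q \<xi> c)
  then obtain X' where X': "simple e (\<lambda>z. indicat_real {e<..} (snd z) *\<^sub>R Y z) X'" by blast
  have "\<xi> \<in> borel_measurable (F (max e p))" using simple_add.hyps(6) by (rule measurable_F_mono) simp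
  moreover have "0 \<le> max e p" "e \<le> max e p" "max e p \<le> max e q" "max e q \<le> T" using simple_add by auto
  ultimately have "simple e (\<lambda>z. indicat_real {e<..} (snd z) *\<^sub>R Y z + indicat_real {max e p<..max e q} (snd z) *\<^sub>R \<xi> (fst z))
      (\<lambda>\<omega>. X' \<omega> + \<xi> \<omega> *v dB (max e p) (max e q) \<omega>)"
    using simple_add.hyps(7) by (intro simple.simple_add[where c = c] X') auto
  moreover have "indicat_real {e<..} r *\<^sub>R Y z + indicat_real {max e p<..max e q} r *\<^sub>R \<xi> (fst z)
     = indicat_real {e<..} r *\<^sub>R (Y z + indicat_real {p<..q} r *\<^sub>R \<xi> (fst z))" for r z
    by (auto simp: indicator_def scaleR_add_right max_def)
  ultimately show ?case by auto
qed

lemma simple_measurable: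
  assumes "simple a Y X"
  shows "Y \<in> borel_measurable PL" "X \<in> borel_measurable P"
proof -
  have "Y \<in> borel_measurable PL \<and> X \<in> borel_measurable P" using assms
  proof (induction rule: simple.induct)
    case (simple_add Y X p q \<xi> c)
    have [measurable]: "\<xi> \<in> borel_measurable P" "dB p q \<in> borel_measurable P"
      using measurable_F_P[OF simple_add.hyps(6)] dB_meas simple_add.hyps by auto
    show ?case using simple_add.IH by (auto intro!: borel_measurable_add borel_measurable_scaleR)
  qed auto
  then show "Y \<in> borel_measurable PL" "X \<in> borel_measurable P" by auto
qed

lemma integral_product:
  fixes f :: "'a \<Rightarrow> real" and g :: "real \<Rightarrow> real"
  assumes f: "integrable P f" and g: "integrable lborel g"
  shows "integrable PL (\<lambda>z. f (fst z) * g (snd z))"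
    "integral\<^sup>L PL (\<lambda>z. f (fst z) * g (snd z)) = integral\<^sup>L P f * integral\<^sup>L lborel g"
proof -
  have [measurable]: "f \<in> borel_measurable P" "g \<in> borel_measurable lborel" using f g by auto
  show i: "integrable PL (\<lambda>z. f (fst z) * g (snd z))"
    by (rule PL.Fubini_integrable) (use f g in \<open>auto simp: abs_mult\<close>)
  show "integral\<^sup>L PL (\<lambda>z. f (fst z) * g (snd z)) = integral\<^sup>L P f * integral\<^sup>L lborel g"
    using PL.integral_fst'[OF i] by simp
qed

text \<open>The same number \<open>L\<close>, the length of the overlap, arises from the covariance
  of the increments and from integrating the product of the two indicators over time.\<close>

lemma block_isometry:
  fixes \<xi> \<xi>' :: "'a \<Rightarrow> real^'k^'l::finite"
  assumes A: "0 \<le> p" "p \<le> q" "q \<le> T" "0 \<le> p'" "p' \<le> q'" "q' \<le> T"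
    and \<xi>: "\<xi> \<in> borel_measurable (F p)" "\<And>\<omega>. \<omega> \<in> space P \<Longrightarrow> norm (\<xi> \<omega>) \<le> c"
    and \<xi>': "\<xi>' \<in> borel_measurable (F p')" "\<And>\<omega>. \<omega> \<in> space P \<Longrightarrow> norm (\<xi>' \<omega>) \<le> c'"
  shows "integrable P (\<lambda>\<omega>. (\<xi> \<omega> *v dB p q \<omega>) \<bullet> (\<xi>' \<omega> *v dB p' q' \<omega>))" (is "integrable P ?f")
    "integrable PL (\<lambda>z. (indicat_real {p<..q} (snd z) *\<^sub>R \<xi> (fst z)) \<bullet> (indicat_real {p'<..q'} (snd z) *\<^sub>R \<xi>' (fst z)))" (is "integrable PL ?g")
    "expectation (\<lambda>\<omega>. (\<xi> \<omega> *v dB p q \<omega>) \<bullet> (\<xi>' \<omega> *v dB p' q' \<omega>)) =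
     integral\<^sup>L PL (\<lambda>z. (indicat_real {p<..q} (snd z) *\<^sub>R \<xi> (fst z)) \<bullet> (indicat_real {p'<..q'} (snd z) *\<^sub>R \<xi>' (fst z)))"
proof -
  define L where "L = max 0 (min q q' - max p p')"
  let ?h = "\<lambda>l i j \<omega>. (\<xi> \<omega> $ l $ i * \<xi>' \<omega> $ l $ j) * (dB p q \<omega> $ i * dB p' q' \<omega> $ j)"
  have comp: "\<bar>A $ l $ i\<bar> \<le> norm A" for A :: "real^'k^'l" and l i
    using Finite_Cartesian_Product.norm_nth_le[of A l] Finite_Cartesian_Product.norm_nth_le[of "A $ l" i] by simp
  have b: "integrable P (?h l i j) \<and> expectation (?h l i j) = (if i = j then expectation (\<lambda>\<omega>. \<xi> \<omega> $ l $ i * \<xi>' \<omega> $ l $ j) * L else 0)" for l i j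
    unfolding L_def
    by (intro conjI expectation_blocks[where c = c and c' = c'] A)
      (use \<xi> \<xi>' order_trans[OF comp \<xi>(2)] order_trans[OF comp \<xi>'(2)] in \<open>auto intro!: borel_measurable_vec_nth'\<close>)
  have f: "?f = (\<lambda>\<omega>. \<Sum>l\<in>UNIV. \<Sum>i\<in>UNIV. \<Sum>j\<in>UNIV. ?h l i j \<omega>)"
    by (simp add: inner_vec_def matrix_vector_mult_def sum_product algebra_simps)
  show "integrable P ?f" unfolding f using b by (intro Bochner_Integration.integrable_sum) auto
  have [measurable]: "\<xi> \<in> borel_measurable P" "\<xi>' \<in> borel_measurable P"
    using measurable_F_P \<xi> \<xi>' by auto
  have ixx: "integrable P (\<lambda>\<omega>. \<xi> \<omega> $ l $ i * \<xi>' \<omega> $ l $ j)" for l i j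
  proof (rule integrable_const_bound[of _ "\<bar>c\<bar> * \<bar>c'\<bar>"])
    show "AE \<omega> in P. norm (\<xi> \<omega> $ l $ i * \<xi>' \<omega> $ l $ j) \<le> \<bar>c\<bar> * \<bar>c'\<bar>"
    proof (rule AE_I2)
      fix \<omega> assume \<omega>: "\<omega> \<in> space P"
      show "norm (\<xi> \<omega> $ l $ i * \<xi>' \<omega> $ l $ j) \<le> \<bar>c\<bar> * \<bar>c'\<bar>"
        unfolding real_norm_def abs_mult
        by (intro mult_mono order_trans[OF order_trans[OF comp \<xi>(2)[OF \<omega>]] abs_ge_self]
            order_trans[OF order_trans[OF comp \<xi>'(2)[OF \<omega>]] abs_ge_self]) auto
    qed
  qed measurable
  have E: "expectation ?f = expectation (\<lambda>\<omega>. \<xi> \<omega> \<bullet> \<xi>' \<omega>) * L"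
  proof -
    have "expectation ?f = (\<Sum>l\<in>UNIV. \<Sum>i\<in>UNIV. \<Sum>j\<in>UNIV. expectation (?h l i j))"
      unfolding f using b by (simp add: Bochner_Integration.integral_sum)
    also have "\<dots> = (\<Sum>l\<in>UNIV. \<Sum>i\<in>UNIV. expectation (\<lambda>\<omega>. \<xi> \<omega> $ l $ i * \<xi>' \<omega> $ l $ i) * L)"
      using b by simp
    also have "\<dots> = expectation (\<lambda>\<omega>. \<xi> \<omega> \<bullet> \<xi>' \<omega>) * L"
      using ixx by (simp add: inner_vec_def sum_distrib_right Bochner_Integration.integral_sum)
    finally show ?thesis .
  qed
  have ix: "integrable P (\<lambda>\<omega>. \<xi> \<omega> \<bullet> \<xi>' \<omega>)"
    using ixx by (simp add: inner_vec_def)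
  have g: "?g = (\<lambda>z. (\<xi> (fst z) \<bullet> \<xi>' (fst z)) * indicat_real {max p p'<..min q q'} (snd z))"
    by (auto simp: fun_eq_iff indicator_def)
  have il: "integrable lborel (indicat_real {max p p'<..min q q'})" "integral\<^sup>L lborel (indicat_real {max p p'<..min q q'}) = L"
  proof -
    have "measure lborel {u<..v} = max 0 (v - u)" "emeasure lborel {u<..v} < \<infinity>" for u v :: real
      by (cases "u \<le> v"; simp)+
    then show "integrable lborel (indicat_real {max p p'<..min q q'})" "integral\<^sup>L lborel (indicat_real {max p p'<..min q q'}) = L"
      by (auto simp: L_def intro!: integrable_real_indicator)
  qed
  show "integrable PL ?g" unfolding g by (rule integral_product[OF ix il(1)])
  show "expectation ?f = integral\<^sup>L PL ?g"
    unfolding g E using integral_product(2)[OF ix il(1)] il(2) by simp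
qed

text \<open>Overlapping blocks produce cross terms, so the bilinear identity is proved, by induction
  on each argument in turn; the norm identity is its diagonal case.\<close>

lemma simple_isometry_polar:
  assumes "simple a (Y :: _ \<Rightarrow> real^'k^'l::finite) X" "simple a' Y' X'"
  shows "integrable P (\<lambda>\<omega>. X \<omega> \<bullet> X' \<omega>) \<and> integrable PL (\<lambda>z. Y z \<bullet> Y' z) \<and>
    expectation (\<lambda>\<omega>. X \<omega> \<bullet> X' \<omega>) = integral\<^sup>L PL (\<lambda>z. Y z \<bullet> Y' z)"
  using assms(1)
proof (induction rule: simple.induct)
  case (simple_add Y X p q \<xi> c)
  have "integrable P (\<lambda>\<omega>. (\<xi> \<omega> *v dB p q \<omega>) \<bullet> X' \<omega>) \<and> integrable PL (\<lambda>z. (indicat_real {p<..q} (snd z) *\<^sub>R \<xi> (fst z)) \<bullet> Y' z) \<and>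
    expectation (\<lambda>\<omega>. (\<xi> \<omega> *v dB p q \<omega>) \<bullet> X' \<omega>) = integral\<^sup>L PL (\<lambda>z. (indicat_real {p<..q} (snd z) *\<^sub>R \<xi> (fst z)) \<bullet> Y' z)"
    using assms(2)
  proof (induction rule: simple.induct)
    case (simple_add Y' X' p' q' \<xi>' c')
    note b = block_isometry[of p q p' q' \<xi> c \<xi>' c', OF \<open>0 \<le> p\<close> \<open>p \<le> q\<close> \<open>q \<le> T\<close> \<open>0 \<le> p'\<close> \<open>p' \<le> q'\<close> \<open>q' \<le> T\<close>
      \<open>\<xi> \<in> borel_measurable (F p)\<close> _ \<open>\<xi>' \<in> borel_measurable (F p')\<close>]
    show ?case
      unfolding inner_add_right
      using b simple_add.IH simple_add.hyps(7) \<open>\<forall>\<omega>\<in>space P. norm (\<xi> \<omega>) \<le> c\<close>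
      by (auto simp del: inner_scaleR_left inner_scaleR_right)
  qed simp
  then show ?case
    using simple_add.IH unfolding inner_add_left by (auto simp del: inner_scaleR_left inner_scaleR_right)
qed simp

lemma simple_isometry:
  assumes "simple a (Y :: _ \<Rightarrow> real^'k^'l::finite) X"
  shows "(\<integral>\<^sup>+\<omega>. ennreal ((norm (X \<omega>))\<^sup>2) \<partial>P) = (\<integral>\<^sup>+z. ennreal ((norm (Y z))\<^sup>2) \<partial>PL)"
  using simple_isometry_polar[OF assms assms]
  by (simp add: nn_integral_eq_integral power2_norm_eq_inner)

text \<open>The closure of the simple pairs under joint mean square convergence. Integrands live on
  the whole product space, cut off by indicators, and the start \<open>a\<close> is kept so that
  orthogonality to \<open>F a\<close> survives the limit.\<close>

definition ito_lim :: "real \<Rightarrow> ('a \<times> real \<Rightarrow> real^'k^'l::finite) \<Rightarrow> ('a \<Rightarrow> real^'l) \<Rightarrow> bool" where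
  "ito_lim a Y X \<longleftrightarrow> Y \<in> borel_measurable PL \<and> X \<in> borel_measurable P \<and>
    (\<exists>Yj Xj. (\<forall>j. simple a (Yj j) (Xj j)) \<and>
      (\<lambda>j. \<integral>\<^sup>+z. ennreal ((norm (Yj j z - Y z))\<^sup>2) \<partial>PL) \<longlonglongrightarrow> 0 \<and>
      (\<lambda>j. \<integral>\<^sup>+\<omega>. ennreal ((norm (Xj j \<omega> - X \<omega>))\<^sup>2) \<partial>P) \<longlonglongrightarrow> 0)"

lemma ito_lim_measurable: "ito_lim a Y X \<Longrightarrow> Y \<in> borel_measurable PL" "ito_lim a Y X \<Longrightarrow> X \<in> borel_measurable P"
  by (auto simp: ito_lim_def)

lemma ito_limE:
  assumes "ito_lim a Y X"
  obtains Yj Xj where "\<And>j. simple a (Yj j) (Xj j)"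
    "(\<lambda>j. \<integral>\<^sup>+z. ennreal ((norm (Yj j z - Y z))\<^sup>2) \<partial>PL) \<longlonglongrightarrow> 0"
    "(\<lambda>j. \<integral>\<^sup>+\<omega>. ennreal ((norm (Xj j \<omega> - X \<omega>))\<^sup>2) \<partial>P) \<longlonglongrightarrow> 0"
proof -
  from assms obtain Yj Xj where "\<forall>j. simple a (Yj j) (Xj j)"
    "(\<lambda>j. \<integral>\<^sup>+z. ennreal ((norm (Yj j z - Y z))\<^sup>2) \<partial>PL) \<longlonglongrightarrow> 0"
    "(\<lambda>j. \<integral>\<^sup>+\<omega>. ennreal ((norm (Xj j \<omega> - X \<omega>))\<^sup>2) \<partial>P) \<longlonglongrightarrow> 0"
    unfolding ito_lim_def by (elim conjE exE)
  then show ?thesis by (intro that[of Yj Xj]) auto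
qed

lemma ito_lim_simple: "simple a Y X \<Longrightarrow> ito_lim a Y X"
  unfolding ito_lim_def using simple_measurable
  by (intro conjI exI[of _ "\<lambda>_. Y"] exI[of _ "\<lambda>_. X"]) auto

lemma ito_lim_diff:
  assumes "ito_lim a Y X" "ito_lim a Y' X'"
  shows "ito_lim a (\<lambda>z. Y z - Y' z) (\<lambda>\<omega>. X \<omega> - X' \<omega>)"
proof -
  note m [measurable] = ito_lim_measurable[OF assms(1)] ito_lim_measurable[OF assms(2)]
  obtain Yj Xj where j1: "\<And>j. simple a (Yj j) (Xj j)"
    and l1: "(\<lambda>j. \<integral>\<^sup>+z. ennreal ((norm (Yj j z - Y z))\<^sup>2) \<partial>PL) \<longlonglongrightarrow> 0"
    and l3: "(\<lambda>j. \<integral>\<^sup>+\<omega>. ennreal ((norm (Xj j \<omega> - X \<omega>))\<^sup>2) \<partial>P) \<longlonglongrightarrow> 0"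
    using ito_limE[OF assms(1)] by blast
  obtain Yj' Xj' where j2: "\<And>j. simple a (Yj' j) (Xj' j)"
    and l2: "(\<lambda>j. \<integral>\<^sup>+z. ennreal ((norm (Yj' j z - Y' z))\<^sup>2) \<partial>PL) \<longlonglongrightarrow> 0"
    and l4: "(\<lambda>j. \<integral>\<^sup>+\<omega>. ennreal ((norm (Xj' j \<omega> - X' \<omega>))\<^sup>2) \<partial>P) \<longlonglongrightarrow> 0"
    using ito_limE[OF assms(2)] by blast
  note j = j1 j2 and l = l1 l2 l3 l4
  note mj [measurable] = simple_measurable[OF j(1)] simple_measurable[OF j(2)]
  have r: "Yj j z - Yj' j z - (Y z - Y' z) = (Yj j z - Y z) - (Yj' j z - Y' z)"
    "Xj j \<omega> - Xj' j \<omega> - (X \<omega> - X' \<omega>) = (Xj j \<omega> - X \<omega>) - (Xj' j \<omega> - X' \<omega>)" for j z \<omega>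
    by (simp_all add: algebra_simps)
  have "(\<lambda>j. \<integral>\<^sup>+z. ennreal ((norm (Yj j z - Yj' j z - (Y z - Y' z)))\<^sup>2) \<partial>PL) \<longlonglongrightarrow> 0"
    unfolding r by (rule tendsto_zero_ennreal_double[OF l(1,2)]) (intro nn_integral_norm_sq_diff, measurable)
  moreover have "(\<lambda>j. \<integral>\<^sup>+\<omega>. ennreal ((norm (Xj j \<omega> - Xj' j \<omega> - (X \<omega> - X' \<omega>)))\<^sup>2) \<partial>P) \<longlonglongrightarrow> 0"
    unfolding r by (rule tendsto_zero_ennreal_double[OF l(3,4)]) (intro nn_integral_norm_sq_diff, measurable)
  ultimately show ?thesis
    unfolding ito_lim_def
    by (intro conjI exI[of _ "\<lambda>j z. Yj j z - Yj' j z"] exI[of _ "\<lambda>j \<omega>. Xj j \<omega> - Xj' j \<omega>"] allI simple_diff j) measurable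
qed

text \<open>Two uses of \<open>|x + y|^2 \<le> 2 |x|^2 + 2 |y|^2\<close> around the isometry of the
  approximants. They produce the factor 4 instead of 1, which is harmless, and the estimate holds
  for infinite right-hand sides as well.\<close>

lemma ito_lim_bound:
  assumes "ito_lim a Y X"
  shows "(\<integral>\<^sup>+\<omega>. ennreal ((norm (X \<omega>))\<^sup>2) \<partial>P) \<le> 4 * (\<integral>\<^sup>+z. ennreal ((norm (Y z))\<^sup>2) \<partial>PL)"
proof -
  note m [measurable] = ito_lim_measurable[OF assms(1)]
  obtain Yj Xj where j: "\<And>j. simple a (Yj j) (Xj j)"
    and l: "(\<lambda>j. \<integral>\<^sup>+z. ennreal ((norm (Yj j z - Y z))\<^sup>2) \<partial>PL) \<longlonglongrightarrow> 0"
    "(\<lambda>j. \<integral>\<^sup>+\<omega>. ennreal ((norm (Xj j \<omega> - X \<omega>))\<^sup>2) \<partial>P) \<longlonglongrightarrow> 0"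
    using ito_limE[OF assms(1)] by blast
  note mj [measurable] = simple_measurable[OF j(1)]
  let ?dX = "\<lambda>j. \<integral>\<^sup>+\<omega>. ennreal ((norm (Xj j \<omega> - X \<omega>))\<^sup>2) \<partial>P"
  let ?dY = "\<lambda>j. \<integral>\<^sup>+z. ennreal ((norm (Yj j z - Y z))\<^sup>2) \<partial>PL"
  let ?Y = "\<integral>\<^sup>+z. ennreal ((norm (Y z))\<^sup>2) \<partial>PL"
  have "(\<integral>\<^sup>+\<omega>. ennreal ((norm (X \<omega>))\<^sup>2) \<partial>P) \<le> 2 * ?dX j + 4 * ?dY j + 4 * ?Y" for j
  proof -
    have "(\<integral>\<^sup>+\<omega>. ennreal ((norm (X \<omega>))\<^sup>2) \<partial>P) = (\<integral>\<^sup>+\<omega>. ennreal ((norm (Xj j \<omega> - (Xj j \<omega> - X \<omega>)))\<^sup>2) \<partial>P)" by simp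
    also have "\<dots> \<le> 2 * (\<integral>\<^sup>+\<omega>. ennreal ((norm (Xj j \<omega>))\<^sup>2) \<partial>P) + 2 * ?dX j"
      by (intro nn_integral_norm_sq_diff) measurable
    also have "(\<integral>\<^sup>+\<omega>. ennreal ((norm (Xj j \<omega>))\<^sup>2) \<partial>P) = (\<integral>\<^sup>+z. ennreal ((norm ((Yj j z - Y z) + Y z))\<^sup>2) \<partial>PL)"
      using simple_isometry[OF j] by simp
    also have "\<dots> \<le> 2 * ?dY j + 2 * ?Y" by (intro nn_integral_norm_sq_add) measurable
    also have "2 * (2 * ?dY j + 2 * ?Y) + 2 * ?dX j = 2 * ?dX j + 4 * ?dY j + 4 * ?Y"
      by (simp add: distrib_left add.commute mult.assoc[symmetric])
    finally show ?thesis by (simp add: mult_left_mono add_mono)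
  qed
  moreover have "(\<lambda>j. 2 * ?dX j + 4 * ?dY j + 4 * ?Y) \<longlonglongrightarrow> 2 * 0 + 4 * 0 + 4 * ?Y"
    by (intro tendsto_add ennreal_tendsto_cmult l tendsto_const) auto
  ultimately show ?thesis by (intro LIMSEQ_le_const[where X = "\<lambda>j. 2 * ?dX j + 4 * ?dY j + 4 * ?Y"]) auto
qed

text \<open>Makes increments of the integral into integrals started at \<open>e\<close>. The two
  given integrals come with unrelated approximations, so neither difference need be a simple
  integral after \<open>e\<close>; instead the clipped approximants of \<open>Y\<close> are compared
  with \<open>Xj - Xj'\<close> by the isometry.\<close>

lemma ito_lim_clip:
  assumes "ito_lim a Y X" "ito_lim a Y' X'" and e: "0 \<le> e" "e \<le> T" "a \<le> e"
    and Y': "\<And>z. Y' z = indicat_real {..e} (snd z) *\<^sub>R Y z"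
  shows "ito_lim e (\<lambda>z. indicat_real {e<..} (snd z) *\<^sub>R Y z) (\<lambda>\<omega>. X \<omega> - X' \<omega>)"
proof -
  note m [measurable] = ito_lim_measurable[OF assms(1)] ito_lim_measurable[OF assms(2)]
  obtain Yj Xj where j1: "\<And>j. simple a (Yj j) (Xj j)"
    and l1: "(\<lambda>j. \<integral>\<^sup>+z. ennreal ((norm (Yj j z - Y z))\<^sup>2) \<partial>PL) \<longlonglongrightarrow> 0"
    and l3: "(\<lambda>j. \<integral>\<^sup>+\<omega>. ennreal ((norm (Xj j \<omega> - X \<omega>))\<^sup>2) \<partial>P) \<longlonglongrightarrow> 0"
    using ito_limE[OF assms(1)] by blast
  obtain Yj' Xj' where j2: "\<And>j. simple a (Yj' j) (Xj' j)"
    and l2: "(\<lambda>j. \<integral>\<^sup>+z. ennreal ((norm (Yj' j z - Y' z))\<^sup>2) \<partial>PL) \<longlonglongrightarrow> 0"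
    and l4: "(\<lambda>j. \<integral>\<^sup>+\<omega>. ennreal ((norm (Xj' j \<omega> - X' \<omega>))\<^sup>2) \<partial>P) \<longlonglongrightarrow> 0"
    using ito_limE[OF assms(2)] by blast
  note j = j1 j2 and l = l1 l2 l3 l4
  have "\<forall>j. \<exists>X'. simple e (\<lambda>z. indicat_real {e<..} (snd z) *\<^sub>R Yj j z) X'"
    using simple_clip[OF j(1) e(1,2)] by blast
  then obtain Xc where c: "\<And>j. simple e (\<lambda>z. indicat_real {e<..} (snd z) *\<^sub>R Yj j z) (Xc j)" by metis
  note mj [measurable] = simple_measurable[OF j(1)] simple_measurable[OF j(2)] simple_measurable[OF c]
  have [measurable]: "(\<lambda>z :: 'a \<times> real. indicat_real {e<..} (snd z)) \<in> borel_measurable PL"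
     "(\<lambda>z :: 'a \<times> real. indicat_real {..e} (snd z)) \<in> borel_measurable PL" by measurable
  have ind_le: "\<integral>\<^sup>+z. ennreal ((norm (indicat_real A (snd z) *\<^sub>R f z))\<^sup>2) \<partial>PL \<le> \<integral>\<^sup>+z. ennreal ((norm (f z))\<^sup>2) \<partial>PL"
    for A and f :: "'a \<times> real \<Rightarrow> real^'k^'l"
    by (intro nn_integral_mono) (auto simp: indicator_def)
  have i1: "(\<lambda>j. \<integral>\<^sup>+z. ennreal ((norm (indicat_real {e<..} (snd z) *\<^sub>R Yj j z - indicat_real {e<..} (snd z) *\<^sub>R Y z))\<^sup>2) \<partial>PL) \<longlonglongrightarrow> 0"
    unfolding scaleR_diff_right[symmetric]
    by (rule tendsto_sandwich[OF _ _ tendsto_const l(1)]) (intro always_eventually allI ind_le zero_le)+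
  have i2: "(\<lambda>j. \<integral>\<^sup>+\<omega>. ennreal ((norm (Xc j \<omega> - (Xj j \<omega> - Xj' j \<omega>)))\<^sup>2) \<partial>P) \<longlonglongrightarrow> 0"
  proof (rule tendsto_zero_ennreal_double[OF l(2) l(1)])
    fix j
    have s: "simple a (\<lambda>z. indicat_real {e<..} (snd z) *\<^sub>R Yj j z - (Yj j z - Yj' j z)) (\<lambda>\<omega>. Xc j \<omega> - (Xj j \<omega> - Xj' j \<omega>))"
      by (intro simple_diff simple_mono[OF c e(3)] j)
    have "(\<integral>\<^sup>+\<omega>. ennreal ((norm (Xc j \<omega> - (Xj j \<omega> - Xj' j \<omega>)))\<^sup>2) \<partial>P) =
      (\<integral>\<^sup>+z. ennreal ((norm (indicat_real {e<..} (snd z) *\<^sub>R Yj j z - (Yj j z - Yj' j z)))\<^sup>2) \<partial>PL)"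
      by (rule simple_isometry[OF s])
    \<comment> \<open>After \<open>e\<close> the two occurrences of \<open>Yj\<close> cancel; before
      \<open>e\<close> only \<open>Yj' - Yj\<close> is left. Inserting the common limit
      \<open>Y' = Y\<close> there exhibits two approximation errors.\<close>
    also have "\<dots> = (\<integral>\<^sup>+z. ennreal ((norm ((Yj' j z - Y' z) - indicat_real {..e} (snd z) *\<^sub>R (Yj j z - Y z)))\<^sup>2) \<partial>PL)"
      by (intro nn_integral_cong) (auto simp: indicator_def Y')
    also have "\<dots> \<le> 2 * (\<integral>\<^sup>+z. ennreal ((norm (Yj' j z - Y' z))\<^sup>2) \<partial>PL) +
      2 * (\<integral>\<^sup>+z. ennreal ((norm (indicat_real {..e} (snd z) *\<^sub>R (Yj j z - Y z)))\<^sup>2) \<partial>PL)"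
      by (intro nn_integral_norm_sq_diff) measurable
    also have "\<dots> \<le> 2 * (\<integral>\<^sup>+z. ennreal ((norm (Yj' j z - Y' z))\<^sup>2) \<partial>PL) + 2 * (\<integral>\<^sup>+z. ennreal ((norm (Yj j z - Y z))\<^sup>2) \<partial>PL)"
      by (intro add_mono mult_left_mono ind_le) auto
    finally show "(\<integral>\<^sup>+\<omega>. ennreal ((norm (Xc j \<omega> - (Xj j \<omega> - Xj' j \<omega>)))\<^sup>2) \<partial>P)
      \<le> 2 * (\<integral>\<^sup>+z. ennreal ((norm (Yj' j z - Y' z))\<^sup>2) \<partial>PL) + 2 * (\<integral>\<^sup>+z. ennreal ((norm (Yj j z - Y z))\<^sup>2) \<partial>PL)" .
  qed
  have i3: "(\<lambda>j. \<integral>\<^sup>+\<omega>. ennreal ((norm ((Xj j \<omega> - X \<omega>) - (Xj' j \<omega> - X' \<omega>)))\<^sup>2) \<partial>P) \<longlonglongrightarrow> 0"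
    by (rule tendsto_zero_ennreal_double[OF l(3,4)]) (intro nn_integral_norm_sq_diff, measurable)
  have r: "Xc j \<omega> - (X \<omega> - X' \<omega>) = (Xc j \<omega> - (Xj j \<omega> - Xj' j \<omega>)) + ((Xj j \<omega> - X \<omega>) - (Xj' j \<omega> - X' \<omega>))" for j \<omega>
    by (simp add: algebra_simps)
  have "(\<lambda>j. \<integral>\<^sup>+\<omega>. ennreal ((norm (Xc j \<omega> - (X \<omega> - X' \<omega>)))\<^sup>2) \<partial>P) \<longlonglongrightarrow> 0"
    unfolding r by (rule tendsto_zero_ennreal_double[OF i2 i3]) (intro nn_integral_norm_sq_add, measurable)
  with i1 c show ?thesis
    unfolding ito_lim_def
    by (intro conjI exI[of _ "\<lambda>j z. indicat_real {e<..} (snd z) *\<^sub>R Yj j z"] exI[of _ Xc] allI) measurable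
qed

text \<open>Every block starts at some \<open>p \<ge> a\<close>, so \<open>g\<close> times the
  coefficient is known at \<open>p\<close> and the increment averages it to zero.\<close>

lemma simple_orthogonal:
  assumes "simple a (Y :: _ \<Rightarrow> real^'k^'l::finite) X"
    and g: "g \<in> borel_measurable (F a)" "\<And>\<omega>. \<omega> \<in> space P \<Longrightarrow> norm (g \<omega>) \<le> c"
  shows "integrable P (\<lambda>\<omega>. g \<omega> \<bullet> X \<omega>) \<and> expectation (\<lambda>\<omega>. g \<omega> \<bullet> X \<omega>) = 0"
  using assms(1)
proof (induction rule: simple.induct)
  case (simple_add Y X p q \<xi> d)
  have [measurable]: "g \<in> borel_measurable (F p)" "\<xi> \<in> borel_measurable (F p)"
    using measurable_F_mono[OF g(1)] simple_add.hyps by auto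
  have comp: "\<bar>A $ l $ i\<bar> \<le> norm A" for A :: "real^'k^'l" and l i
    using Finite_Cartesian_Product.norm_nth_le[of A l] Finite_Cartesian_Product.norm_nth_le[of "A $ l" i] by simp
  have b: "integrable P (\<lambda>\<omega>. (g \<omega> $ l * \<xi> \<omega> $ l $ i) * dB p q \<omega> $ i) \<and> expectation (\<lambda>\<omega>. (g \<omega> $ l * \<xi> \<omega> $ l $ i) * dB p q \<omega> $ i) = 0" for l i
  proof -
    have m: "(\<lambda>\<omega>. g \<omega> $ l * \<xi> \<omega> $ l $ i) \<in> borel_measurable (F p)" by measurable
    have i: "integrable P (\<lambda>\<omega>. g \<omega> $ l * \<xi> \<omega> $ l $ i)"
    proof (rule integrable_const_bound[of _ "\<bar>c\<bar> * \<bar>d\<bar>"])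
      show "AE \<omega> in P. norm (g \<omega> $ l * \<xi> \<omega> $ l $ i) \<le> \<bar>c\<bar> * \<bar>d\<bar>"
      proof (rule AE_I2)
        fix \<omega> assume \<omega>: "\<omega> \<in> space P"
        have "\<bar>g \<omega> $ l\<bar> \<le> \<bar>c\<bar>" using g(2)[OF \<omega>] component_le_norm_cart[of "g \<omega>" l] by linarith
        moreover have "\<bar>\<xi> \<omega> $ l $ i\<bar> \<le> \<bar>d\<bar>" using simple_add.hyps(7) \<omega> comp[of "\<xi> \<omega>" l i] by fastforce
        ultimately show "norm (g \<omega> $ l * \<xi> \<omega> $ l $ i) \<le> \<bar>c\<bar> * \<bar>d\<bar>"
          unfolding real_norm_def abs_mult by (intro mult_mono) auto
      qed
    qed (rule measurable_F_P[OF m])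
    show ?thesis using expectation_mult_dB[OF simple_add.hyps(2,4,5) m i, of i] by simp
  qed
  have "g \<omega> \<bullet> (\<xi> \<omega> *v dB p q \<omega>) = (\<Sum>l\<in>UNIV. \<Sum>i\<in>UNIV. (g \<omega> $ l * \<xi> \<omega> $ l $ i) * dB p q \<omega> $ i)" for \<omega>
    by (simp add: inner_vec_def matrix_vector_mult_def sum_distrib_left mult.assoc)
  then have "integrable P (\<lambda>\<omega>. g \<omega> \<bullet> (\<xi> \<omega> *v dB p q \<omega>)) \<and> expectation (\<lambda>\<omega>. g \<omega> \<bullet> (\<xi> \<omega> *v dB p q \<omega>)) = 0"
    using b by (simp add: Bochner_Integration.integral_sum)
  then show ?case using simple_add.IH by (simp add: inner_add_right)
qed simp

lemma integrable_of_norm_sq: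
  fixes X :: "'a \<Rightarrow> 'b::{second_countable_topology, banach}"
  assumes [measurable]: "X \<in> borel_measurable P" and "(\<integral>\<^sup>+\<omega>. ennreal ((norm (X \<omega>))\<^sup>2) \<partial>P) < \<infinity>"
  shows "integrable P (\<lambda>\<omega>. (norm (X \<omega>))\<^sup>2)" "integrable P X"
proof -
  show i: "integrable P (\<lambda>\<omega>. (norm (X \<omega>))\<^sup>2)" using assms(2) by (intro integrableI_bounded) auto
  show "integrable P X"
  proof (rule Bochner_Integration.integrable_bound[of P "\<lambda>\<omega>. 1 + (norm (X \<omega>))\<^sup>2"])
    have "x \<le> 1 + x\<^sup>2" for x :: real using zero_le_power2[of "x - 1 / 2"] by (simp add: power2_eq_square algebra_simps)
    then show "AE \<omega> in P. norm (X \<omega>) \<le> norm (1 + (norm (X \<omega>))\<^sup>2)" by auto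
  qed (use i in auto)
qed

text \<open>The martingale property tested against bounded \<open>F a\<close>-measurable vectors.
  The approximants are orthogonal to \<open>g\<close>, hence the mean of \<open>g . X\<close> equals
  minus that of \<open>g . (Xj - X)\<close>, and its square is at most \<open>c^2\<close> times the
  mean square error.\<close>

lemma ito_lim_orthogonal:
  assumes "ito_lim a (Y :: _ \<Rightarrow> real^'k^'l::finite) X" and Y: "(\<integral>\<^sup>+z. ennreal ((norm (Y z))\<^sup>2) \<partial>PL) < \<infinity>"
    and g: "g \<in> borel_measurable (F a)" "\<And>\<omega>. \<omega> \<in> space P \<Longrightarrow> norm (g \<omega>) \<le> c"
  shows "integrable P (\<lambda>\<omega>. g \<omega> \<bullet> X \<omega>)" "expectation (\<lambda>\<omega>. g \<omega> \<bullet> X \<omega>) = 0"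
proof -
  note m [measurable] = ito_lim_measurable[OF assms(1)]
  have gm [measurable]: "g \<in> borel_measurable P" by (rule measurable_F_P[OF g(1)])
  obtain Yj Xj where j: "\<And>j. simple a (Yj j) (Xj j)"
    and l: "(\<lambda>j. \<integral>\<^sup>+\<omega>. ennreal ((norm (Xj j \<omega> - X \<omega>))\<^sup>2) \<partial>P) \<longlonglongrightarrow> 0"
    using ito_limE[OF assms(1)] by blast
  note mj [measurable] = simple_measurable[OF j(1)]
  have "(\<integral>\<^sup>+\<omega>. ennreal ((norm (X \<omega>))\<^sup>2) \<partial>P) < \<infinity>"
    using ito_lim_bound[OF assms(1)] Y by (auto simp: ennreal_mult_less_top intro: le_less_trans)
  then have iX: "integrable P X" by (intro integrable_of_norm_sq) auto
  have gX: "norm (g \<omega> \<bullet> Z) \<le> \<bar>c\<bar> * norm Z" if "\<omega> \<in> space P" for \<omega> Z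
    using Cauchy_Schwarz_ineq2[of "g \<omega>" Z] mult_right_mono[OF g(2)[OF that], of "norm Z"] mult_right_mono[OF abs_ge_self[of c], of "norm Z"] by simp
  have ig: "integrable P (\<lambda>\<omega>. g \<omega> \<bullet> Z \<omega>)" if "integrable P Z" for Z
    by (rule Bochner_Integration.integrable_bound[OF integrable_mult_right[of "\<bar>c\<bar>" P "\<lambda>\<omega>. norm (Z \<omega>)"]])
      (use that gX in \<open>auto\<close>)
  show "integrable P (\<lambda>\<omega>. g \<omega> \<bullet> X \<omega>)" by (rule ig[OF iX])
  let ?E = "expectation (\<lambda>\<omega>. g \<omega> \<bullet> X \<omega>)"
  have bound: "ennreal (?E\<^sup>2) \<le> ennreal (c\<^sup>2) * (\<integral>\<^sup>+\<omega>. ennreal ((norm (Xj j \<omega> - X \<omega>))\<^sup>2) \<partial>P)" for j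
  \<comment> \<open>An infinite mean square error makes the bound trivial unless
    \<open>c = 0\<close>, where the product of extended reals is 0; but then \<open>g\<close>
    vanishes.\<close>
  proof (cases "(\<integral>\<^sup>+\<omega>. ennreal ((norm (Xj j \<omega> - X \<omega>))\<^sup>2) \<partial>P) = \<infinity>")
    case True
    show ?thesis
    proof (cases "c = 0")
      case True
      have "?E = 0" using gX[of _ "X _"] True by (intro integral_eq_zero_AE) auto
      then show ?thesis by simp
    next
      case False
      then show ?thesis using True by (simp add: ennreal_mult_top)
    qed
  next
    case False
    then have fin: "(\<integral>\<^sup>+\<omega>. ennreal ((norm (Xj j \<omega> - X \<omega>))\<^sup>2) \<partial>P) < \<infinity>"
      by (simp only: infinity_ennreal_def top.not_eq_extremum)
    have i: "integrable P (\<lambda>\<omega>. (norm (Xj j \<omega> - X \<omega>))\<^sup>2)" "integrable P (\<lambda>\<omega>. Xj j \<omega> - X \<omega>)"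
      by (rule integrable_of_norm_sq[OF _ fin], measurable)+
    have "expectation (\<lambda>\<omega>. g \<omega> \<bullet> (Xj j \<omega> - X \<omega>)) = - ?E"
      using simple_orthogonal[OF j g, of j] ig[OF iX] by (simp add: inner_diff_right)
    then have "\<bar>?E\<bar> = \<bar>expectation (\<lambda>\<omega>. g \<omega> \<bullet> (Xj j \<omega> - X \<omega>))\<bar>" by simp
    also have "\<dots> \<le> expectation (\<lambda>\<omega>. norm (g \<omega> \<bullet> (Xj j \<omega> - X \<omega>)))"
      using integral_norm_bound[of P "\<lambda>\<omega>. g \<omega> \<bullet> (Xj j \<omega> - X \<omega>)"] by simp
    also have "\<dots> \<le> expectation (\<lambda>\<omega>. \<bar>c\<bar> * norm (Xj j \<omega> - X \<omega>))"
      using gX by (intro integral_mono_AE integrable_norm ig i integrable_mult_right AE_I2) auto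
    finally have "\<bar>?E\<bar> \<le> \<bar>c\<bar> * expectation (\<lambda>\<omega>. norm (Xj j \<omega> - X \<omega>))" by simp
    then have "\<bar>?E\<bar>\<^sup>2 \<le> (\<bar>c\<bar> * expectation (\<lambda>\<omega>. norm (Xj j \<omega> - X \<omega>)))\<^sup>2" by (intro power_mono) auto
    also have "\<dots> = c\<^sup>2 * (expectation (\<lambda>\<omega>. norm (Xj j \<omega> - X \<omega>)))\<^sup>2" by (simp add: power_mult_distrib)
    \<comment> \<open>Jensen's inequality, in the form that a variance is nonnegative.\<close>
    also have "\<dots> \<le> c\<^sup>2 * expectation (\<lambda>\<omega>. (norm (Xj j \<omega> - X \<omega>))\<^sup>2)"
      using variance_positive[of "\<lambda>\<omega>. norm (Xj j \<omega> - X \<omega>)"] variance_eq[OF integrable_norm[OF i(2)] i(1)]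
      by (intro mult_left_mono) auto
    finally have "ennreal (?E\<^sup>2) \<le> ennreal (c\<^sup>2 * expectation (\<lambda>\<omega>. (norm (Xj j \<omega> - X \<omega>))\<^sup>2))" by (intro ennreal_leI) simp
    also have "\<dots> = ennreal (c\<^sup>2) * (\<integral>\<^sup>+\<omega>. ennreal ((norm (Xj j \<omega> - X \<omega>))\<^sup>2) \<partial>P)"
      using i by (simp add: nn_integral_eq_integral ennreal_mult')
    finally show ?thesis .
  qed
  have "(\<lambda>j. ennreal (c\<^sup>2) * (\<integral>\<^sup>+\<omega>. ennreal ((norm (Xj j \<omega> - X \<omega>))\<^sup>2) \<partial>P)) \<longlonglongrightarrow> ennreal (c\<^sup>2) * 0"
    by (intro ennreal_tendsto_cmult l) auto
  then have "ennreal (?E\<^sup>2) \<le> 0" using bound by (intro LIMSEQ_le_const) auto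
  then show "?E = 0" by (simp add: ennreal_eq_0_iff)
qed

end

section \<open>Uniform grids\<close>

text \<open>For \<open>n = 0\<close> division by zero makes every point equal to \<open>a\<close>,
  so the order bounds remain true, while the statements about the end point, cells and sums ask for
  \<open>n > 0\<close>.\<close>

definition grid :: "real \<Rightarrow> real \<Rightarrow> nat \<Rightarrow> nat \<Rightarrow> real" where
  "grid a b n k = a + (b - a) * real k / real n"

lemma grid_0 [simp]: "grid a b n 0 = a"
  by (simp add: grid_def)

lemma grid_end [simp]: "n > 0 \<Longrightarrow> grid a b n n = b"
  by (simp add: grid_def)

lemma grid_step: "grid a b n (Suc k) - grid a b n k = (b - a) / real n"
  by (simp add: grid_def add_divide_distrib distrib_left)

lemma grid_mono: "a \<le> b \<Longrightarrow> j \<le> k \<Longrightarrow> grid a b n j \<le> grid a b n k"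
  by (auto simp: grid_def intro!: divide_right_mono mult_left_mono)

lemma grid_ge: "a \<le> b \<Longrightarrow> a \<le> grid a b n k"
  by (simp add: grid_def)

lemma grid_le:
  assumes "a \<le> b" "k \<le> n" shows "grid a b n k \<le> b"
proof (cases "n = 0")
  case False
  then show ?thesis using grid_mono[OF assms, of n] by simp
qed (use assms in \<open>simp add: grid_def\<close>)

text \<open>Take the least \<open>k\<close> whose right end reaches \<open>r\<close>. Cells are open
  on the left and closed on the right, matching the elementary processes.\<close>

lemma grid_cell:
  assumes "a < r" "r \<le> b" "n > 0"
  shows "\<exists>k<n. grid a b n k < r \<and> r \<le> grid a b n (Suc k)"
proof -
  define k where "k = (LEAST k. r \<le> grid a b n (Suc k))"
  have n: "r \<le> grid a b n (Suc (n - 1))" using assms by simp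
  have k: "r \<le> grid a b n (Suc k)" "k \<le> n - 1"
    unfolding k_def using n by (rule LeastI, rule Least_le)
  have "grid a b n k < r"
  proof (cases k)
    case 0
    then show ?thesis using assms by simp
  next
    case (Suc j)
    then have "\<not> r \<le> grid a b n (Suc j)" using not_less_Least[of j "\<lambda>k. r \<le> grid a b n (Suc k)"] by (simp add: k_def)
    then show ?thesis using Suc by simp
  qed
  then show ?thesis using k assms by (intro exI[of _ k]) simp
qed

lemma grid_cell_unique:
  assumes "a \<le> b" "grid a b n k < r" "r \<le> grid a b n (Suc k)" "grid a b n j < r" "r \<le> grid a b n (Suc j)"
  shows "j = k"
proof (rule ccontr)
  assume "j \<noteq> k"
  then consider "Suc j \<le> k" | "Suc k \<le> j" by linarith
  then show False
    using grid_mono[OF assms(1), of "Suc j" k n] grid_mono[OF assms(1), of "Suc k" j n] assms by cases auto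
qed

lemma sum_grid_telescope:
  fixes f :: "real \<Rightarrow> 'b::ab_group_add"
  shows "n > 0 \<Longrightarrow> (\<Sum>k<n. f (grid a b n (Suc k)) - f (grid a b n k)) = f b - f a"
  using sum_lessThan_telescope[of "\<lambda>k. f (grid a b n k)" n] by simp

lemma sum_grid_const:
  assumes "n > 0" shows "(\<Sum>k<n. c * (grid a b n (Suc k) - grid a b n k)) = c * (b - a)"
  using sum_grid_telescope[OF assms, of "\<lambda>x. x" a b] by (simp flip: sum_distrib_left)

lemma sum_indicator_grid:
  assumes "a \<le> b" "n > 0"
  shows "(\<Sum>k<n. indicat_real {grid a b n k<..grid a b n (Suc k)} r) = indicat_real {a<..b} r"
proof (cases "r \<in> {a<..b}")
  case True
  then obtain k where k: "k < n" "grid a b n k < r" "r \<le> grid a b n (Suc k)" using grid_cell[of a r b n] assms by auto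
  have "(\<Sum>j<n. indicat_real {grid a b n j<..grid a b n (Suc j)} r) = (\<Sum>j<n. if j = k then 1 else 0)"
  proof (intro sum.cong refl)
    fix j
    show "indicat_real {grid a b n j<..grid a b n (Suc j)} r = (if j = k then 1 else 0)"
    proof (cases "j = k")
      case False
      then have "\<not> (grid a b n j < r \<and> r \<le> grid a b n (Suc j))" using grid_cell_unique[OF assms(1) k(2,3)] by blast
      then show ?thesis using False by (simp add: indicator_def)
    qed (use k in simp)
  qed
  then show ?thesis using k True by simp
next
  case False
  have "indicat_real {grid a b n j<..grid a b n (Suc j)} r = 0" if "j < n" for j
    using False grid_ge[OF assms(1), of n j] grid_le[OF assms(1), of "Suc j" n] that by (auto simp: indicator_def)
  then show ?thesis using False by simp
qed

lemma partition_bounds: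
  assumes p: "is_partition a b n p" and i: "i \<le> n"
  shows "a \<le> p i" "p i \<le> b"
proof -
  have st: "p k \<le> p (Suc k)" if "k < n" for k using p that by (simp add: is_partition_def)
  show "a \<le> p i" using i
  proof (induction i)
    case 0
    then show ?case using p by (simp add: is_partition_def)
  next
    case (Suc k)
    then show ?case using st[of k] by simp
  qed
  show "p i \<le> b" using i
  proof (induction rule: inc_induct)
    case base
    then show ?case using p by (simp add: is_partition_def)
  next
    case (step k)
    then show ?case using st[of k] by simp
  qed
qed

section \<open>Vanishing Riemann sums and increments of the Ito integral\<close>

context filtered_wiener
begin

text \<open>Dominated convergence for quantities attached to cells: at each time exactly one cell
  contributes, and both of its ends converge to that time. Only pointwise convergence along
  shrinking cells has to be supplied, so continuity of each path replaces any modulus uniform in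
  \<open>\<omega>\<close>.\<close>

lemma riemann_vanish:
  fixes \<phi> :: "real \<Rightarrow> real \<Rightarrow> 'a \<times> real \<Rightarrow> real"
  assumes tu: "t \<le> u"
    and meas: "\<And>a b. t \<le> a \<Longrightarrow> a \<le> b \<Longrightarrow> b \<le> u \<Longrightarrow> \<phi> a b \<in> borel_measurable PL"
    and D: "integrable PL (\<lambda>z. indicat_real {t<..u} (snd z) * D z)"
    and bound: "\<And>a b z. t \<le> a \<Longrightarrow> a < snd z \<Longrightarrow> snd z \<le> b \<Longrightarrow> b \<le> u \<Longrightarrow> fst z \<in> space P \<Longrightarrow> \<bar>\<phi> a b z\<bar> \<le> D z"
    and conv: "\<And>a b z. (\<And>n. t \<le> a n \<and> a n < snd z \<and> snd z \<le> b n \<and> b n \<le> u) \<Longrightarrow> a \<longlonglongrightarrow> snd z \<Longrightarrow> b \<longlonglongrightarrow> snd z \<Longrightarrow>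
      fst z \<in> space P \<Longrightarrow> (\<lambda>n. \<phi> (a n) (b n) z) \<longlonglongrightarrow> 0"
  shows "(\<lambda>n. \<Sum>k<n. \<integral>z. indicat_real {grid t u n k<..grid t u n (Suc k)} (snd z) * \<phi> (grid t u n k) (grid t u n (Suc k)) z \<partial>PL) \<longlonglongrightarrow> 0"
    and "k < n \<Longrightarrow> integrable PL (\<lambda>z. indicat_real {grid t u n k<..grid t u n (Suc k)} (snd z) * \<phi> (grid t u n k) (grid t u n (Suc k)) z)"
proof -
  let ?g = "grid t u"
  let ?f = "\<lambda>n k z. indicat_real {?g n k<..?g n (Suc k)} (snd z) * \<phi> (?g n k) (?g n (Suc k)) z"
  have mf: "?f n k \<in> borel_measurable PL" if "k < n" for n k
  proof -
    have [measurable]: "\<phi> (?g n k) (?g n (Suc k)) \<in> borel_measurable PL"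
      using that grid_ge[OF tu] grid_le[OF tu] grid_mono[OF tu] by (intro meas) auto
    show ?thesis by measurable
  qed
  have cell: "?g n k \<ge> t" "?g n (Suc k) \<le> u" if "k < n" for n k
    using that grid_ge[OF tu] grid_le[OF tu] by auto
  have fb: "\<bar>?f n k z\<bar> \<le> indicat_real {?g n k<..?g n (Suc k)} (snd z) * D z" if "k < n" "z \<in> space PL" for n k z
    using bound[OF cell(1)[OF that(1)] _ _ cell(2)[OF that(1)], of z] that(2) by (auto simp: indicator_def space_pair_measure)
  have int: "integrable PL (?f n k)" if "k < n" for n k
  proof (rule Bochner_Integration.integrable_bound[OF D mf[OF that]])
    show "AE z in PL. norm (?f n k z) \<le> norm (indicat_real {t<..u} (snd z) * D z)"
    proof (rule AE_I2)
      fix z assume z: "z \<in> space PL"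
      have "indicat_real {?g n k<..?g n (Suc k)} (snd z) * D z \<le> \<bar>indicat_real {t<..u} (snd z) * D z\<bar>"
        using cell[OF that] by (auto simp: indicator_def)
      with fb[OF that z] show "norm (?f n k z) \<le> norm (indicat_real {t<..u} (snd z) * D z)" by simp
    qed
  qed
  show "k < n \<Longrightarrow> integrable PL (?f n k)" by (rule int)
  let ?S = "\<lambda>n z. \<Sum>k<n. ?f n k z"
  have Sval: "?S n z = \<phi> (?g n k) (?g n (Suc k)) z" if "k < n" "?g n k < snd z" "snd z \<le> ?g n (Suc k)" for n k z
  proof -
    have "?S n z = (\<Sum>j<n. if j = k then \<phi> (?g n k) (?g n (Suc k)) z else 0)"
    proof (intro sum.cong refl)
      fix j
      show "?f n j z = (if j = k then \<phi> (?g n k) (?g n (Suc k)) z else 0)"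
      proof (cases "j = k")
        case False
        then have "\<not> (?g n j < snd z \<and> snd z \<le> ?g n (Suc j))" using grid_cell_unique[OF tu that(2,3)] by blast
        then show ?thesis using False by (simp add: indicator_def)
      qed (use that in simp)
    qed
    then show ?thesis using that by simp
  qed
  have S0: "?S n z = 0" if "snd z \<notin> {t<..u}" for n z
  proof (intro sum.neutral ballI)
    fix k assume "k \<in> {..<n}"
    then have "snd z \<notin> {?g n k<..?g n (Suc k)}" using that cell[of k n] by auto
    then show "?f n k z = 0" by simp
  qed
  have "(\<lambda>n. integral\<^sup>L PL (?S n)) \<longlonglongrightarrow> integral\<^sup>L PL (\<lambda>z. 0)"
  proof (rule integral_dominated_convergence[where w = "\<lambda>z. \<bar>indicat_real {t<..u} (snd z) * D z\<bar>"])
    show "AE z in PL. (\<lambda>n. ?S n z) \<longlonglongrightarrow> 0"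
    proof (rule AE_I2)
      fix z assume z: "z \<in> space PL"
      show "(\<lambda>n. ?S n z) \<longlonglongrightarrow> 0"
      proof (cases "snd z \<in> {t<..u}")
        case False
        show ?thesis unfolding S0[OF False] by simp
      next
        case True
        have "\<forall>n. \<exists>k. n > 0 \<longrightarrow> k < n \<and> ?g n k < snd z \<and> snd z \<le> ?g n (Suc k)"
          using True grid_cell[of t "snd z" u] by (meson greaterThanAtMost_iff)
        then obtain \<kappa> where \<kappa>: "\<And>n. n > 0 \<Longrightarrow> \<kappa> n < n \<and> ?g n (\<kappa> n) < snd z \<and> snd z \<le> ?g n (Suc (\<kappa> n))"
          by metis
        \<comment> \<open>The cell containing the given time. The index is shifted by one since the
          grid with \<open>n = 0\<close> has no cells.\<close>
        let ?a = "\<lambda>n. ?g (Suc n) (\<kappa> (Suc n))" and ?b = "\<lambda>n. ?g (Suc n) (Suc (\<kappa> (Suc n)))"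
        have st: "?b n - ?a n = (u - t) / real (Suc n)" for n by (rule grid_step)
        have ab: "?a n < snd z" "snd z \<le> ?b n" for n using \<kappa>[of "Suc n"] by auto
        have lim: "(\<lambda>n. (u - t) / real (Suc n)) \<longlonglongrightarrow> 0"
          by (rule LIMSEQ_Suc) (rule lim_const_over_n)
        have "?a \<longlonglongrightarrow> snd z"
        proof (rule tendsto_sandwich[of "\<lambda>n. snd z - (u - t) / real (Suc n)" _ _ "\<lambda>_. snd z"])
          show "(\<lambda>n. snd z - (u - t) / real (Suc n)) \<longlonglongrightarrow> snd z" using tendsto_diff[OF tendsto_const lim] by simp
          show "\<forall>\<^sub>F n in sequentially. snd z - (u - t) / real (Suc n) \<le> ?a n"
            unfolding st[symmetric] using ab(2) by (intro always_eventually allI) (simp add: algebra_simps)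
          show "\<forall>\<^sub>F n in sequentially. ?a n \<le> snd z" using ab(1) by (intro always_eventually allI less_imp_le)
        qed simp
        moreover have "?b \<longlonglongrightarrow> snd z"
        proof (rule tendsto_sandwich[of "\<lambda>_. snd z" _ _ "\<lambda>n. snd z + (u - t) / real (Suc n)"])
          show "(\<lambda>n. snd z + (u - t) / real (Suc n)) \<longlonglongrightarrow> snd z" using tendsto_add[OF tendsto_const lim] by simp
          show "\<forall>\<^sub>F n in sequentially. ?b n \<le> snd z + (u - t) / real (Suc n)"
            unfolding st[symmetric] using ab(1) by (intro always_eventually allI) (simp add: less_imp_le)
          show "\<forall>\<^sub>F n in sequentially. snd z \<le> ?b n" using ab(2) by (intro always_eventually allI)
        qed simp
        moreover have "t \<le> ?a n \<and> ?a n < snd z \<and> snd z \<le> ?b n \<and> ?b n \<le> u" for n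
          using ab cell[of "\<kappa> (Suc n)" "Suc n"] \<kappa>[of "Suc n"] by auto
        ultimately have "(\<lambda>n. \<phi> (?a n) (?b n) z) \<longlonglongrightarrow> 0"
          using z by (intro conv) (auto simp: space_pair_measure)
        moreover have "?S (Suc n) z = \<phi> (?a n) (?b n) z" for n
          using \<kappa>[of "Suc n"] by (intro Sval) auto
        ultimately have "(\<lambda>n. ?S (Suc n) z) \<longlonglongrightarrow> 0" by simp
        then show ?thesis by (rule LIMSEQ_imp_Suc)
      qed
    qed
    show "AE z in PL. norm (?S n z) \<le> \<bar>indicat_real {t<..u} (snd z) * D z\<bar>" for n
    proof (rule AE_I2)
      fix z assume z: "z \<in> space PL"
      show "norm (?S n z) \<le> \<bar>indicat_real {t<..u} (snd z) * D z\<bar>"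
      proof (cases "snd z \<in> {t<..u} \<and> n > 0")
        case False
        then have "?S n z = 0" using S0[of z n] by (cases "n = 0") auto
        then show ?thesis by (simp del: sum.lessThan_Suc)
      next
        case True
        then obtain k where k: "k < n" "?g n k < snd z" "snd z \<le> ?g n (Suc k)" using grid_cell[of t "snd z" u n] by auto
        then have "?S n z = \<phi> (?g n k) (?g n (Suc k)) z" by (rule Sval)
        moreover have "\<bar>\<phi> (?g n k) (?g n (Suc k)) z\<bar> \<le> D z"
          using k cell[of k n] z by (intro bound) (auto simp: space_pair_measure)
        ultimately show ?thesis using True by simp
      qed
    qed
    show "?S n \<in> borel_measurable PL" for n using mf by (intro borel_measurable_sum) auto
    show "integrable PL (\<lambda>z. \<bar>indicat_real {t<..u} (snd z) * D z\<bar>)" using D by (rule integrable_abs)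
  qed simp
  moreover have "integral\<^sup>L PL (?S n) = (\<Sum>k<n. integral\<^sup>L PL (?f n k))" for n
    using int by (intro Bochner_Integration.integral_sum) auto
  ultimately show "(\<lambda>n. \<Sum>k<n. integral\<^sup>L PL (?f n k)) \<longlonglongrightarrow> 0" by simp
qed

lemma elementary_simple:
  assumes el: "elementary P F a b n p \<xi>" and a: "0 \<le> a" and b: "b \<le> T"
  shows "simple a (\<lambda>z. elementary_process n p \<xi> (snd z) (fst z)) (elementary_integral B n p \<xi>)"
proof -
  have p: "p 0 = a" "p n = b" "\<And>i. i < n \<Longrightarrow> p i \<le> p (Suc i)"
    using el by (auto simp: elementary_def is_partition_def)
  have part: "is_partition a b n p" using el by (simp add: elementary_def)
  have "simple a (\<lambda>z. \<Sum>i<k. indicat_real {p i<..p (Suc i)} (snd z) *\<^sub>R \<xi> i (fst z)) (\<lambda>\<omega>. \<Sum>i<k. \<xi> i \<omega> *v dB (p i) (p (Suc i)) \<omega>)"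
    if "k \<le> n" for k
    using that
  proof (induction k)
    case 0
    then show ?case using simple_zero by simp
  next
    case (Suc k)
    then have k: "k < n" by simp
    obtain c where c: "\<forall>\<omega>\<in>space P. norm (\<xi> k \<omega>) \<le> c" and m: "\<xi> k \<in> borel_measurable (F (p k))"
      using el k by (auto simp: elementary_def)
    have "simple a (\<lambda>z. (\<Sum>i<k. indicat_real {p i<..p (Suc i)} (snd z) *\<^sub>R \<xi> i (fst z)) + indicat_real {p k<..p (Suc k)} (snd z) *\<^sub>R \<xi> k (fst z))
      (\<lambda>\<omega>. (\<Sum>i<k. \<xi> i \<omega> *v dB (p i) (p (Suc i)) \<omega>) + \<xi> k \<omega> *v dB (p k) (p (Suc k)) \<omega>)"
      using Suc k partition_bounds(1)[OF part, of k] partition_bounds(2)[OF part, of "Suc k"] p(3)[OF k] a b by (intro simple_add[OF _ _ _ _ _ m c]) auto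
    then show ?case by simp
  qed
  from this[of n] show ?thesis
    by (simp add: elementary_process_def elementary_integral_def[abs_def] dB_def)
qed

text \<open>Elementary processes vanish outside the half-open interval, so cutting the integrand off
  there can only decrease the distance, which the definition measures on the closed
  interval.\<close>

lemma ito_lim_of_integral:
  assumes I: "has_ito_integral P F B a b Y X" and a: "0 \<le> a" and b: "b \<le> T"
  shows "ito_lim a (\<lambda>z. indicat_real {a<..b} (snd z) *\<^sub>R Y (snd z) (fst z)) X"
proof -
  let ?Y = "\<lambda>z. indicat_real {a<..b} (snd z) *\<^sub>R Y (snd z) (fst z)"
  have X: "X \<in> borel_measurable P" using I by (simp add: has_ito_integral_def)
  have "set_borel_measurable PL (space P \<times> {a..b}) (\<lambda>(\<omega>, r). Y r \<omega>)" using I by (simp add: has_ito_integral_def)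
  then have "(\<lambda>z. indicat_real (space P \<times> {a..b}) z *\<^sub>R Y (snd z) (fst z)) \<in> borel_measurable PL"
    by (simp add: set_borel_measurable_def case_prod_unfold)
  then have "(\<lambda>z. indicat_real {a<..b} (snd z) *\<^sub>R (indicat_real (space P \<times> {a..b}) z *\<^sub>R Y (snd z) (fst z))) \<in> borel_measurable PL"
    by measurable
  then have Y: "?Y \<in> borel_measurable PL"
    by (subst (asm) measurable_cong[where g = ?Y]) (auto simp: indicator_def space_pair_measure)
  from I obtain n p \<xi> where el: "\<forall>j. elementary P F a b (n j) (p j) (\<xi> j)"
    and l: "(\<lambda>j. set_nn_integral PL (space P \<times> {a..b}) (\<lambda>(\<omega>, r).
               ennreal ((norm (elementary_process (n j) (p j) (\<xi> j) r \<omega> - Y r \<omega>))\<^sup>2))) \<longlonglongrightarrow> 0"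
      "(\<lambda>j. \<integral>\<^sup>+ \<omega>. ennreal ((norm (elementary_integral B (n j) (p j) (\<xi> j) \<omega> - X \<omega>))\<^sup>2) \<partial>P) \<longlonglongrightarrow> 0"
    unfolding has_ito_integral_def by (elim conjE exE)
  let ?Yj = "\<lambda>j z. elementary_process (n j) (p j) (\<xi> j) (snd z) (fst z)"
  have zero: "?Yj j z = 0" if "snd z \<notin> {a<..b}" for j z
  proof -
    have part: "is_partition a b (n j) (p j)" using el by (simp add: elementary_def)
    show ?thesis unfolding elementary_process_def
    proof (intro sum.neutral ballI)
      fix i assume "i \<in> {..<n j}"
      then have "snd z \<notin> {p j i<..p j (Suc i)}"
        using that partition_bounds(1)[OF part, of i] partition_bounds(2)[OF part, of "Suc i"] by auto
      then show "indicat_real {p j i<..p j (Suc i)} (snd z) *\<^sub>R \<xi> j i (fst z) = 0" by simp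
    qed
  qed
  have "(\<lambda>j. \<integral>\<^sup>+z. ennreal ((norm (?Yj j z - ?Y z))\<^sup>2) \<partial>PL) \<longlonglongrightarrow> 0"
  proof (rule tendsto_sandwich[OF _ _ tendsto_const l(1)])
    show "\<forall>\<^sub>F j in sequentially. (\<integral>\<^sup>+z. ennreal ((norm (?Yj j z - ?Y z))\<^sup>2) \<partial>PL) \<le>
      set_nn_integral PL (space P \<times> {a..b}) (\<lambda>(\<omega>, r). ennreal ((norm (elementary_process (n j) (p j) (\<xi> j) r \<omega> - Y r \<omega>))\<^sup>2))"
    proof (intro always_eventually allI nn_integral_mono)
      fix j z assume z: "z \<in> space PL"
      show "ennreal ((norm (?Yj j z - ?Y z))\<^sup>2) \<le> (case z of (\<omega>, r) \<Rightarrow>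
          ennreal ((norm (elementary_process (n j) (p j) (\<xi> j) r \<omega> - Y r \<omega>))\<^sup>2)) * indicator (space P \<times> {a..b}) z"
      proof (cases "snd z \<in> {a<..b}")
        case True
        then show ?thesis using z by (auto simp: indicator_def space_pair_measure)
      next
        case False
        then show ?thesis using zero[OF False] by simp
      qed
    qed
  qed simp
  moreover have "\<forall>j. simple a (?Yj j) (elementary_integral B (n j) (p j) (\<xi> j))"
    using elementary_simple[OF _ a b] el by blast
  ultimately show ?thesis
    unfolding ito_lim_def using X Y l(2)
    by (intro conjI exI[of _ ?Yj] exI[of _ "\<lambda>j. elementary_integral B (n j) (p j) (\<xi> j)"])
qed

lemma ito_lim_increment:
  assumes I: "\<And>s. s \<in> {t..T} \<Longrightarrow> has_ito_integral P F B t s Y (I s)"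
    and ab: "0 \<le> t" "t \<le> a" "a \<le> b" "b \<le> T"
  shows "ito_lim a (\<lambda>z. indicat_real {a<..b} (snd z) *\<^sub>R Y (snd z) (fst z)) (\<lambda>\<omega>. I b \<omega> - I a \<omega>)"
proof -
  have "ito_lim a (\<lambda>z. indicat_real {a<..} (snd z) *\<^sub>R (indicat_real {t<..b} (snd z) *\<^sub>R Y (snd z) (fst z))) (\<lambda>\<omega>. I b \<omega> - I a \<omega>)"
    by (rule ito_lim_clip[OF ito_lim_of_integral[OF I[of b]] ito_lim_of_integral[OF I[of a]]])
      (use ab in \<open>auto simp: indicator_def\<close>)
  moreover have "(\<lambda>z :: 'a \<times> real. indicat_real {a<..} (snd z) *\<^sub>R (indicat_real {t<..b} (snd z) *\<^sub>R Y (snd z) (fst z)))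
    = (\<lambda>z. indicat_real {a<..b} (snd z) *\<^sub>R Y (snd z) (fst z))"
    using ab by (auto simp: indicator_def fun_eq_iff)
  ultimately show ?thesis by simp
qed

text \<open>Subtracting the integrand frozen at \<open>a\<close> leaves the error of the Euler step
  for the noise, again as an Ito integral and thus open to the mean square bound.\<close>

lemma ito_lim_increment_frozen:
  assumes I: "\<And>s. s \<in> {t..T} \<Longrightarrow> has_ito_integral P F B t s Y (I s)"
    and ab: "0 \<le> t" "t \<le> a" "a \<le> b" "b \<le> T"
    and Z: "Z \<in> borel_measurable (F a)" "\<And>\<omega>. \<omega> \<in> space P \<Longrightarrow> norm (Z \<omega>) \<le> c"
  shows "ito_lim a (\<lambda>z. indicat_real {a<..b} (snd z) *\<^sub>R (Y (snd z) (fst z) - Z (fst z))) (\<lambda>\<omega>. I b \<omega> - I a \<omega> - Z \<omega> *v dB a b \<omega>)"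
proof -
  have "ito_lim a (\<lambda>z. indicat_real {a<..b} (snd z) *\<^sub>R Z (fst z)) (\<lambda>\<omega>. Z \<omega> *v dB a b \<omega>)"
    by (rule ito_lim_simple, rule simple_block) (use ab Z in auto)
  from ito_lim_diff[OF ito_lim_increment[OF I ab] this] show ?thesis
    by (simp add: scaleR_diff_right)
qed

end

section \<open>Drift integrals\<close>

text \<open>The form in which Cauchy-Schwarz is used for sums over cells: instead of a product of
  square roots there is a free weight \<open>c\<close>, sent to zero after \<open>n\<close> has gone
  to infinity.\<close>

lemma tendsto_zero_tradeoff:
  fixes x u :: "nat \<Rightarrow> real"
  assumes x: "\<And>n. 0 \<le> x n" and u: "u \<longlonglongrightarrow> 0"
    and le: "\<And>c n. c > 0 \<Longrightarrow> n > 0 \<Longrightarrow> x n \<le> u n / c + c * K"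
  shows "x \<longlonglongrightarrow> 0"
proof (rule LIMSEQ_I)
  fix e :: real assume e: "e > 0"
  define c where "c = e / (2 * (\<bar>K\<bar> + 1))"
  have c: "c > 0" using e by (simp add: c_def)
  have cK: "c * K \<le> e / 2"
  proof -
    have "c * K \<le> c * (\<bar>K\<bar> + 1)" using c by (intro mult_left_mono) auto
    also have "\<dots> = e / 2" using e by (simp add: c_def field_simps del: distrib_left_numeral)
    finally show ?thesis .
  qed
  have "0 < c * (e / 2)" using c e by simp
  from LIMSEQ_D[OF u this] obtain N where N: "\<And>n. n \<ge> N \<Longrightarrow> \<bar>u n\<bar> < c * (e / 2)" by auto
  show "\<exists>N. \<forall>n\<ge>N. norm (x n - 0) < e"
  proof (intro exI[of _ "Suc N"] allI impI)
    fix n assume n: "Suc N \<le> n"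
    then have "u n / c < e / 2" using N[of n] c by (simp add: pos_divide_less_eq mult.commute)
    moreover have "x n \<le> u n / c + c * K" using n by (intro le c) auto
    ultimately have "x n < e" using cK by linarith
    then show "norm (x n - 0) < e" using x[of n] by simp
  qed
qed

text \<open>Young's inequality with the factor 1/2 given away.\<close>

lemma norm_mult_le_tradeoff:
  fixes x y c :: real
  assumes "c > 0" shows "x * y \<le> x\<^sup>2 / c + c * y\<^sup>2"
proof -
  have "0 \<le> (x - c * y)\<^sup>2 / c" using assms by simp
  also have "\<dots> = x\<^sup>2 / c + c * y\<^sup>2 - 2 * (x * y)"
    using assms by (simp add: power2_eq_square field_simps)
  finally have 1: "2 * (x * y) \<le> x\<^sup>2 / c + c * y\<^sup>2" by simp
  have 2: "0 \<le> x\<^sup>2 / c + c * y\<^sup>2" using assms by simp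
  show ?thesis using 1 2 by (cases "0 \<le> x * y") auto
qed

lemma linear_sigma_mat: "linear (sigma_mat :: 'n::finite spins \<Rightarrow> _)"
  by (rule linearI) (simp_all add: sigma_mat_def matrix_def vec_eq_iff cprod.add_left cprod.scaleR_left)

lemma sigma_mat_diff: "sigma_mat (x - y) = sigma_mat x - sigma_mat y"
  by (rule linear_diff[OF linear_sigma_mat])

lemma norm_sigma_mat_le: "\<exists>K>0. \<forall>x :: 'n::finite spins. norm (sigma_mat x) \<le> K * norm x"
  using linear_bounded_pos[OF linear_sigma_mat] by metis

lemma borel_measurable_cprod [measurable (raw)]:
  assumes "f \<in> borel_measurable M" "g \<in> borel_measurable M"
  shows "(\<lambda>x. cprod (f x) (g x :: 'n::finite spins)) \<in> borel_measurable M"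
proof -
  have "continuous_on UNIV (\<lambda>z :: 'n spins \<times> 'n spins. cprod (fst z) (snd z))"
    by (intro cprod.continuous_on continuous_intros)
  from borel_measurable_continuous_onI[OF this]
  have "(\<lambda>z :: 'n spins \<times> 'n spins. cprod (fst z) (snd z)) \<in> borel_measurable borel" .
  from measurable_compose[OF _ this, of "\<lambda>x. (f x, g x)" M] assms show ?thesis by (simp add: borel_prod[symmetric])
qed

lemma borel_measurable_sigma_mat [measurable]: "sigma_mat \<in> borel_measurable (borel :: 'n::finite spins measure)"
  by (intro borel_measurable_continuous_onI linear_continuous_on) (simp add: linear_sigma_mat linear_conv_bounded_linear[symmetric])

section \<open>Convergence in probability and drift integrals over cells\<close>

context filtered_wiener
begin

text \<open>The standard functional metrising convergence in probability. It is finite for every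
  random variable, which is essential for the covariation, and it still satisfies the triangle
  inequality.\<close>

definition qn :: "('a \<Rightarrow> 'b::real_normed_vector) \<Rightarrow> real" where
  "qn X = expectation (\<lambda>\<omega>. min 1 (norm (X \<omega>)))"

lemma qn_integrable:
  fixes X :: "'a \<Rightarrow> 'b::euclidean_space"
  assumes "X \<in> borel_measurable P" shows "integrable P (\<lambda>\<omega>. min 1 (norm (X \<omega>)))"
  by (rule integrable_const_bound[of _ 1]) (use assms in auto)

lemma qn_nonneg: "0 \<le> qn X"
  by (simp add: qn_def)

lemma qn_triangle:
  fixes X Y :: "'a \<Rightarrow> 'b::euclidean_space"
  assumes [measurable]: "X \<in> borel_measurable P" "Y \<in> borel_measurable P"
  shows "qn (\<lambda>\<omega>. X \<omega> + Y \<omega>) \<le> qn X + qn Y"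
proof -
  have "qn (\<lambda>\<omega>. X \<omega> + Y \<omega>) \<le> expectation (\<lambda>\<omega>. min 1 (norm (X \<omega>)) + min 1 (norm (Y \<omega>)))"
    unfolding qn_def
  proof (intro integral_mono qn_integrable Bochner_Integration.integrable_add)
    fix \<omega>
    show "min 1 (norm (X \<omega> + Y \<omega>)) \<le> min 1 (norm (X \<omega>)) + min 1 (norm (Y \<omega>))"
      using norm_triangle_ineq[of "X \<omega>" "Y \<omega>"] norm_ge_zero[of "X \<omega>"] norm_ge_zero[of "Y \<omega>"] by linarith
  qed measurable
  also have "\<dots> = qn X + qn Y" unfolding qn_def by (intro Bochner_Integration.integral_add qn_integrable) auto
  finally show ?thesis .
qed

lemma qn_le_expectation:
  fixes X :: "'a \<Rightarrow> 'b::euclidean_space"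
  assumes "integrable P X" shows "qn X \<le> expectation (\<lambda>\<omega>. norm (X \<omega>))"
  unfolding qn_def using assms by (intro integral_mono qn_integrable integrable_norm) auto

lemma qn_cong: "(AE \<omega> in P. X \<omega> = Y \<omega>) \<Longrightarrow> (X :: 'a \<Rightarrow> 'b::euclidean_space) \<in> borel_measurable P \<Longrightarrow> Y \<in> borel_measurable P \<Longrightarrow> qn X = qn Y"
  unfolding qn_def by (intro integral_cong_AE) auto

lemma qn_AE_tendsto:
  fixes X :: "nat \<Rightarrow> 'a \<Rightarrow> 'b::euclidean_space"
  assumes [measurable]: "\<And>n. X n \<in> borel_measurable P" and lim: "AE \<omega> in P. (\<lambda>n. X n \<omega>) \<longlonglongrightarrow> 0"
  shows "(\<lambda>n. qn (X n)) \<longlonglongrightarrow> 0"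
proof -
  have "(\<lambda>n. expectation (\<lambda>\<omega>. min 1 (norm (X n \<omega>)))) \<longlonglongrightarrow> expectation (\<lambda>\<omega>. 0)"
  proof (rule integral_dominated_convergence[where w = "\<lambda>_. 1"])
    show "AE \<omega> in P. (\<lambda>n. min 1 (norm (X n \<omega>))) \<longlonglongrightarrow> 0"
      using lim
    proof (rule AE_mp, intro AE_I2 impI)
      fix \<omega> assume "(\<lambda>n. X n \<omega>) \<longlonglongrightarrow> 0"
      from tendsto_min[OF tendsto_const[of 1] tendsto_norm[OF this]]
      show "(\<lambda>n. min 1 (norm (X n \<omega>))) \<longlonglongrightarrow> 0" by simp
    qed
  qed auto
  then show ?thesis by (simp add: qn_def)
qed

lemma qn_zero:
  fixes X :: "'a \<Rightarrow> 'b::euclidean_space"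
  assumes X: "X \<in> borel_measurable P" and "qn X = 0"
  shows "AE \<omega> in P. X \<omega> = 0"
proof -
  have "AE \<omega> in P. min 1 (norm (X \<omega>)) = 0"
    using assms(2) integral_nonneg_eq_0_iff_AE[OF qn_integrable[OF X]] by (auto simp: qn_def)
  then show ?thesis by (rule AE_mp) (auto intro!: AE_I2 simp: min_def split: if_splits)
qed

text \<open>Split at the level \<open>e\<close>: below it the truncated norm is at most
  \<open>e\<close>, above it at most 1 on an event of probability at most \<open>e\<close>.\<close>

lemma qn_prob:
  fixes X :: "'a \<Rightarrow> 'b::euclidean_space"
  assumes [measurable]: "X \<in> borel_measurable P" and e: "e > 0" and p: "measure P {\<omega> \<in> space P. e \<le> norm (X \<omega>)} \<le> e"
  shows "qn X \<le> 2 * e"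
proof -
  have [measurable]: "{\<omega> \<in> space P. e \<le> norm (X \<omega>)} \<in> events" by measurable
  have ii: "integrable P (indicat_real {\<omega> \<in> space P. e \<le> norm (X \<omega>)})"
    by (intro integrable_real_indicator) (auto simp: emeasure_eq_measure)
  have "qn X \<le> expectation (\<lambda>\<omega>. e + indicator {\<omega> \<in> space P. e \<le> norm (X \<omega>)} \<omega>)"
    unfolding qn_def
  proof (intro integral_mono qn_integrable Bochner_Integration.integrable_add ii)
    show "min 1 (norm (X \<omega>)) \<le> e + indicat_real {\<omega> \<in> space P. e \<le> norm (X \<omega>)} \<omega>" if "\<omega> \<in> space P" for \<omega>
      using e that by (auto simp: indicator_def)
  qed auto
  also have "\<dots> = e + measure P {\<omega> \<in> space P. e \<le> norm (X \<omega>)}"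
    using ii by (subst Bochner_Integration.integral_add) (auto simp: prob_space)
  finally show ?thesis using p by simp
qed

lemma expectation_norm_le_tradeoff:
  fixes X Y :: "'a \<Rightarrow> 'b::euclidean_space"
  assumes [measurable]: "X \<in> borel_measurable P" "Y \<in> borel_measurable P"
    and X: "integrable P (\<lambda>\<omega>. (norm (X \<omega>))\<^sup>2)" and Y: "integrable P (\<lambda>\<omega>. (norm (Y \<omega>))\<^sup>2)"
  shows "integrable P (\<lambda>\<omega>. norm (X \<omega>) * norm (Y \<omega>))"
    "c > 0 \<Longrightarrow> expectation (\<lambda>\<omega>. norm (X \<omega>) * norm (Y \<omega>)) \<le>
      expectation (\<lambda>\<omega>. (norm (X \<omega>))\<^sup>2) / c + c * expectation (\<lambda>\<omega>. (norm (Y \<omega>))\<^sup>2)"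
proof -
  show i: "integrable P (\<lambda>\<omega>. norm (X \<omega>) * norm (Y \<omega>))"
  proof (rule Bochner_Integration.integrable_bound[OF Bochner_Integration.integrable_add[OF X Y]])
    show "AE \<omega> in P. norm (norm (X \<omega>) * norm (Y \<omega>)) \<le> norm ((norm (X \<omega>))\<^sup>2 + (norm (Y \<omega>))\<^sup>2)"
    proof (rule AE_I2)
      fix \<omega>
      show "norm (norm (X \<omega>) * norm (Y \<omega>)) \<le> norm ((norm (X \<omega>))\<^sup>2 + (norm (Y \<omega>))\<^sup>2)"
        using norm_mult_le_tradeoff[of 1 "norm (X \<omega>)" "norm (Y \<omega>)"] by simp
    qed
  qed measurable
  assume c: "c > 0"
  have "expectation (\<lambda>\<omega>. norm (X \<omega>) * norm (Y \<omega>)) \<le> expectation (\<lambda>\<omega>. (norm (X \<omega>))\<^sup>2 / c + c * (norm (Y \<omega>))\<^sup>2)"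
    using X Y norm_mult_le_tradeoff[OF c] by (intro integral_mono i) auto
  then show "expectation (\<lambda>\<omega>. norm (X \<omega>) * norm (Y \<omega>)) \<le>
      expectation (\<lambda>\<omega>. (norm (X \<omega>))\<^sup>2) / c + c * expectation (\<lambda>\<omega>. (norm (Y \<omega>))\<^sup>2)"
    using X Y by simp
qed

text \<open>Half-open intervals make the values over neighbouring cells add up exactly.\<close>

definition drift :: "('a \<times> real \<Rightarrow> 'b) \<Rightarrow> real \<Rightarrow> real \<Rightarrow> 'a \<Rightarrow> 'b::euclidean_space" where
  "drift \<gamma> a b \<omega> = (\<integral>r. indicat_real {a<..b} r *\<^sub>R \<gamma> (\<omega>, r) \<partial>lborel)"

lemma drift_measurable [measurable]: "\<gamma> \<in> borel_measurable PL \<Longrightarrow> drift \<gamma> a b \<in> borel_measurable P"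
  unfolding drift_def
  by (intro lborel.borel_measurable_lebesgue_integral) (simp add: case_prod_unfold)

lemma integrable_PL_of_square:
  fixes \<gamma> :: "'a \<times> real \<Rightarrow> 'b::euclidean_space"
  assumes [measurable]: "\<gamma> \<in> borel_measurable PL"
    and sq: "integrable PL (\<lambda>z. indicat_real {a..b} (snd z) * (norm (\<gamma> z))\<^sup>2)"
  shows "integrable PL (\<lambda>z. indicat_real {a..b} (snd z) *\<^sub>R \<gamma> z)"
proof -
  have "integrable PL (\<lambda>z. 1 * indicat_real {a..b} (snd z))"
    by (rule integral_product(1)[of "\<lambda>_. 1" "indicat_real {a..b}"]) (auto intro!: integrable_real_indicator simp: emeasure_lborel_Icc_eq)
  then have "integrable PL (\<lambda>z. indicat_real {a..b} (snd z) + indicat_real {a..b} (snd z) * (norm (\<gamma> z))\<^sup>2)"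
    using sq by (intro Bochner_Integration.integrable_add) auto
  then show ?thesis
  proof (rule Bochner_Integration.integrable_bound)
    have "x \<le> 1 + x\<^sup>2" for x :: real using zero_le_power2[of "x - 1 / 2"] by (simp add: power2_eq_square algebra_simps)
    then show "AE z in PL. norm (indicat_real {a..b} (snd z) *\<^sub>R \<gamma> z) \<le> norm (indicat_real {a..b} (snd z) + indicat_real {a..b} (snd z) * (norm (\<gamma> z))\<^sup>2)"
      by (intro AE_I2) (auto simp: indicator_def)
  qed measurable
qed

lemma drift_split:
  fixes \<gamma> :: "'a \<times> real \<Rightarrow> 'b::euclidean_space"
  assumes int: "integrable lborel (\<lambda>r. indicat_real {t..u} r *\<^sub>R \<gamma> (\<omega>, r))"
    and ab: "t \<le> a" "a \<le> b" "b \<le> u"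
  shows "(\<integral>r. indicat_real {t..b} r *\<^sub>R \<gamma> (\<omega>, r) \<partial>lborel) - (\<integral>r. indicat_real {t..a} r *\<^sub>R \<gamma> (\<omega>, r) \<partial>lborel) = drift \<gamma> a b \<omega>"
proof -
  have i: "integrable lborel (\<lambda>r. indicat_real {t..b} r *\<^sub>R \<gamma> (\<omega>, r))" if "b \<le> u" for b
    using integrable_mult_indicator[OF _ int, of "{t..b}"] that by (simp add: indicator_inter_arith[symmetric] min_def)
  have "(\<integral>r. indicat_real {t..b} r *\<^sub>R \<gamma> (\<omega>, r) \<partial>lborel) - (\<integral>r. indicat_real {t..a} r *\<^sub>R \<gamma> (\<omega>, r) \<partial>lborel)
    = (\<integral>r. indicat_real {t..b} r *\<^sub>R \<gamma> (\<omega>, r) - indicat_real {t..a} r *\<^sub>R \<gamma> (\<omega>, r) \<partial>lborel)"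
    using ab by (intro Bochner_Integration.integral_diff[symmetric] i) auto
  also have "\<dots> = drift \<gamma> a b \<omega>"
    unfolding drift_def using ab by (intro Bochner_Integration.integral_cong) (auto simp: indicator_def)
  finally show ?thesis .
qed

text \<open>Cauchy-Schwarz on an interval, obtained by integrating the square of the deviation of
  \<open>f\<close> from its mean value there.\<close>

lemma integral_square_le:
  fixes f :: "real \<Rightarrow> real"
  assumes [measurable]: "f \<in> borel_measurable lborel" and ab: "a \<le> b"
    and sq: "integrable lborel (\<lambda>r. indicat_real {a<..b} r * (f r)\<^sup>2)"
  shows "integrable lborel (\<lambda>r. indicat_real {a<..b} r * f r)"
    "(\<integral>r. indicat_real {a<..b} r * f r \<partial>lborel)\<^sup>2 \<le> (b - a) * (\<integral>r. indicat_real {a<..b} r * (f r)\<^sup>2 \<partial>lborel)"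
proof -
  have i1: "integrable lborel (indicat_real {a<..b})" "(\<integral>r. indicat_real {a<..b} r \<partial>lborel) = b - a"
    using ab by (auto intro!: integrable_real_indicator)
  show i: "integrable lborel (\<lambda>r. indicat_real {a<..b} r * f r)"
  proof (rule Bochner_Integration.integrable_bound[OF Bochner_Integration.integrable_add[OF i1(1) sq]])
    have "\<bar>x\<bar> \<le> 1 + x\<^sup>2" for x :: real using zero_le_power2[of "\<bar>x\<bar> - 1 / 2"] by (simp add: power2_eq_square algebra_simps)
    then show "AE r in lborel. norm (indicat_real {a<..b} r * f r) \<le> norm (indicat_real {a<..b} r + indicat_real {a<..b} r * (f r)\<^sup>2)"
      by (intro AE_I2) (auto simp: indicator_def)
  qed measurable
  let ?m = "\<integral>r. indicat_real {a<..b} r * f r \<partial>lborel" and ?s = "\<integral>r. indicat_real {a<..b} r * (f r)\<^sup>2 \<partial>lborel"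
  show "?m\<^sup>2 \<le> (b - a) * ?s"
  proof (cases "a = b")
    case False
    then have L: "b - a > 0" using ab by simp
    have "0 \<le> (\<integral>r. indicat_real {a<..b} r * (f r - ?m / (b - a))\<^sup>2 \<partial>lborel)" by simp
    also have "\<dots> = (\<integral>r. indicat_real {a<..b} r * (f r)\<^sup>2 - (2 * ?m / (b - a)) * (indicat_real {a<..b} r * f r) + (?m / (b - a))\<^sup>2 * indicat_real {a<..b} r \<partial>lborel)"
      by (intro Bochner_Integration.integral_cong) (simp_all add: power2_eq_square algebra_simps)
    also have "\<dots> = ?s - (2 * ?m / (b - a)) * ?m + (?m / (b - a))\<^sup>2 * (b - a)"
      using sq i i1 by simp
    also have "\<dots> = ?s - ?m\<^sup>2 / (b - a)"
    proof -
      have "x - (2 * y / l) * y + (y / l)\<^sup>2 * l = x - y\<^sup>2 / l" if "l > 0" for x y l :: real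
        using that by (simp add: power2_eq_square field_simps)
      from this[OF L] show ?thesis .
    qed
    finally have "?m\<^sup>2 / (b - a) \<le> ?s" by simp
    then show ?thesis using L by (simp add: pos_divide_le_eq mult.commute)
  qed simp
qed

lemma drift_square:
  fixes \<gamma> :: "'a \<times> real \<Rightarrow> 'b::euclidean_space"
  assumes \<gamma> [measurable]: "\<gamma> \<in> borel_measurable PL" and ab: "t \<le> a" "a \<le> b" "b \<le> u"
    and sq: "integrable PL (\<lambda>z. indicat_real {t..u} (snd z) * (norm (\<gamma> z))\<^sup>2)"
  shows "integrable P (\<lambda>\<omega>. (norm (drift \<gamma> a b \<omega>))\<^sup>2)"
    "expectation (\<lambda>\<omega>. (norm (drift \<gamma> a b \<omega>))\<^sup>2) \<le> (b - a) * (\<integral>z. indicat_real {a<..b} (snd z) * (norm (\<gamma> z))\<^sup>2 \<partial>PL)"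
    "integrable PL (\<lambda>z. indicat_real {a<..b} (snd z) * (norm (\<gamma> z))\<^sup>2)"
proof -
  show sq': "integrable PL (\<lambda>z. indicat_real {a<..b} (snd z) * (norm (\<gamma> z))\<^sup>2)"
    by (rule Bochner_Integration.integrable_bound[OF sq]) (use ab in \<open>auto simp: indicator_def\<close>)
  let ?J = "\<lambda>\<omega>. \<integral>r. indicat_real {a<..b} r * (norm (\<gamma> (\<omega>, r)))\<^sup>2 \<partial>lborel"
  have J: "integrable P (\<lambda>\<omega>. (b - a) * ?J \<omega>)" "expectation (\<lambda>\<omega>. (b - a) * ?J \<omega>) = (b - a) * (\<integral>z. indicat_real {a<..b} (snd z) * (norm (\<gamma> z))\<^sup>2 \<partial>PL)"
    using PL.integrable_fst'[OF sq'] PL.integral_fst'[OF sq'] by auto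
  have le: "AE \<omega> in P. (norm (drift \<gamma> a b \<omega>))\<^sup>2 \<le> (b - a) * ?J \<omega>"
    using PL.AE_integrable_fst'[OF sq']
  proof (rule AE_mp, intro AE_I2 impI)
    fix \<omega> assume "\<omega> \<in> space P" and i: "integrable lborel (\<lambda>r. indicat_real {a<..b} (snd (\<omega>, r)) * (norm (\<gamma> (\<omega>, r)))\<^sup>2)"
    have "norm (drift \<gamma> a b \<omega>) \<le> (\<integral>r. indicat_real {a<..b} r * norm (\<gamma> (\<omega>, r)) \<partial>lborel)"
      unfolding drift_def using integral_norm_bound[of lborel "\<lambda>r. indicat_real {a<..b} r *\<^sub>R \<gamma> (\<omega>, r)"] by simp
    then have "(norm (drift \<gamma> a b \<omega>))\<^sup>2 \<le> (\<integral>r. indicat_real {a<..b} r * norm (\<gamma> (\<omega>, r)) \<partial>lborel)\<^sup>2" by (intro power_mono) auto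
    also have "\<dots> \<le> (b - a) * ?J \<omega>"
    proof (rule integral_square_le(2))
      show "(\<lambda>r. norm (\<gamma> (\<omega>, r))) \<in> borel_measurable lborel"
      proof -
        have [measurable]: "(\<lambda>r. \<gamma> (\<omega>, r)) \<in> borel_measurable lborel"
          by (rule measurable_compose[OF measurable_Pair1'[OF \<open>\<omega> \<in> space P\<close>] \<gamma>])
        show ?thesis by measurable
      qed
    qed (use i ab in simp_all)
    finally show "(norm (drift \<gamma> a b \<omega>))\<^sup>2 \<le> (b - a) * ?J \<omega>" .
  qed
  show i: "integrable P (\<lambda>\<omega>. (norm (drift \<gamma> a b \<omega>))\<^sup>2)"
  proof (rule Bochner_Integration.integrable_bound[OF J(1)])
    show "AE \<omega> in P. norm ((norm (drift \<gamma> a b \<omega>))\<^sup>2) \<le> norm ((b - a) * ?J \<omega>)"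
      using le by eventually_elim (simp add: abs_le_iff)
  qed measurable
  show "expectation (\<lambda>\<omega>. (norm (drift \<gamma> a b \<omega>))\<^sup>2) \<le> (b - a) * (\<integral>z. indicat_real {a<..b} (snd z) * (norm (\<gamma> z))\<^sup>2 \<partial>PL)"
    using integral_mono_AE[OF i J(1) le] unfolding J(2) .
qed

lemma sum_cell_integrals:
  fixes f :: "'a \<times> real \<Rightarrow> real"
  assumes "t \<le> u" "n > 0" and f: "integrable PL (\<lambda>z. indicat_real {t<..u} (snd z) * f z)"
  shows "(\<Sum>k<n. \<integral>z. indicat_real {grid t u n k<..grid t u n (Suc k)} (snd z) * f z \<partial>PL) = (\<integral>z. indicat_real {t<..u} (snd z) * f z \<partial>PL)"
    "k < n \<Longrightarrow> integrable PL (\<lambda>z. indicat_real {grid t u n k<..grid t u n (Suc k)} (snd z) * f z)"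
proof -
  have i: "integrable PL (\<lambda>z. indicat_real {grid t u n k<..grid t u n (Suc k)} (snd z) * f z)" if "k < n" for k
  proof -
    have "integrable PL (\<lambda>z. indicat_real {grid t u n k<..grid t u n (Suc k)} (snd z) *\<^sub>R (indicat_real {t<..u} (snd z) * f z))"
      by (rule Bochner_Integration.integrable_bound[OF f]) (use f in \<open>auto simp: indicator_def\<close>)
    moreover have "indicat_real {grid t u n k<..grid t u n (Suc k)} r * (indicat_real {t<..u} r * y) = indicat_real {grid t u n k<..grid t u n (Suc k)} r * y" for r y
      using grid_ge[OF assms(1), of n k] grid_le[OF assms(1), of "Suc k" n] that by (auto simp: indicator_def)
    ultimately show ?thesis by simp
  qed
  then show "k < n \<Longrightarrow> integrable PL (\<lambda>z. indicat_real {grid t u n k<..grid t u n (Suc k)} (snd z) * f z)" .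
  have "(\<Sum>k<n. \<integral>z. indicat_real {grid t u n k<..grid t u n (Suc k)} (snd z) * f z \<partial>PL)
     = (\<integral>z. (\<Sum>k<n. indicat_real {grid t u n k<..grid t u n (Suc k)} (snd z) * f z) \<partial>PL)"
    using i by (intro Bochner_Integration.integral_sum[symmetric]) auto
  also have "\<dots> = (\<integral>z. indicat_real {t<..u} (snd z) * f z \<partial>PL)"
    unfolding sum_distrib_right[symmetric] sum_indicator_grid[OF assms(1,2)] by simp
  finally show "(\<Sum>k<n. \<integral>z. indicat_real {grid t u n k<..grid t u n (Suc k)} (snd z) * f z \<partial>PL) = (\<integral>z. indicat_real {t<..u} (snd z) * f z \<partial>PL)" .
qed

text \<open>Each cell contributes at most its length times its share of the total energy, so the sum
  is at most the mesh times the total energy.\<close>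

lemma sum_drift_square_tendsto:
  fixes \<gamma> :: "'a \<times> real \<Rightarrow> 'b::euclidean_space"
  assumes \<gamma> [measurable]: "\<gamma> \<in> borel_measurable PL" and tu: "t \<le> u"
    and sq: "integrable PL (\<lambda>z. indicat_real {t..u} (snd z) * (norm (\<gamma> z))\<^sup>2)"
  shows "(\<lambda>n. \<Sum>k<n. expectation (\<lambda>\<omega>. (norm (drift \<gamma> (grid t u n k) (grid t u n (Suc k)) \<omega>))\<^sup>2)) \<longlonglongrightarrow> 0"
proof -
  let ?K = "\<integral>z. indicat_real {t<..u} (snd z) * (norm (\<gamma> z))\<^sup>2 \<partial>PL"
  have sq': "integrable PL (\<lambda>z. indicat_real {t<..u} (snd z) * (norm (\<gamma> z))\<^sup>2)" by (rule drift_square(3)[OF \<gamma> _ tu _ sq]) auto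
  have le: "(\<Sum>k<n. expectation (\<lambda>\<omega>. (norm (drift \<gamma> (grid t u n k) (grid t u n (Suc k)) \<omega>))\<^sup>2)) \<le> (u - t) / real n * ?K" for n
  proof (cases "n = 0")
    case False
    have "(\<Sum>k<n. expectation (\<lambda>\<omega>. (norm (drift \<gamma> (grid t u n k) (grid t u n (Suc k)) \<omega>))\<^sup>2))
      \<le> (\<Sum>k<n. (u - t) / real n * (\<integral>z. indicat_real {grid t u n k<..grid t u n (Suc k)} (snd z) * (norm (\<gamma> z))\<^sup>2 \<partial>PL))"
    proof (intro sum_mono)
      fix k assume "k \<in> {..<n}"
      then show "expectation (\<lambda>\<omega>. (norm (drift \<gamma> (grid t u n k) (grid t u n (Suc k)) \<omega>))\<^sup>2) \<le>
        (u - t) / real n * (\<integral>z. indicat_real {grid t u n k<..grid t u n (Suc k)} (snd z) * (norm (\<gamma> z))\<^sup>2 \<partial>PL)"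
        unfolding grid_step[of t u n k, symmetric] using grid_ge[OF tu] grid_le[OF tu] grid_mono[OF tu] by (intro drift_square(2)[OF \<gamma> _ _ _ sq]) auto
    qed
    also have "\<dots> = (u - t) / real n * ?K"
      unfolding sum_distrib_left[symmetric] using False sum_cell_integrals(1)[OF tu _ sq', of n] by simp
    finally show ?thesis .
  qed simp
  have "(\<lambda>n. (u - t) / real n * ?K) \<longlonglongrightarrow> 0"
    using tendsto_mult[OF lim_const_over_n[of "u - t"] tendsto_const[of ?K]] by simp
  then show ?thesis
  proof (rule tendsto_sandwich[OF _ _ tendsto_const, rotated 2])
    show "\<forall>\<^sub>F n in sequentially. (\<Sum>k<n. expectation (\<lambda>\<omega>. (norm (drift \<gamma> (grid t u n k) (grid t u n (Suc k)) \<omega>))\<^sup>2)) \<le> (u - t) / real n * ?K"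
      by (intro always_eventually allI le)
  qed (simp add: sum_nonneg)
qed

end

section \<open>Solutions of the stochastic Landau-Lifschitz-Gilbert equation\<close>

text \<open>Collects what follows from the state and its Ito integral alone, before any equation is
  imposed. The start time need not be 0.\<close>

locale sllg_state = filtered_wiener P F B T
  for P :: "'a measure" and F :: "real \<Rightarrow> 'a measure" and B :: "real \<Rightarrow> 'a \<Rightarrow> 'n::finite spins" and T :: real +
  fixes t :: real and m :: "real \<Rightarrow> 'a \<Rightarrow> 'n spins" and I :: "real \<Rightarrow> 'a \<Rightarrow> 'n spins"
  assumes t0: "0 \<le> t" and tT: "t \<le> T"
    and m_adapted: "adapted F {t..T} m"
    and m_cont: "\<And>\<omega>. \<omega> \<in> space P \<Longrightarrow> continuous_on {t..T} (\<lambda>s. m s \<omega>)"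
    and m_sphere: "\<And>\<omega> s. \<omega> \<in> space P \<Longrightarrow> s \<in> {t..T} \<Longrightarrow> m s \<omega> \<in> sphere_prod"
    and I: "\<And>s. s \<in> {t..T} \<Longrightarrow> has_ito_integral P F B t s (\<lambda>s \<omega>. sigma_mat (m s \<omega>)) (I s)"
begin

definition N :: real where "N = real CARD('n)"

lemma N: "N \<ge> 0" by (simp add: N_def)

lemma m_meas_F: "s \<in> {t..T} \<Longrightarrow> m s \<in> borel_measurable (F s)"
  using m_adapted by (simp add: adapted_def)

lemma m_meas: "s \<in> {t..T} \<Longrightarrow> m s \<in> borel_measurable P"
  by (rule measurable_F_P[OF m_meas_F])

lemma m_bound: "\<omega> \<in> space P \<Longrightarrow> s \<in> {t..T} \<Longrightarrow> norm (m s \<omega>) \<le> N"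
  unfolding N_def by (intro norm_sphere_prod m_sphere)

text \<open>The time is clamped to \<open>{t..T}\<close>, so that \<open>mm\<close> is a measurable
  map on the whole product space with values in the manifold at all real times.\<close>

definition mm :: "'a \<times> real \<Rightarrow> 'n spins" where
  "mm z = m (max t (min T (snd z))) (fst z)"

lemma mm_eq: "snd z \<in> {t..T} \<Longrightarrow> mm z = m (snd z) (fst z)"
  by (simp add: mm_def min_absorb2 max_absorb2)

lemma clamp_in: "max t (min T r) \<in> {t..T}"
  using tT by auto

lemma mm_sphere: "fst z \<in> space P \<Longrightarrow> mm z \<in> sphere_prod"
  unfolding mm_def by (intro m_sphere clamp_in)

lemma mm_bound: "fst z \<in> space P \<Longrightarrow> norm (mm z) \<le> N"
  unfolding mm_def by (intro m_bound clamp_in)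

lemma m_tendsto:
  assumes "\<omega> \<in> space P" "\<And>n. a n \<in> {t..T}" "r \<in> {t..T}" "a \<longlonglongrightarrow> r"
  shows "(\<lambda>n. m (a n) \<omega>) \<longlonglongrightarrow> m r \<omega>"
  by (rule continuous_on_tendsto_compose[OF m_cont[OF assms(1)] assms(4,3)]) (use assms(2) in auto)

text \<open>Joint measurability is inherited from the integrand \<open>sigma_mat m\<close>, from which \<open>m\<close> is recovered by a
  partial trace.\<close>

lemma mm_measurable [measurable]: "mm \<in> borel_measurable PL"
proof -
  have "set_borel_measurable PL (space P \<times> {t..T}) (\<lambda>(\<omega>, r). sigma_mat (m r \<omega>))"
    using I[of T] tT by (simp add: has_ito_integral_def)
  then have S [measurable]: "(\<lambda>z. indicat_real (space P \<times> {t..T}) z *\<^sub>R sigma_mat (m (snd z) (fst z))) \<in> borel_measurable PL" (is "?S \<in> _")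
    by (simp add: set_borel_measurable_def case_prod_unfold)
  have [measurable]: "m t \<in> borel_measurable P" "m T \<in> borel_measurable P" using m_meas tT by auto
  \<comment> \<open>The factor \<open>-1/2\<close> undoes the \<open>-2\<close> of the partial
    trace; outside \<open>{t..T}\<close> that summand is zero and the boundary states are put in, as
    the clamping demands.\<close>
  let ?f = "\<lambda>z. (- (1/2)) *\<^sub>R (\<Sum>q\<in>UNIV. cprod (?S z *v axis q 1) (axis q 1))
     + indicat_real {..<t} (snd z) *\<^sub>R m t (fst z) + indicat_real {T<..} (snd z) *\<^sub>R m T (fst z)"
  have "?f \<in> borel_measurable PL" by measurable
  moreover have "?f z = mm z" if z: "z \<in> space PL" for z
  proof (cases "snd z \<in> {t..T}")
    case True
    then have "?S z = sigma_mat (m (snd z) (fst z))" using z by (auto simp: indicator_def space_pair_measure)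
    then have "(- (1/2)) *\<^sub>R (\<Sum>q\<in>UNIV. cprod (?S z *v axis q 1) (axis q 1)) = m (snd z) (fst z)"
      by (simp only: sigma_mat_mult sum_cprod_cprod_axis) simp
    then show ?thesis using True by (simp add: mm_eq)
  next
    case False
    then have "?S z = 0" by (auto simp: indicator_def)
    then have "(\<Sum>q\<in>UNIV. cprod (?S z *v axis q 1) (axis q 1)) = 0" by (simp only: matrix_vector_mult_0 cprod.zero_left sum.neutral_const)
    moreover have "mm z = indicat_real {..<t} (snd z) *\<^sub>R m t (fst z) + indicat_real {T<..} (snd z) *\<^sub>R m T (fst z)"
      using False tT by (auto simp: mm_def indicator_def max_def min_def)
    ultimately show ?thesis by (simp only: scaleR_zero_right add_0)
  qed
  ultimately show ?thesis using measurable_cong[of PL ?f mm borel] by blast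
qed

lemma integrable_indicator_PL: "integrable PL (\<lambda>z. indicat_real {a<..b} (snd z) * c)"
  using integral_product(1)[of "\<lambda>_. c" "indicat_real {a<..b}"]
  by (cases "a \<le> b") (auto intro!: integrable_real_indicator simp: mult.commute)

text \<open>The error of freezing the noise coefficient at the left end of a cell.\<close>

definition rem :: "real \<Rightarrow> real \<Rightarrow> 'a \<Rightarrow> 'n spins" where
  "rem a b \<omega> = I b \<omega> - I a \<omega> - cprod (m a \<omega>) (dB a b \<omega>)"

lemma I_meas: "s \<in> {t..T} \<Longrightarrow> I s \<in> borel_measurable P"
  using I[of s] by (simp add: has_ito_integral_def)

lemma cprod_dB_meas: "t \<le> a \<Longrightarrow> a \<le> b \<Longrightarrow> b \<le> T \<Longrightarrow> (\<lambda>\<omega>. cprod (m a \<omega>) (dB a b \<omega>)) \<in> borel_measurable P"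
  using m_meas[of a] dB_meas[of a b] t0 by (intro borel_measurable_cprod) auto

lemma rem_meas: "t \<le> a \<Longrightarrow> a \<le> b \<Longrightarrow> b \<le> T \<Longrightarrow> rem a b \<in> borel_measurable P"
  unfolding rem_def[abs_def] using cprod_dB_meas[of a b] I_meas[of a] I_meas[of b]
  by (intro borel_measurable_diff) auto

lemma expectation_inner_ito_increment:
  assumes ab: "t \<le> a" "a \<le> b" "b \<le> T"
    and g: "g \<in> borel_measurable (F a)" "\<And>\<omega>. \<omega> \<in> space P \<Longrightarrow> norm (g \<omega>) \<le> c"
  shows "integrable P (\<lambda>\<omega>. g \<omega> \<bullet> (I b \<omega> - I a \<omega>))" "expectation (\<lambda>\<omega>. g \<omega> \<bullet> (I b \<omega> - I a \<omega>)) = 0"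
proof -
  let ?Y = "\<lambda>z. indicat_real {a<..b} (snd z) *\<^sub>R sigma_mat (m (snd z) (fst z))"
  obtain K where K: "K > 0" "\<And>x :: 'n spins. norm (sigma_mat x) \<le> K * norm x" using norm_sigma_mat_le by metis
  have l: "ito_lim a ?Y (\<lambda>\<omega>. I b \<omega> - I a \<omega>)" by (rule ito_lim_increment[OF I t0 ab])
  have "(\<integral>\<^sup>+z. ennreal ((norm (?Y z))\<^sup>2) \<partial>PL) \<le> (\<integral>\<^sup>+z. ennreal (norm (indicat_real {a<..b} (snd z) * (K * N)\<^sup>2)) \<partial>PL)"
  proof (intro nn_integral_mono ennreal_leI)
    fix z assume z: "z \<in> space PL"
    show "(norm (?Y z))\<^sup>2 \<le> norm (indicat_real {a<..b} (snd z) * (K * N)\<^sup>2)"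
    proof (cases "snd z \<in> {a<..b}")
      case True
      have "norm (m (snd z) (fst z)) \<le> N" using True ab z by (intro m_bound) (auto simp: space_pair_measure)
      then have "norm (sigma_mat (m (snd z) (fst z))) \<le> K * N"
        using K(1) by (intro order_trans[OF K(2)] mult_left_mono) auto
      from power_mono[OF this, of 2] show ?thesis using True by simp
    qed simp
  qed
  also have "\<dots> < \<infinity>"
    using integrable_indicator_PL[of a b "(K * N)\<^sup>2"] unfolding integrable_iff_bounded by (rule conjunct2)
  finally have fin: "(\<integral>\<^sup>+z. ennreal ((norm (?Y z))\<^sup>2) \<partial>PL) < \<infinity>" .
  show "integrable P (\<lambda>\<omega>. g \<omega> \<bullet> (I b \<omega> - I a \<omega>))" "expectation (\<lambda>\<omega>. g \<omega> \<bullet> (I b \<omega> - I a \<omega>)) = 0"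
    using ito_lim_orthogonal[OF l fin g] by auto
qed

lemma rem_square:
  obtains K where "K \<ge> 0" "\<And>a b. t \<le> a \<Longrightarrow> a \<le> b \<Longrightarrow> b \<le> T \<Longrightarrow> integrable P (\<lambda>\<omega>. (norm (rem a b \<omega>))\<^sup>2)"
    "\<And>a b. t \<le> a \<Longrightarrow> a \<le> b \<Longrightarrow> b \<le> T \<Longrightarrow> expectation (\<lambda>\<omega>. (norm (rem a b \<omega>))\<^sup>2) \<le>
      K * (\<integral>z. indicat_real {a<..b} (snd z) * (norm (mm z - m a (fst z)))\<^sup>2 \<partial>PL)"
proof -
  obtain K where K: "K > 0" "\<And>x :: 'n spins. norm (sigma_mat x) \<le> K * norm x" using norm_sigma_mat_le by metis
  have *: "integrable P (\<lambda>\<omega>. (norm (rem a b \<omega>))\<^sup>2) \<and> expectation (\<lambda>\<omega>. (norm (rem a b \<omega>))\<^sup>2) \<le>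
      4 * K\<^sup>2 * (\<integral>z. indicat_real {a<..b} (snd z) * (norm (mm z - m a (fst z)))\<^sup>2 \<partial>PL)"
    if ab: "t \<le> a" "a \<le> b" "b \<le> T" for a b
  proof -
    have [measurable]: "rem a b \<in> borel_measurable P" "m a \<in> borel_measurable P"
      using ab rem_meas m_meas by auto
    let ?Y = "\<lambda>z. indicat_real {a<..b} (snd z) *\<^sub>R (sigma_mat (m (snd z) (fst z)) - sigma_mat (m a (fst z)))"
    let ?q = "\<lambda>z. indicat_real {a<..b} (snd z) * (norm (mm z - m a (fst z)))\<^sup>2"
    have Zm: "(\<lambda>\<omega>. sigma_mat (m a \<omega>)) \<in> borel_measurable (F a)"
      using measurable_compose[OF m_meas_F[of a] borel_measurable_sigma_mat] ab by simp
    have Zb: "norm (sigma_mat (m a \<omega>)) \<le> K * N" if "\<omega> \<in> space P" for \<omega>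
      using K(1) m_bound[OF that, of a] ab by (intro order_trans[OF K(2)] mult_left_mono) auto
    have "ito_lim a ?Y (\<lambda>\<omega>. I b \<omega> - I a \<omega> - sigma_mat (m a \<omega>) *v dB a b \<omega>)"
      by (rule ito_lim_increment_frozen[OF I t0 ab Zm Zb])
    then have "ito_lim a ?Y (rem a b)" by (simp add: sigma_mat_mult rem_def[abs_def])
    from ito_lim_bound[OF this]
    have 1: "(\<integral>\<^sup>+\<omega>. ennreal ((norm (rem a b \<omega>))\<^sup>2) \<partial>P) \<le> 4 * (\<integral>\<^sup>+z. ennreal ((norm (?Y z))\<^sup>2) \<partial>PL)" .
    have iq: "integrable PL ?q"
    proof (rule Bochner_Integration.integrable_bound[OF integrable_indicator_PL[of a b "(2 * N)\<^sup>2"]])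
      show "AE z in PL. norm (?q z) \<le> norm (indicat_real {a<..b} (snd z) * (2 * N)\<^sup>2)"
      proof (rule AE_I2)
        fix z assume "z \<in> space PL"
        then have "norm (mm z - m a (fst z)) \<le> N + N"
          using ab by (intro order_trans[OF norm_triangle_ineq4] add_mono mm_bound m_bound) (auto simp: space_pair_measure)
        from power_mono[OF this, of 2] show "norm (?q z) \<le> norm (indicat_real {a<..b} (snd z) * (2 * N)\<^sup>2)"
          by (simp add: indicator_def)
      qed
    qed measurable
    have "(\<integral>\<^sup>+z. ennreal ((norm (?Y z))\<^sup>2) \<partial>PL) \<le> (\<integral>\<^sup>+z. ennreal (K\<^sup>2 * ?q z) \<partial>PL)"
    proof (intro nn_integral_mono ennreal_leI)
      fix z assume z: "z \<in> space PL"
      show "(norm (?Y z))\<^sup>2 \<le> K\<^sup>2 * ?q z"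
      proof (cases "snd z \<in> {a<..b}")
        case True
        have "norm (sigma_mat (m (snd z) (fst z)) - sigma_mat (m a (fst z))) \<le> K * norm (m (snd z) (fst z) - m a (fst z))"
          unfolding sigma_mat_diff[symmetric] by (rule K(2))
        from power_mono[OF this, of 2] show ?thesis using True ab mm_eq[of z] by (simp add: power_mult_distrib)
      qed simp
    qed
    also have "\<dots> = ennreal (K\<^sup>2 * integral\<^sup>L PL ?q)"
      using iq by (subst nn_integral_eq_integral) (auto intro!: integrable_mult_right)
    finally have 2: "(\<integral>\<^sup>+\<omega>. ennreal ((norm (rem a b \<omega>))\<^sup>2) \<partial>P) \<le> ennreal (4 * K\<^sup>2 * integral\<^sup>L PL ?q)"
      using order_trans[OF 1 mult_left_mono[of _ _ "4::ennreal"]]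
      by (simp add: ennreal_mult'' mult.assoc ennreal_numeral[symmetric] del: ennreal_numeral)
    then have fin: "(\<integral>\<^sup>+\<omega>. ennreal ((norm (rem a b \<omega>))\<^sup>2) \<partial>P) < \<infinity>" by (rule le_less_trans) simp
    have i: "integrable P (\<lambda>\<omega>. (norm (rem a b \<omega>))\<^sup>2)" by (rule integrable_of_norm_sq[OF _ fin]) measurable
    have "0 \<le> integral\<^sup>L PL ?q" by (rule Bochner_Integration.integral_nonneg) auto
    then show ?thesis using 2 i by (simp add: nn_integral_eq_integral)
  qed
  show ?thesis by (rule that[of "4 * K\<^sup>2"]) (use * in auto)
qed

text \<open>Continuity of the paths gives pointwise convergence and compactness of the manifold
  gives a constant majorant; no rate is obtained or wanted.\<close>

lemma modulus_vanish:
  assumes s: "s \<in> {t..T}" and "p > 0"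
  shows "(\<lambda>n. \<Sum>k<n. \<integral>z. indicat_real {grid t s n k<..grid t s n (Suc k)} (snd z) * (norm (mm z - m (grid t s n k) (fst z))) ^ p \<partial>PL) \<longlonglongrightarrow> 0"
proof (rule riemann_vanish(1)[where \<phi> = "\<lambda>a b z. (norm (mm z - m a (fst z))) ^ p" and D = "\<lambda>_. (2 * N) ^ p"])
  show "t \<le> s" using s by simp
  show "(\<lambda>z. norm (mm z - m a (fst z)) ^ p) \<in> borel_measurable PL" if "t \<le> a" "a \<le> b" "b \<le> s" for a b
  proof -
    have [measurable]: "m a \<in> borel_measurable P" using that s by (intro m_meas) auto
    show ?thesis by measurable
  qed
  show "integrable PL (\<lambda>z. indicat_real {t<..s} (snd z) * (2 * N) ^ p)" by (rule integrable_indicator_PL)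
  show "\<bar>norm (mm z - m a (fst z)) ^ p\<bar> \<le> (2 * N) ^ p"
    if "t \<le> a" "a < snd z" "snd z \<le> b" "b \<le> s" "fst z \<in> space P" for a b z
  proof -
    have "norm (mm z - m a (fst z)) \<le> N + N"
      using that s by (intro order_trans[OF norm_triangle_ineq4] add_mono mm_bound m_bound) auto
    from power_mono[OF this, of p] show ?thesis by simp
  qed
  show "(\<lambda>n. norm (mm z - m (a n) (fst z)) ^ p) \<longlonglongrightarrow> 0"
    if "\<And>n. t \<le> a n \<and> a n < snd z \<and> snd z \<le> b n \<and> b n \<le> s" "a \<longlonglongrightarrow> snd z" "b \<longlonglongrightarrow> snd z" "fst z \<in> space P" for a b z
  proof -
    have r: "snd z \<in> {t..T}" using that(1)[of 0] s by auto
    have an: "a n \<in> {t..T}" for n using that(1)[of n] s by auto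
    have "(\<lambda>n. m (a n) (fst z)) \<longlonglongrightarrow> m (snd z) (fst z)" by (rule m_tendsto[OF that(4) an r that(2)])
    from tendsto_power[OF tendsto_norm[OF tendsto_diff[OF tendsto_const[of "mm z"] this]], of p]
    have "(\<lambda>n. norm (mm z - m (a n) (fst z)) ^ p) \<longlonglongrightarrow> norm (mm z - m (snd z) (fst z)) ^ p" .
    moreover have "norm (mm z - m (snd z) (fst z)) ^ p = 0" using \<open>p > 0\<close> by (simp add: mm_eq[OF r])
    ultimately show ?thesis by (simp only:)
  qed
qed

lemma sum_rem_square_tendsto:
  assumes s: "s \<in> {t..T}"
  shows "(\<lambda>n. \<Sum>k<n. expectation (\<lambda>\<omega>. (norm (rem (grid t s n k) (grid t s n (Suc k)) \<omega>))\<^sup>2)) \<longlonglongrightarrow> 0"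
proof -
  obtain K where K: "K \<ge> 0" "\<And>a b. t \<le> a \<Longrightarrow> a \<le> b \<Longrightarrow> b \<le> T \<Longrightarrow> integrable P (\<lambda>\<omega>. (norm (rem a b \<omega>))\<^sup>2)"
    "\<And>a b. t \<le> a \<Longrightarrow> a \<le> b \<Longrightarrow> b \<le> T \<Longrightarrow> expectation (\<lambda>\<omega>. (norm (rem a b \<omega>))\<^sup>2) \<le>
      K * (\<integral>z. indicat_real {a<..b} (snd z) * (norm (mm z - m a (fst z)))\<^sup>2 \<partial>PL)"
    by (rule rem_square) blast
  have ts: "t \<le> s" "s \<le> T" using s by auto
  have "(\<lambda>n. K * (\<Sum>k<n. \<integral>z. indicat_real {grid t s n k<..grid t s n (Suc k)} (snd z) * (norm (mm z - m (grid t s n k) (fst z)))\<^sup>2 \<partial>PL)) \<longlonglongrightarrow> K * 0"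
    by (intro tendsto_mult_left modulus_vanish[OF s]) simp
  then have l: "(\<lambda>n. K * (\<Sum>k<n. \<integral>z. indicat_real {grid t s n k<..grid t s n (Suc k)} (snd z) * (norm (mm z - m (grid t s n k) (fst z)))\<^sup>2 \<partial>PL)) \<longlonglongrightarrow> 0" by simp
  show ?thesis
  proof (rule tendsto_sandwich[OF _ _ tendsto_const l])
    show "\<forall>\<^sub>F n in sequentially. (\<Sum>k<n. expectation (\<lambda>\<omega>. (norm (rem (grid t s n k) (grid t s n (Suc k)) \<omega>))\<^sup>2))
       \<le> K * (\<Sum>k<n. \<integral>z. indicat_real {grid t s n k<..grid t s n (Suc k)} (snd z) * (norm (mm z - m (grid t s n k) (fst z)))\<^sup>2 \<partial>PL)"
      unfolding sum_distrib_left
    proof (intro always_eventually allI sum_mono)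
      fix n k :: nat assume "k \<in> {..<n}"
      then show "expectation (\<lambda>\<omega>. (norm (rem (grid t s n k) (grid t s n (Suc k)) \<omega>))\<^sup>2) \<le>
        K * (\<integral>z. indicat_real {grid t s n k<..grid t s n (Suc k)} (snd z) * (norm (mm z - m (grid t s n k) (fst z)))\<^sup>2 \<partial>PL)"
        using grid_ge[OF ts(1)] order_trans[OF grid_le[OF ts(1)] ts(2)] grid_mono[OF ts(1)] by (intro K(3)) auto
    qed
  qed (simp add: sum_nonneg)
qed

end

section \<open>The Stratonovich correction\<close>

lemma cprod_cprod_expand:
  fixes x b :: "'n::finite spins"
  shows "cprod (cprod x b) b = (\<Sum>p\<in>UNIV. \<Sum>q\<in>UNIV. (b $ p * b $ q) *\<^sub>R cprod (cprod x (axis p 1)) (axis q 1))"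
proof -
  have b: "b = (\<Sum>p\<in>UNIV. b $ p *\<^sub>R axis p 1)"
    using basis_expansion[of b] by (simp add: scalar_mult_eq_scaleR)
  have "cprod (cprod x b) b = cprod (cprod x (\<Sum>p\<in>UNIV. b $ p *\<^sub>R axis p 1)) (\<Sum>q\<in>UNIV. b $ q *\<^sub>R axis q 1)"
    using b by simp
  also have "\<dots> = (\<Sum>p\<in>UNIV. \<Sum>q\<in>UNIV. (b $ p * b $ q) *\<^sub>R cprod (cprod x (axis p 1)) (axis q 1))"
    by (simp add: cprod.sum_left cprod.sum_right cprod.scaleR_left cprod.scaleR_right scaleR_sum_right mult.commute)
       (subst sum.swap, simp add: mult.commute)
  finally show ?thesis .
qed

context filtered_wiener
begin

lemma drift_L1:
  fixes \<gamma> :: "'a \<times> real \<Rightarrow> 'b::euclidean_space"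
  assumes \<gamma>: "integrable PL (\<lambda>z. indicat_real {a<..b} (snd z) *\<^sub>R \<gamma> z)"
  shows "integrable P (drift \<gamma> a b)"
    "expectation (\<lambda>\<omega>. norm (drift \<gamma> a b \<omega>)) \<le> (\<integral>z. indicat_real {a<..b} (snd z) * norm (\<gamma> z) \<partial>PL)"
proof -
  show i: "integrable P (drift \<gamma> a b)"
    using PL.integrable_fst'[OF \<gamma>] by (simp add: drift_def[abs_def])
  have n: "integrable PL (\<lambda>z. indicat_real {a<..b} (snd z) * norm (\<gamma> z))"
    using integrable_norm[OF \<gamma>] by simp
  have "expectation (\<lambda>\<omega>. norm (drift \<gamma> a b \<omega>)) \<le> expectation (\<lambda>\<omega>. \<integral>r. indicat_real {a<..b} r * norm (\<gamma> (\<omega>, r)) \<partial>lborel)"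
  proof (intro integral_mono integrable_norm i)
    show "integrable P (\<lambda>\<omega>. \<integral>r. indicat_real {a<..b} r * norm (\<gamma> (\<omega>, r)) \<partial>lborel)" using PL.integrable_fst'[OF n] by simp
    show "norm (drift \<gamma> a b \<omega>) \<le> (\<integral>r. indicat_real {a<..b} r * norm (\<gamma> (\<omega>, r)) \<partial>lborel)" for \<omega>
      unfolding drift_def using integral_norm_bound[of lborel "\<lambda>r. indicat_real {a<..b} r *\<^sub>R \<gamma> (\<omega>, r)"] by simp
  qed
  also have "\<dots> = (\<integral>z. indicat_real {a<..b} (snd z) * norm (\<gamma> z) \<partial>PL)"
    using PL.integral_fst'[OF n] by simp
  finally show "expectation (\<lambda>\<omega>. norm (drift \<gamma> a b \<omega>)) \<le> (\<integral>z. indicat_real {a<..b} (snd z) * norm (\<gamma> z) \<partial>PL)" .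
qed

lemma drift_cells:
  fixes \<gamma> :: "'a \<times> real \<Rightarrow> 'b::euclidean_space"
  assumes ts: "t \<le> s" "n > 0" and int: "integrable lborel (\<lambda>r. indicat_real {t<..s} r *\<^sub>R \<gamma> (\<omega>, r))"
  shows "k < n \<Longrightarrow> integrable lborel (\<lambda>r. indicat_real {grid t s n k<..grid t s n (Suc k)} r *\<^sub>R \<gamma> (\<omega>, r))"
    "(\<Sum>k<n. drift \<gamma> (grid t s n k) (grid t s n (Suc k)) \<omega>) = drift \<gamma> t s \<omega>"
    "(\<Sum>k<n. norm (drift \<gamma> (grid t s n k) (grid t s n (Suc k)) \<omega>)) \<le> (\<integral>r. norm (indicat_real {t<..s} r *\<^sub>R \<gamma> (\<omega>, r)) \<partial>lborel)"
proof -
  have i: "integrable lborel (\<lambda>r. indicat_real {grid t s n k<..grid t s n (Suc k)} r *\<^sub>R \<gamma> (\<omega>, r))" if "k < n" for k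
  proof -
    have "integrable lborel (\<lambda>r. indicat_real {grid t s n k<..grid t s n (Suc k)} r *\<^sub>R (indicat_real {t<..s} r *\<^sub>R \<gamma> (\<omega>, r)))"
      by (rule integrable_mult_indicator[OF _ int]) simp
    moreover have "indicat_real {grid t s n k<..grid t s n (Suc k)} r * indicat_real {t<..s} r = indicat_real {grid t s n k<..grid t s n (Suc k)} r" for r
      using grid_ge[OF ts(1), of n k] grid_le[OF ts(1), of "Suc k" n] that by (auto simp: indicator_def)
    ultimately show ?thesis by simp
  qed
  then show "k < n \<Longrightarrow> integrable lborel (\<lambda>r. indicat_real {grid t s n k<..grid t s n (Suc k)} r *\<^sub>R \<gamma> (\<omega>, r))" .
  have "(\<Sum>k<n. drift \<gamma> (grid t s n k) (grid t s n (Suc k)) \<omega>) = (\<integral>r. (\<Sum>k<n. indicat_real {grid t s n k<..grid t s n (Suc k)} r *\<^sub>R \<gamma> (\<omega>, r)) \<partial>lborel)"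
    unfolding drift_def using i by (intro Bochner_Integration.integral_sum[symmetric]) auto
  also have "\<dots> = drift \<gamma> t s \<omega>"
    unfolding scaleR_sum_left[symmetric] sum_indicator_grid[OF ts] drift_def ..
  finally show "(\<Sum>k<n. drift \<gamma> (grid t s n k) (grid t s n (Suc k)) \<omega>) = drift \<gamma> t s \<omega>" .
  have "(\<Sum>k<n. norm (drift \<gamma> (grid t s n k) (grid t s n (Suc k)) \<omega>)) \<le>
      (\<Sum>k<n. \<integral>r. norm (indicat_real {grid t s n k<..grid t s n (Suc k)} r *\<^sub>R \<gamma> (\<omega>, r)) \<partial>lborel)"
    unfolding drift_def by (intro sum_mono integral_norm_bound)
  also have "\<dots> = (\<integral>r. (\<Sum>k<n. norm (indicat_real {grid t s n k<..grid t s n (Suc k)} r *\<^sub>R \<gamma> (\<omega>, r))) \<partial>lborel)"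
    using i by (intro Bochner_Integration.integral_sum[symmetric] integrable_norm) auto
  also have "\<dots> = (\<integral>r. norm (indicat_real {t<..s} r *\<^sub>R \<gamma> (\<omega>, r)) \<partial>lborel)"
    unfolding norm_scaleR real_norm_def abs_of_nonneg[OF indicator_pos_le] sum_distrib_right[symmetric] sum_indicator_grid[OF ts] ..
  finally show "(\<Sum>k<n. norm (drift \<gamma> (grid t s n k) (grid t s n (Suc k)) \<omega>)) \<le> (\<integral>r. norm (indicat_real {t<..s} r *\<^sub>R \<gamma> (\<omega>, r)) \<partial>lborel)" .
qed

end

text \<open>The control is hidden in a general square-integrable drift \<open>\<beta>\<close>, so
  the same results serve controlled and closed loop equations. The equation is only required almost
  surely at each fixed time.\<close>

locale sllg_solution = sllg_state P F B T t m I
  for P :: "'a measure" and F :: "real \<Rightarrow> 'a measure" and B :: "real \<Rightarrow> 'a \<Rightarrow> 'n::finite spins" and T t :: real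
    and m I :: "real \<Rightarrow> 'a \<Rightarrow> 'n spins" +
  fixes \<nu> :: real and m0 :: "'n spins" and \<beta> :: "'a \<times> real \<Rightarrow> 'n spins" and C :: "real \<Rightarrow> 'a \<Rightarrow> 'n spins"
  assumes nu: "\<nu> \<ge> 0"
    and \<beta>_meas [measurable]: "\<beta> \<in> borel_measurable PL"
    and \<beta>_sq: "integrable PL (\<lambda>z. indicat_real {t..T} (snd z) * (norm (\<beta> z))\<^sup>2)"
    and C: "has_covariation P F B t T (\<lambda>s \<omega>. sigma_mat (m s \<omega>)) C"
    and eq: "\<And>s. s \<in> {t..T} \<Longrightarrow> AE \<omega> in P. m s \<omega> = m0 + (\<integral>r. indicat_real {t..s} r *\<^sub>R \<beta> (\<omega>, r) \<partial>lborel)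
        + \<nu> *\<^sub>R I s \<omega> + (\<nu> / 2) *\<^sub>R C s \<omega>"
begin

lemma AE_\<beta>_integrable: "AE \<omega> in P. integrable lborel (\<lambda>r. indicat_real {t..T} r *\<^sub>R \<beta> (\<omega>, r))"
  using PL.AE_integrable_fst'[OF integrable_PL_of_square[OF \<beta>_meas \<beta>_sq]] by simp

lemma mm_integrable:
  assumes "\<omega> \<in> space P" shows "integrable lborel (\<lambda>r. indicat_real {a<..b} r *\<^sub>R mm (\<omega>, r))"
proof -
  have [measurable]: "(\<lambda>r. mm (\<omega>, r)) \<in> borel_measurable lborel"
    by (rule measurable_compose[OF measurable_Pair1'[OF assms] mm_measurable])
  have "integrable lborel (\<lambda>r. indicat_real {a<..b} r * N)"
    by (cases "a \<le> b") (auto intro!: integrable_mult_left integrable_real_indicator)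
  then show ?thesis
  proof (rule Bochner_Integration.integrable_bound)
    show "AE r in lborel. norm (indicat_real {a<..b} r *\<^sub>R mm (\<omega>, r)) \<le> norm (indicat_real {a<..b} r * N)"
      using mm_bound[of "(\<omega>, _)"] assms N by (intro AE_I2) (auto simp: indicator_def)
  qed measurable
qed

lemma raw_increment:
  assumes ab: "t \<le> a" "a \<le> b" "b \<le> T"
  shows "AE \<omega> in P. m b \<omega> - m a \<omega> = drift \<beta> a b \<omega> + \<nu> *\<^sub>R (I b \<omega> - I a \<omega>) + (\<nu> / 2) *\<^sub>R (C b \<omega> - C a \<omega>)"
proof -
  have "a \<in> {t..T}" "b \<in> {t..T}" using ab by auto
  from AE_\<beta>_integrable eq[OF this(1)] eq[OF this(2)]
  show ?thesis
  proof eventually_elim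
    case (elim \<omega>)
    from drift_split[OF elim(1) ab]
    show ?case unfolding elim(2) elim(3) by (simp add: algebra_simps)
  qed
qed

text \<open>The quadratic noise term of a cell minus its conditional mean
  \<open>- 2 (b - a) m a\<close>.\<close>

definition quad :: "real \<Rightarrow> real \<Rightarrow> 'a \<Rightarrow> 'n spins" where
  "quad a b \<omega> = cprod (cprod (m a \<omega>) (dB a b \<omega>)) (dB a b \<omega>) + (2 * (b - a)) *\<^sub>R m a \<omega>"

lemma quad_meas_F:
  assumes ab: "t \<le> a" "a \<le> b" "b \<le> T" shows "quad a b \<in> borel_measurable (F b)"
proof -
  have [measurable]: "m a \<in> borel_measurable (F b)" "dB a b \<in> borel_measurable (F b)"
    using measurable_F_mono[OF m_meas_F[of a] ab(2)] dB_meas_F[of a b] ab t0 by auto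
  show ?thesis unfolding quad_def[abs_def] by measurable
qed

text \<open>Given \<open>F a\<close>, products of different noise components average to zero and
  squares to \<open>b - a\<close>; the remaining sum over the axes is \<open>- 2 m a\<close>, which
  the compensator removes.\<close>

lemma quad_orthogonal:
  assumes ab: "t \<le> a" "a \<le> b" "b \<le> T" and X: "X \<in> borel_measurable (F a)" "integrable P X"
  shows "integrable P (\<lambda>\<omega>. X \<omega> \<bullet> quad a b \<omega>)" "expectation (\<lambda>\<omega>. X \<omega> \<bullet> quad a b \<omega>) = 0"
proof -
  have a0: "0 \<le> a" and aT: "a \<in> {t..T}" using ab t0 by auto
  have [measurable]: "X \<in> borel_measurable (F a)" "m a \<in> borel_measurable (F a)" using X m_meas_F[OF aT] by auto
  let ?v = "\<lambda>p q \<omega>. cprod (cprod (m a \<omega>) (axis p 1)) (axis q 1)"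
  have iX: "integrable P (\<lambda>\<omega>. X \<omega> \<bullet> Z \<omega>)" if "Z \<in> borel_measurable (F a)" "\<And>\<omega>. \<omega> \<in> space P \<Longrightarrow> norm (Z \<omega>) \<le> N" for Z
  proof (rule Bochner_Integration.integrable_bound[OF integrable_mult_left[OF integrable_norm[OF X(2)], of N]])
    have [measurable]: "Z \<in> borel_measurable P" "X \<in> borel_measurable P" using measurable_F_P that X by auto
    show "(\<lambda>\<omega>. X \<omega> \<bullet> Z \<omega>) \<in> borel_measurable P" by measurable
    show "AE \<omega> in P. norm (X \<omega> \<bullet> Z \<omega>) \<le> norm (norm (X \<omega>) * N)"
    proof (rule AE_I2)
      fix \<omega> assume \<omega>: "\<omega> \<in> space P"
      have "\<bar>X \<omega> \<bullet> Z \<omega>\<bar> \<le> norm (X \<omega>) * norm (Z \<omega>)" by (rule Cauchy_Schwarz_ineq2)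
      also have "\<dots> \<le> norm (X \<omega>) * N" using that(2)[OF \<omega>] by (intro mult_left_mono) auto
      finally show "norm (X \<omega> \<bullet> Z \<omega>) \<le> norm (norm (X \<omega>) * N)" using N by simp
    qed
  qed
  have vb: "norm (?v p q \<omega>) \<le> N" if "\<omega> \<in> space P" for p q \<omega>
  proof -
    have "norm (?v p q \<omega>) \<le> norm (m a \<omega>) * norm (axis p 1 :: 'n spins) * norm (axis q 1 :: 'n spins)"
      by (intro order_trans[OF norm_cprod_le] mult_right_mono norm_cprod_le) auto
    also have "\<dots> = norm (m a \<omega>)" by simp
    finally show ?thesis using m_bound[OF that aT] by simp
  qed
  have vm: "?v p q \<in> borel_measurable (F a)" for p q by measurable
  have iv: "integrable P (\<lambda>\<omega>. X \<omega> \<bullet> ?v p q \<omega>)" for p q by (rule iX[OF vm vb])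
  have im: "integrable P (\<lambda>\<omega>. X \<omega> \<bullet> m a \<omega>)" by (rule iX) (use m_bound aT in auto)
  have vXm: "(\<lambda>\<omega>. X \<omega> \<bullet> ?v p q \<omega>) \<in> borel_measurable (F a)" for p q by measurable
  note e = expectation_mult_dB_dB[OF a0 ab(2,3) vXm iv]
  have eq: "X \<omega> \<bullet> quad a b \<omega> = (\<Sum>p\<in>UNIV. \<Sum>q\<in>UNIV. (X \<omega> \<bullet> ?v p q \<omega>) * (dB a b \<omega> $ p * dB a b \<omega> $ q)) + 2 * (b - a) * (X \<omega> \<bullet> m a \<omega>)" for \<omega>
    unfolding quad_def cprod_cprod_expand[of _ "dB a b \<omega>"]
    by (simp add: inner_add_right inner_sum_right mult.commute)
  show "integrable P (\<lambda>\<omega>. X \<omega> \<bullet> quad a b \<omega>)" unfolding eq using e(1) im by auto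
  have "expectation (\<lambda>\<omega>. X \<omega> \<bullet> quad a b \<omega>) = (\<Sum>p\<in>UNIV. \<Sum>q\<in>UNIV. expectation (\<lambda>\<omega>. X \<omega> \<bullet> ?v p q \<omega>) * (if p = q then b - a else 0))
      + 2 * (b - a) * expectation (\<lambda>\<omega>. X \<omega> \<bullet> m a \<omega>)"
    unfolding eq using e im by (simp add: Bochner_Integration.integral_sum)
  also have "(\<Sum>p\<in>UNIV. \<Sum>q\<in>UNIV. expectation (\<lambda>\<omega>. X \<omega> \<bullet> ?v p q \<omega>) * (if p = q then b - a else 0))
     = (\<Sum>p\<in>UNIV. expectation (\<lambda>\<omega>. X \<omega> \<bullet> ?v p p \<omega>)) * (b - a)"
    by (simp add: sum_distrib_right if_distrib[of "\<lambda>x. _ * x"] cong: if_cong)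
  also have "(\<Sum>p\<in>UNIV. expectation (\<lambda>\<omega>. X \<omega> \<bullet> ?v p p \<omega>)) = expectation (\<lambda>\<omega>. X \<omega> \<bullet> (\<Sum>p\<in>UNIV. ?v p p \<omega>))"
    using iv by (simp add: inner_sum_right Bochner_Integration.integral_sum)
  also have "\<dots> = - 2 * expectation (\<lambda>\<omega>. X \<omega> \<bullet> m a \<omega>)"
    unfolding sum_cprod_cprod_axis by simp
  finally show "expectation (\<lambda>\<omega>. X \<omega> \<bullet> quad a b \<omega>) = 0" by simp
qed

lemma quad_square:
  obtains K where "K \<ge> 0" "\<And>a b. t \<le> a \<Longrightarrow> a \<le> b \<Longrightarrow> b \<le> T \<Longrightarrow> integrable P (\<lambda>\<omega>. (norm (quad a b \<omega>))\<^sup>2)"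
    "\<And>a b. t \<le> a \<Longrightarrow> a \<le> b \<Longrightarrow> b \<le> T \<Longrightarrow> expectation (\<lambda>\<omega>. (norm (quad a b \<omega>))\<^sup>2) \<le> K * (b - a)\<^sup>2"
proof -
  let ?k = "3 * (real CARD('n \<times> 3))\<^sup>2"
  have *: "integrable P (\<lambda>\<omega>. (norm (quad a b \<omega>))\<^sup>2) \<and> expectation (\<lambda>\<omega>. (norm (quad a b \<omega>))\<^sup>2) \<le> (2 * N\<^sup>2 * ?k + 8 * N\<^sup>2) * (b - a)\<^sup>2"
    if ab: "t \<le> a" "a \<le> b" "b \<le> T" for a b
  proof -
    have a0: "0 \<le> a" and aT: "a \<in> {t..T}" using ab t0 by auto
    have [measurable]: "quad a b \<in> borel_measurable P" by (rule measurable_F_P[OF quad_meas_F[OF ab]])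
    note M = norm_dB_moments[OF a0 ab(2,3)]
    have le: "(norm (quad a b \<omega>))\<^sup>2 \<le> 2 * N\<^sup>2 * (norm (dB a b \<omega>)) ^ 4 + 8 * N\<^sup>2 * (b - a)\<^sup>2" if \<omega>: "\<omega> \<in> space P" for \<omega>
    proof -
      have "norm (quad a b \<omega>) \<le> norm (cprod (cprod (m a \<omega>) (dB a b \<omega>)) (dB a b \<omega>)) + norm ((2 * (b - a)) *\<^sub>R m a \<omega>)"
        unfolding quad_def by (rule norm_triangle_ineq)
      also have "\<dots> \<le> N * (norm (dB a b \<omega>))\<^sup>2 + 2 * (b - a) * N"
      proof (rule add_mono)
        have "norm (cprod (cprod (m a \<omega>) (dB a b \<omega>)) (dB a b \<omega>)) \<le> norm (m a \<omega>) * norm (dB a b \<omega>) * norm (dB a b \<omega>)"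
          by (intro order_trans[OF norm_cprod_le] mult_right_mono norm_cprod_le) auto
        also have "\<dots> \<le> N * norm (dB a b \<omega>) * norm (dB a b \<omega>)" using m_bound[OF \<omega> aT] by (intro mult_right_mono) auto
        finally show "norm (cprod (cprod (m a \<omega>) (dB a b \<omega>)) (dB a b \<omega>)) \<le> N * (norm (dB a b \<omega>))\<^sup>2" by (simp add: power2_eq_square)
        show "norm ((2 * (b - a)) *\<^sub>R m a \<omega>) \<le> 2 * (b - a) * N" using m_bound[OF \<omega> aT] ab by (simp add: mult_left_mono)
      qed
      finally have "(norm (quad a b \<omega>))\<^sup>2 \<le> (N * (norm (dB a b \<omega>))\<^sup>2 + 2 * (b - a) * N)\<^sup>2" by (intro power_mono) auto
      also have "\<dots> \<le> 2 * (N * (norm (dB a b \<omega>))\<^sup>2)\<^sup>2 + 2 * (2 * (b - a) * N)\<^sup>2"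
        using zero_le_power2[of "N * (norm (dB a b \<omega>))\<^sup>2 - 2 * (b - a) * N"] by (simp only: power2_sum power2_diff)
      also have "\<dots> = 2 * N\<^sup>2 * (norm (dB a b \<omega>)) ^ 4 + 8 * N\<^sup>2 * (b - a)\<^sup>2"
        by (simp add: power2_eq_square power4_eq_xxxx algebra_simps)
      finally show ?thesis .
    qed
    have i: "integrable P (\<lambda>\<omega>. 2 * N\<^sup>2 * (norm (dB a b \<omega>)) ^ 4 + 8 * N\<^sup>2 * (b - a)\<^sup>2)" using M(3) by simp
    have i': "integrable P (\<lambda>\<omega>. (norm (quad a b \<omega>))\<^sup>2)"
    proof (rule Bochner_Integration.integrable_bound[OF i])
      show "AE \<omega> in P. norm ((norm (quad a b \<omega>))\<^sup>2) \<le> norm (2 * N\<^sup>2 * (norm (dB a b \<omega>)) ^ 4 + 8 * N\<^sup>2 * (b - a)\<^sup>2)"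
        using le by (intro AE_I2) simp
    qed measurable
    have "expectation (\<lambda>\<omega>. (norm (quad a b \<omega>))\<^sup>2) \<le> 2 * N\<^sup>2 * expectation (\<lambda>\<omega>. (norm (dB a b \<omega>)) ^ 4) + 8 * N\<^sup>2 * (b - a)\<^sup>2"
      using integral_mono[OF i' i le] M(3) by (simp add: prob_space)
    also have "\<dots> \<le> 2 * N\<^sup>2 * (?k * (b - a)\<^sup>2) + 8 * N\<^sup>2 * (b - a)\<^sup>2"
      using M(4) by (intro add_mono mult_left_mono) auto
    finally show ?thesis using i' by (simp add: algebra_simps)
  qed
  show ?thesis by (rule that[of "2 * N\<^sup>2 * ?k + 8 * N\<^sup>2"]) (use * in auto)
qed

text \<open>The cell terms are martingale differences, so their mean squares add: \<open>n\<close>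
  terms of order \<open>1 / n^2\<close> leave \<open>1 / n\<close>.\<close>

lemma quad_sum_square:
  assumes s: "s \<in> {t..T}"
  obtains K where "\<And>n. n > 0 \<Longrightarrow> integrable P (\<lambda>\<omega>. (norm (\<Sum>k<n. quad (grid t s n k) (grid t s n (Suc k)) \<omega>))\<^sup>2)"
    "\<And>n. n > 0 \<Longrightarrow> expectation (\<lambda>\<omega>. (norm (\<Sum>k<n. quad (grid t s n k) (grid t s n (Suc k)) \<omega>))\<^sup>2) \<le> K / real n"
proof -
  have ts: "t \<le> s" "s \<le> T" using s by auto
  obtain K where K: "K \<ge> 0" "\<And>a b. t \<le> a \<Longrightarrow> a \<le> b \<Longrightarrow> b \<le> T \<Longrightarrow> integrable P (\<lambda>\<omega>. (norm (quad a b \<omega>))\<^sup>2)"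
    "\<And>a b. t \<le> a \<Longrightarrow> a \<le> b \<Longrightarrow> b \<le> T \<Longrightarrow> expectation (\<lambda>\<omega>. (norm (quad a b \<omega>))\<^sup>2) \<le> K * (b - a)\<^sup>2"
    by (rule quad_square) blast
  have main: "integrable P (\<lambda>\<omega>. (norm (\<Sum>k<n. quad (grid t s n k) (grid t s n (Suc k)) \<omega>))\<^sup>2) \<and>
    expectation (\<lambda>\<omega>. (norm (\<Sum>k<n. quad (grid t s n k) (grid t s n (Suc k)) \<omega>))\<^sup>2) \<le> (K * (s - t)\<^sup>2) / real n" if n: "n > 0" for n
  proof -
    let ?g = "grid t s n"
    let ?S = "\<lambda>j \<omega>. \<Sum>k<j. quad (?g k) (?g (Suc k)) \<omega>"
    have cell: "t \<le> ?g k" "?g k \<le> ?g (Suc k)" "?g (Suc k) \<le> T" if "k < n" for k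
      using that grid_ge[OF ts(1)] order_trans[OF grid_le[OF ts(1)] ts(2)] grid_mono[OF ts(1)] by auto
    have Sm: "?S j \<in> borel_measurable (F (?g j))" if "j \<le> n" for j
    proof (intro borel_measurable_sum)
      fix k assume "k \<in> {..<j}"
      then show "quad (?g k) (?g (Suc k)) \<in> borel_measurable (F (?g j))"
        using that cell[of k] by (intro measurable_F_mono[OF quad_meas_F] grid_mono[OF ts(1)]) auto
    qed
    have ind: "j \<le> n \<Longrightarrow> integrable P (\<lambda>\<omega>. (norm (?S j \<omega>))\<^sup>2) \<and> expectation (\<lambda>\<omega>. (norm (?S j \<omega>))\<^sup>2) \<le> real j * (K * ((s - t) / real n)\<^sup>2)" for j
    proof (induction j)
      case (Suc j)
      then have j: "j < n" and IH: "integrable P (\<lambda>\<omega>. (norm (?S j \<omega>))\<^sup>2)" "expectation (\<lambda>\<omega>. (norm (?S j \<omega>))\<^sup>2) \<le> real j * (K * ((s - t) / real n)\<^sup>2)"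
        by auto
      have Sj: "?S j \<in> borel_measurable (F (?g j))" using j by (intro Sm) auto
      have "integrable P (?S j)"
      proof (rule integrable_of_norm_sq(2)[OF measurable_F_P[OF Sj]])
        show "(\<integral>\<^sup>+\<omega>. ennreal ((norm (?S j \<omega>))\<^sup>2) \<partial>P) < \<infinity>"
          using IH(1) by (subst nn_integral_eq_integral) auto
      qed
      note o = quad_orthogonal[OF cell[OF j] Sj this]
      note q = K(2)[OF cell[OF j]] K(3)[OF cell[OF j]]
      have e: "(norm (?S (Suc j) \<omega>))\<^sup>2 = (norm (?S j \<omega>))\<^sup>2 + 2 * (?S j \<omega> \<bullet> quad (?g j) (?g (Suc j)) \<omega>) + (norm (quad (?g j) (?g (Suc j)) \<omega>))\<^sup>2" for \<omega>
        by (simp add: power2_norm_eq_inner inner_add_left inner_add_right inner_commute)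
      have "expectation (\<lambda>\<omega>. (norm (?S (Suc j) \<omega>))\<^sup>2) = expectation (\<lambda>\<omega>. (norm (?S j \<omega>))\<^sup>2) + expectation (\<lambda>\<omega>. (norm (quad (?g j) (?g (Suc j)) \<omega>))\<^sup>2)"
        unfolding e using IH(1) o q by simp
      also have "\<dots> \<le> real j * (K * ((s - t) / real n)\<^sup>2) + K * ((s - t) / real n)\<^sup>2"
        using IH(2) q(2) unfolding grid_step by (rule add_mono)
      finally show ?case unfolding e using IH(1) o q by (simp add: algebra_simps)
    qed simp
    have "real n * (K * ((s - t) / real n)\<^sup>2) = (K * (s - t)\<^sup>2) / real n"
      using n by (simp add: power2_eq_square)
    with ind[OF order_refl] show ?thesis by simp
  qed
  show ?thesis by (rule that[of "K * (s - t)\<^sup>2"]) (use main in auto)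
qed

lemma qn_scaled_tendsto:
  fixes X :: "nat \<Rightarrow> 'a \<Rightarrow> 'n spins"
  assumes "\<And>n. n > 0 \<Longrightarrow> integrable P (X n)" and lim: "(\<lambda>n. expectation (\<lambda>\<omega>. norm (X n \<omega>))) \<longlonglongrightarrow> 0"
  shows "(\<lambda>n. qn (\<lambda>\<omega>. c *\<^sub>R X n \<omega>)) \<longlonglongrightarrow> 0"
proof (rule tendsto_sandwich[OF _ _ tendsto_const])
  show "(\<lambda>n. \<bar>c\<bar> * expectation (\<lambda>\<omega>. norm (X n \<omega>))) \<longlonglongrightarrow> 0"
    using tendsto_mult_left[OF lim, of "\<bar>c\<bar>"] by simp
  show "\<forall>\<^sub>F n in sequentially. qn (\<lambda>\<omega>. c *\<^sub>R X n \<omega>) \<le> \<bar>c\<bar> * expectation (\<lambda>\<omega>. norm (X n \<omega>))"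
    using eventually_gt_at_top[of 0]
  proof eventually_elim
    case (elim n)
    have "integrable P (\<lambda>\<omega>. c *\<^sub>R X n \<omega>)" using assms(1)[OF elim] by simp
    from qn_le_expectation[OF this] show ?case by simp
  qed
qed (simp add: qn_nonneg)

lemma qn_quad_tendsto:
  assumes s: "s \<in> {t..T}"
  shows "(\<lambda>n. qn (\<lambda>\<omega>. c *\<^sub>R (\<Sum>k<n. quad (grid t s n k) (grid t s n (Suc k)) \<omega>))) \<longlonglongrightarrow> 0"
proof (rule qn_scaled_tendsto)
  have ts: "t \<le> s" "s \<le> T" using s by auto
  let ?S = "\<lambda>n \<omega>. \<Sum>k<n. quad (grid t s n k) (grid t s n (Suc k)) \<omega>"
  obtain K where K: "\<And>n. n > 0 \<Longrightarrow> integrable P (\<lambda>\<omega>. (norm (?S n \<omega>))\<^sup>2)"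
    "\<And>n. n > 0 \<Longrightarrow> expectation (\<lambda>\<omega>. (norm (?S n \<omega>))\<^sup>2) \<le> K / real n"
    by (rule quad_sum_square[OF s]) blast
  have m: "?S n \<in> borel_measurable P" for n
    using grid_ge[OF ts(1)] order_trans[OF grid_le[OF ts(1)] ts(2)] grid_mono[OF ts(1)]
    by (intro borel_measurable_sum measurable_F_P[OF quad_meas_F]) auto
  show i: "integrable P (?S n)" if "n > 0" for n
    by (rule integrable_of_norm_sq(2)[OF m]) (use K(1)[OF that] in \<open>simp add: nn_integral_eq_integral\<close>)
  show "(\<lambda>n. expectation (\<lambda>\<omega>. norm (?S n \<omega>))) \<longlonglongrightarrow> 0"
  proof (rule tendsto_zero_tradeoff[where K = 1])
    show "(\<lambda>n. K / real n) \<longlonglongrightarrow> 0" by (rule lim_const_over_n)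
    fix c :: real and n :: nat assume c: "c > 0" and n: "n > 0"
    have "expectation (\<lambda>\<omega>. norm (?S n \<omega>)) \<le> expectation (\<lambda>\<omega>. (norm (?S n \<omega>))\<^sup>2 / c + c)"
      using norm_mult_le_tradeoff[OF c, of "norm _" 1] i[OF n] K(1)[OF n] by (intro integral_mono) auto
    also have "\<dots> = expectation (\<lambda>\<omega>. (norm (?S n \<omega>))\<^sup>2) / c + c" using K(1)[OF n] by (simp add: prob_space)
    also have "\<dots> \<le> K / real n / c + c * 1" using divide_right_mono[OF K(2)[OF n] less_imp_le[OF c]] by simp
    finally show "expectation (\<lambda>\<omega>. norm (?S n \<omega>)) \<le> K / real n / c + c * 1" .
  qed simp
qed

text \<open>The mean squares of \<open>rem\<close> have a vanishing sum, those of the increments of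
  \<open>B\<close> a bounded one. The weighted product estimate therefore sends the sum of their
  products to zero.\<close>

lemma qn_rem_tendsto:
  assumes s: "s \<in> {t..T}"
  shows "(\<lambda>n. qn (\<lambda>\<omega>. c *\<^sub>R (\<Sum>k<n. cprod (rem (grid t s n k) (grid t s n (Suc k)) \<omega>) (dB (grid t s n k) (grid t s n (Suc k)) \<omega>)))) \<longlonglongrightarrow> 0"
proof (rule qn_scaled_tendsto)
  have ts: "t \<le> s" "s \<le> T" using s by auto
  let ?R = "\<lambda>n k. rem (grid t s n k) (grid t s n (Suc k))" and ?D = "\<lambda>n k. dB (grid t s n k) (grid t s n (Suc k))"
  let ?S = "\<lambda>n \<omega>. \<Sum>k<n. cprod (?R n k \<omega>) (?D n k \<omega>)"
  obtain K where K: "K \<ge> 0" "\<And>a b. t \<le> a \<Longrightarrow> a \<le> b \<Longrightarrow> b \<le> T \<Longrightarrow> integrable P (\<lambda>\<omega>. (norm (rem a b \<omega>))\<^sup>2)"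
    "\<And>a b. t \<le> a \<Longrightarrow> a \<le> b \<Longrightarrow> b \<le> T \<Longrightarrow> expectation (\<lambda>\<omega>. (norm (rem a b \<omega>))\<^sup>2) \<le>
      K * (\<integral>z. indicat_real {a<..b} (snd z) * (norm (mm z - m a (fst z)))\<^sup>2 \<partial>PL)"
    by (rule rem_square) blast
  have cell: "t \<le> grid t s n k" "0 \<le> grid t s n k" "grid t s n k \<le> grid t s n (Suc k)" "grid t s n (Suc k) \<le> T" if "k < n" for n k
    using that t0 grid_ge[OF ts(1), of n k] order_trans[OF grid_le[OF ts(1)] ts(2), of "Suc k" n] grid_mono[OF ts(1), of k "Suc k" n] by auto
  have mR: "?R n k \<in> borel_measurable P" and mD: "?D n k \<in> borel_measurable P"
    and sR: "integrable P (\<lambda>\<omega>. (norm (?R n k \<omega>))\<^sup>2)"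
    and sD: "integrable P (\<lambda>\<omega>. (norm (?D n k \<omega>))\<^sup>2)"
    if "k < n" for n k
    using cell[OF that] by (auto intro!: rem_meas dB_meas K(2) norm_dB_moments)
  have eD: "expectation (\<lambda>\<omega>. (norm (?D n k \<omega>))\<^sup>2) = real CARD('n \<times> 3) * (grid t s n (Suc k) - grid t s n k)" if "k < n" for n k
    using cell[OF that] by (intro norm_dB_moments(2)) auto
  note tr = expectation_norm_le_tradeoff[OF mR mD sR sD]
  have i: "integrable P (\<lambda>\<omega>. cprod (?R n k \<omega>) (?D n k \<omega>))" if "k < n" for n k
  proof (rule Bochner_Integration.integrable_bound[OF tr(1)[OF that that that that]])
    show "(\<lambda>\<omega>. cprod (?R n k \<omega>) (?D n k \<omega>)) \<in> borel_measurable P" using mR[OF that] mD[OF that] by measurable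
    show "AE \<omega> in P. norm (cprod (?R n k \<omega>) (?D n k \<omega>)) \<le> norm (norm (?R n k \<omega>) * norm (?D n k \<omega>))"
      by (intro AE_I2) (simp add: norm_cprod_le)
  qed
  then show iS: "integrable P (?S n)" for n by (intro Bochner_Integration.integrable_sum) auto
  show "(\<lambda>n. expectation (\<lambda>\<omega>. norm (?S n \<omega>))) \<longlonglongrightarrow> 0"
  proof (rule tendsto_zero_tradeoff[OF _ sum_rem_square_tendsto[OF s], where K = "real CARD('n \<times> 3) * (s - t)"])
    fix c :: real and n :: nat assume c: "c > 0" and n: "n > 0"
    have "expectation (\<lambda>\<omega>. norm (?S n \<omega>)) \<le> expectation (\<lambda>\<omega>. \<Sum>k<n. norm (?R n k \<omega>) * norm (?D n k \<omega>))"
    proof (intro integral_mono integrable_norm iS Bochner_Integration.integrable_sum)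
      show "norm (?S n \<omega>) \<le> (\<Sum>k<n. norm (?R n k \<omega>) * norm (?D n k \<omega>))" for \<omega>
        by (intro sum_norm_le norm_cprod_le)
    qed (use tr(1) in auto)
    also have "\<dots> = (\<Sum>k<n. expectation (\<lambda>\<omega>. norm (?R n k \<omega>) * norm (?D n k \<omega>)))"
      using tr(1) by (intro Bochner_Integration.integral_sum) auto
    also have "\<dots> \<le> (\<Sum>k<n. expectation (\<lambda>\<omega>. (norm (?R n k \<omega>))\<^sup>2) / c + c * (real CARD('n \<times> 3) * (grid t s n (Suc k) - grid t s n k)))"
    proof (rule sum_mono)
      fix k assume "k \<in> {..<n}"
      then have k: "k < n" by simp
      show "expectation (\<lambda>\<omega>. norm (?R n k \<omega>) * norm (?D n k \<omega>)) \<le> expectation (\<lambda>\<omega>. (norm (?R n k \<omega>))\<^sup>2) / c + c * (real CARD('n \<times> 3) * (grid t s n (Suc k) - grid t s n k))"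
        using tr(2)[OF k k k k c] unfolding eD[OF k] .
    qed
    also have "\<dots> = (\<Sum>k<n. expectation (\<lambda>\<omega>. (norm (?R n k \<omega>))\<^sup>2)) / c + c * (real CARD('n \<times> 3) * (s - t))"
      unfolding sum.distrib sum_divide_distrib[symmetric] sum_distrib_left[symmetric]
      using sum_grid_telescope[OF n, of "\<lambda>x. x" t s] by simp
    finally show "expectation (\<lambda>\<omega>. norm (?S n \<omega>)) \<le> (\<Sum>k<n. expectation (\<lambda>\<omega>. (norm (?R n k \<omega>))\<^sup>2)) / c + c * (real CARD('n \<times> 3) * (s - t))" .
  qed simp
qed

text \<open>The error of the left-point Riemann sums for the time integral of
  \<open>m\<close>.\<close>

lemma qn_riemann_tendsto:
  assumes s: "s \<in> {t..T}"
  shows "(\<lambda>n. qn (\<lambda>\<omega>. c *\<^sub>R (\<Sum>k<n. drift (\<lambda>z. m (grid t s n k) (fst z) - mm z) (grid t s n k) (grid t s n (Suc k)) \<omega>))) \<longlonglongrightarrow> 0"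
proof (rule qn_scaled_tendsto)
  have ts: "t \<le> s" "s \<le> T" using s by auto
  let ?g = "\<lambda>n k z. m (grid t s n k) (fst z) - mm z"
  let ?d = "\<lambda>n k. drift (?g n k) (grid t s n k) (grid t s n (Suc k))"
  have ia: "integrable PL (\<lambda>z. indicat_real {grid t s n k<..grid t s n (Suc k)} (snd z) *\<^sub>R ?g n k z)" if k: "k < n" for n k
  proof (rule Bochner_Integration.integrable_bound[OF integrable_indicator_PL[of _ _ "2 * N"]])
    have gT: "grid t s n k \<in> {t..T}" using k grid_ge[OF ts(1)] order_trans[OF grid_le[OF ts(1)] ts(2)] by auto
    have [measurable]: "m (grid t s n k) \<in> borel_measurable P" by (rule m_meas[OF gT])
    show "(\<lambda>z. indicat_real {grid t s n k<..grid t s n (Suc k)} (snd z) *\<^sub>R ?g n k z) \<in> borel_measurable PL" by measurable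
    show "AE z in PL. norm (indicat_real {grid t s n k<..grid t s n (Suc k)} (snd z) *\<^sub>R ?g n k z) \<le> norm (indicat_real {grid t s n k<..grid t s n (Suc k)} (snd z) * (2 * N))"
    proof (rule AE_I2)
      fix z assume "z \<in> space PL"
      then have "norm (?g n k z) \<le> N + N"
        using gT by (intro order_trans[OF norm_triangle_ineq4] add_mono mm_bound m_bound) (auto simp: space_pair_measure)
      then show "norm (indicat_real {grid t s n k<..grid t s n (Suc k)} (snd z) *\<^sub>R ?g n k z) \<le> norm (indicat_real {grid t s n k<..grid t s n (Suc k)} (snd z) * (2 * N))"
        using N by (simp add: indicator_def)
    qed
  qed
  show iS: "integrable P (\<lambda>\<omega>. \<Sum>k<n. ?d n k \<omega>)" for n
    using drift_L1(1)[OF ia] by (intro Bochner_Integration.integrable_sum) auto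
  have l: "(\<lambda>n. \<Sum>k<n. \<integral>z. indicat_real {grid t s n k<..grid t s n (Suc k)} (snd z) * norm (mm z - m (grid t s n k) (fst z)) \<partial>PL) \<longlonglongrightarrow> 0"
    using modulus_vanish[OF s, of 1] by simp
  show "(\<lambda>n. expectation (\<lambda>\<omega>. norm (\<Sum>k<n. ?d n k \<omega>))) \<longlonglongrightarrow> 0"
  proof (rule tendsto_sandwich[OF _ _ tendsto_const l])
    show "\<forall>\<^sub>F n in sequentially. expectation (\<lambda>\<omega>. norm (\<Sum>k<n. ?d n k \<omega>))
       \<le> (\<Sum>k<n. \<integral>z. indicat_real {grid t s n k<..grid t s n (Suc k)} (snd z) * norm (mm z - m (grid t s n k) (fst z)) \<partial>PL)"
    proof (intro always_eventually allI)
      fix n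
      have "expectation (\<lambda>\<omega>. norm (\<Sum>k<n. ?d n k \<omega>)) \<le> expectation (\<lambda>\<omega>. \<Sum>k<n. norm (?d n k \<omega>))"
        using drift_L1(1)[OF ia] by (intro integral_mono integrable_norm iS Bochner_Integration.integrable_sum norm_sum) auto
      also have "\<dots> = (\<Sum>k<n. expectation (\<lambda>\<omega>. norm (?d n k \<omega>)))"
        using drift_L1(1)[OF ia] by (intro Bochner_Integration.integral_sum) auto
      also have "\<dots> \<le> (\<Sum>k<n. \<integral>z. indicat_real {grid t s n k<..grid t s n (Suc k)} (snd z) * norm (?g n k z) \<partial>PL)"
        using drift_L1(2)[OF ia] by (intro sum_mono) auto
      finally show "expectation (\<lambda>\<omega>. norm (\<Sum>k<n. ?d n k \<omega>))
       \<le> (\<Sum>k<n. \<integral>z. indicat_real {grid t s n k<..grid t s n (Suc k)} (snd z) * norm (mm z - m (grid t s n k) (fst z)) \<partial>PL)"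
        by (simp add: norm_minus_commute)
    qed
  qed simp
qed

text \<open>Argued path by path, as \<open>C\<close> has no moments: the total variation of the
  drift integral and of \<open>C\<close> is finite, while the increments of \<open>B\<close> tend to
  zero uniformly. This works before \<open>C\<close> is known.\<close>

lemma qn_bounded_variation_tendsto:
  assumes s: "s \<in> {t..T}"
  shows "(\<lambda>n. qn (\<lambda>\<omega>. \<Sum>k<n. cprod (drift \<beta> (grid t s n k) (grid t s n (Suc k)) \<omega> + c *\<^sub>R (C (grid t s n (Suc k)) \<omega> - C (grid t s n k) \<omega>))
      (dB (grid t s n k) (grid t s n (Suc k)) \<omega>))) \<longlonglongrightarrow> 0"
proof (rule qn_AE_tendsto)
  have ts: "t \<le> s" "s \<le> T" using s by auto
  have cell: "t \<le> grid t s n k" "0 \<le> grid t s n k" "grid t s n k \<le> grid t s n (Suc k)" "grid t s n (Suc k) \<le> T" if "k < n" for n k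
    using that t0 grid_ge[OF ts(1), of n k] order_trans[OF grid_le[OF ts(1)] ts(2), of "Suc k" n] grid_mono[OF ts(1), of k "Suc k" n] by auto
  have Cm: "C r \<in> borel_measurable P" if "r \<in> {t..T}" for r
    using C that by (auto simp: has_covariation_def adapted_def intro: measurable_F_P)
  let ?x = "\<lambda>n k \<omega>. drift \<beta> (grid t s n k) (grid t s n (Suc k)) \<omega> + c *\<^sub>R (C (grid t s n (Suc k)) \<omega> - C (grid t s n k) \<omega>)"
  let ?D = "\<lambda>n k. dB (grid t s n k) (grid t s n (Suc k))"
  show "(\<lambda>\<omega>. \<Sum>k<n. cprod (?x n k \<omega>) (?D n k \<omega>)) \<in> borel_measurable P" for n
  proof (rule borel_measurable_sum)
    fix k assume "k \<in> {..<n}"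
    then have k: "k < n" by simp
    have [measurable]: "C (grid t s n (Suc k)) \<in> borel_measurable P" "C (grid t s n k) \<in> borel_measurable P" "?D n k \<in> borel_measurable P"
      using cell[OF k] by (auto intro!: Cm dB_meas)
    show "(\<lambda>\<omega>. cprod (?x n k \<omega>) (?D n k \<omega>)) \<in> borel_measurable P" by measurable
  qed
  have BV: "AE \<omega> in P. bounded_variation_on_Icc t T (\<lambda>s. C s \<omega>)" using C by (auto simp: has_covariation_def)
  show "AE \<omega> in P. (\<lambda>n. \<Sum>k<n. cprod (?x n k \<omega>) (?D n k \<omega>)) \<longlonglongrightarrow> 0"
    using BV B_continuous AE_\<beta>_integrable
  proof eventually_elim
    case (elim \<omega>)
    obtain V where V: "\<And>n p. is_partition t T n p \<Longrightarrow> (\<Sum>i<n. norm (C (p (Suc i)) \<omega> - C (p i) \<omega>)) \<le> V"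
      using elim(1) by (auto simp: bounded_variation_on_Icc_def)
    have Vg: "(\<Sum>k<n. norm (C (grid t s n (Suc k)) \<omega> - C (grid t s n k) \<omega>)) \<le> V" if n: "n > 0" for n
    proof -
      \<comment> \<open>The variation bound refers to partitions of \<open>{t..T}\<close>; the grid
        of \<open>{t..s}\<close> is completed by the single further point \<open>T\<close>.\<close>
      define p where "p k = (if k \<le> n then grid t s n k else T)" for k
      have "is_partition t T (Suc n) p"
        using n ts grid_mono[OF ts(1)] by (auto simp: is_partition_def p_def le_Suc_eq less_Suc_eq)
      from V[OF this] have "(\<Sum>k<n. norm (C (p (Suc k)) \<omega> - C (p k) \<omega>)) + norm (C (p (Suc n)) \<omega> - C (p n) \<omega>) \<le> V" by simp
      moreover have "(\<Sum>k<n. norm (C (p (Suc k)) \<omega> - C (p k) \<omega>)) = (\<Sum>k<n. norm (C (grid t s n (Suc k)) \<omega> - C (grid t s n k) \<omega>))"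
        by (intro sum.cong) (auto simp: p_def)
      ultimately show ?thesis using norm_ge_zero[of "C (p (Suc n)) \<omega> - C (p n) \<omega>"] by linarith
    qed
    have \<beta>i: "integrable lborel (\<lambda>r. indicat_real {t<..s} r *\<^sub>R \<beta> (\<omega>, r))"
    proof -
      have "integrable lborel (\<lambda>r. indicat_real {t<..s} r *\<^sub>R (indicat_real {t..T} r *\<^sub>R \<beta> (\<omega>, r)))"
        by (rule integrable_mult_indicator[OF _ elim(3)]) simp
      moreover have "indicat_real {t<..s} r * indicat_real {t..T} r = indicat_real {t<..s} r" for r
        using ts by (auto simp: indicator_def)
      ultimately show ?thesis by simp
    qed
    define G where "G = (\<integral>r. norm (indicat_real {t<..s} r *\<^sub>R \<beta> (\<omega>, r)) \<partial>lborel) + \<bar>c\<bar> * V"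
    have xG: "(\<Sum>k<n. norm (?x n k \<omega>)) \<le> G" if n: "n > 0" for n
    proof -
      have "(\<Sum>k<n. norm (?x n k \<omega>)) \<le> (\<Sum>k<n. norm (drift \<beta> (grid t s n k) (grid t s n (Suc k)) \<omega>) + \<bar>c\<bar> * norm (C (grid t s n (Suc k)) \<omega> - C (grid t s n k) \<omega>))"
        by (intro sum_mono order_trans[OF norm_triangle_ineq]) simp
      also have "\<dots> \<le> G" unfolding sum.distrib sum_distrib_left[symmetric] G_def
        using drift_cells(3)[OF ts(1) n \<beta>i] Vg[OF n] by (intro add_mono mult_left_mono) auto
      finally show ?thesis .
    qed
    have G0: "0 \<le> G" using xG[of 1] by (rule order_trans[rotated]) (auto intro: sum_nonneg)
    have uc: "uniformly_continuous_on {0..T} (\<lambda>s. B s \<omega>)" by (rule compact_uniformly_continuous[OF elim(2)]) simp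
    show "(\<lambda>n. \<Sum>k<n. cprod (?x n k \<omega>) (?D n k \<omega>)) \<longlonglongrightarrow> 0"
    proof (rule LIMSEQ_I)
      fix e :: real assume e: "e > 0"
      have "e / (G + 1) > 0" using e G0 by simp
      with uc obtain d where d: "d > 0" "\<And>r r'. r \<in> {0..T} \<Longrightarrow> r' \<in> {0..T} \<Longrightarrow> dist r' r < d \<Longrightarrow> dist (B r' \<omega>) (B r \<omega>) < e / (G + 1)"
        unfolding uniformly_continuous_on_def by meson
      have "(\<lambda>n. (s - t) / real n) \<longlonglongrightarrow> 0" by (rule lim_const_over_n)
      from LIMSEQ_D[OF this d(1)] obtain n0 where n0: "\<And>n. n \<ge> n0 \<Longrightarrow> \<bar>(s - t) / real n\<bar> < d" by auto
      show "\<exists>n0. \<forall>n\<ge>n0. norm ((\<Sum>k<n. cprod (?x n k \<omega>) (?D n k \<omega>)) - 0) < e"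
      proof (intro exI[of _ "Suc n0"] allI impI)
        fix n assume n: "Suc n0 \<le> n"
        have Dk: "norm (?D n k \<omega>) \<le> e / (G + 1)" if k: "k < n" for k
        proof -
          have "\<bar>grid t s n (Suc k) - grid t s n k\<bar> < d" unfolding grid_step using n0[of n] n by simp
          then have "dist (grid t s n (Suc k)) (grid t s n k) < d" by (simp add: dist_real_def)
          from d(2)[OF _ _ this] cell[OF k] show ?thesis by (simp add: dB_def dist_norm)
        qed
        have "norm (\<Sum>k<n. cprod (?x n k \<omega>) (?D n k \<omega>)) \<le> (\<Sum>k<n. norm (?x n k \<omega>) * (e / (G + 1)))"
          using Dk by (intro sum_norm_le order_trans[OF norm_cprod_le] mult_left_mono) auto
        also have "\<dots> \<le> G * (e / (G + 1))"
          unfolding sum_distrib_right[symmetric] using xG[of n] n e G0 by (intro mult_right_mono) auto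
        also have "\<dots> < e" using e G0 by (simp add: field_simps)
        finally show "norm ((\<Sum>k<n. cprod (?x n k \<omega>) (?D n k \<omega>)) - 0) < e" by simp
      qed
    qed
  qed
qed

lemma qn_covariation_tendsto:
  assumes s: "s \<in> {t..T}"
  shows "(\<lambda>n. qn (\<lambda>\<omega>. (\<Sum>k<n. cprod (m (grid t s n (Suc k)) \<omega> - m (grid t s n k) \<omega>) (dB (grid t s n k) (grid t s n (Suc k)) \<omega>)) - C s \<omega>)) \<longlonglongrightarrow> 0"
    and "(\<lambda>\<omega>. (\<Sum>k<n. cprod (m (grid t s n (Suc k)) \<omega> - m (grid t s n k) \<omega>) (dB (grid t s n k) (grid t s n (Suc k)) \<omega>)) - C s \<omega>) \<in> borel_measurable P"
proof -
  have ts: "t \<le> s" "s \<le> T" using s by auto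
  let ?X = "\<lambda>n \<omega>. (\<Sum>k<n. cprod (m (grid t s n (Suc k)) \<omega> - m (grid t s n k) \<omega>) (dB (grid t s n k) (grid t s n (Suc k)) \<omega>)) - C s \<omega>"
  have cell: "t \<le> grid t s n k" "0 \<le> grid t s n k" "grid t s n k \<le> grid t s n (Suc k)" "grid t s n (Suc k) \<le> T" if "k < n" for n k
    using that t0 grid_ge[OF ts(1), of n k] order_trans[OF grid_le[OF ts(1)] ts(2), of "Suc k" n] grid_mono[OF ts(1), of k "Suc k" n] by auto
  have Cm: "C s \<in> borel_measurable P"
    using C s by (auto simp: has_covariation_def adapted_def intro: measurable_F_P)
  show Xm: "?X n \<in> borel_measurable P" for n
  proof (intro borel_measurable_diff borel_measurable_sum Cm)
    fix k assume "k \<in> {..<n}"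
    then have k: "k < n" by simp
    have [measurable]: "m (grid t s n (Suc k)) \<in> borel_measurable P" "m (grid t s n k) \<in> borel_measurable P"
      "dB (grid t s n k) (grid t s n (Suc k)) \<in> borel_measurable P"
      using cell[OF k] by (auto intro!: m_meas dB_meas)
    show "(\<lambda>\<omega>. cprod (m (grid t s n (Suc k)) \<omega> - m (grid t s n k) \<omega>) (dB (grid t s n k) (grid t s n (Suc k)) \<omega>)) \<in> borel_measurable P"
      by measurable
  qed
  show "(\<lambda>n. qn (?X n)) \<longlonglongrightarrow> 0"
  proof (rule LIMSEQ_I)
    fix e :: real assume e: "e > 0"
    have "\<forall>\<epsilon>>0. \<exists>\<eta>>0. \<forall>n p. is_partition t s n p \<and> (\<forall>i<n. p (Suc i) - p i < \<eta>) \<longrightarrow>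
        measure P {\<omega> \<in> space P. \<epsilon> \<le> norm
          ((\<Sum>i<n. (sigma_mat (m (p (Suc i)) \<omega>) - sigma_mat (m (p i) \<omega>)) *v (B (p (Suc i)) \<omega> - B (p i) \<omega>)) - C s \<omega>)} \<le> \<epsilon>"
      using C s unfolding has_covariation_def by blast
    \<comment> \<open>Convergence in probability at level \<open>e / 3\<close> bounds
      \<open>qn\<close> by \<open>2 e / 3\<close>, strictly below \<open>e\<close>.\<close>
    moreover have "e / 3 > 0" using e by simp
    ultimately obtain \<eta> where \<eta>: "\<eta> > 0" "\<And>n p. is_partition t s n p \<Longrightarrow> (\<forall>i<n. p (Suc i) - p i < \<eta>) \<Longrightarrow>
        measure P {\<omega> \<in> space P. e / 3 \<le> norm
          ((\<Sum>i<n. (sigma_mat (m (p (Suc i)) \<omega>) - sigma_mat (m (p i) \<omega>)) *v (B (p (Suc i)) \<omega> - B (p i) \<omega>)) - C s \<omega>)} \<le> e / 3"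
      by meson
    have "(\<lambda>n. (s - t) / real n) \<longlonglongrightarrow> 0" by (rule lim_const_over_n)
    from LIMSEQ_D[OF this \<eta>(1)] obtain n0 where n0: "\<And>n. n \<ge> n0 \<Longrightarrow> \<bar>(s - t) / real n\<bar> < \<eta>" by auto
    show "\<exists>n0. \<forall>n\<ge>n0. norm (qn (?X n) - 0) < e"
    proof (intro exI[of _ "Suc n0"] allI impI)
      fix n assume n: "Suc n0 \<le> n"
      have "is_partition t s n (grid t s n)" using n ts grid_mono[OF ts(1)] by (auto simp: is_partition_def)
      moreover have "\<forall>i<n. grid t s n (Suc i) - grid t s n i < \<eta>" unfolding grid_step using le_less_trans[OF abs_ge_self n0[of n]] n by simp
      ultimately have "measure P {\<omega> \<in> space P. e / 3 \<le> norm (?X n \<omega>)} \<le> e / 3"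
        using \<eta>(2)[of n "grid t s n"] by (simp only: sigma_mat_diff[symmetric] sigma_mat_mult dB_def)
      then have "qn (?X n) \<le> 2 * (e / 3)" using e by (intro qn_prob Xm) auto
      then show "norm (qn (?X n) - 0) < e" using e qn_nonneg[of "?X n"] by simp
    qed
  qed
qed

text \<open>The increments of \<open>m\<close> contain \<open>C\<close> itself, so the identity
  looks circular. But \<open>C\<close> has bounded variation and thus contributes nothing to the
  covariation with \<open>B\<close>; what survives is the quadratic noise term with mean
  \<open>- 2 \<nu> (b - a) m a\<close> on each cell.\<close>

lemma covariation_eq:
  assumes s: "s \<in> {t..T}"
  shows "AE \<omega> in P. C s \<omega> = - (2 * \<nu>) *\<^sub>R drift mm t s \<omega>"
proof -
  have ts: "t \<le> s" "s \<le> T" using s by auto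
  have cell: "t \<le> grid t s n k" "0 \<le> grid t s n k" "grid t s n k \<le> grid t s n (Suc k)" "grid t s n (Suc k) \<le> T" if "k < n" for n k
    using that t0 grid_ge[OF ts(1), of n k] order_trans[OF grid_le[OF ts(1)] ts(2), of "Suc k" n] grid_mono[OF ts(1), of k "Suc k" n] by auto
  let ?D = "\<lambda>n k. dB (grid t s n k) (grid t s n (Suc k))"
  let ?S = "\<lambda>n \<omega>. \<Sum>k<n. cprod (m (grid t s n (Suc k)) \<omega> - m (grid t s n k) \<omega>) (?D n k \<omega>)"
  let ?T1 = "\<lambda>n \<omega>. \<Sum>k<n. cprod (drift \<beta> (grid t s n k) (grid t s n (Suc k)) \<omega> + (\<nu> / 2) *\<^sub>R (C (grid t s n (Suc k)) \<omega> - C (grid t s n k) \<omega>)) (?D n k \<omega>)"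
  let ?T2 = "\<lambda>n \<omega>. \<nu> *\<^sub>R (\<Sum>k<n. cprod (rem (grid t s n k) (grid t s n (Suc k)) \<omega>) (?D n k \<omega>))"
  let ?T3 = "\<lambda>n \<omega>. \<nu> *\<^sub>R (\<Sum>k<n. quad (grid t s n k) (grid t s n (Suc k)) \<omega>)"
  let ?T4 = "\<lambda>n \<omega>. (- (2 * \<nu>)) *\<^sub>R (\<Sum>k<n. drift (\<lambda>z. m (grid t s n k) (fst z) - mm z) (grid t s n k) (grid t s n (Suc k)) \<omega>)"
  let ?Z = "\<lambda>\<omega>. C s \<omega> + (2 * \<nu>) *\<^sub>R drift mm t s \<omega>"
  have Cm: "C r \<in> borel_measurable P" if "r \<in> {t..T}" for r
    using C that by (auto simp: has_covariation_def adapted_def intro: measurable_F_P)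
  have mD [measurable]: "?D n k \<in> borel_measurable P" if "k < n" for n k using cell[OF that] by (intro dB_meas) auto
  have mm1 [measurable]: "m (grid t s n k) \<in> borel_measurable P" if "k < n" for n k using cell[OF that] by (intro m_meas) auto
  have T1m: "?T1 n \<in> borel_measurable P" for n
  proof (rule borel_measurable_sum)
    fix k assume "k \<in> {..<n}"
    then have k: "k < n" by simp
    have [measurable]: "C (grid t s n (Suc k)) \<in> borel_measurable P" "C (grid t s n k) \<in> borel_measurable P"
      using cell[OF k] by (auto intro!: Cm)
    show "(\<lambda>\<omega>. cprod (drift \<beta> (grid t s n k) (grid t s n (Suc k)) \<omega> + (\<nu> / 2) *\<^sub>R (C (grid t s n (Suc k)) \<omega> - C (grid t s n k) \<omega>)) (?D n k \<omega>)) \<in> borel_measurable P"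
      using mD[OF k] by measurable
  qed
  have T2m: "?T2 n \<in> borel_measurable P" for n
    using mD rem_meas[OF cell(1,3,4)] by (intro borel_measurable_scaleR borel_measurable_const borel_measurable_sum borel_measurable_cprod) auto
  have T3m: "?T3 n \<in> borel_measurable P" for n
    using measurable_F_P[OF quad_meas_F[OF cell(1,3,4)]] by (intro borel_measurable_scaleR borel_measurable_const borel_measurable_sum) auto
  have T4m: "?T4 n \<in> borel_measurable P" for n
  proof (intro borel_measurable_scaleR borel_measurable_const borel_measurable_sum)
    fix k assume "k \<in> {..<n}"
    then have [measurable]: "m (grid t s n k) \<in> borel_measurable P" by (intro mm1) auto
    show "drift (\<lambda>z. m (grid t s n k) (fst z) - mm z) (grid t s n k) (grid t s n (Suc k)) \<in> borel_measurable P"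
      by (rule drift_measurable) measurable
  qed
  have Zm: "?Z \<in> borel_measurable P" using Cm[OF s] by measurable
  have main: "AE \<omega> in P. ?S n \<omega> + (2 * \<nu>) *\<^sub>R drift mm t s \<omega> = ((?T1 n \<omega> + ?T2 n \<omega>) + ?T3 n \<omega>) + ?T4 n \<omega>" if n: "n > 0" for n
  proof -
    have "AE \<omega> in P. \<forall>k\<in>{..<n}. m (grid t s n (Suc k)) \<omega> - m (grid t s n k) \<omega> = drift \<beta> (grid t s n k) (grid t s n (Suc k)) \<omega>
        + \<nu> *\<^sub>R (I (grid t s n (Suc k)) \<omega> - I (grid t s n k) \<omega>) + (\<nu> / 2) *\<^sub>R (C (grid t s n (Suc k)) \<omega> - C (grid t s n k) \<omega>)"
      using raw_increment[OF cell(1,3,4)] by (intro AE_finite_allI) auto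
    then show ?thesis
    proof (rule AE_mp, intro AE_I2 impI)
      fix \<omega> assume \<omega>: "\<omega> \<in> space P" and incr: "\<forall>k\<in>{..<n}. m (grid t s n (Suc k)) \<omega> - m (grid t s n k) \<omega> = drift \<beta> (grid t s n k) (grid t s n (Suc k)) \<omega>
        + \<nu> *\<^sub>R (I (grid t s n (Suc k)) \<omega> - I (grid t s n k) \<omega>) + (\<nu> / 2) *\<^sub>R (C (grid t s n (Suc k)) \<omega> - C (grid t s n k) \<omega>)"
      let ?h = "\<lambda>k. grid t s n (Suc k) - grid t s n k"
      have Sk: "?S n \<omega> = ?T1 n \<omega> + ?T2 n \<omega> + ?T3 n \<omega> - (2 * \<nu>) *\<^sub>R (\<Sum>k<n. ?h k *\<^sub>R m (grid t s n k) \<omega>)"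
        unfolding scaleR_sum_right sum.distrib[symmetric] sum_subtractf[symmetric]
      proof (intro sum.cong refl)
        fix k assume k: "k \<in> {..<n}"
        show "cprod (m (grid t s n (Suc k)) \<omega> - m (grid t s n k) \<omega>) (?D n k \<omega>) =
          cprod (drift \<beta> (grid t s n k) (grid t s n (Suc k)) \<omega> + (\<nu> / 2) *\<^sub>R (C (grid t s n (Suc k)) \<omega> - C (grid t s n k) \<omega>)) (?D n k \<omega>)
          + \<nu> *\<^sub>R cprod (rem (grid t s n k) (grid t s n (Suc k)) \<omega>) (?D n k \<omega>)
          + \<nu> *\<^sub>R quad (grid t s n k) (grid t s n (Suc k)) \<omega> - (2 * \<nu>) *\<^sub>R ?h k *\<^sub>R m (grid t s n k) \<omega>"
          unfolding incr[rule_format, OF k] rem_def quad_def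
          by (simp add: cprod.add_left cprod.diff_left cprod.scaleR_left scaleR_diff_right scaleR_add_right algebra_simps)
      qed
      have dk: "drift (\<lambda>z. m (grid t s n k) (fst z) - mm z) (grid t s n k) (grid t s n (Suc k)) \<omega>
         = ?h k *\<^sub>R m (grid t s n k) \<omega> - drift mm (grid t s n k) (grid t s n (Suc k)) \<omega>" if k: "k < n" for k
      proof -
        have gi: "integrable lborel (indicat_real {grid t s n k<..grid t s n (Suc k)})"
          using cell[OF k] by (intro integrable_real_indicator) auto
        have "drift (\<lambda>z. m (grid t s n k) (fst z) - mm z) (grid t s n k) (grid t s n (Suc k)) \<omega>
          = (\<integral>r. indicat_real {grid t s n k<..grid t s n (Suc k)} r *\<^sub>R m (grid t s n k) \<omega> \<partial>lborel) - drift mm (grid t s n k) (grid t s n (Suc k)) \<omega>"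
          unfolding drift_def fst_conv scaleR_diff_right
          using gi mm_integrable[OF \<omega>] by (intro Bochner_Integration.integral_diff integrable_scaleR_left) auto
        also have "(\<integral>r. indicat_real {grid t s n k<..grid t s n (Suc k)} r *\<^sub>R m (grid t s n k) \<omega> \<partial>lborel) = ?h k *\<^sub>R m (grid t s n k) \<omega>"
          using cell[OF k] gi by simp
        finally show ?thesis .
      qed
      have "(\<Sum>k<n. drift (\<lambda>z. m (grid t s n k) (fst z) - mm z) (grid t s n k) (grid t s n (Suc k)) \<omega>)
         = (\<Sum>k<n. ?h k *\<^sub>R m (grid t s n k) \<omega>) - (\<Sum>k<n. drift mm (grid t s n k) (grid t s n (Suc k)) \<omega>)"
        unfolding sum_subtractf[symmetric] using dk by (intro sum.cong) auto
      also have "(\<Sum>k<n. drift mm (grid t s n k) (grid t s n (Suc k)) \<omega>) = drift mm t s \<omega>"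
        by (rule drift_cells(2)[OF ts(1) n mm_integrable[OF \<omega>]])
      finally have d: "(\<Sum>k<n. drift (\<lambda>z. m (grid t s n k) (fst z) - mm z) (grid t s n k) (grid t s n (Suc k)) \<omega>)
         = (\<Sum>k<n. ?h k *\<^sub>R m (grid t s n k) \<omega>) - drift mm t s \<omega>" .
      show "?S n \<omega> + (2 * \<nu>) *\<^sub>R drift mm t s \<omega> = ((?T1 n \<omega> + ?T2 n \<omega>) + ?T3 n \<omega>) + ?T4 n \<omega>"
        unfolding Sk d by (simp add: scaleR_diff_right)
    qed
  qed
  have le: "qn ?Z \<le> qn (\<lambda>\<omega>. ?S n \<omega> - C s \<omega>) + (qn (?T1 n) + qn (?T2 n) + qn (?T3 n) + qn (?T4 n))" if n: "n > 0" for n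
  proof -
    note Sm = qn_covariation_tendsto(2)[OF s, of n]
    have Sm': "(\<lambda>\<omega>. - (?S n \<omega> - C s \<omega>)) \<in> borel_measurable P" using Sm by (rule borel_measurable_uminus)
    have "?S n = (\<lambda>\<omega>. (?S n \<omega> - C s \<omega>) + C s \<omega>)" by auto
    then have S0: "?S n \<in> borel_measurable P" using borel_measurable_add[OF Sm Cm[OF s]] by simp
    have Ym: "(\<lambda>\<omega>. ?S n \<omega> + (2 * \<nu>) *\<^sub>R drift mm t s \<omega>) \<in> borel_measurable P"
      using S0 by (intro borel_measurable_add) auto
    have "qn ?Z = qn (\<lambda>\<omega>. - (?S n \<omega> - C s \<omega>) + (?S n \<omega> + (2 * \<nu>) *\<^sub>R drift mm t s \<omega>))" by simp
    also have "\<dots> \<le> qn (\<lambda>\<omega>. - (?S n \<omega> - C s \<omega>)) + qn (\<lambda>\<omega>. ?S n \<omega> + (2 * \<nu>) *\<^sub>R drift mm t s \<omega>)"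
      by (rule qn_triangle[OF Sm' Ym])
    also have "qn (\<lambda>\<omega>. - (?S n \<omega> - C s \<omega>)) = qn (\<lambda>\<omega>. ?S n \<omega> - C s \<omega>)"
      unfolding qn_def norm_minus_cancel ..
    also have "qn (\<lambda>\<omega>. ?S n \<omega> + (2 * \<nu>) *\<^sub>R drift mm t s \<omega>) = qn (\<lambda>\<omega>. ((?T1 n \<omega> + ?T2 n \<omega>) + ?T3 n \<omega>) + ?T4 n \<omega>)"
      by (rule qn_cong[OF main[OF n] Ym]) (intro borel_measurable_add T1m T2m T3m T4m)
    also have "\<dots> \<le> qn (\<lambda>\<omega>. (?T1 n \<omega> + ?T2 n \<omega>) + ?T3 n \<omega>) + qn (?T4 n)"
      by (intro qn_triangle borel_measurable_add T1m T2m T3m T4m)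
    also have "qn (\<lambda>\<omega>. (?T1 n \<omega> + ?T2 n \<omega>) + ?T3 n \<omega>) \<le> qn (\<lambda>\<omega>. ?T1 n \<omega> + ?T2 n \<omega>) + qn (?T3 n)"
      by (intro qn_triangle borel_measurable_add T1m T2m T3m T4m)
    also have "qn (\<lambda>\<omega>. ?T1 n \<omega> + ?T2 n \<omega>) \<le> qn (?T1 n) + qn (?T2 n)"
      by (intro qn_triangle T1m T2m)
    finally show ?thesis by simp
  qed
  have "(\<lambda>n. qn (\<lambda>\<omega>. ?S n \<omega> - C s \<omega>) + (qn (?T1 n) + qn (?T2 n) + qn (?T3 n) + qn (?T4 n))) \<longlonglongrightarrow> 0 + (0 + 0 + 0 + 0)"
    by (intro tendsto_add qn_covariation_tendsto(1) qn_bounded_variation_tendsto qn_rem_tendsto qn_quad_tendsto qn_riemann_tendsto s)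
  then have "qn ?Z \<le> 0 + (0 + 0 + 0 + 0)"
    by (rule LIMSEQ_le_const) (use le in \<open>intro exI[of _ 1] allI impI\<close>, simp)
  then have "qn ?Z = 0" using qn_nonneg[of ?Z] by simp
  from qn_zero[OF Zm this] show ?thesis
  proof eventually_elim
    case (elim \<omega>)
    then show ?case by (simp add: eq_neg_iff_add_eq_0)
  qed
qed

end

section \<open>Ito's formula in expectation\<close>

lemma C12_FTC:
  assumes W: "C12_M T W" and x: "x \<in> sphere_prod" and ab: "0 \<le> a" "a \<le> b" "b \<le> T"
  shows "(\<integral>r. indicat_real {a<..b} r * dt_on T W r x \<partial>lborel) = W b x - W a x"
proof -
  have cont: "continuous_on {a..b} (\<lambda>r. dt_on T W r x)"
  proof -
    have "continuous_on ({0..T} \<times> sphere_prod) (\<lambda>(s, m). dt_on T W s m)" using W by (simp add: C12_M_def)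
    then have "continuous_on {a..b} (\<lambda>r. case (r, x) of (s, m) \<Rightarrow> dt_on T W s m)"
      by (rule continuous_on_compose2) (use x ab in \<open>auto intro!: continuous_intros\<close>)
    then show ?thesis by simp
  qed
  have "(\<integral>r. indicat_real {a..b} r *\<^sub>R dt_on T W r x \<partial>lborel) = W b x - W a x"
  proof (rule integral_FTC_Icc[OF ab(2) _ cont])
    fix r assume r: "a \<le> r" "r \<le> b"
    have "(\<lambda>s. W s x) differentiable (at r within {0..T})"
      using W x r ab by (auto simp: C12_M_def differentiable_on_def)
    then have "((\<lambda>s. W s x) has_vector_derivative dt_on T W r x) (at r within {0..T})"
      unfolding dt_on_def by (simp add: vector_derivative_works)
    then show "((\<lambda>s. W s x) has_vector_derivative dt_on T W r x) (at r within {a..b})"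
      by (rule has_vector_derivative_within_subset) (use ab in auto)
  qed
  moreover have "(\<integral>r. indicat_real {a<..b} r * dt_on T W r x \<partial>lborel) = (\<integral>r. indicat_real {a..b} r *\<^sub>R dt_on T W r x \<partial>lborel)"
  proof (rule integral_cong_AE)
    have [measurable]: "(\<lambda>r. indicat_real {a..b} r *\<^sub>R dt_on T W r x) \<in> borel_measurable borel"
      by (rule borel_measurable_continuous_on_indicator[OF _ cont]) simp
    then show "(\<lambda>r. indicat_real {a..b} r *\<^sub>R dt_on T W r x) \<in> borel_measurable lborel" by simp
    have "(\<lambda>r. indicat_real {a<..b} r * (indicat_real {a..b} r *\<^sub>R dt_on T W r x)) \<in> borel_measurable lborel" by measurable
    moreover have "(\<lambda>r. indicat_real {a<..b} r * (indicat_real {a..b} r *\<^sub>R dt_on T W r x)) = (\<lambda>r. indicat_real {a<..b} r * dt_on T W r x)"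
      by (auto simp: indicator_def fun_eq_iff)
    ultimately show "(\<lambda>r. indicat_real {a<..b} r * dt_on T W r x) \<in> borel_measurable lborel" by simp
    show "AE r in lborel. indicat_real {a<..b} r * dt_on T W r x = indicat_real {a..b} r *\<^sub>R dt_on T W r x"
      using AE_lborel_singleton[of a] by eventually_elim (auto simp: indicator_def)
  qed
  ultimately show ?thesis by simp
qed

lemma laplace_mhess: "laplace_beltrami \<psi> x = (\<Sum>p\<in>UNIV. mhess \<psi> x $ p $ p)"
  by (simp add: laplace_beltrami_def mdiv_def mhess_def)

context sllg_state
begin

definition rr :: "'a \<times> real \<Rightarrow> real" where "rr z = max t (min T (snd z))"

lemma rr_in: "rr z \<in> {0..T}" "rr z \<in> {t..T}"
  using t0 tT by (auto simp: rr_def)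

lemma rr_eq: "snd z \<in> {t..T} \<Longrightarrow> rr z = snd z"
  by (simp add: rr_def min_absorb2 max_absorb2)

lemma borel_measurable_state:
  fixes f :: "'n spins \<Rightarrow> 'b::real_normed_vector"
  assumes f: "continuous_on sphere_prod f" and a: "a \<in> {t..T}"
  shows "(\<lambda>\<omega>. f (m a \<omega>)) \<in> borel_measurable (F a)"
proof -
  have "m a \<in> measurable (F a) (restrict_space borel sphere_prod)"
    using m_meas_F[OF a] m_sphere[OF _ a] by (intro measurable_restrict_space2) (auto simp: space_F)
  from measurable_compose[OF this borel_measurable_continuous_on_restrict[OF f]] show ?thesis .
qed

lemma borel_measurable_time_state:
  fixes f :: "real \<times> 'n spins \<Rightarrow> 'b::real_normed_vector"
  assumes f: "continuous_on ({0..T} \<times> sphere_prod) f" and [measurable]: "g \<in> borel_measurable PL"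
    and g: "\<And>z. z \<in> space PL \<Longrightarrow> g z \<in> sphere_prod"
  shows "(\<lambda>z. f (rr z, g z)) \<in> borel_measurable PL"
proof -
  have [measurable]: "rr \<in> borel_measurable PL" unfolding rr_def[abs_def] by measurable
  have "(\<lambda>z. (rr z, g z)) \<in> measurable PL (restrict_space borel ({0..T} \<times> sphere_prod))"
    using rr_in(1) g by (intro measurable_restrict_space2) (auto simp: borel_prod[symmetric])
  from measurable_compose[OF this borel_measurable_continuous_on_restrict[OF f]] show ?thesis .
qed

end

context sllg_solution
begin

text \<open>The drift in Ito form: \<open>(\<nu> / 2) C\<close> has density
  \<open>- \<nu>^2 m\<close>.\<close>

definition \<gamma> :: "'a \<times> real \<Rightarrow> 'n spins" where "\<gamma> z = \<beta> z - \<nu>\<^sup>2 *\<^sub>R mm z"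

lemma \<gamma>_measurable [measurable]: "\<gamma> \<in> borel_measurable PL"
  unfolding \<gamma>_def[abs_def] by measurable

lemma \<gamma>_sq: "integrable PL (\<lambda>z. indicat_real {t..T} (snd z) * (norm (\<gamma> z))\<^sup>2)"
proof -
  have "integrable PL (\<lambda>z. indicat_real {t..T} (snd z))"
    using integral_product(1)[of "\<lambda>_. 1" "indicat_real {t..T}"] tT by (auto intro!: integrable_real_indicator)
  then have "integrable PL (\<lambda>z. 2 * (indicat_real {t..T} (snd z) * (norm (\<beta> z))\<^sup>2) + (2 * (\<nu>\<^sup>2 * N)\<^sup>2) * indicat_real {t..T} (snd z))"
    by (intro Bochner_Integration.integrable_add integrable_mult_right \<beta>_sq)
  then show ?thesis
  proof (rule Bochner_Integration.integrable_bound)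
    show "AE z in PL. norm (indicat_real {t..T} (snd z) * (norm (\<gamma> z))\<^sup>2)
      \<le> norm (2 * (indicat_real {t..T} (snd z) * (norm (\<beta> z))\<^sup>2) + (2 * (\<nu>\<^sup>2 * N)\<^sup>2) * indicat_real {t..T} (snd z))"
    proof (rule AE_I2)
      fix z assume "z \<in> space PL"
      then have "norm (mm z) \<le> N" by (intro mm_bound) (auto simp: space_pair_measure)
      then have "norm (\<nu>\<^sup>2 *\<^sub>R mm z) \<le> \<nu>\<^sup>2 * N" by (simp add: mult_left_mono)
      then have "norm (\<gamma> z) \<le> norm (\<beta> z) + \<nu>\<^sup>2 * N"
        unfolding \<gamma>_def by (rule order_trans[OF norm_triangle_ineq4 add_left_mono])
      then have "(norm (\<gamma> z))\<^sup>2 \<le> (norm (\<beta> z) + \<nu>\<^sup>2 * N)\<^sup>2" by (intro power_mono) auto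
      also have "\<dots> \<le> 2 * (norm (\<beta> z))\<^sup>2 + 2 * (\<nu>\<^sup>2 * N)\<^sup>2"
        using zero_le_power2[of "norm (\<beta> z) - \<nu>\<^sup>2 * N"] unfolding power2_sum power2_diff by linarith
      finally show "norm (indicat_real {t..T} (snd z) * (norm (\<gamma> z))\<^sup>2)
        \<le> norm (2 * (indicat_real {t..T} (snd z) * (norm (\<beta> z))\<^sup>2) + (2 * (\<nu>\<^sup>2 * N)\<^sup>2) * indicat_real {t..T} (snd z))"
        by (simp add: indicator_def)
    qed
  qed measurable
qed

lemma integrable_\<gamma>: "t \<le> a \<Longrightarrow> b \<le> T \<Longrightarrow> integrable PL (\<lambda>z. indicat_real {a<..b} (snd z) *\<^sub>R \<gamma> z)"
  by (rule Bochner_Integration.integrable_bound[OF integrable_PL_of_square[OF \<gamma>_measurable \<gamma>_sq]])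
    (measurable, auto simp: indicator_def intro!: AE_I2)

lemma increment:
  assumes ab: "t \<le> a" "a \<le> b" "b \<le> T"
  shows "AE \<omega> in P. m b \<omega> - m a \<omega> = drift \<gamma> a b \<omega> + \<nu> *\<^sub>R (I b \<omega> - I a \<omega>)"
proof -
  have "a \<in> {t..T}" "b \<in> {t..T}" using ab by auto
  from raw_increment[OF ab] covariation_eq[OF this(1)] covariation_eq[OF this(2)] AE_\<beta>_integrable AE_space
  show ?thesis
  proof eventually_elim
    case (elim \<omega>)
    have \<beta>i: "integrable lborel (\<lambda>r. indicat_real {a<..b} r *\<^sub>R \<beta> (\<omega>, r))"
    proof -
      have "integrable lborel (\<lambda>r. indicat_real {a<..b} r *\<^sub>R (indicat_real {t..T} r *\<^sub>R \<beta> (\<omega>, r)))"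
        by (rule integrable_mult_indicator[OF _ elim(4)]) simp
      moreover have "indicat_real {a<..b} r * indicat_real {t..T} r = indicat_real {a<..b} r" for r
        using ab by (auto simp: indicator_def)
      ultimately show ?thesis by simp
    qed
    note mi = mm_integrable[OF elim(5)]
    have d\<gamma>: "drift \<gamma> a b \<omega> = drift \<beta> a b \<omega> - \<nu>\<^sup>2 *\<^sub>R drift mm a b \<omega>"
    proof -
      have "drift \<gamma> a b \<omega> = (\<integral>r. indicat_real {a<..b} r *\<^sub>R \<beta> (\<omega>, r) - \<nu>\<^sup>2 *\<^sub>R (indicat_real {a<..b} r *\<^sub>R mm (\<omega>, r)) \<partial>lborel)"
        unfolding drift_def \<gamma>_def by (intro Bochner_Integration.integral_cong) (auto simp: algebra_simps)
      also have "\<dots> = drift \<beta> a b \<omega> - \<nu>\<^sup>2 *\<^sub>R drift mm a b \<omega>"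
        unfolding drift_def by (simp only: Bochner_Integration.integral_diff[OF \<beta>i integrable_scaleR_right[OF mi]] integral_scaleR_right)
      finally show ?thesis .
    qed
    have dm: "drift mm t b \<omega> - drift mm t a \<omega> = drift mm a b \<omega>"
    proof -
      have "drift mm t b \<omega> - drift mm t a \<omega> = (\<integral>r. indicat_real {t<..b} r *\<^sub>R mm (\<omega>, r) - indicat_real {t<..a} r *\<^sub>R mm (\<omega>, r) \<partial>lborel)"
        unfolding drift_def by (intro Bochner_Integration.integral_diff[symmetric] mi)
      also have "\<dots> = drift mm a b \<omega>"
        unfolding drift_def using ab by (intro Bochner_Integration.integral_cong) (auto simp: indicator_def)
      finally show ?thesis .
    qed
    have "C b \<omega> - C a \<omega> = - (2 * \<nu>) *\<^sub>R (drift mm t b \<omega> - drift mm t a \<omega>)"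
      unfolding elim(2,3) by (simp add: scaleR_diff_right)
    then have "(\<nu> / 2) *\<^sub>R (C b \<omega> - C a \<omega>) = - (\<nu>\<^sup>2 *\<^sub>R drift mm a b \<omega>)"
      unfolding dm by (simp add: power2_eq_square)
    then show ?case unfolding elim(1) d\<gamma> by (simp add: algebra_simps)
  qed
qed

lemma ito_start: "AE \<omega> in P. I t \<omega> = 0"
proof -
  have "ito_lim t (\<lambda>z. indicat_real {t<..t} (snd z) *\<^sub>R sigma_mat (m (snd z) (fst z))) (I t)"
    by (rule ito_lim_of_integral[OF I t0 tT]) (use tT in simp)
  from ito_lim_bound[OF this] have "(\<integral>\<^sup>+\<omega>. ennreal ((norm (I t \<omega>))\<^sup>2) \<partial>P) = 0" by simp
  then have "AE \<omega> in P. ennreal ((norm (I t \<omega>))\<^sup>2) = 0"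
    using I_meas[of t] tT by (subst (asm) nn_integral_0_iff_AE) auto
  then show ?thesis by (auto simp: ennreal_eq_0_iff)
qed

text \<open>The equation at \<open>s = t\<close>: the drift integral runs over one point, the Ito
  integral vanishes by its mean square bound, and the covariation by its explicit form.\<close>

lemma initial_value: "AE \<omega> in P. m t \<omega> = m0"
proof -
  have "t \<in> {t..T}" using tT by simp
  from eq[OF this] covariation_eq[OF this] ito_start
  show ?thesis
  proof eventually_elim
    case (elim \<omega>)
    have "(\<integral>r. indicat_real {t..t} r *\<^sub>R \<beta> (\<omega>, r) \<partial>lborel) = (\<integral>r. 0 \<partial>(lborel :: real measure))"
    proof (rule integral_cong_AE)
      have "AE r in lborel. indicat_real {t..t} r *\<^sub>R \<beta> (\<omega>, r) = 0"
        using AE_lborel_singleton[of t] by eventually_elim (auto simp: indicator_def)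
      then show "AE r in lborel. indicat_real {t..t} r *\<^sub>R \<beta> (\<omega>, r) = 0" .
      have "(\<lambda>r. indicat_real {t..t} r *\<^sub>R \<beta> (\<omega>, r)) = (\<lambda>r. indicat_real {t} r *\<^sub>R \<beta> (\<omega>, t))"
        by (auto simp: indicator_def fun_eq_iff)
      then show "(\<lambda>r. indicat_real {t..t} r *\<^sub>R \<beta> (\<omega>, r)) \<in> borel_measurable lborel" by simp
    qed simp
    then show ?case using elim by (simp add: drift_def)
  qed
qed

text \<open>In coordinates the mixed products of the noise average to zero given \<open>F a\<close>
  and the squares to \<open>b - a\<close>, so the Hessian is summed over the frame of noise
  directions.\<close>

lemma expectation_hess:
  assumes ab: "t \<le> a" "a \<le> b" "b \<le> T" and A: "A \<in> borel_measurable (F a)" "\<And>\<omega>. \<omega> \<in> space P \<Longrightarrow> norm (A \<omega>) \<le> K"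
  shows "integrable P (\<lambda>\<omega>. (A \<omega> *v cprod (m a \<omega>) (dB a b \<omega>)) \<bullet> cprod (m a \<omega>) (dB a b \<omega>))" (is "integrable P ?f")
    "expectation (\<lambda>\<omega>. (A \<omega> *v cprod (m a \<omega>) (dB a b \<omega>)) \<bullet> cprod (m a \<omega>) (dB a b \<omega>))
      = (b - a) * expectation (\<lambda>\<omega>. \<Sum>p\<in>UNIV. (A \<omega> *v cprod (m a \<omega>) (axis p 1)) \<bullet> cprod (m a \<omega>) (axis p 1))"
proof -
  have a0: "0 \<le> a" and aT: "a \<in> {t..T}" using ab t0 by auto
  let ?h = "\<lambda>p q \<omega>. (A \<omega> *v cprod (m a \<omega>) (axis p 1)) \<bullet> cprod (m a \<omega>) (axis q 1)"
  have [measurable]: "A \<in> borel_measurable (F a)" "m a \<in> borel_measurable (F a)" using A m_meas_F[OF aT] by auto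
  have hm: "?h p q \<in> borel_measurable (F a)" for p q by measurable
  have hb: "\<bar>?h p q \<omega>\<bar> \<le> \<bar>K\<bar> * N * N" if \<omega>: "\<omega> \<in> space P" for p q \<omega>
  proof -
    have c: "norm (cprod (m a \<omega>) (axis p 1)) \<le> N" for p :: "'n \<times> 3"
      using norm_cprod_le[of "m a \<omega>" "axis p 1"] m_bound[OF \<omega> aT] by simp
    have "\<bar>?h p q \<omega>\<bar> \<le> norm (A \<omega> *v cprod (m a \<omega>) (axis p 1)) * norm (cprod (m a \<omega>) (axis q 1))" by (rule Cauchy_Schwarz_ineq2)
    also have "\<dots> \<le> (norm (A \<omega>) * norm (cprod (m a \<omega>) (axis p 1))) * norm (cprod (m a \<omega>) (axis q 1))"
      by (intro mult_right_mono norm_matrix_vector_mult_le) auto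
    also have "\<dots> \<le> \<bar>K\<bar> * N * N" using A(2)[OF \<omega>] c N by (intro mult_mono) auto
    finally show ?thesis .
  qed
  have hi: "integrable P (?h p q)" for p q
    by (rule integrable_const_bound[of _ "\<bar>K\<bar> * N * N"]) (use hb measurable_F_P[OF hm] in auto)
  note e = expectation_mult_dB_dB[OF a0 ab(2,3) hm hi]
  have f: "?f = (\<lambda>\<omega>. \<Sum>p\<in>UNIV. \<Sum>q\<in>UNIV. ?h p q \<omega> * (dB a b \<omega> $ p * dB a b \<omega> $ q))"
  proof
    fix \<omega>
    have b: "dB a b \<omega> = (\<Sum>p\<in>UNIV. dB a b \<omega> $ p *\<^sub>R axis p 1)"
      using basis_expansion[of "dB a b \<omega>"] by (simp add: scalar_mult_eq_scaleR)
    have c: "cprod (m a \<omega>) (dB a b \<omega>) = (\<Sum>p\<in>UNIV. dB a b \<omega> $ p *\<^sub>R cprod (m a \<omega>) (axis p 1))"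
      by (subst b) (simp add: cprod.sum_right cprod.scaleR_right)
    have "A \<omega> *v cprod (m a \<omega>) (dB a b \<omega>) = (\<Sum>p\<in>UNIV. dB a b \<omega> $ p *\<^sub>R (A \<omega> *v cprod (m a \<omega>) (axis p 1)))"
      unfolding c by (simp add: linear_sum[OF matrix_vector_mul_linear] matrix_vector_mult_scaleR)
    then show "?f \<omega> = (\<Sum>p\<in>UNIV. \<Sum>q\<in>UNIV. ?h p q \<omega> * (dB a b \<omega> $ p * dB a b \<omega> $ q))"
      unfolding c by (simp add: inner_sum_left inner_sum_right sum_distrib_left mult_ac) (subst sum.swap, simp add: mult_ac)
  qed
  show "integrable P ?f" unfolding f using e(1) by (intro Bochner_Integration.integrable_sum) auto
  have "expectation ?f = (\<Sum>p\<in>UNIV. \<Sum>q\<in>UNIV. expectation (?h p q) * (if p = q then b - a else 0))"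
    unfolding f using e by (simp add: Bochner_Integration.integral_sum)
  also have "\<dots> = (b - a) * (\<Sum>p\<in>UNIV. expectation (?h p p))"
    by (simp add: if_distrib[of "\<lambda>x. _ * x"] cong: if_cong) (simp add: sum_distrib_left mult.commute)
  also have "(\<Sum>p\<in>UNIV. expectation (?h p p)) = expectation (\<lambda>\<omega>. \<Sum>p\<in>UNIV. ?h p p \<omega>)"
    using hi by (intro Bochner_Integration.integral_sum[symmetric]) auto
  finally show "expectation ?f = (b - a) * expectation (\<lambda>\<omega>. \<Sum>p\<in>UNIV. ?h p p \<omega>)" .
qed

lemma integral_cell_const:
  fixes f :: "'a \<Rightarrow> real"
  assumes "integrable P f" "a \<le> b"
  shows "integrable PL (\<lambda>z. indicat_real {a<..b} (snd z) * f (fst z))"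
    "(\<integral>z. indicat_real {a<..b} (snd z) * f (fst z) \<partial>PL) = (b - a) * expectation f"
proof -
  have g: "integrable lborel (indicat_real {a<..b})" using assms(2) by (intro integrable_real_indicator) auto
  show "integrable PL (\<lambda>z. indicat_real {a<..b} (snd z) * f (fst z))"
    using integral_product(1)[OF assms(1) g] by (simp add: mult.commute)
  show "(\<integral>z. indicat_real {a<..b} (snd z) * f (fst z) \<partial>PL) = (b - a) * expectation f"
    using integral_product(2)[OF assms(1) g] assms(2) by (simp add: mult.commute)
qed

lemma integrable_state:
  fixes f :: "'n spins \<Rightarrow> 'b::{banach, second_countable_topology}"
  assumes "continuous_on sphere_prod f" "a \<in> {t..T}"
  shows "integrable P (\<lambda>\<omega>. f (m a \<omega>))"
proof -
  obtain K where K: "\<And>x. x \<in> sphere_prod \<Longrightarrow> norm (f x) \<le> K"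
    using compact_imp_bounded[OF compact_continuous_image[OF assms(1) compact_sphere_prod]] by (auto simp: bounded_iff)
  show ?thesis
    by (rule integrable_const_bound[of _ K])
      (use K m_sphere assms measurable_F_P[OF borel_measurable_state[OF assms]] in auto)
qed

section \<open>Expectations over a single cell\<close>

context
  fixes W :: "real \<Rightarrow> 'n spins \<Rightarrow> real"
  assumes W: "C12_M T W"
begin

lemma C12_section:
  assumes "a \<in> {0..T}"
  shows "continuous_on sphere_prod (W a)" "continuous_on sphere_prod (mgrad (W a))"
    "continuous_on sphere_prod (mhess (W a))" "continuous_on sphere_prod (laplace_beltrami (W a))"
proof -
  have sec: "continuous_on sphere_prod (f a)" if "continuous_on ({0..T} \<times> sphere_prod) (\<lambda>(s, x). f s x)" for f :: "real \<Rightarrow> 'n spins \<Rightarrow> 'b::topological_space"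
  proof -
    have "continuous_on sphere_prod (\<lambda>x. case (a, x) of (s, x) \<Rightarrow> f s x)"
      by (rule continuous_on_compose2[OF that]) (use assms in \<open>auto intro!: continuous_intros\<close>)
    then show ?thesis by simp
  qed
  show "continuous_on sphere_prod (W a)" "continuous_on sphere_prod (mgrad (W a))"
    using W by (auto intro!: sec simp: C12_M_def)
  show h: "continuous_on sphere_prod (mhess (W a))" by (rule sec[OF continuous_on_mhess[OF W]])
  show "continuous_on sphere_prod (laplace_beltrami (W a))"
    unfolding laplace_mhess[abs_def] by (intro continuous_on_sum continuous_on_component h)
qed

text \<open>The increment of \<open>W\<close> is split as \<open>W b (m b) - W a (m b)\<close> plus
  \<open>W a (m b) - W a (m a)\<close>. The time part thus has its state frozen at the right end,
  which does no harm because it is integrated path by path without any conditioning.\<close>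

lemma cell_time:
  assumes ab: "t \<le> a" "a \<le> b" "b \<le> T"
  shows "integrable PL (\<lambda>z. indicat_real {a<..b} (snd z) * dt_on T W (rr z) (m b (fst z)))"
    "(\<integral>z. indicat_real {a<..b} (snd z) * dt_on T W (rr z) (m b (fst z)) \<partial>PL) = expectation (\<lambda>\<omega>. W b (m b \<omega>) - W a (m b \<omega>))"
proof -
  obtain K where K: "K \<ge> 0"
    "\<And>s x. s \<in> {0..T} \<Longrightarrow> x \<in> sphere_prod \<Longrightarrow> \<bar>W s x\<bar> \<le> K"
    "\<And>s x. s \<in> {0..T} \<Longrightarrow> x \<in> sphere_prod \<Longrightarrow> \<bar>dt_on T W s x\<bar> \<le> K"
    "\<And>s x. s \<in> {0..T} \<Longrightarrow> x \<in> sphere_prod \<Longrightarrow> norm (mgrad (W s) x) \<le> K"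
    "\<And>s x. s \<in> {0..T} \<Longrightarrow> x \<in> sphere_prod \<Longrightarrow> norm (mhess (W s) x) \<le> K"
    by (rule C12_bounds[OF W]) blast
  have bT: "b \<in> {t..T}" using ab by auto
  have [measurable]: "m b \<in> borel_measurable P" by (rule m_meas[OF bT])
  have sp: "m b (fst z) \<in> sphere_prod" if "z \<in> space PL" for z
    using that bT by (intro m_sphere) (auto simp: space_pair_measure)
  have [measurable]: "(\<lambda>z. dt_on T W (rr z) (m b (fst z))) \<in> borel_measurable PL"
    using borel_measurable_time_state[of "\<lambda>(s, x). dt_on T W s x" "\<lambda>z. m b (fst z)"] W sp by (simp add: C12_M_def)
  show i: "integrable PL (\<lambda>z. indicat_real {a<..b} (snd z) * dt_on T W (rr z) (m b (fst z)))"
  proof (rule Bochner_Integration.integrable_bound[OF integrable_indicator_PL[of a b K]])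
    show "AE z in PL. norm (indicat_real {a<..b} (snd z) * dt_on T W (rr z) (m b (fst z))) \<le> norm (indicat_real {a<..b} (snd z) * K)"
      using K(3)[OF rr_in(1) sp] K(1) by (intro AE_I2) (simp add: indicator_def)
  qed measurable
  have "(\<integral>z. indicat_real {a<..b} (snd z) * dt_on T W (rr z) (m b (fst z)) \<partial>PL)
    = expectation (\<lambda>\<omega>. \<integral>r. indicat_real {a<..b} r * dt_on T W (rr (\<omega>, r)) (m b \<omega>) \<partial>lborel)"
    using PL.integral_fst'[OF i] by simp
  also have "\<dots> = expectation (\<lambda>\<omega>. W b (m b \<omega>) - W a (m b \<omega>))"
  proof (intro Bochner_Integration.integral_cong refl)
    fix \<omega> assume \<omega>: "\<omega> \<in> space P"
    have "(\<integral>r. indicat_real {a<..b} r * dt_on T W (rr (\<omega>, r)) (m b \<omega>) \<partial>lborel) = (\<integral>r. indicat_real {a<..b} r * dt_on T W r (m b \<omega>) \<partial>lborel)"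
      using ab by (intro Bochner_Integration.integral_cong refl) (auto simp: indicator_def rr_eq)
    also have "\<dots> = W b (m b \<omega>) - W a (m b \<omega>)"
      using ab t0 by (intro C12_FTC[OF W m_sphere[OF \<omega> bT]]) auto
    finally show "(\<integral>r. indicat_real {a<..b} r * dt_on T W (rr (\<omega>, r)) (m b \<omega>) \<partial>lborel) = W b (m b \<omega>) - W a (m b \<omega>)" .
  qed
  finally show "(\<integral>z. indicat_real {a<..b} (snd z) * dt_on T W (rr z) (m b (fst z)) \<partial>PL) = expectation (\<lambda>\<omega>. W b (m b \<omega>) - W a (m b \<omega>))" .
qed

text \<open>The gradient at the left end is bounded and \<open>F a\<close>-measurable, hence
  orthogonal to the Ito increment; in expectation only the drift remains.\<close>

lemma cell_gradient:
  assumes ab: "t \<le> a" "a \<le> b" "b \<le> T"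
  shows "integrable PL (\<lambda>z. indicat_real {a<..b} (snd z) * (mgrad (W a) (m a (fst z)) \<bullet> \<gamma> z))"
    "integrable P (\<lambda>\<omega>. mgrad (W a) (m a \<omega>) \<bullet> (m b \<omega> - m a \<omega>))"
    "expectation (\<lambda>\<omega>. mgrad (W a) (m a \<omega>) \<bullet> (m b \<omega> - m a \<omega>)) = (\<integral>z. indicat_real {a<..b} (snd z) * (mgrad (W a) (m a (fst z)) \<bullet> \<gamma> z) \<partial>PL)"
proof -
  obtain K where K: "K \<ge> 0"
    "\<And>s x. s \<in> {0..T} \<Longrightarrow> x \<in> sphere_prod \<Longrightarrow> \<bar>W s x\<bar> \<le> K"
    "\<And>s x. s \<in> {0..T} \<Longrightarrow> x \<in> sphere_prod \<Longrightarrow> \<bar>dt_on T W s x\<bar> \<le> K"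
    "\<And>s x. s \<in> {0..T} \<Longrightarrow> x \<in> sphere_prod \<Longrightarrow> norm (mgrad (W s) x) \<le> K"
    "\<And>s x. s \<in> {0..T} \<Longrightarrow> x \<in> sphere_prod \<Longrightarrow> norm (mhess (W s) x) \<le> K"
    by (rule C12_bounds[OF W]) blast
  have aT: "a \<in> {t..T}" "a \<in> {0..T}" "b \<in> {t..T}" using ab t0 by auto
  let ?g = "\<lambda>\<omega>. mgrad (W a) (m a \<omega>)"
  have gF: "?g \<in> borel_measurable (F a)" by (rule borel_measurable_state[OF C12_section(2)[OF aT(2)] aT(1)])
  have gP [measurable]: "?g \<in> borel_measurable P" by (rule measurable_F_P[OF gF])
  have [measurable]: "m a \<in> borel_measurable P" "m b \<in> borel_measurable P" using m_meas aT by auto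
  have gK: "norm (?g \<omega>) \<le> K" if "\<omega> \<in> space P" for \<omega> by (rule K(4)[OF aT(2) m_sphere[OF that aT(1)]])
  have [measurable]: "(\<lambda>z :: 'a \<times> real. ?g (fst z)) \<in> borel_measurable PL" by (rule measurable_compose[OF measurable_fst gP])
  show i: "integrable PL (\<lambda>z. indicat_real {a<..b} (snd z) * (?g (fst z) \<bullet> \<gamma> z))"
  proof (rule Bochner_Integration.integrable_bound[OF integrable_mult_right[of K PL "\<lambda>z. norm (indicat_real {a<..b} (snd z) *\<^sub>R \<gamma> z)"]])
    show "integrable PL (\<lambda>z. norm (indicat_real {a<..b} (snd z) *\<^sub>R \<gamma> z))" by (intro integrable_norm integrable_\<gamma> ab)
    show "AE z in PL. norm (indicat_real {a<..b} (snd z) * (?g (fst z) \<bullet> \<gamma> z)) \<le> norm (K * norm (indicat_real {a<..b} (snd z) *\<^sub>R \<gamma> z))"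
    proof (rule AE_I2)
      fix z assume "z \<in> space PL"
      then have "norm (?g (fst z)) \<le> K" by (intro gK) (auto simp: space_pair_measure)
      then have "\<bar>?g (fst z) \<bullet> \<gamma> z\<bar> \<le> K * norm (\<gamma> z)"
        by (intro order_trans[OF Cauchy_Schwarz_ineq2] mult_right_mono) auto
      then show "norm (indicat_real {a<..b} (snd z) * (?g (fst z) \<bullet> \<gamma> z)) \<le> norm (K * norm (indicat_real {a<..b} (snd z) *\<^sub>R \<gamma> z))"
        using K(1) by (simp add: indicator_def)
    qed
  qed measurable
  have mb: "norm (m b \<omega> - m a \<omega>) \<le> N + N" if "\<omega> \<in> space P" for \<omega>
    using that aT by (intro order_trans[OF norm_triangle_ineq4] add_mono m_bound) auto
  show iP: "integrable P (\<lambda>\<omega>. ?g \<omega> \<bullet> (m b \<omega> - m a \<omega>))"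
  proof (rule integrable_const_bound[of _ "K * (N + N)"])
    show "AE \<omega> in P. norm (?g \<omega> \<bullet> (m b \<omega> - m a \<omega>)) \<le> K * (N + N)"
    proof (rule AE_I2)
      fix \<omega> assume \<omega>: "\<omega> \<in> space P"
      show "norm (?g \<omega> \<bullet> (m b \<omega> - m a \<omega>)) \<le> K * (N + N)"
        unfolding real_norm_def using gK[OF \<omega>] mb[OF \<omega>] K(1) by (intro order_trans[OF Cauchy_Schwarz_ineq2] mult_mono) auto
    qed
  qed measurable
  note o = expectation_inner_ito_increment[OF ab gF gK]
  have AEi: "AE \<omega> in P. integrable lborel (\<lambda>r. indicat_real {a<..b} r *\<^sub>R \<gamma> (\<omega>, r))"
    using PL.AE_integrable_fst'[OF integrable_\<gamma>[OF ab(1,3)]] by simp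
  have d: "AE \<omega> in P. (\<integral>r. indicat_real {a<..b} (snd (\<omega>, r)) * (?g (fst (\<omega>, r)) \<bullet> \<gamma> (\<omega>, r)) \<partial>lborel) = ?g \<omega> \<bullet> drift \<gamma> a b \<omega>"
    using AEi
  proof eventually_elim
    case (elim \<omega>)
    have "(\<integral>r. ?g \<omega> \<bullet> (indicat_real {a<..b} r *\<^sub>R \<gamma> (\<omega>, r)) \<partial>lborel) = ?g \<omega> \<bullet> drift \<gamma> a b \<omega>"
      unfolding drift_def by (rule integral_inner_right) (rule elim)
    then show ?case by simp
  qed
  have ig: "integrable P (\<lambda>\<omega>. ?g \<omega> \<bullet> drift \<gamma> a b \<omega>)"
  proof -
    have "(\<lambda>\<omega>. ?g \<omega> \<bullet> drift \<gamma> a b \<omega>) \<in> borel_measurable P" by measurable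
    from integrable_cong_AE[OF borel_measurable_integrable[OF PL.integrable_fst'[OF i]] this d] PL.integrable_fst'[OF i]
    show ?thesis by blast
  qed
  have "expectation (\<lambda>\<omega>. ?g \<omega> \<bullet> (m b \<omega> - m a \<omega>)) = expectation (\<lambda>\<omega>. ?g \<omega> \<bullet> drift \<gamma> a b \<omega> + \<nu> * (?g \<omega> \<bullet> (I b \<omega> - I a \<omega>)))"
  proof (rule integral_cong_AE)
    show "AE \<omega> in P. ?g \<omega> \<bullet> (m b \<omega> - m a \<omega>) = ?g \<omega> \<bullet> drift \<gamma> a b \<omega> + \<nu> * (?g \<omega> \<bullet> (I b \<omega> - I a \<omega>))"
      using increment[OF ab] by eventually_elim (simp add: inner_add_right)
    show "(\<lambda>\<omega>. ?g \<omega> \<bullet> drift \<gamma> a b \<omega> + \<nu> * (?g \<omega> \<bullet> (I b \<omega> - I a \<omega>))) \<in> borel_measurable P" using ig o(1) by auto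
  qed measurable
  also have "\<dots> = expectation (\<lambda>\<omega>. ?g \<omega> \<bullet> drift \<gamma> a b \<omega>)" using ig o by simp
  also have "\<dots> = expectation (\<lambda>\<omega>. \<integral>r. indicat_real {a<..b} (snd (\<omega>, r)) * (?g (fst (\<omega>, r)) \<bullet> \<gamma> (\<omega>, r)) \<partial>lborel)"
    using d PL.integrable_fst'[OF i] ig by (intro integral_cong_AE) (auto simp: eq_commute)
  also have "\<dots> = (\<integral>z. indicat_real {a<..b} (snd z) * (?g (fst z) \<bullet> \<gamma> z) \<partial>PL)" by (rule PL.integral_fst'[OF i])
  finally show "expectation (\<lambda>\<omega>. ?g \<omega> \<bullet> (m b \<omega> - m a \<omega>)) = (\<integral>z. indicat_real {a<..b} (snd z) * (?g (fst z) \<bullet> \<gamma> z) \<partial>PL)" .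
qed

lemma cell_laplacian:
  assumes ab: "t \<le> a" "a \<le> b" "b \<le> T"
  shows "integrable PL (\<lambda>z. indicat_real {a<..b} (snd z) * laplace_beltrami (W a) (m a (fst z)))"
    "integrable P (\<lambda>\<omega>. (mhess (W a) (m a \<omega>) *v cprod (m a \<omega>) (dB a b \<omega>)) \<bullet> cprod (m a \<omega>) (dB a b \<omega>))"
    "expectation (\<lambda>\<omega>. (mhess (W a) (m a \<omega>) *v cprod (m a \<omega>) (dB a b \<omega>)) \<bullet> cprod (m a \<omega>) (dB a b \<omega>))
      = (\<integral>z. indicat_real {a<..b} (snd z) * laplace_beltrami (W a) (m a (fst z)) \<partial>PL)"
proof -
  obtain K where K: "K \<ge> 0"
    "\<And>s x. s \<in> {0..T} \<Longrightarrow> x \<in> sphere_prod \<Longrightarrow> \<bar>W s x\<bar> \<le> K"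
    "\<And>s x. s \<in> {0..T} \<Longrightarrow> x \<in> sphere_prod \<Longrightarrow> \<bar>dt_on T W s x\<bar> \<le> K"
    "\<And>s x. s \<in> {0..T} \<Longrightarrow> x \<in> sphere_prod \<Longrightarrow> norm (mgrad (W s) x) \<le> K"
    "\<And>s x. s \<in> {0..T} \<Longrightarrow> x \<in> sphere_prod \<Longrightarrow> norm (mhess (W s) x) \<le> K"
    by (rule C12_bounds[OF W]) blast
  have aT: "a \<in> {t..T}" "a \<in> {0..T}" using ab t0 by auto
  have A: "(\<lambda>\<omega>. mhess (W a) (m a \<omega>)) \<in> borel_measurable (F a)" by (rule borel_measurable_state[OF C12_section(3)[OF aT(2)] aT(1)])
  note e = expectation_hess[OF ab A K(5)[OF aT(2) m_sphere[OF _ aT(1)]]]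
  have l: "integrable P (\<lambda>\<omega>. laplace_beltrami (W a) (m a \<omega>))" by (rule integrable_state[OF C12_section(4)[OF aT(2)] aT(1)])
  show "integrable PL (\<lambda>z. indicat_real {a<..b} (snd z) * laplace_beltrami (W a) (m a (fst z)))"
    by (rule integral_cell_const(1)[OF l ab(2)])
  show "integrable P (\<lambda>\<omega>. (mhess (W a) (m a \<omega>) *v cprod (m a \<omega>) (dB a b \<omega>)) \<bullet> cprod (m a \<omega>) (dB a b \<omega>))" by (rule e(1))
  have "expectation (\<lambda>\<omega>. \<Sum>p\<in>UNIV. (mhess (W a) (m a \<omega>) *v cprod (m a \<omega>) (axis p 1)) \<bullet> cprod (m a \<omega>) (axis p 1))
    = expectation (\<lambda>\<omega>. laplace_beltrami (W a) (m a \<omega>))"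
    by (intro Bochner_Integration.integral_cong refl laplace_trace C12_diff(3)[OF W aT(2)] m_sphere aT(1))
  then show "expectation (\<lambda>\<omega>. (mhess (W a) (m a \<omega>) *v cprod (m a \<omega>) (dB a b \<omega>)) \<bullet> cprod (m a \<omega>) (dB a b \<omega>))
      = (\<integral>z. indicat_real {a<..b} (snd z) * laplace_beltrami (W a) (m a (fst z)) \<partial>PL)"
    using e(2) integral_cell_const(2)[OF l ab(2)] by simp
qed

text \<open>The spatial expansion with \<open>\<Delta> = b - a\<close>, in expectation. The noise
  moments give \<open>\<eta>\<close> times a dimensional constant times the cell length: the fourth
  moment is of order \<open>(b - a)^2\<close> and is divided by \<open>b - a\<close>.\<close>

lemma cell_estimate:
  assumes ab: "t \<le> a" "a < b" "b \<le> T" and \<eta>: "\<eta> > 0" and Cd: "D \<ge> 0" "d > 0"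
    and expand: "\<And>s x y V b \<Delta>. s \<in> {0..T} \<Longrightarrow> x \<in> sphere_prod \<Longrightarrow> y \<in> sphere_prod \<Longrightarrow> \<Delta> > 0 \<Longrightarrow>
      y - x = V + \<nu> *\<^sub>R cprod x b \<Longrightarrow>
      \<bar>W s y - W s x - mgrad (W s) x \<bullet> (y - x) - \<nu>\<^sup>2 / 2 * ((mhess (W s) x *v cprod x b) \<bullet> cprod x b)\<bar>
       \<le> D * (norm V)\<^sup>2 + \<eta> * (norm b)\<^sup>2 + \<eta> * (norm b) ^ 4 / \<Delta> + D * \<Delta> * (if norm (y - x) \<ge> d then 1 else 0)"
  shows "\<bar>expectation (\<lambda>\<omega>. W b (m b \<omega>)) - expectation (\<lambda>\<omega>. W a (m a \<omega>))
      - (\<integral>z. indicat_real {a<..b} (snd z) * (dt_on T W (rr z) (m b (fst z)) + mgrad (W a) (m a (fst z)) \<bullet> \<gamma> z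
          + \<nu>\<^sup>2 / 2 * laplace_beltrami (W a) (m a (fst z))) \<partial>PL)\<bar>
    \<le> D * (2 * expectation (\<lambda>\<omega>. (norm (drift \<gamma> a b \<omega>))\<^sup>2) + 2 * \<nu>\<^sup>2 * expectation (\<lambda>\<omega>. (norm (rem a b \<omega>))\<^sup>2))
      + \<eta> * (real CARD('n \<times> 3) + 3 * (real CARD('n \<times> 3))\<^sup>2) * (b - a)
      + D * (\<integral>z. indicat_real {a<..b} (snd z) * (if norm (m b (fst z) - m a (fst z)) \<ge> d then 1 else 0) \<partial>PL)"
proof -
  have ab': "a \<le> b" using ab by simp
  have aT: "a \<in> {t..T}" "a \<in> {0..T}" "b \<in> {t..T}" "b \<in> {0..T}" "0 \<le> a" using ab t0 by auto
  have [measurable]: "m a \<in> borel_measurable P" "m b \<in> borel_measurable P" "rem a b \<in> borel_measurable P"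
    using m_meas aT rem_meas ab by auto
  let ?V = "\<lambda>\<omega>. drift \<gamma> a b \<omega> + \<nu> *\<^sub>R rem a b \<omega>"
  let ?Q = "\<lambda>\<omega>. (mhess (W a) (m a \<omega>) *v cprod (m a \<omega>) (dB a b \<omega>)) \<bullet> cprod (m a \<omega>) (dB a b \<omega>)"
  let ?G = "\<lambda>\<omega>. mgrad (W a) (m a \<omega>) \<bullet> (m b \<omega> - m a \<omega>)"
  let ?\<chi> = "\<lambda>\<omega>. if norm (m b \<omega> - m a \<omega>) \<ge> d then 1 else 0 :: real"
  let ?err = "\<lambda>\<omega>. W a (m b \<omega>) - W a (m a \<omega>) - ?G \<omega> - \<nu>\<^sup>2 / 2 * ?Q \<omega>"
  let ?bd = "\<lambda>\<omega>. D * (2 * (norm (drift \<gamma> a b \<omega>))\<^sup>2 + 2 * \<nu>\<^sup>2 * (norm (rem a b \<omega>))\<^sup>2) + \<eta> * (norm (dB a b \<omega>))\<^sup>2 + \<eta> * (norm (dB a b \<omega>)) ^ 4 / (b - a) + D * (b - a) * ?\<chi> \<omega>"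
  note W1 = integrable_state[OF C12_section(1)[OF aT(4)] aT(3)] integrable_state[OF C12_section(1)[OF aT(2)] aT(3)]
    integrable_state[OF C12_section(1)[OF aT(2)] aT(1)]
  note ct = cell_time[OF ab(1) ab' ab(3)] and cg = cell_gradient[OF ab(1) ab' ab(3)] and cl = cell_laplacian[OF ab(1) ab' ab(3)]
  note dB = norm_dB_moments[OF aT(5) ab' ab(3)]
  obtain K where "K \<ge> 0" and iR: "\<And>a b. t \<le> a \<Longrightarrow> a \<le> b \<Longrightarrow> b \<le> T \<Longrightarrow> integrable P (\<lambda>\<omega>. (norm (rem a b \<omega>))\<^sup>2)"
    "\<And>a b. t \<le> a \<Longrightarrow> a \<le> b \<Longrightarrow> b \<le> T \<Longrightarrow> expectation (\<lambda>\<omega>. (norm (rem a b \<omega>))\<^sup>2) \<le>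
      K * (\<integral>z. indicat_real {a<..b} (snd z) * (norm (mm z - m a (fst z)))\<^sup>2 \<partial>PL)"
    by (rule rem_square) blast
  note R = iR(1)[OF ab(1) ab' ab(3)]
  note dr = drift_square(1)[OF \<gamma>_measurable ab(1) ab' ab(3) \<gamma>_sq]
  have i\<chi>: "integrable P ?\<chi>" by (rule integrable_const_bound[of _ 1]) auto
  have ierr: "integrable P ?err" using W1 cg cl by simp
  have ibd: "integrable P ?bd" using dr R dB i\<chi> by simp
  have err_bd: "AE \<omega> in P. \<bar>?err \<omega>\<bar> \<le> ?bd \<omega>"
    using increment[OF ab(1) ab' ab(3)] AE_space
  proof eventually_elim
    case (elim \<omega>)
    \<comment> \<open>The part \<open>V\<close> consists of the drift and of the error of freezing
      the noise coefficient.\<close>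
    have "m b \<omega> - m a \<omega> = ?V \<omega> + \<nu> *\<^sub>R cprod (m a \<omega>) (dB a b \<omega>)"
      unfolding elim(1) rem_def by (simp add: algebra_simps)
    from expand[OF aT(2) m_sphere[OF elim(2) aT(1)] m_sphere[OF elim(2) aT(3)] _ this, of "b - a"] ab
    have 1: "\<bar>?err \<omega>\<bar> \<le> D * (norm (?V \<omega>))\<^sup>2 + \<eta> * (norm (dB a b \<omega>))\<^sup>2 + \<eta> * (norm (dB a b \<omega>)) ^ 4 / (b - a) + D * (b - a) * ?\<chi> \<omega>"
      by simp
    have "(norm (?V \<omega>))\<^sup>2 \<le> (norm (drift \<gamma> a b \<omega>) + norm (\<nu> *\<^sub>R rem a b \<omega>))\<^sup>2" by (intro power_mono norm_triangle_ineq) auto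
    also have "\<dots> \<le> 2 * (norm (drift \<gamma> a b \<omega>))\<^sup>2 + 2 * (norm (\<nu> *\<^sub>R rem a b \<omega>))\<^sup>2"
      using zero_le_power2[of "norm (drift \<gamma> a b \<omega>) - norm (\<nu> *\<^sub>R rem a b \<omega>)"] unfolding power2_sum power2_diff by linarith
    also have "\<dots> = 2 * (norm (drift \<gamma> a b \<omega>))\<^sup>2 + 2 * \<nu>\<^sup>2 * (norm (rem a b \<omega>))\<^sup>2" by (simp add: power_mult_distrib)
    finally have "D * (norm (?V \<omega>))\<^sup>2 \<le> D * (2 * (norm (drift \<gamma> a b \<omega>))\<^sup>2 + 2 * \<nu>\<^sup>2 * (norm (rem a b \<omega>))\<^sup>2)"
      using Cd(1) by (rule mult_left_mono)
    with 1 show ?case by linarith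
  qed
  have ints: "integrable PL (\<lambda>z. indicat_real {a<..b} (snd z) * dt_on T W (rr z) (m b (fst z)))"
    "integrable PL (\<lambda>z. indicat_real {a<..b} (snd z) * (mgrad (W a) (m a (fst z)) \<bullet> \<gamma> z))"
    "integrable PL (\<lambda>z. \<nu>\<^sup>2 / 2 * (indicat_real {a<..b} (snd z) * laplace_beltrami (W a) (m a (fst z))))"
    using ct(1) cg(1) cl(1) by auto
  have "(\<integral>z. indicat_real {a<..b} (snd z) * (dt_on T W (rr z) (m b (fst z)) + mgrad (W a) (m a (fst z)) \<bullet> \<gamma> z
          + \<nu>\<^sup>2 / 2 * laplace_beltrami (W a) (m a (fst z))) \<partial>PL)
    = (\<integral>z. indicat_real {a<..b} (snd z) * dt_on T W (rr z) (m b (fst z)) + indicat_real {a<..b} (snd z) * (mgrad (W a) (m a (fst z)) \<bullet> \<gamma> z)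
          + \<nu>\<^sup>2 / 2 * (indicat_real {a<..b} (snd z) * laplace_beltrami (W a) (m a (fst z))) \<partial>PL)"
    by (intro Bochner_Integration.integral_cong refl) (simp add: algebra_simps)
  also have "\<dots> = expectation (\<lambda>\<omega>. W b (m b \<omega>) - W a (m b \<omega>)) + expectation ?G + \<nu>\<^sup>2 / 2 * expectation ?Q"
    using ints unfolding ct(2)[symmetric] cg(3) cl(3) by simp
  finally have "expectation (\<lambda>\<omega>. W b (m b \<omega>)) - expectation (\<lambda>\<omega>. W a (m a \<omega>))
      - (\<integral>z. indicat_real {a<..b} (snd z) * (dt_on T W (rr z) (m b (fst z)) + mgrad (W a) (m a (fst z)) \<bullet> \<gamma> z
          + \<nu>\<^sup>2 / 2 * laplace_beltrami (W a) (m a (fst z))) \<partial>PL) = expectation ?err"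
    using W1 cg(2) cl(2) by simp
  moreover have "\<bar>expectation ?err\<bar> \<le> expectation ?bd"
  proof -
    have "\<bar>expectation ?err\<bar> \<le> expectation (\<lambda>\<omega>. \<bar>?err \<omega>\<bar>)" by (rule integral_abs_bound)
    also have "\<dots> \<le> expectation ?bd" by (rule integral_mono_AE[OF integrable_abs[OF ierr] ibd err_bd])
    finally show ?thesis .
  qed
  moreover have "expectation ?bd = D * (2 * expectation (\<lambda>\<omega>. (norm (drift \<gamma> a b \<omega>))\<^sup>2) + 2 * \<nu>\<^sup>2 * expectation (\<lambda>\<omega>. (norm (rem a b \<omega>))\<^sup>2))
     + \<eta> * expectation (\<lambda>\<omega>. (norm (dB a b \<omega>))\<^sup>2) + \<eta> * expectation (\<lambda>\<omega>. (norm (dB a b \<omega>)) ^ 4) / (b - a) + D * (b - a) * expectation ?\<chi>"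
    using dr R dB i\<chi> by simp
  moreover have "\<eta> * expectation (\<lambda>\<omega>. (norm (dB a b \<omega>)) ^ 4) / (b - a) \<le> \<eta> * (3 * (real CARD('n \<times> 3))\<^sup>2 * (b - a)\<^sup>2) / (b - a)"
    using dB(4) \<eta> ab by (intro divide_right_mono mult_left_mono) auto
  moreover have "\<eta> * (3 * (real CARD('n \<times> 3))\<^sup>2 * (b - a)\<^sup>2) / (b - a) = \<eta> * (3 * (real CARD('n \<times> 3))\<^sup>2) * (b - a)"
    using ab by (simp add: power2_eq_square)
  moreover have "D * (b - a) * expectation ?\<chi> = D * (\<integral>z. indicat_real {a<..b} (snd z) * ?\<chi> (fst z) \<partial>PL)"
    using integral_cell_const(2)[OF i\<chi> ab'] by simp
  ultimately show ?thesis
    unfolding dB(2) by (simp only: distrib_left distrib_right mult.assoc)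
qed

section \<open>The generator and its Riemann sums\<close>

lemma time_state_tendsto:
  fixes f :: "real \<times> 'n spins \<Rightarrow> 'b::topological_space"
  assumes f: "continuous_on ({0..T} \<times> sphere_prod) f" and \<omega>: "\<omega> \<in> space P"
    and "\<And>n. a n \<in> {t..T}" "a \<longlonglongrightarrow> r" "\<And>n. c n \<in> {t..T}" "c \<longlonglongrightarrow> r" "r \<in> {t..T}"
  shows "(\<lambda>n. f (a n, m (c n) \<omega>)) \<longlonglongrightarrow> f (r, m r \<omega>)"
proof (rule continuous_on_tendsto_compose[OF f])
  show "(\<lambda>n. (a n, m (c n) \<omega>)) \<longlonglongrightarrow> (r, m r \<omega>)"
    by (intro tendsto_Pair m_tendsto[OF \<omega>] assms)
  show "(r, m r \<omega>) \<in> {0..T} \<times> sphere_prod" using assms(7) t0 m_sphere[OF \<omega>] by auto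
  show "\<forall>\<^sub>F n in sequentially. (a n, m (c n) \<omega>) \<in> {0..T} \<times> sphere_prod"
  proof (intro always_eventually allI)
    fix n show "(a n, m (c n) \<omega>) \<in> {0..T} \<times> sphere_prod"
      using assms(3)[of n] assms(5)[of n] t0 m_sphere[OF \<omega>] by auto
  qed
qed

text \<open>Written with the Stratonovich drift \<open>\<beta>\<close>, which is the one in the
  Hamilton-Jacobi-Bellman equation, whereas the cell formulas produce the Ito drift
  \<open>\<gamma>\<close>; \<open>generator_\<gamma>\<close> reconciles the two.\<close>

definition generator :: "'a \<times> real \<Rightarrow> real" where
  "generator z = dt_on T W (rr z) (mm z) + mgrad (W (rr z)) (mm z) \<bullet> \<beta> z + \<nu>\<^sup>2 / 2 * laplace_beltrami (W (rr z)) (mm z)"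

lemma continuous_on_laplace: "continuous_on ({0..T} \<times> sphere_prod) (\<lambda>(s, x). laplace_beltrami (W s) x)"
  unfolding laplace_mhess case_prod_unfold
  by (intro continuous_on_sum continuous_on_component) (use continuous_on_mhess[OF W] in \<open>simp add: case_prod_unfold\<close>)

lemma mm_sphere_PL: "z \<in> space PL \<Longrightarrow> mm z \<in> sphere_prod"
  by (intro mm_sphere) (auto simp: space_pair_measure)

lemma generator_\<gamma>:
  assumes "z \<in> space PL"
  shows "generator z = dt_on T W (rr z) (mm z) + mgrad (W (rr z)) (mm z) \<bullet> \<gamma> z + \<nu>\<^sup>2 / 2 * laplace_beltrami (W (rr z)) (mm z)"
  using tangent_inner_base[OF C12_tangent[OF W rr_in(1) mm_sphere_PL[OF assms], of z]]
  by (simp add: generator_def \<gamma>_def inner_diff_right)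

lemma generator_parts_measurable:
  "(\<lambda>z. dt_on T W (rr z) (mm z)) \<in> borel_measurable PL" "(\<lambda>z. mgrad (W (rr z)) (mm z)) \<in> borel_measurable PL"
  "(\<lambda>z. laplace_beltrami (W (rr z)) (mm z)) \<in> borel_measurable PL"
  using borel_measurable_time_state[of "\<lambda>(s, x). dt_on T W s x" mm] borel_measurable_time_state[of "\<lambda>(s, x). mgrad (W s) x" mm]
    borel_measurable_time_state[OF continuous_on_laplace, of mm] W mm_sphere_PL
  by (auto simp: C12_M_def)

lemma generator_integrable: "integrable PL (\<lambda>z. indicat_real {t<..T} (snd z) * generator z)"
  and riemann_generator:
    "(\<lambda>n. \<Sum>k<n. \<integral>z. indicat_real {grid t T n k<..grid t T n (Suc k)} (snd z) *
      (dt_on T W (rr z) (m (grid t T n (Suc k)) (fst z)) + mgrad (W (grid t T n k)) (m (grid t T n k) (fst z)) \<bullet> \<gamma> z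
        + \<nu>\<^sup>2 / 2 * laplace_beltrami (W (grid t T n k)) (m (grid t T n k) (fst z)) - generator z) \<partial>PL) \<longlonglongrightarrow> 0"
  and riemann_generator_integrable:
    "k < n \<Longrightarrow> integrable PL (\<lambda>z. indicat_real {grid t T n k<..grid t T n (Suc k)} (snd z) *
      (dt_on T W (rr z) (m (grid t T n (Suc k)) (fst z)) + mgrad (W (grid t T n k)) (m (grid t T n k) (fst z)) \<bullet> \<gamma> z
        + \<nu>\<^sup>2 / 2 * laplace_beltrami (W (grid t T n k)) (m (grid t T n k) (fst z)) - generator z))"
proof -
  obtain K where K: "K \<ge> 0"
    "\<And>s x. s \<in> {0..T} \<Longrightarrow> x \<in> sphere_prod \<Longrightarrow> \<bar>W s x\<bar> \<le> K"
    "\<And>s x. s \<in> {0..T} \<Longrightarrow> x \<in> sphere_prod \<Longrightarrow> \<bar>dt_on T W s x\<bar> \<le> K"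
    "\<And>s x. s \<in> {0..T} \<Longrightarrow> x \<in> sphere_prod \<Longrightarrow> norm (mgrad (W s) x) \<le> K"
    "\<And>s x. s \<in> {0..T} \<Longrightarrow> x \<in> sphere_prod \<Longrightarrow> norm (mhess (W s) x) \<le> K"
    by (rule C12_bounds[OF W]) blast
  have "bounded ((\<lambda>(s, x). laplace_beltrami (W s) x) ` ({0..T} \<times> sphere_prod))"
    by (intro compact_imp_bounded compact_continuous_image continuous_on_laplace compact_Times compact_Icc compact_sphere_prod)
  then obtain L where L: "\<And>s x. s \<in> {0..T} \<Longrightarrow> x \<in> sphere_prod \<Longrightarrow> \<bar>laplace_beltrami (W s) x\<bar> \<le> L"
    unfolding bounded_iff by fastforce
  note gm [measurable] = generator_parts_measurable
  have Gm: "generator \<in> borel_measurable PL" unfolding generator_def[abs_def] by measurable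
  \<comment> \<open>The drift is not bounded, so the majorant is affine in
    \<open>norm (\<gamma> z)\<close>; integrability over a bounded time interval follows from square
    integrability.\<close>
  define Dd where "Dd z = K + K * norm (\<gamma> z) + \<nu>\<^sup>2 / 2 * L" for z
  have Gb: "\<bar>x + g \<bullet> \<gamma> z + \<nu>\<^sup>2 / 2 * l\<bar> \<le> Dd z" if "\<bar>x\<bar> \<le> K" "norm g \<le> K" "\<bar>l\<bar> \<le> L" for x g l z
  proof -
    have "\<bar>g \<bullet> \<gamma> z\<bar> \<le> K * norm (\<gamma> z)" using that by (intro order_trans[OF Cauchy_Schwarz_ineq2] mult_right_mono) auto
    moreover have "\<bar>\<nu>\<^sup>2 / 2 * l\<bar> \<le> \<nu>\<^sup>2 / 2 * L" using that unfolding abs_mult by (intro mult_mono) auto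
    ultimately show ?thesis using that abs_triangle_ineq[of "x + g \<bullet> \<gamma> z" "\<nu>\<^sup>2 / 2 * l"] abs_triangle_ineq[of x "g \<bullet> \<gamma> z"]
      unfolding Dd_def by linarith
  qed
  have GD: "\<bar>generator z\<bar> \<le> Dd z" if "z \<in> space PL" for z
    unfolding generator_\<gamma>[OF that] using rr_in(1) mm_sphere_PL[OF that] by (intro Gb K L)
  have iD: "integrable PL (\<lambda>z. indicat_real {t<..T} (snd z) * Dd z)"
  proof -
    have "integrable PL (\<lambda>z. indicat_real {t<..T} (snd z) * (K + \<nu>\<^sup>2 / 2 * L) + K * norm (indicat_real {t<..T} (snd z) *\<^sub>R \<gamma> z))"
      by (intro Bochner_Integration.integrable_add integrable_indicator_PL integrable_mult_right integrable_norm integrable_\<gamma>) auto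
    then show ?thesis by (simp add: Dd_def algebra_simps)
  qed
  show "integrable PL (\<lambda>z. indicat_real {t<..T} (snd z) * generator z)"
  proof (rule Bochner_Integration.integrable_bound[OF iD])
    show "(\<lambda>z. indicat_real {t<..T} (snd z) * generator z) \<in> borel_measurable PL" using Gm by measurable
    show "AE z in PL. norm (indicat_real {t<..T} (snd z) * generator z) \<le> norm (indicat_real {t<..T} (snd z) * Dd z)"
    proof (rule AE_I2)
      fix z assume "z \<in> space PL"
      from GD[OF this] show "norm (indicat_real {t<..T} (snd z) * generator z) \<le> norm (indicat_real {t<..T} (snd z) * Dd z)"
        by (simp add: indicator_def)
    qed
  qed
  let ?\<phi> = "\<lambda>a b z. dt_on T W (rr z) (m b (fst z)) + mgrad (W a) (m a (fst z)) \<bullet> \<gamma> z + \<nu>\<^sup>2 / 2 * laplace_beltrami (W a) (m a (fst z)) - generator z"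
  have meas: "?\<phi> a b \<in> borel_measurable PL" if "t \<le> a" "a \<le> b" "b \<le> T" for a b
  proof -
    have aT: "a \<in> {t..T}" "b \<in> {t..T}" "a \<in> {0..T}" using that t0 by auto
    have [measurable]: "m b \<in> borel_measurable P" by (rule m_meas[OF aT(2)])
    have sp: "m b (fst z) \<in> sphere_prod" if "z \<in> space PL" for z
      using that aT by (intro m_sphere) (auto simp: space_pair_measure)
    have [measurable]: "(\<lambda>z. dt_on T W (rr z) (m b (fst z))) \<in> borel_measurable PL"
      using borel_measurable_time_state[of "\<lambda>(s, x). dt_on T W s x" "\<lambda>z. m b (fst z)"] W sp by (simp add: C12_M_def)
    have [measurable]: "(\<lambda>\<omega>. mgrad (W a) (m a \<omega>)) \<in> borel_measurable P" "(\<lambda>\<omega>. laplace_beltrami (W a) (m a \<omega>)) \<in> borel_measurable P"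
      using measurable_F_P[OF borel_measurable_state[OF C12_section(2)[OF aT(3)] aT(1)]]
        measurable_F_P[OF borel_measurable_state[OF C12_section(4)[OF aT(3)] aT(1)]] by auto
    show ?thesis using Gm by measurable
  qed
  have bound: "\<bar>?\<phi> a b z\<bar> \<le> 2 * Dd z" if "t \<le> a" "a < snd z" "snd z \<le> b" "b \<le> T" "fst z \<in> space P" for a b z
  proof -
    have z: "z \<in> space PL" using that by (cases z) (auto simp: space_pair_measure)
    have "\<bar>dt_on T W (rr z) (m b (fst z)) + mgrad (W a) (m a (fst z)) \<bullet> \<gamma> z + \<nu>\<^sup>2 / 2 * laplace_beltrami (W a) (m a (fst z))\<bar> \<le> Dd z"
      using that t0 by (intro Gb K L rr_in m_sphere) auto
    then show ?thesis using GD[OF z] by linarith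
  qed
  have conv: "(\<lambda>n. ?\<phi> (a n) (b n) z) \<longlonglongrightarrow> 0"
    if ab: "\<And>n. t \<le> a n \<and> a n < snd z \<and> snd z \<le> b n \<and> b n \<le> T" and lim: "a \<longlonglongrightarrow> snd z" "b \<longlonglongrightarrow> snd z" and \<omega>: "fst z \<in> space P" for a b z
  proof -
    have z: "z \<in> space PL" using \<omega> by (cases z) (auto simp: space_pair_measure)
    have r: "snd z \<in> {t..T}" using ab[of 0] by auto
    have an: "a n \<in> {t..T}" and bn: "b n \<in> {t..T}" for n using ab[of n] by auto
    have "(\<lambda>n. (case (snd z, m (b n) (fst z)) of (s, x) \<Rightarrow> dt_on T W s x)) \<longlonglongrightarrow> (case (snd z, m (snd z) (fst z)) of (s, x) \<Rightarrow> dt_on T W s x)"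
      using W r bn lim(2)
      by (intro time_state_tendsto[where f = "\<lambda>(s, x). dt_on T W s x" and a = "\<lambda>_. snd z" and c = b, OF _ \<omega>]) (auto simp: C12_M_def)
    then have 1: "(\<lambda>n. dt_on T W (rr z) (m (b n) (fst z))) \<longlonglongrightarrow> dt_on T W (rr z) (mm z)"
      by (simp add: rr_eq[OF r] mm_eq[OF r])
    have "(\<lambda>n. (case (a n, m (a n) (fst z)) of (s, x) \<Rightarrow> mgrad (W s) x)) \<longlonglongrightarrow> (case (snd z, m (snd z) (fst z)) of (s, x) \<Rightarrow> mgrad (W s) x)"
      using W by (intro time_state_tendsto \<omega> an lim(1) r) (simp add: C12_M_def)
    then have 2: "(\<lambda>n. mgrad (W (a n)) (m (a n) (fst z))) \<longlonglongrightarrow> mgrad (W (rr z)) (mm z)"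
      by (simp add: rr_eq[OF r] mm_eq[OF r])
    have "(\<lambda>n. (case (a n, m (a n) (fst z)) of (s, x) \<Rightarrow> laplace_beltrami (W s) x)) \<longlonglongrightarrow> (case (snd z, m (snd z) (fst z)) of (s, x) \<Rightarrow> laplace_beltrami (W s) x)"
      by (intro time_state_tendsto[OF continuous_on_laplace] \<omega> an lim(1) r)
    then have 3: "(\<lambda>n. laplace_beltrami (W (a n)) (m (a n) (fst z))) \<longlonglongrightarrow> laplace_beltrami (W (rr z)) (mm z)"
      by (simp add: rr_eq[OF r] mm_eq[OF r])
    have "(\<lambda>n. ?\<phi> (a n) (b n) z) \<longlonglongrightarrow> dt_on T W (rr z) (mm z) + mgrad (W (rr z)) (mm z) \<bullet> \<gamma> z + \<nu>\<^sup>2 / 2 * laplace_beltrami (W (rr z)) (mm z) - generator z"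
      by (intro tendsto_intros 1 2 3)
    then show ?thesis unfolding generator_\<gamma>[OF z] by simp
  qed
  have iD2: "integrable PL (\<lambda>z. indicat_real {t<..T} (snd z) * (2 * Dd z))"
    using integrable_mult_right[OF iD, of 2] by (simp add: mult.left_commute)
  show "(\<lambda>n. \<Sum>k<n. \<integral>z. indicat_real {grid t T n k<..grid t T n (Suc k)} (snd z) * ?\<phi> (grid t T n k) (grid t T n (Suc k)) z \<partial>PL) \<longlonglongrightarrow> 0"
    by (rule riemann_vanish(1)[where \<phi> = ?\<phi>, OF tT meas iD2 bound conv])
  show "k < n \<Longrightarrow> integrable PL (\<lambda>z. indicat_real {grid t T n k<..grid t T n (Suc k)} (snd z) * ?\<phi> (grid t T n k) (grid t T n (Suc k)) z)"
    by (rule riemann_vanish(2)[where \<phi> = ?\<phi>, OF tT meas iD2 bound conv])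
qed

text \<open>By continuity of the path the indicator is eventually zero along cells shrinking to a
  fixed time.\<close>

lemma large_increments_vanish:
  assumes d: "d > 0"
  shows "(\<lambda>n. \<Sum>k<n. \<integral>z. indicat_real {grid t T n k<..grid t T n (Suc k)} (snd z) *
    (if norm (m (grid t T n (Suc k)) (fst z) - m (grid t T n k) (fst z)) \<ge> d then 1 else 0) \<partial>PL) \<longlonglongrightarrow> 0"
proof (rule riemann_vanish(1)[where \<phi> = "\<lambda>a b z. if norm (m b (fst z) - m a (fst z)) \<ge> d then 1 else 0" and D = "\<lambda>_. 1"])
  show "t \<le> T" by (rule tT)
  show "(\<lambda>z. if norm (m b (fst z) - m a (fst z)) \<ge> d then 1 else 0 :: real) \<in> borel_measurable PL" if "t \<le> a" "a \<le> b" "b \<le> T" for a b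
  proof -
    have [measurable]: "m a \<in> borel_measurable P" "m b \<in> borel_measurable P" using that by (auto intro!: m_meas)
    show ?thesis by measurable
  qed
  show "integrable PL (\<lambda>z. indicat_real {t<..T} (snd z) * 1)" by (rule integrable_indicator_PL)
  show "(\<lambda>n. if norm (m (b n) (fst z) - m (a n) (fst z)) \<ge> d then 1 else 0 :: real) \<longlonglongrightarrow> 0"
    if ab: "\<And>n. t \<le> a n \<and> a n < snd z \<and> snd z \<le> b n \<and> b n \<le> T" and lim: "a \<longlonglongrightarrow> snd z" "b \<longlonglongrightarrow> snd z" and \<omega>: "fst z \<in> space P" for a b z
  proof -
    have r: "snd z \<in> {t..T}" using ab[of 0] by auto
    have an: "a n \<in> {t..T}" and bn: "b n \<in> {t..T}" for n using ab[of n] by auto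
    have "(\<lambda>n. norm (m (b n) (fst z) - m (a n) (fst z))) \<longlonglongrightarrow> norm (m (snd z) (fst z) - m (snd z) (fst z))"
      by (intro tendsto_norm tendsto_diff m_tendsto \<omega> an bn r lim)
    then have "\<forall>\<^sub>F n in sequentially. norm (m (b n) (fst z) - m (a n) (fst z)) < d"
      using d by (intro order_tendstoD(2)[where a = d]) auto
    then show ?thesis by (intro tendsto_eventually) (auto elim!: eventually_mono)
  qed
qed auto

text \<open>The order of limits matters: \<open>\<eta>\<close> is fixed and determines
  \<open>D\<close> and \<open>d\<close>; then refining the grid removes every error except a
  multiple of \<open>\<eta>\<close>; only then is \<open>\<eta>\<close> sent to zero.\<close>

lemma ito_formula:
  "expectation (\<lambda>\<omega>. W T (m T \<omega>)) - expectation (\<lambda>\<omega>. W t (m t \<omega>)) = (\<integral>z. indicat_real {t<..T} (snd z) * generator z \<partial>PL)"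
proof (cases "t = T")
  case False
  \<comment> \<open>Strict inequality gives cells of positive length, by which the fourth moments
    are divided.\<close>
  then have tT': "t < T" using tT by simp
  let ?x = "expectation (\<lambda>\<omega>. W T (m T \<omega>)) - expectation (\<lambda>\<omega>. W t (m t \<omega>)) - (\<integral>z. indicat_real {t<..T} (snd z) * generator z \<partial>PL)"
  \<comment> \<open>Second moment of the noise plus the bound for its fourth moment, both per unit
    of time.\<close>
  define \<kappa> where "\<kappa> = real CARD('n \<times> 3) + 3 * (real CARD('n \<times> 3))\<^sup>2"
  have main: "\<bar>?x\<bar> \<le> \<eta> * \<kappa> * (T - t)" if \<eta>: "\<eta> > 0" for \<eta>
  proof -
    obtain D d where Dd: "D \<ge> 0" "d > 0" "\<And>s x y V b \<Delta>. s \<in> {0..T} \<Longrightarrow> x \<in> sphere_prod \<Longrightarrow> y \<in> sphere_prod \<Longrightarrow> \<Delta> > 0 \<Longrightarrow>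
      y - x = V + \<nu> *\<^sub>R cprod x b \<Longrightarrow>
      \<bar>W s y - W s x - mgrad (W s) x \<bullet> (y - x) - \<nu>\<^sup>2 / 2 * ((mhess (W s) x *v cprod x b) \<bullet> cprod x b)\<bar>
       \<le> D * (norm V)\<^sup>2 + \<eta> * (norm b)\<^sup>2 + \<eta> * (norm b) ^ 4 / \<Delta> + D * \<Delta> * (if norm (y - x) \<ge> d then 1 else 0)"
      by (rule C12_expansion[OF W \<eta> nu]) blast
    let ?g = "grid t T"
    let ?H = "\<lambda>n k z. dt_on T W (rr z) (m (?g n (Suc k)) (fst z)) + mgrad (W (?g n k)) (m (?g n k) (fst z)) \<bullet> \<gamma> z
        + \<nu>\<^sup>2 / 2 * laplace_beltrami (W (?g n k)) (m (?g n k) (fst z))"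
    let ?ind = "\<lambda>n k z. indicat_real {?g n k<..?g n (Suc k)} (snd z)"
    let ?X = "\<lambda>n. \<Sum>k<n. \<integral>z. ?ind n k z * (?H n k z - generator z) \<partial>PL"
    let ?v1 = "\<lambda>n k. expectation (\<lambda>\<omega>. (norm (drift \<gamma> (?g n k) (?g n (Suc k)) \<omega>))\<^sup>2)"
    let ?v2 = "\<lambda>n k. expectation (\<lambda>\<omega>. (norm (rem (?g n k) (?g n (Suc k)) \<omega>))\<^sup>2)"
    let ?c = "\<lambda>n k. \<integral>z. ?ind n k z * (if norm (m (?g n (Suc k)) (fst z) - m (?g n k) (fst z)) \<ge> d then 1 else 0) \<partial>PL"
    let ?w = "\<lambda>s. expectation (\<lambda>\<omega>. W s (m s \<omega>))"
    have bnd: "\<bar>?x\<bar> \<le> \<bar>?X n\<bar> + (D * (2 * (\<Sum>k<n. ?v1 n k) + 2 * \<nu>\<^sup>2 * (\<Sum>k<n. ?v2 n k)) + \<eta> * \<kappa> * (T - t) + D * (\<Sum>k<n. ?c n k))" if n: "n > 0" for n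
    proof -
      have iG: "integrable PL (\<lambda>z. ?ind n k z * generator z)" if "k < n" for k
        by (rule sum_cell_integrals(2)[OF tT n generator_integrable that])
      have sG: "(\<Sum>k<n. \<integral>z. ?ind n k z * generator z \<partial>PL) = (\<integral>z. indicat_real {t<..T} (snd z) * generator z \<partial>PL)"
        by (rule sum_cell_integrals(1)[OF tT n generator_integrable])
      have H: "(\<integral>z. ?ind n k z * ?H n k z \<partial>PL) = (\<integral>z. ?ind n k z * (?H n k z - generator z) \<partial>PL) + (\<integral>z. ?ind n k z * generator z \<partial>PL)" if "k < n" for k
        by (subst Bochner_Integration.integral_add[OF riemann_generator_integrable[OF that] iG[OF that], symmetric])
          (simp add: algebra_simps)
      have "?x = (\<Sum>k<n. ?w (?g n (Suc k)) - ?w (?g n k)) - (\<Sum>k<n. \<integral>z. ?ind n k z * generator z \<partial>PL)"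
        unfolding sG sum_grid_telescope[OF n, of ?w] ..
      also have "\<dots> = (\<Sum>k<n. ?w (?g n (Suc k)) - ?w (?g n k) - (\<integral>z. ?ind n k z * ?H n k z \<partial>PL)) + ?X n"
        unfolding sum_subtractf[symmetric] sum.distrib[symmetric]
      proof (intro sum.cong refl)
        fix j assume "j \<in> {..<n}"
        then have j: "j < n" by simp
        show "?w (?g n (Suc j)) - ?w (?g n j) - (\<integral>z. ?ind n j z * generator z \<partial>PL)
          = ?w (?g n (Suc j)) - ?w (?g n j) - (\<integral>z. ?ind n j z * ?H n j z \<partial>PL) + (\<integral>z. ?ind n j z * (?H n j z - generator z) \<partial>PL)"
          unfolding H[OF j] by simp
      qed
      finally have "\<bar>?x\<bar> \<le> \<bar>\<Sum>k<n. ?w (?g n (Suc k)) - ?w (?g n k) - (\<integral>z. ?ind n k z * ?H n k z \<partial>PL)\<bar> + \<bar>?X n\<bar>"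
        by linarith
      also have "\<bar>\<Sum>k<n. ?w (?g n (Suc k)) - ?w (?g n k) - (\<integral>z. ?ind n k z * ?H n k z \<partial>PL)\<bar>
        \<le> (\<Sum>k<n. D * (2 * ?v1 n k + 2 * \<nu>\<^sup>2 * ?v2 n k) + \<eta> * \<kappa> * (?g n (Suc k) - ?g n k) + D * ?c n k)"
      proof (rule order_trans[OF sum_abs sum_mono])
        fix j assume "j \<in> {..<n}"
        then have j: "j < n" by simp
        have "?g n j < ?g n (Suc j)" using grid_step[of t T n j] tT' n divide_pos_pos[of "T - t" "real n"] by linarith
        then show "\<bar>?w (?g n (Suc j)) - ?w (?g n j) - (\<integral>z. ?ind n j z * ?H n j z \<partial>PL)\<bar>
          \<le> D * (2 * ?v1 n j + 2 * \<nu>\<^sup>2 * ?v2 n j) + \<eta> * \<kappa> * (?g n (Suc j) - ?g n j) + D * ?c n j"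
          unfolding \<kappa>_def using j grid_ge[OF tT, of n j] grid_le[OF tT, of "Suc j" n]
          by (intro cell_estimate[OF _ _ _ \<eta> Dd]) auto
      qed
      also have "\<dots> = D * (2 * (\<Sum>k<n. ?v1 n k) + 2 * \<nu>\<^sup>2 * (\<Sum>k<n. ?v2 n k)) + \<eta> * \<kappa> * (T - t) + D * (\<Sum>k<n. ?c n k)"
        unfolding sum.distrib sum_distrib_left[symmetric] using sum_grid_const[OF n, of "\<eta> * \<kappa>" t T] by (simp add: sum_distrib_left)
      finally show ?thesis by simp
    qed
    have TT: "T \<in> {t..T}" using tT by simp
    have "(\<lambda>n. \<bar>?X n\<bar> + (D * (2 * (\<Sum>k<n. ?v1 n k) + 2 * \<nu>\<^sup>2 * (\<Sum>k<n. ?v2 n k)) + \<eta> * \<kappa> * (T - t) + D * (\<Sum>k<n. ?c n k)))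
       \<longlonglongrightarrow> \<bar>0\<bar> + (D * (2 * 0 + 2 * \<nu>\<^sup>2 * 0) + \<eta> * \<kappa> * (T - t) + D * 0)"
      by (intro tendsto_add tendsto_rabs tendsto_mult_left tendsto_const riemann_generator large_increments_vanish[OF Dd(2)]
          sum_rem_square_tendsto[OF TT] sum_drift_square_tendsto[OF \<gamma>_measurable tT \<gamma>_sq])
    then have "\<bar>?x\<bar> \<le> \<bar>0\<bar> + (D * (2 * 0 + 2 * \<nu>\<^sup>2 * 0) + \<eta> * \<kappa> * (T - t) + D * 0)"
      by (rule LIMSEQ_le_const) (use bnd in \<open>intro exI[of _ 1] allI impI\<close>, simp)
    then show ?thesis by simp
  qed
  have "\<bar>?x\<bar> \<le> 0"
  proof (rule field_le_epsilon)
    fix e :: real assume e: "e > 0"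
    have c: "\<kappa> * (T - t) + 1 > 0" using tT' by (auto simp: \<kappa>_def intro!: add_nonneg_pos mult_nonneg_nonneg)
    have "\<bar>?x\<bar> \<le> e / (\<kappa> * (T - t) + 1) * (\<kappa> * (T - t))" using main[of "e / (\<kappa> * (T - t) + 1)"] e c by (simp add: mult.assoc)
    also have "\<dots> \<le> e / (\<kappa> * (T - t) + 1) * (\<kappa> * (T - t) + 1)" using e c by (intro mult_left_mono) auto
    also have "\<dots> = e" using c by simp
    finally show "\<bar>?x\<bar> \<le> 0 + e" by simp
  qed
  then show ?thesis by simp
qed simp

end
end

section \<open>The closed loop\<close>

text \<open>Skewness moves each cross product onto \<open>g\<close>, and two of them turn the
  tangent vector \<open>g\<close> into \<open>- g\<close>. Up to the factor
  \<open>Cext / lam\<close>, the bracket on the right is the feedback law.\<close>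

lemma feedback_adjoint:
  assumes x: "x \<in> sphere_prod" and g: "g \<in> tangent_space x"
  shows "(cprod x w - \<alpha> *\<^sub>R cprod x (cprod x w)) \<bullet> g = - (w \<bullet> (cprod x g - \<alpha> *\<^sub>R g))"
proof -
  have "cprod x (cprod x w) \<bullet> g = w \<bullet> cprod x (cprod x g)" by (simp add: cprod_skew)
  then show ?thesis
    by (simp add: inner_diff_left inner_diff_right cprod_skew cprod_cprod_tangent[OF x g])
qed

text \<open>Completing the square in the Hamiltonian: the supremum is attained exactly at the feedback control.\<close>

lemma hjb_square:
  assumes hjb: "hjb_solution T \<alpha> Cext Q \<nu> \<delta> lam mt h W" and lam: "lam > 0"
    and s: "s \<in> {0..<T}" and x: "x \<in> sphere_prod"
  shows "dt_on T W s x + mgrad (W s) x \<bullet> llg_drift \<alpha> Cext Q x v + \<nu>\<^sup>2 / 2 * laplace_beltrami (W s) x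
      + (\<delta> * (norm (x - mt s))\<^sup>2 + lam / 2 * (norm v)\<^sup>2)
    = lam / 2 * (norm (v - feedback \<alpha> Cext lam W s x))\<^sup>2"
proof -
  have W: "C12_M T W" using hjb by (simp add: hjb_solution_def)
  let ?g = "mgrad (W s) x" and ?u = "feedback \<alpha> Cext lam W s x"
  have g: "?g \<in> tangent_space x" using s by (intro C12_tangent[OF W _ x]) auto
  let ?F = "\<lambda>u. - (llg_drift \<alpha> Cext Q x u \<bullet> ?g) - lam / 2 * (norm u)\<^sup>2"
  \<comment> \<open>The drift is affine in the control, so the Hamiltonian is a concave quadratic in
    it with Hessian \<open>- lam\<close>.\<close>
  have lin: "llg_drift \<alpha> Cext Q x (?u + w) = llg_drift \<alpha> Cext Q x ?u + Cext *\<^sub>R (cprod x w - \<alpha> *\<^sub>R cprod x (cprod x w))" for w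
  proof -
    have e: "- (Q *v x) + Cext *\<^sub>R (?u + w) = (- (Q *v x) + Cext *\<^sub>R ?u) + Cext *\<^sub>R w" by (simp add: scaleR_add_right)
    show ?thesis unfolding llg_drift_eq Let_def e cprod.add_right cprod.scaleR_right
      by (simp add: scaleR_add_right scaleR_diff_right mult.commute)
  qed
  have F: "?F v = ?F ?u - lam / 2 * (norm (v - ?u))\<^sup>2" for v
  proof -
    define w where "w = v - ?u"
    have v: "v = ?u + w" by (simp add: w_def)
    have "Cext * ((cprod x w - \<alpha> *\<^sub>R cprod x (cprod x w)) \<bullet> ?g) = - (lam * (w \<bullet> ?u))"
      unfolding feedback_adjoint[OF x g] using lam by (simp add: feedback_def)
    then have "llg_drift \<alpha> Cext Q x v \<bullet> ?g = llg_drift \<alpha> Cext Q x ?u \<bullet> ?g - lam * (w \<bullet> ?u)"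
      unfolding v lin by (simp add: inner_add_left)
    moreover have "(norm v)\<^sup>2 = (norm ?u)\<^sup>2 + 2 * (w \<bullet> ?u) + (norm w)\<^sup>2"
      unfolding v by (simp add: power2_norm_eq_inner inner_add_left inner_add_right inner_commute)
    ultimately show ?thesis by (simp add: w_def[symmetric] algebra_simps)
  qed
  have "(SUP u. ?F u) = ?F ?u"
  proof (rule cSup_eq_maximum)
    show "?F ?u \<in> range ?F" by blast
    fix y assume "y \<in> range ?F"
    then obtain v where "y = ?F v" by blast
    then show "y \<le> ?F ?u" using F[of v] lam by simp
  qed
  moreover have "- dt_on T W s x + hamiltonian \<alpha> Cext Q \<nu> \<delta> lam mt s (W s) x = 0"
    using hjb s x by (auto simp: hjb_solution_def)
  ultimately show ?thesis
    using F[of v] by (simp add: hamiltonian_def inner_commute)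
qed

text \<open>Boundedness is part of the notion because it makes the class closed under cross
  products; all fields of interest are built from the state and the gradient by sums, linear maps
  and cross products.\<close>

definition bounded_lipschitz :: "real \<Rightarrow> (real \<Rightarrow> 'n::finite spins \<Rightarrow> 'n spins) \<Rightarrow> bool" where
  "bounded_lipschitz T \<phi> \<longleftrightarrow> (\<exists>L A. 0 \<le> L \<and> 0 \<le> A \<and> (\<forall>s\<in>{0..T}. \<forall>x\<in>sphere_prod. norm (\<phi> s x) \<le> A \<and>
    (\<forall>y\<in>sphere_prod. norm (\<phi> s x - \<phi> s y) \<le> L * norm (x - y))))"

lemma bounded_lipschitzE:
  assumes "bounded_lipschitz T \<phi>"
  obtains L A where "0 \<le> L" "0 \<le> A" "\<And>s x. s \<in> {0..T} \<Longrightarrow> x \<in> sphere_prod \<Longrightarrow> norm (\<phi> s x) \<le> A"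
    "\<And>s x y. s \<in> {0..T} \<Longrightarrow> x \<in> sphere_prod \<Longrightarrow> y \<in> sphere_prod \<Longrightarrow> norm (\<phi> s x - \<phi> s y) \<le> L * norm (x - y)"
  using assms unfolding bounded_lipschitz_def by (elim exE conjE) blast

lemma bounded_lipschitzI:
  assumes "0 \<le> L" "0 \<le> A" "\<And>s x. s \<in> {0..T} \<Longrightarrow> x \<in> sphere_prod \<Longrightarrow> norm (\<phi> s x) \<le> A"
    "\<And>s x y. s \<in> {0..T} \<Longrightarrow> x \<in> sphere_prod \<Longrightarrow> y \<in> sphere_prod \<Longrightarrow> norm (\<phi> s x - \<phi> s y) \<le> L * norm (x - y)"
  shows "bounded_lipschitz T \<phi>"
  unfolding bounded_lipschitz_def using assms by (intro exI[of _ L] exI[of _ A]) auto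

lemma bounded_lipschitz_add:
  assumes "bounded_lipschitz T \<phi>" "bounded_lipschitz T \<psi>"
  shows "bounded_lipschitz T (\<lambda>s x. \<phi> s x + \<psi> s x)"
proof -
  obtain L A where 1: "0 \<le> L" "0 \<le> A" "\<And>s x. s \<in> {0..T} \<Longrightarrow> x \<in> sphere_prod \<Longrightarrow> norm (\<phi> s x) \<le> A"
    "\<And>s x y. s \<in> {0..T} \<Longrightarrow> x \<in> sphere_prod \<Longrightarrow> y \<in> sphere_prod \<Longrightarrow> norm (\<phi> s x - \<phi> s y) \<le> L * norm (x - y)"
    by (rule bounded_lipschitzE[OF assms(1)]) blast
  obtain M D where 2: "0 \<le> M" "0 \<le> D" "\<And>s x. s \<in> {0..T} \<Longrightarrow> x \<in> sphere_prod \<Longrightarrow> norm (\<psi> s x) \<le> D"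
    "\<And>s x y. s \<in> {0..T} \<Longrightarrow> x \<in> sphere_prod \<Longrightarrow> y \<in> sphere_prod \<Longrightarrow> norm (\<psi> s x - \<psi> s y) \<le> M * norm (x - y)"
    by (rule bounded_lipschitzE[OF assms(2)]) blast
  show ?thesis
  proof (rule bounded_lipschitzI[of "L + M" "A + D"])
    fix s x assume s: "s \<in> {0..T}" and x: "x \<in> (sphere_prod :: 'a spins set)"
    show "norm (\<phi> s x + \<psi> s x) \<le> A + D" by (intro order_trans[OF norm_triangle_ineq] add_mono 1 2 s x)
    fix y assume y: "y \<in> (sphere_prod :: 'a spins set)"
    have "\<phi> s x + \<psi> s x - (\<phi> s y + \<psi> s y) = (\<phi> s x - \<phi> s y) + (\<psi> s x - \<psi> s y)" by simp
    also have "norm \<dots> \<le> L * norm (x - y) + M * norm (x - y)"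
      by (intro order_trans[OF norm_triangle_ineq] add_mono 1 2 s x y)
    finally show "norm (\<phi> s x + \<psi> s x - (\<phi> s y + \<psi> s y)) \<le> (L + M) * norm (x - y)" by (simp add: distrib_right)
  qed (use 1 2 in auto)
qed

lemma bounded_lipschitz_linear:
  assumes "bounded_lipschitz T \<phi>" "bounded_linear f"
  shows "bounded_lipschitz T (\<lambda>s x. f (\<phi> s x))"
proof -
  obtain L A where 1: "0 \<le> L" "0 \<le> A" "\<And>s x. s \<in> {0..T} \<Longrightarrow> x \<in> sphere_prod \<Longrightarrow> norm (\<phi> s x) \<le> A"
    "\<And>s x y. s \<in> {0..T} \<Longrightarrow> x \<in> sphere_prod \<Longrightarrow> y \<in> sphere_prod \<Longrightarrow> norm (\<phi> s x - \<phi> s y) \<le> L * norm (x - y)"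
    by (rule bounded_lipschitzE[OF assms(1)]) blast
  obtain K where K: "K > 0" "\<And>v. norm (f v) \<le> norm v * K" using bounded_linear.pos_bounded[OF assms(2)] by blast
  interpret f: bounded_linear f by fact
  show ?thesis
  proof (rule bounded_lipschitzI[of "L * K" "A * K"])
    fix s x assume s: "s \<in> {0..T}" and x: "x \<in> (sphere_prod :: 'a spins set)"
    show "norm (f (\<phi> s x)) \<le> A * K" using 1(3)[OF s x] K by (intro order_trans[OF K(2)] mult_right_mono) auto
    fix y assume y: "y \<in> (sphere_prod :: 'a spins set)"
    have "norm (f (\<phi> s x - \<phi> s y)) \<le> (L * norm (x - y)) * K"
      using 1(4)[OF s x y] K by (intro order_trans[OF K(2)] mult_right_mono) auto
    then show "norm (f (\<phi> s x) - f (\<phi> s y)) \<le> L * K * norm (x - y)" by (simp add: f.diff mult_ac)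
  qed (use 1 K in auto)
qed

lemma bounded_lipschitz_cprod:
  assumes "bounded_lipschitz T \<phi>" "bounded_lipschitz T \<psi>"
  shows "bounded_lipschitz T (\<lambda>s x. cprod (\<phi> s x) (\<psi> s x))"
proof -
  obtain L A where 1: "0 \<le> L" "0 \<le> A" "\<And>s x. s \<in> {0..T} \<Longrightarrow> x \<in> sphere_prod \<Longrightarrow> norm (\<phi> s x) \<le> A"
    "\<And>s x y. s \<in> {0..T} \<Longrightarrow> x \<in> sphere_prod \<Longrightarrow> y \<in> sphere_prod \<Longrightarrow> norm (\<phi> s x - \<phi> s y) \<le> L * norm (x - y)"
    by (rule bounded_lipschitzE[OF assms(1)]) blast
  obtain M D where 2: "0 \<le> M" "0 \<le> D" "\<And>s x. s \<in> {0..T} \<Longrightarrow> x \<in> sphere_prod \<Longrightarrow> norm (\<psi> s x) \<le> D"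
    "\<And>s x y. s \<in> {0..T} \<Longrightarrow> x \<in> sphere_prod \<Longrightarrow> y \<in> sphere_prod \<Longrightarrow> norm (\<psi> s x - \<psi> s y) \<le> M * norm (x - y)"
    by (rule bounded_lipschitzE[OF assms(2)]) blast
  show ?thesis
  proof (rule bounded_lipschitzI[of "L * D + A * M" "A * D"])
    fix s x assume s: "s \<in> {0..T}" and x: "x \<in> (sphere_prod :: 'a spins set)"
    show "norm (cprod (\<phi> s x) (\<psi> s x)) \<le> A * D" using 1 2 s x by (intro order_trans[OF norm_cprod_le] mult_mono) auto
    fix y assume y: "y \<in> (sphere_prod :: 'a spins set)"
    have "cprod (\<phi> s x) (\<psi> s x) - cprod (\<phi> s y) (\<psi> s y) = cprod (\<phi> s x - \<phi> s y) (\<psi> s x) + cprod (\<phi> s y) (\<psi> s x - \<psi> s y)"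
      by (simp add: cprod.diff_left cprod.diff_right)
    also have "norm \<dots> \<le> (L * norm (x - y)) * D + A * (M * norm (x - y))"
      using 1 2 s x y by (intro order_trans[OF norm_triangle_ineq] add_mono order_trans[OF norm_cprod_le] mult_mono) auto
    finally show "norm (cprod (\<phi> s x) (\<psi> s x) - cprod (\<phi> s y) (\<psi> s y)) \<le> (L * D + A * M) * norm (x - y)"
      by (simp add: algebra_simps)
  qed (use 1 2 in auto)
qed

lemma bounded_lipschitz_state: "bounded_lipschitz T (\<lambda>s x :: 'n::finite spins. x)"
  by (rule bounded_lipschitzI[of 1 "real CARD('n)"]) (auto intro: norm_sphere_prod)

definition closed_loop ::
  "real \<Rightarrow> real \<Rightarrow> 'n::finite spin_mat \<Rightarrow> real \<Rightarrow> (real \<Rightarrow> 'n spins \<Rightarrow> real) \<Rightarrow> real \<Rightarrow> 'n spins \<Rightarrow> 'n spins" where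
  "closed_loop \<alpha> Cext Q lam W s x = llg_drift \<alpha> Cext Q x (feedback \<alpha> Cext lam W s x)"

lemma bounded_lipschitz_closed_loop:
  assumes W: "C12_M T W"
  shows "bounded_lipschitz T (closed_loop \<alpha> Cext Q lam W)"
proof -
  obtain K where K: "K \<ge> 0"
    "\<And>s x. s \<in> {0..T} \<Longrightarrow> x \<in> sphere_prod \<Longrightarrow> \<bar>W s x\<bar> \<le> K"
    "\<And>s x. s \<in> {0..T} \<Longrightarrow> x \<in> sphere_prod \<Longrightarrow> \<bar>dt_on T W s x\<bar> \<le> K"
    "\<And>s x. s \<in> {0..T} \<Longrightarrow> x \<in> sphere_prod \<Longrightarrow> norm (mgrad (W s) x) \<le> K"
    "\<And>s x. s \<in> {0..T} \<Longrightarrow> x \<in> sphere_prod \<Longrightarrow> norm (mhess (W s) x) \<le> K"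
    by (rule C12_bounds[OF W]) blast
  obtain L where L: "L \<ge> 0" "\<And>s x y. s \<in> {0..T} \<Longrightarrow> x \<in> sphere_prod \<Longrightarrow> y \<in> sphere_prod \<Longrightarrow>
    norm (mgrad (W s) y - mgrad (W s) x) \<le> L * norm (y - x)"
    by (rule mgrad_lipschitz[OF W]) blast
  have g: "bounded_lipschitz T (\<lambda>s x. mgrad (W s) x)"
    by (rule bounded_lipschitzI[of L K]) (use K L in auto)
  note bl = bounded_linear_scaleR_right bounded_linear_minus[OF bounded_linear_ident] matrix_vector_mul_bounded_linear
  have fb: "bounded_lipschitz T (feedback \<alpha> Cext lam W)"
    unfolding feedback_def[abs_def] diff_conv_add_uminus
    by (intro bounded_lipschitz_linear[OF _ bl(1)] bounded_lipschitz_linear[OF _ bl(2)] bounded_lipschitz_add bounded_lipschitz_cprod bounded_lipschitz_state g)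
  have w: "bounded_lipschitz T (\<lambda>s x. - (Q *v x) + Cext *\<^sub>R feedback \<alpha> Cext lam W s x)"
    by (intro bounded_lipschitz_add bounded_lipschitz_linear[OF _ bl(1)] bounded_lipschitz_linear[OF _ bl(2)]
        bounded_lipschitz_linear[OF _ bl(3)] bounded_lipschitz_state fb)
  show ?thesis
    unfolding closed_loop_def[abs_def] llg_drift_eq Let_def diff_conv_add_uminus
    by (intro bounded_lipschitz_add bounded_lipschitz_linear[OF _ bl(1)] bounded_lipschitz_linear[OF _ bl(2)] bounded_lipschitz_cprod bounded_lipschitz_state w)
qed

lemma continuous_on_llg_drift [continuous_intros]:
  assumes "continuous_on S f" "continuous_on S g"
  shows "continuous_on S (\<lambda>x. llg_drift \<alpha> Cext Q (f x) (g x))"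
  unfolding llg_drift_eq Let_def
  by (intro cprod.continuous_on continuous_intros assms bounded_linear.continuous_on[OF matrix_vector_mul_bounded_linear])

lemma continuous_on_feedback:
  assumes "C12_M T W"
  shows "continuous_on ({0..T} \<times> sphere_prod) (\<lambda>(s, x). feedback \<alpha> Cext lam W s x)"
proof -
  have "continuous_on ({0..T} \<times> sphere_prod) (\<lambda>z. mgrad (W (fst z)) (snd z))"
    using assms by (simp add: C12_M_def case_prod_unfold)
  then show ?thesis
    unfolding feedback_def case_prod_unfold by (intro continuous_intros cprod.continuous_on)
qed

lemma norm_llg_drift_le:
  "\<exists>K\<ge>0. \<forall>x\<in>sphere_prod. \<forall>u. norm (llg_drift \<alpha> Cext Q (x :: 'n::finite spins) u) \<le> K * (1 + norm u)"
proof -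
  let ?N = "real CARD('n)"
  define K where "K = (?N + \<bar>\<alpha>\<bar> * (?N * ?N)) * (norm Q * ?N + \<bar>Cext\<bar>)"
  have "norm (llg_drift \<alpha> Cext Q x u) \<le> K * (1 + norm u)" if x: "x \<in> sphere_prod" for x u :: "'n spins"
  proof -
    let ?w = "- (Q *v x) + Cext *\<^sub>R u"
    have N: "norm x \<le> ?N" by (rule norm_sphere_prod[OF x])
    have "norm ?w \<le> norm Q * norm x + \<bar>Cext\<bar> * norm u"
      by (rule order_trans[OF norm_triangle_ineq]) (simp add: norm_matrix_vector_mult_le)
    also have "\<dots> \<le> norm Q * ?N + \<bar>Cext\<bar> * norm u" using N by (intro add_right_mono mult_left_mono) auto
    also have "\<dots> \<le> (norm Q * ?N + \<bar>Cext\<bar>) * (1 + norm u)" by (simp add: algebra_simps)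
    finally have w: "norm ?w \<le> (norm Q * ?N + \<bar>Cext\<bar>) * (1 + norm u)" .
    have c1: "norm (cprod x v) \<le> ?N * norm v" for v using N by (intro order_trans[OF norm_cprod_le] mult_right_mono) auto
    have "norm (llg_drift \<alpha> Cext Q x u) \<le> norm (cprod x ?w) + \<bar>\<alpha>\<bar> * norm (cprod x (cprod x ?w))"
      unfolding llg_drift_eq Let_def by (rule order_trans[OF norm_triangle_ineq4]) simp
    also have "\<dots> \<le> ?N * norm ?w + \<bar>\<alpha>\<bar> * (?N * (?N * norm ?w))"
      by (intro add_mono mult_left_mono c1 order_trans[OF c1]) auto
    also have "\<dots> = (?N + \<bar>\<alpha>\<bar> * (?N * ?N)) * norm ?w" by (simp add: algebra_simps)
    also have "\<dots> \<le> (?N + \<bar>\<alpha>\<bar> * (?N * ?N)) * ((norm Q * ?N + \<bar>Cext\<bar>) * (1 + norm u))" by (intro mult_left_mono w) auto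
    finally show ?thesis by (simp add: K_def mult.assoc)
  qed
  moreover have "0 \<le> K" by (simp add: K_def)
  ultimately show ?thesis by blast
qed

text \<open>Under the weight \<open>exp (- 2 c s)\<close> the integral operator contracts suprema by the factor \<open>1/2\<close>.\<close>

lemma gronwall_zero:
  fixes \<phi> :: "real \<Rightarrow> real"
  assumes c: "c > 0" and \<phi>: "\<And>s. s \<in> {t..T} \<Longrightarrow> 0 \<le> \<phi> s" "\<And>s. s \<in> {t..T} \<Longrightarrow> \<phi> s \<le> M"
    and int: "\<And>s. s \<in> {t..T} \<Longrightarrow> integrable lborel (\<lambda>r. indicat_real {t<..s} r * \<phi> r)"
    and le: "\<And>s. s \<in> {t..T} \<Longrightarrow> \<phi> s \<le> c * (\<integral>r. indicat_real {t<..s} r * \<phi> r \<partial>lborel)"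
    and s: "s \<in> {t..T}"
  shows "\<phi> s = 0"
proof -
  let ?w = "\<lambda>s. exp (- (2 * c * s)) * \<phi> s"
  define S where "S = (SUP s\<in>{t..T}. ?w s)"
  have "M \<ge> 0" using \<phi>[OF s] by simp
  \<comment> \<open>Boundedness of \<open>\<phi>\<close> makes \<open>S\<close> a genuine supremum;
    without this the final \<open>S \<le> S / 2\<close> would say nothing.\<close>
  have "bdd_above (?w ` {t..T})"
  proof (rule bdd_aboveI2)
    fix r assume r: "r \<in> {t..T}"
    show "?w r \<le> exp (- (2 * c * t)) * M" using r c \<phi>[OF r] by (intro mult_mono) auto
  qed
  then have up: "?w r \<le> S" if "r \<in> {t..T}" for r unfolding S_def by (rule cSUP_upper[OF that])
  have S0: "0 \<le> S" using up[OF s] \<phi>(1)[OF s] by (meson exp_ge_zero mult_nonneg_nonneg order_trans)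
  have \<phi>S: "\<phi> r \<le> S * exp (2 * c * r)" if "r \<in> {t..T}" for r
  proof -
    have "?w r * exp (2 * c * r) \<le> S * exp (2 * c * r)" by (intro mult_right_mono up that) simp
    moreover have "?w r * exp (2 * c * r) = \<phi> r" by (simp add: exp_minus)
    ultimately show ?thesis by simp
  qed
  have half: "?w r \<le> S / 2" if r: "r \<in> {t..T}" for r
  proof -
    have tr: "t \<le> r" using r by simp
    have e: "has_bochner_integral lborel (\<lambda>x. (S * exp (2 * c * x)) * indicator {t..r} x) (S * exp (2 * c * r) / (2 * c) - S * exp (2 * c * t) / (2 * c))"
      by (rule has_bochner_integral_FTC_Icc_real[OF tr]) (use c in \<open>auto intro!: derivative_eq_intros continuous_intros\<close>)
    have "\<phi> r \<le> c * (\<integral>x. indicat_real {t<..r} x * \<phi> x \<partial>lborel)" by (rule le[OF r])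
    also have "\<dots> \<le> c * (\<integral>x. (S * exp (2 * c * x)) * indicator {t..r} x \<partial>lborel)"
      using c e r S0 \<phi>S by (intro mult_left_mono integral_mono int) (auto simp: has_bochner_integral_iff indicator_def)
    also have "\<dots> = c * (S * exp (2 * c * r) / (2 * c) - S * exp (2 * c * t) / (2 * c))"
      using e by (simp add: has_bochner_integral_iff)
    also have "\<dots> \<le> S / 2 * exp (2 * c * r)" using c S0 by (simp add: right_diff_distrib)
    finally have "exp (- (2 * c * r)) * \<phi> r \<le> exp (- (2 * c * r)) * (S / 2 * exp (2 * c * r))" by (intro mult_left_mono) auto
    also have "\<dots> = S / 2 * (exp (- (2 * c * r)) * exp (2 * c * r))" by (rule mult.left_commute)
    also have "exp (- (2 * c * r)) * exp (2 * c * r) = 1" by (simp add: exp_minus)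
    finally show ?thesis by simp
  qed
  have "S \<le> S / 2" unfolding S_def using s half by (intro cSUP_least) (auto simp: S_def)
  then have "S = 0" using S0 by simp
  then show ?thesis using \<phi>S[OF s] \<phi>(1)[OF s] by simp
qed

context filtered_wiener
begin

lemma AE_PL_neq: "AE z in PL. snd z \<noteq> c"
proof -
  have "AE z in PL. \<not> (snd z = c)"
  proof (rule AE_I')
    show "space P \<times> {c} \<in> null_sets PL"
      by (rule lborel.times_in_null_sets2) auto
  qed (auto simp: space_pair_measure)
  then show ?thesis by simp
qed

lemma ito_lim_square:
  assumes l: "ito_lim a Y X" and q: "integrable PL q" and le: "\<And>z. z \<in> space PL \<Longrightarrow> (norm (Y z))\<^sup>2 \<le> q z"
  shows "integrable P (\<lambda>\<omega>. (norm (X \<omega>))\<^sup>2)" "expectation (\<lambda>\<omega>. (norm (X \<omega>))\<^sup>2) \<le> 4 * integral\<^sup>L PL q"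
proof -
  have [measurable]: "X \<in> borel_measurable P" by (rule ito_lim_measurable(2)[OF l])
  have q0: "0 \<le> q z" if "z \<in> space PL" for z using le[OF that] by (rule order_trans[rotated]) simp
  have "(\<integral>\<^sup>+z. ennreal ((norm (Y z))\<^sup>2) \<partial>PL) \<le> (\<integral>\<^sup>+z. ennreal (q z) \<partial>PL)"
    using le by (intro nn_integral_mono ennreal_leI) auto
  also have "\<dots> = ennreal (integral\<^sup>L PL q)" using q q0 by (intro nn_integral_eq_integral AE_I2) auto
  finally have 1: "(\<integral>\<^sup>+z. ennreal ((norm (Y z))\<^sup>2) \<partial>PL) \<le> ennreal (integral\<^sup>L PL q)" .
  have q1: "0 \<le> integral\<^sup>L PL q" using q0 by (intro Bochner_Integration.integral_nonneg) auto
  have "(\<integral>\<^sup>+\<omega>. ennreal ((norm (X \<omega>))\<^sup>2) \<partial>P) \<le> 4 * (\<integral>\<^sup>+z. ennreal ((norm (Y z))\<^sup>2) \<partial>PL)"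
    by (rule ito_lim_bound[OF l])
  also have "\<dots> \<le> 4 * ennreal (integral\<^sup>L PL q)" by (intro mult_left_mono 1) simp
  also have "\<dots> = ennreal (4 * integral\<^sup>L PL q)" using q1 by (simp add: ennreal_mult)
  finally have 2: "(\<integral>\<^sup>+\<omega>. ennreal ((norm (X \<omega>))\<^sup>2) \<partial>P) \<le> ennreal (4 * integral\<^sup>L PL q)" .
  then have fin: "(\<integral>\<^sup>+\<omega>. ennreal ((norm (X \<omega>))\<^sup>2) \<partial>P) < \<infinity>" by (rule le_less_trans) simp
  show i: "integrable P (\<lambda>\<omega>. (norm (X \<omega>))\<^sup>2)" by (rule integrable_of_norm_sq[OF _ fin]) measurable
  have "ennreal (expectation (\<lambda>\<omega>. (norm (X \<omega>))\<^sup>2)) \<le> ennreal (4 * integral\<^sup>L PL q)"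
    using 2 nn_integral_eq_integral[OF i] by simp
  then show "expectation (\<lambda>\<omega>. (norm (X \<omega>))\<^sup>2) \<le> 4 * integral\<^sup>L PL q" using q1 by (simp add: ennreal_le_iff)
qed

end

section \<open>The cost of an admissible pair\<close>

lemma borel_measurable_llg_drift [measurable (raw)]:
  assumes "f \<in> borel_measurable M" "g \<in> borel_measurable M"
  shows "(\<lambda>x. llg_drift \<alpha> Cext Q (f x) (g x :: 'n::finite spins)) \<in> borel_measurable M"
proof -
  have "continuous_on UNIV (\<lambda>z :: 'n spins \<times> 'n spins. llg_drift \<alpha> Cext Q (fst z) (snd z))"
    by (intro continuous_intros)
  from borel_measurable_continuous_onI[OF this]
  have "(\<lambda>z :: 'n spins \<times> 'n spins. llg_drift \<alpha> Cext Q (fst z) (snd z)) \<in> borel_measurable borel" .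
  from measurable_compose[OF _ this, of "\<lambda>x. (f x, g x)" M] assms show ?thesis by (simp add: borel_prod[symmetric])
qed

lemma C2_curve_continuous: "C2_curve T c \<Longrightarrow> continuous_on {0..T} c"
  unfolding C2_curve_def continuous_on_eq_continuous_within using has_vector_derivative_continuous by blast

locale controlled_pair = sllg_solution P F B T t m I \<nu> m0 \<beta> C
  for P :: "'a measure" and F :: "real \<Rightarrow> 'a measure" and B :: "real \<Rightarrow> 'a \<Rightarrow> 'n::finite spins" and T t :: real
    and m I :: "real \<Rightarrow> 'a \<Rightarrow> 'n spins" and \<nu> :: real and m0 :: "'n spins" and \<beta> :: "'a \<times> real \<Rightarrow> 'n spins"
    and C :: "real \<Rightarrow> 'a \<Rightarrow> 'n spins" +
  fixes \<alpha> Cext :: real and Q :: "'n spin_mat" and u :: "real \<Rightarrow> 'a \<Rightarrow> 'n spins"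
  assumes u: "admissible_control P F t T u"
    and \<beta>_eq: "\<And>\<omega> r. \<omega> \<in> space P \<Longrightarrow> r \<in> {t..T} \<Longrightarrow> \<beta> (\<omega>, r) = llg_drift \<alpha> Cext Q (m r \<omega>) (u r \<omega>)"

text \<open>The drift is evaluated at the clamped state and at the control extended by zero, which
  makes \<open>\<beta>\<close> measurable on the whole product space and equal to the true drift on
  the time interval. Linear growth passes square integrability from the control to
  \<open>\<beta>\<close>.\<close>

lemma controlled_pair_of_admissible:
  fixes B :: "real \<Rightarrow> 'a \<Rightarrow> 'n::finite spins"
  assumes "filtered_wiener P F B T" and t: "t \<in> {0..T}" and nu: "\<nu> \<ge> 0"
    and pair: "(m, u) \<in> admissible_pairs P F B T \<alpha> Cext Q \<nu> t m0"
  shows "\<exists>I \<beta> C. controlled_pair P F B T t m I \<nu> m0 \<beta> C \<alpha> Cext Q u"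
proof -
  have u: "admissible_control P F t T u" and sol: "solves_sllg P F B T \<alpha> Cext Q \<nu> t m0 u m"
    using pair by (auto simp: admissible_pairs_def)
  obtain S where S: "has_stratonovich_integral P F B t T (\<lambda>s \<omega>. sigma_mat (m s \<omega>)) S"
    and eq: "AE \<omega> in P. \<forall>s\<in>{t..T}. m s \<omega> = m0 + (LINT r:{t..s}|lborel. llg_drift \<alpha> Cext Q (m r \<omega>) (u r \<omega>)) + \<nu> *\<^sub>R S s \<omega>"
    using sol unfolding solves_sllg_def by (elim conjE exE)
  obtain I C where I: "\<forall>s\<in>{t..T}. has_ito_integral P F B t s (\<lambda>s \<omega>. sigma_mat (m s \<omega>)) (I s)"
    and C: "has_covariation P F B t T (\<lambda>s \<omega>. sigma_mat (m s \<omega>)) C"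
    and SIC: "\<forall>s\<in>{t..T}. AE \<omega> in P. S s \<omega> = I s \<omega> + (1/2) *\<^sub>R C s \<omega>"
    using S unfolding has_stratonovich_integral_def by (elim conjE exE)
  interpret filtered_wiener P F B T by fact
  interpret s: sllg_state P F B T t m I
  proof
    show "0 \<le> t" "t \<le> T" using t by auto
    show "adapted F {t..T} m" using sol by (simp add: solves_sllg_def)
    show "continuous_on {t..T} (\<lambda>s. m s \<omega>)" if "\<omega> \<in> space P" for \<omega> using sol that by (simp add: solves_sllg_def)
    show "m s \<omega> \<in> sphere_prod" if "\<omega> \<in> space P" "s \<in> {t..T}" for \<omega> s using sol that by (simp add: solves_sllg_def)
  qed (use I in blast)
  let ?u = "\<lambda>z. indicat_real (space P \<times> {t..T}) z *\<^sub>R u (snd z) (fst z)"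
  have [measurable]: "?u \<in> borel_measurable PL"
    using u by (simp add: admissible_control_def set_borel_measurable_def case_prod_unfold)
  define \<beta> where "\<beta> z = indicat_real {t..T} (snd z) *\<^sub>R llg_drift \<alpha> Cext Q (s.mm z) (?u z)" for z
  have [measurable]: "\<beta> \<in> borel_measurable PL" unfolding \<beta>_def[abs_def] by measurable
  have \<beta>: "\<beta> (\<omega>, r) = llg_drift \<alpha> Cext Q (m r \<omega>) (u r \<omega>)" if "\<omega> \<in> space P" "r \<in> {t..T}" for \<omega> r
    using that by (simp add: \<beta>_def s.mm_eq)
  obtain K where K: "K \<ge> 0" "\<forall>x\<in>sphere_prod. \<forall>v. norm (llg_drift \<alpha> Cext Q (x :: 'n spins) v) \<le> K * (1 + norm v)"
    using norm_llg_drift_le[of \<alpha> Cext Q] by (elim exE conjE)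
  have "controlled_pair P F B T t m I \<nu> m0 \<beta> C \<alpha> Cext Q u"
  proof
    show "\<nu> \<ge> 0" "\<beta> \<in> borel_measurable PL" "has_covariation P F B t T (\<lambda>s \<omega>. sigma_mat (m s \<omega>)) C"
      "admissible_control P F t T u" by fact+
    have "integrable PL (\<lambda>z. (2 * K\<^sup>2) * indicat_real {t..T} (snd z))"
      by (rule integral_product(1)[of "\<lambda>_. 2 * K\<^sup>2" "indicat_real {t..T}"]) (auto intro!: integrable_real_indicator simp: emeasure_lborel_Icc_eq)
    moreover have "integrable PL (\<lambda>z. (2 * K\<^sup>2) * (indicat_real (space P \<times> {t..T}) z * (norm (u (snd z) (fst z)))\<^sup>2))"
      using u by (intro integrable_mult_right) (simp add: admissible_control_def set_integrable_def case_prod_unfold)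
    ultimately have "integrable PL (\<lambda>z. (2 * K\<^sup>2) * indicat_real {t..T} (snd z) + (2 * K\<^sup>2) * (indicat_real (space P \<times> {t..T}) z * (norm (u (snd z) (fst z)))\<^sup>2))"
      by (rule Bochner_Integration.integrable_add)
    then show "integrable PL (\<lambda>z. indicat_real {t..T} (snd z) * (norm (\<beta> z))\<^sup>2)"
    proof (rule Bochner_Integration.integrable_bound)
      show "AE z in PL. norm (indicat_real {t..T} (snd z) * (norm (\<beta> z))\<^sup>2)
        \<le> norm ((2 * K\<^sup>2) * indicat_real {t..T} (snd z) + (2 * K\<^sup>2) * (indicat_real (space P \<times> {t..T}) z * (norm (u (snd z) (fst z)))\<^sup>2))"
      proof (rule AE_I2)
        fix z assume "z \<in> space PL"
        then obtain \<omega> r where z: "z = (\<omega>, r)" "\<omega> \<in> space P" by (auto simp: space_pair_measure)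
        have "(norm (\<beta> (\<omega>, r)))\<^sup>2 \<le> 2 * K\<^sup>2 + 2 * K\<^sup>2 * (norm (u r \<omega>))\<^sup>2" if r: "r \<in> {t..T}"
        proof -
          have "(norm (\<beta> (\<omega>, r)))\<^sup>2 \<le> (K * (1 + norm (u r \<omega>)))\<^sup>2"
            unfolding \<beta>[OF z(2) r] using K(2) s.m_sphere[OF z(2) r] by (intro power_mono) auto
          also have "\<dots> = K\<^sup>2 * (1 + norm (u r \<omega>))\<^sup>2" by (rule power_mult_distrib)
          also have "\<dots> \<le> K\<^sup>2 * (2 + 2 * (norm (u r \<omega>))\<^sup>2)"
            using zero_le_power2[of "1 - norm (u r \<omega>)"] unfolding power2_sum power2_diff by (intro mult_left_mono) auto
          finally show ?thesis by (simp add: distrib_left mult_ac)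
        qed
        then show "norm (indicat_real {t..T} (snd z) * (norm (\<beta> z))\<^sup>2)
          \<le> norm ((2 * K\<^sup>2) * indicat_real {t..T} (snd z) + (2 * K\<^sup>2) * (indicat_real (space P \<times> {t..T}) z * (norm (u (snd z) (fst z)))\<^sup>2))"
          using z by (simp add: indicator_def)
      qed
    qed measurable
    show "AE \<omega> in P. m s \<omega> = m0 + (\<integral>r. indicat_real {t..s} r *\<^sub>R \<beta> (\<omega>, r) \<partial>lborel) + \<nu> *\<^sub>R I s \<omega> + (\<nu> / 2) *\<^sub>R C s \<omega>"
      if s: "s \<in> {t..T}" for s
      using eq bspec[OF SIC s] AE_space
    proof eventually_elim
      case (elim \<omega>)
      have "(LINT r:{t..s}|lborel. llg_drift \<alpha> Cext Q (m r \<omega>) (u r \<omega>)) = (\<integral>r. indicat_real {t..s} r *\<^sub>R \<beta> (\<omega>, r) \<partial>lborel)"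
        unfolding set_lebesgue_integral_def using s \<beta>[OF elim(3)]
        by (intro Bochner_Integration.integral_cong refl) (auto simp: indicator_def)
      then show ?case using bspec[OF elim(1) s] elim(2) by (simp add: scaleR_add_right)
    qed
  qed (use \<beta> in blast)
  then show ?thesis by blast
qed

context controlled_pair
begin

definition uu :: "'a \<times> real \<Rightarrow> 'n spins" where
  "uu z = indicat_real (space P \<times> {t..T}) z *\<^sub>R u (snd z) (fst z)"

lemma uu_measurable [measurable]: "uu \<in> borel_measurable PL"
  using u by (simp add: uu_def[abs_def] admissible_control_def set_borel_measurable_def case_prod_unfold)

lemma uu_eq: "\<omega> \<in> space P \<Longrightarrow> r \<in> {t..T} \<Longrightarrow> uu (\<omega>, r) = u r \<omega>"
  by (simp add: uu_def)

lemma uu_sq: "integrable PL (\<lambda>z. indicat_real {t<..T} (snd z) * (norm (uu z))\<^sup>2)"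
proof -
  have "integrable PL (\<lambda>z. indicat_real (space P \<times> {t..T}) z * (norm (u (snd z) (fst z)))\<^sup>2)"
    using u by (simp add: admissible_control_def set_integrable_def case_prod_unfold)
  then show ?thesis
  proof (rule Bochner_Integration.integrable_bound)
    show "AE z in PL. norm (indicat_real {t<..T} (snd z) * (norm (uu z))\<^sup>2) \<le> norm (indicat_real (space P \<times> {t..T}) z * (norm (u (snd z) (fst z)))\<^sup>2)"
      by (intro AE_I2) (auto simp: uu_def indicator_def space_pair_measure)
  qed measurable
qed

context
  fixes \<delta> lam :: real and mt :: "real \<Rightarrow> 'n spins" and h :: "'n spins \<Rightarrow> real" and W :: "real \<Rightarrow> 'n spins \<Rightarrow> real"
  assumes hjb: "hjb_solution T \<alpha> Cext Q \<nu> \<delta> lam mt h W" and lam: "lam > 0" and mt: "C2_curve T mt"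
begin

lemma W_C12: "C12_M T W"
  using hjb by (simp add: hjb_solution_def)

lemma feedback_measurable [measurable]: "(\<lambda>z. feedback \<alpha> Cext lam W (rr z) (mm z)) \<in> borel_measurable PL"
  using borel_measurable_time_state[OF continuous_on_feedback[OF W_C12], of mm] mm_sphere_PL[OF W_C12] by simp

lemma running_cost_integrable:
  "integrable PL (\<lambda>z. indicat_real {t<..T} (snd z) * (\<delta> * (norm (mm z - mt (rr z)))\<^sup>2 + lam / 2 * (norm (uu z))\<^sup>2))"
proof -
  have cont: "continuous_on ({0..T} \<times> (sphere_prod :: 'n spins set)) (\<lambda>z. mt (fst z))"
    by (rule continuous_on_compose2[OF C2_curve_continuous[OF mt]]) (auto intro!: continuous_intros)
  have [measurable]: "(\<lambda>z. mt (rr z)) \<in> borel_measurable PL"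
    using borel_measurable_time_state[OF cont, of mm] mm_sphere_PL[OF W_C12] by simp
  have "integrable PL (\<lambda>z. indicat_real {t<..T} (snd z) * (norm (mm z - mt (rr z)))\<^sup>2)"
  proof (rule Bochner_Integration.integrable_bound[OF integrable_indicator_PL[of t T "(2 * N)\<^sup>2"]])
    show "AE z in PL. norm (indicat_real {t<..T} (snd z) * (norm (mm z - mt (rr z)))\<^sup>2) \<le> norm (indicat_real {t<..T} (snd z) * (2 * N)\<^sup>2)"
    proof (rule AE_I2)
      fix z assume z: "z \<in> space PL"
      have "mt (rr z) \<in> sphere_prod" using mt rr_in(1)[of z] by (auto simp: C2_curve_def)
      then have "norm (mm z - mt (rr z)) \<le> N + N"
        unfolding N_def by (intro order_trans[OF norm_triangle_ineq4] add_mono norm_sphere_prod mm_sphere_PL[OF W_C12 z])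
      then have "(norm (mm z - mt (rr z)))\<^sup>2 \<le> (2 * N)\<^sup>2" by (intro power_mono) auto
      then show "norm (indicat_real {t<..T} (snd z) * (norm (mm z - mt (rr z)))\<^sup>2) \<le> norm (indicat_real {t<..T} (snd z) * (2 * N)\<^sup>2)"
        by (simp add: indicator_def)
    qed
  qed measurable
  then have "integrable PL (\<lambda>z. \<delta> * (indicat_real {t<..T} (snd z) * (norm (mm z - mt (rr z)))\<^sup>2) + lam / 2 * (indicat_real {t<..T} (snd z) * (norm (uu z))\<^sup>2))"
    by (intro Bochner_Integration.integrable_add integrable_mult_right uu_sq)
  then show ?thesis by (simp add: distrib_left mult_ac)
qed

lemma cost_eq_PL:
  "cost P T \<delta> lam mt h t (m, u) = (\<integral>z. indicat_real {t<..T} (snd z) * (\<delta> * (norm (mm z - mt (rr z)))\<^sup>2 + lam / 2 * (norm (uu z))\<^sup>2) \<partial>PL)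
    + expectation (\<lambda>\<omega>. W T (m T \<omega>))"
proof -
  let ?l = "\<lambda>z. indicat_real {t<..T} (snd z) * (\<delta> * (norm (mm z - mt (rr z)))\<^sup>2 + lam / 2 * (norm (uu z))\<^sup>2)"
  have T: "T \<in> {t..T}" "T \<in> {0..T}" using tT t0 by auto
  have "cost P T \<delta> lam mt h t (m, u) = expectation (\<lambda>\<omega>. (\<integral>r. ?l (\<omega>, r) \<partial>lborel) + W T (m T \<omega>))"
    unfolding cost_def split set_lebesgue_integral_def
  proof (rule Bochner_Integration.integral_cong[OF refl], rule arg_cong2[where f = "(+)"])
    fix \<omega> assume \<omega>: "\<omega> \<in> space P"
    show "h (m T \<omega>) = W T (m T \<omega>)" using hjb m_sphere[OF \<omega> T(1)] by (simp add: hjb_solution_def)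
    show "(\<integral>r. indicat_real {t..T} r *\<^sub>R (\<delta> * (norm (m r \<omega> - mt r))\<^sup>2 + lam / 2 * (norm (u r \<omega>))\<^sup>2) \<partial>lborel) = (\<integral>r. ?l (\<omega>, r) \<partial>lborel)"
      \<comment> \<open>The closed and the half-open time interval differ in the point
        \<open>t\<close> only.\<close>
      by (rule integral_discrete_difference[of "{t}"]) (use \<omega> in \<open>auto simp: indicator_def mm_eq rr_eq uu_eq\<close>)
  qed
  also have "\<dots> = expectation (\<lambda>\<omega>. \<integral>r. ?l (\<omega>, r) \<partial>lborel) + expectation (\<lambda>\<omega>. W T (m T \<omega>))"
    by (intro Bochner_Integration.integral_add PL.integrable_fst' running_cost_integrable integrable_state[OF C12_section(1)[OF W_C12 T(2)] T(1)])
  also have "expectation (\<lambda>\<omega>. \<integral>r. ?l (\<omega>, r) \<partial>lborel) = integral\<^sup>L PL ?l"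
    by (rule PL.integral_fst'[OF running_cost_integrable])
  finally show ?thesis .
qed

text \<open>Adding Ito's formula to the cost cancels the terminal value and leaves the integral of
  generator plus running cost. By the completed square this is \<open>lam / 2\<close> times the
  squared distance of the control from the feedback law.\<close>

lemma cost_formula:
  "integrable PL (\<lambda>z. indicat_real {t<..T} (snd z) * (norm (uu z - feedback \<alpha> Cext lam W (rr z) (mm z)))\<^sup>2)"
  "cost P T \<delta> lam mt h t (m, u) = W t m0
    + lam / 2 * (\<integral>z. indicat_real {t<..T} (snd z) * (norm (uu z - feedback \<alpha> Cext lam W (rr z) (mm z)))\<^sup>2 \<partial>PL)"
proof -
  let ?d = "\<lambda>z. indicat_real {t<..T} (snd z) * (norm (uu z - feedback \<alpha> Cext lam W (rr z) (mm z)))\<^sup>2"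
  let ?l = "\<lambda>z. indicat_real {t<..T} (snd z) * (\<delta> * (norm (mm z - mt (rr z)))\<^sup>2 + lam / 2 * (norm (uu z))\<^sup>2)"
  let ?G = "\<lambda>z. indicat_real {t<..T} (snd z) * generator W z"
  note ig = generator_integrable[OF W_C12]
  \<comment> \<open>The Hamilton-Jacobi-Bellman equation is posed before \<open>T\<close> only; the
    slice at time \<open>T\<close> is a null set of the product measure.\<close>
  have AE: "AE z in PL. ?G z + ?l z = lam / 2 * ?d z"
    using AE_PL_neq[of T] AE_space
  proof eventually_elim
    case (elim z)
    show ?case
    proof (cases "snd z \<in> {t<..T}")
      case True
      obtain \<omega> r where z: "z = (\<omega>, r)" "\<omega> \<in> space P" using elim(2) by (auto simp: space_pair_measure)
      have r: "r \<in> {t..T}" "r \<in> {0..<T}" using True z elim(1) t0 by auto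
      have "generator W z + (\<delta> * (norm (mm z - mt (rr z)))\<^sup>2 + lam / 2 * (norm (uu z))\<^sup>2)
        = lam / 2 * (norm (uu z - feedback \<alpha> Cext lam W (rr z) (mm z)))\<^sup>2"
        using hjb_square[OF hjb lam r(2) m_sphere[OF z(2) r(1)], of "u r \<omega>"] r(1) z
        by (simp add: generator_def[OF W_C12] rr_eq mm_eq uu_eq \<beta>_eq inner_commute)
      then show ?thesis using True by simp
    qed simp
  qed
  have i: "integrable PL (\<lambda>z. ?G z + ?l z)" by (intro Bochner_Integration.integrable_add ig running_cost_integrable)
  have m: "(\<lambda>z. lam / 2 * ?d z) \<in> borel_measurable PL" by measurable
  have "integrable PL (\<lambda>z. lam / 2 * ?d z)"
    using integrable_cong_AE[OF borel_measurable_integrable[OF i] m AE] i by blast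
  then have "integrable PL (\<lambda>z. 2 / lam * (lam / 2 * ?d z))" by (rule integrable_mult_right)
  then show d: "integrable PL ?d" using lam by simp
  have "integral\<^sup>L PL ?G + integral\<^sup>L PL ?l = (\<integral>z. ?G z + ?l z \<partial>PL)"
    by (rule Bochner_Integration.integral_add[symmetric, OF ig running_cost_integrable])
  also have "\<dots> = (\<integral>z. lam / 2 * ?d z \<partial>PL)"
    by (rule integral_cong_AE[OF borel_measurable_integrable[OF i] m AE])
  also have "\<dots> = lam / 2 * integral\<^sup>L PL ?d" by simp
  finally have 1: "integral\<^sup>L PL ?G + integral\<^sup>L PL ?l = lam / 2 * integral\<^sup>L PL ?d" .
  have tT': "t \<in> {t..T}" "t \<in> {0..T}" using tT t0 by auto
  have "expectation (\<lambda>\<omega>. W t (m t \<omega>)) = expectation (\<lambda>\<omega>. W t m0)"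
  proof (rule integral_cong_AE)
    show "AE \<omega> in P. W t (m t \<omega>) = W t m0" using initial_value by eventually_elim simp
    show "(\<lambda>\<omega>. W t (m t \<omega>)) \<in> borel_measurable P"
      by (rule borel_measurable_integrable[OF integrable_state[OF C12_section(1)[OF W_C12 tT'(2)] tT'(1)]])
  qed simp
  then have "expectation (\<lambda>\<omega>. W t (m t \<omega>)) = W t m0" by (simp add: prob_space)
  with 1 ito_formula[OF W_C12] cost_eq_PL
  show "cost P T \<delta> lam mt h t (m, u) = W t m0 + lam / 2 * integral\<^sup>L PL ?d" by linarith
qed

end
end

section \<open>Pathwise uniqueness\<close>

text \<open>Gronwall's lemma for the mean square distance of the two states. The closed loop drift
  is demanded only almost everywhere on the product space, because optimality determines the control
  no better than that.\<close>

lemma pathwise_uniqueness: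
  fixes B :: "real \<Rightarrow> 'a \<Rightarrow> 'n::finite spins" and G :: "real \<Rightarrow> 'n spins \<Rightarrow> 'n spins"
  assumes 1: "sllg_solution P F B T t m1 I1 \<nu> m0 \<beta>1 C1" and 2: "sllg_solution P F B T t m2 I2 \<nu> m0 \<beta>2 C2"
    and G: "bounded_lipschitz T G"
    and \<beta>1: "AE z in P \<Otimes>\<^sub>M lborel. snd z \<in> {t..T} \<longrightarrow> \<beta>1 z = G (snd z) (m1 (snd z) (fst z))"
    and \<beta>2: "AE z in P \<Otimes>\<^sub>M lborel. snd z \<in> {t..T} \<longrightarrow> \<beta>2 z = G (snd z) (m2 (snd z) (fst z))"
  shows "AE z in P \<Otimes>\<^sub>M lborel. snd z \<in> {t..T} \<longrightarrow> m1 (snd z) (fst z) = m2 (snd z) (fst z)"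
proof -
  interpret filtered_wiener P F B T using 1 by (simp add: sllg_solution_def sllg_state_def)
  interpret S1: sllg_solution P F B T t m1 I1 \<nu> m0 \<beta>1 C1 by (rule 1)
  interpret S2: sllg_solution P F B T t m2 I2 \<nu> m0 \<beta>2 C2 by (rule 2)
  note t0 = S1.t0 and tT = S1.tT
  obtain L A where L: "0 \<le> L" "0 \<le> A" "\<And>s x. s \<in> {0..T} \<Longrightarrow> x \<in> sphere_prod \<Longrightarrow> norm (G s x - \<nu>\<^sup>2 *\<^sub>R x) \<le> A"
    "\<And>s x y. s \<in> {0..T} \<Longrightarrow> x \<in> sphere_prod \<Longrightarrow> y \<in> sphere_prod \<Longrightarrow>
      norm ((G s x - \<nu>\<^sup>2 *\<^sub>R x) - (G s y - \<nu>\<^sup>2 *\<^sub>R y)) \<le> L * norm (x - y)"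
  proof (rule bounded_lipschitzE)
    \<comment> \<open>Passing to Ito form subtracts \<open>\<nu>^2 x\<close>, which preserves the
      Lipschitz bound.\<close>
    have "bounded_lipschitz T (\<lambda>s x :: 'n spins. G s x + (- (\<nu>\<^sup>2)) *\<^sub>R x)"
      by (intro bounded_lipschitz_add G bounded_lipschitz_linear[OF bounded_lipschitz_state] bounded_linear_scaleR_right)
    then show "bounded_lipschitz T (\<lambda>s x :: 'n spins. G s x - \<nu>\<^sup>2 *\<^sub>R x)" by simp
  qed blast
  obtain K where K: "K > 0" "\<forall>x :: 'n spins. norm (sigma_mat x) \<le> K * norm x"
    using norm_sigma_mat_le by (elim exE conjE)
  \<comment> \<open>\<open>2 T L^2\<close> comes from Cauchy-Schwarz for the drift;
    \<open>8 \<nu>^2 K^2\<close> is the splitting factor 2, times \<open>\<nu>^2\<close>, times the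
    4 of the mean square bound for Ito integrals, times \<open>K^2\<close>. The 1 ensures
    positivity.\<close>
  define c where "c = 2 * T * L\<^sup>2 + 8 * \<nu>\<^sup>2 * K\<^sup>2 + 1"
  have c: "c > 0" using t0 tT by (simp add: c_def add_nonneg_pos)
  define \<Delta> where "\<Delta> z = S1.mm z - S2.mm z" for z
  have [measurable]: "\<Delta> \<in> borel_measurable PL" unfolding \<Delta>_def[abs_def] by measurable
  have \<Delta>N: "(norm (\<Delta> z))\<^sup>2 \<le> (2 * real CARD('n))\<^sup>2" if "fst z \<in> space P" for z
  proof (rule power_mono)
    have "norm (\<Delta> z) \<le> real CARD('n) + real CARD('n)" unfolding \<Delta>_def
      by (intro order_trans[OF norm_triangle_ineq4] add_mono norm_sphere_prod S1.mm_sphere S2.mm_sphere that)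
    then show "norm (\<Delta> z) \<le> 2 * real CARD('n)" by simp
  qed simp
  let ?q = "\<lambda>s z. indicat_real {t<..s} (snd z) * (norm (\<Delta> z))\<^sup>2"
  have iq: "integrable PL (?q s)" for s
  proof (rule Bochner_Integration.integrable_bound[OF S1.integrable_indicator_PL[of t s "(2 * real CARD('n))\<^sup>2"]])
    show "AE z in PL. norm (?q s z) \<le> norm (indicat_real {t<..s} (snd z) * (2 * real CARD('n))\<^sup>2)"
      using \<Delta>N by (intro AE_I2) (auto simp: space_pair_measure indicator_def)
  qed measurable
  \<comment> \<open>Both equations hold almost surely at each fixed time, so the integral inequality
    for \<open>\<phi>\<close> is available at every \<open>s\<close> and not merely at almost every
    one.\<close>
  define \<phi> where "\<phi> r = expectation (\<lambda>\<omega>. (norm (\<Delta> (\<omega>, r)))\<^sup>2)" for r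
  have \<phi>q: "integrable lborel (\<lambda>r. indicat_real {t<..s} r * \<phi> r)" "(\<integral>r. indicat_real {t<..s} r * \<phi> r \<partial>lborel) = integral\<^sup>L PL (?q s)" for s
    using PL.integrable_snd[of "\<lambda>\<omega> r. ?q s (\<omega>, r)"] PL.integral_snd[of "\<lambda>\<omega> r. ?q s (\<omega>, r)"] iq[of s]
    by (simp_all add: \<phi>_def case_prod_unfold)
  have \<phi>_le: "\<phi> s \<le> c * (\<integral>r. indicat_real {t<..s} r * \<phi> r \<partial>lborel)" if s: "s \<in> {t..T}" for s
  proof -
    have ts: "t \<le> t" "t \<le> s" "s \<le> T" "0 \<le> s" using s t0 by auto
    let ?d = "\<lambda>z. S1.\<gamma> z - S2.\<gamma> z"
    have dm [measurable]: "?d \<in> borel_measurable PL" by measurable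
    have dle: "AE z in PL. indicat_real {t..T} (snd z) * (norm (?d z))\<^sup>2 \<le> L\<^sup>2 * (indicat_real {t..T} (snd z) * (norm (\<Delta> z))\<^sup>2)"
      using \<beta>1 \<beta>2 AE_space
    proof eventually_elim
      case (elim z)
      show ?case
      proof (cases "snd z \<in> {t..T}")
        case True
        have z: "fst z \<in> space P" using elim(3) by (auto simp: space_pair_measure)
        have "norm (?d z) \<le> L * norm (\<Delta> z)"
          using elim(1,2) True t0 L(4)[OF _ S1.m_sphere[OF z True] S2.m_sphere[OF z True], of "snd z"]
          by (simp add: S1.\<gamma>_def S2.\<gamma>_def \<Delta>_def S1.mm_eq S2.mm_eq)
        then have "(norm (?d z))\<^sup>2 \<le> L\<^sup>2 * (norm (\<Delta> z))\<^sup>2" unfolding power_mult_distrib[symmetric] by (intro power_mono) auto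
        then show ?thesis using True by simp
      qed simp
    qed
    have i\<Delta>: "integrable PL (\<lambda>z. indicat_real {t..T} (snd z) * (norm (\<Delta> z))\<^sup>2)"
    proof (rule Bochner_Integration.integrable_bound[OF integral_product(1)[of "\<lambda>_. (2 * real CARD('n))\<^sup>2" "indicat_real {t..T}"]])
      show "AE z in PL. norm (indicat_real {t..T} (snd z) * (norm (\<Delta> z))\<^sup>2) \<le> norm ((2 * real CARD('n))\<^sup>2 * indicat_real {t..T} (snd z))"
        using \<Delta>N by (intro AE_I2) (auto simp: space_pair_measure indicator_def)
    qed (auto intro!: integrable_real_indicator simp: emeasure_lborel_Icc_eq)
    have dsq: "integrable PL (\<lambda>z. indicat_real {t..T} (snd z) * (norm (?d z))\<^sup>2)"
    proof (rule Bochner_Integration.integrable_bound[OF integrable_mult_right[of "L\<^sup>2", OF i\<Delta>]])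
      show "AE z in PL. norm (indicat_real {t..T} (snd z) * (norm (?d z))\<^sup>2) \<le> norm (L\<^sup>2 * (indicat_real {t..T} (snd z) * (norm (\<Delta> z))\<^sup>2))"
        using dle by eventually_elim simp
    qed measurable
    note D = drift_square[OF dm ts(1-3) dsq]
    have "(\<integral>z. indicat_real {t<..s} (snd z) * (norm (?d z))\<^sup>2 \<partial>PL) \<le> (\<integral>z. L\<^sup>2 * ?q s z \<partial>PL)"
    proof (rule integral_mono_AE[OF D(3) integrable_mult_right[OF iq]])
      show "AE z in PL. indicat_real {t<..s} (snd z) * (norm (?d z))\<^sup>2 \<le> L\<^sup>2 * ?q s z"
        using dle ts by (auto elim!: eventually_mono simp: indicator_def split: if_splits)
    qed
    then have "expectation (\<lambda>\<omega>. (norm (drift ?d t s \<omega>))\<^sup>2) \<le> (s - t) * (L\<^sup>2 * integral\<^sup>L PL (?q s))"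
      using ts by (intro order_trans[OF D(2)] mult_left_mono) auto
    also have "\<dots> \<le> T * (L\<^sup>2 * integral\<^sup>L PL (?q s))" using ts t0 by (intro mult_right_mono mult_nonneg_nonneg integral_nonneg) auto
    finally have D': "expectation (\<lambda>\<omega>. (norm (drift ?d t s \<omega>))\<^sup>2) \<le> T * (L\<^sup>2 * integral\<^sup>L PL (?q s))" .
    let ?Y = "\<lambda>z. indicat_real {t<..s} (snd z) *\<^sub>R sigma_mat (m1 (snd z) (fst z)) - indicat_real {t<..s} (snd z) *\<^sub>R sigma_mat (m2 (snd z) (fst z))"
    have il: "ito_lim t (\<lambda>z. indicat_real {t<..s} (snd z) *\<^sub>R sigma_mat (m1 (snd z) (fst z)) - indicat_real {t<..s} (snd z) *\<^sub>R sigma_mat (m2 (snd z) (fst z)))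
      (\<lambda>\<omega>. I1 s \<omega> - I2 s \<omega>)"
      by (intro ito_lim_diff ito_lim_of_integral S1.I S2.I s t0 ts)
    have Yq: "(norm (?Y z))\<^sup>2 \<le> K\<^sup>2 * ?q s z" for z
    proof (cases "snd z \<in> {t<..s}")
        case True
        then have "snd z \<in> {t..T}" using ts by auto
        then have "norm (sigma_mat (m1 (snd z) (fst z)) - sigma_mat (m2 (snd z) (fst z))) \<le> K * norm (\<Delta> z)"
          using K(2) by (simp add: \<Delta>_def S1.mm_eq S2.mm_eq sigma_mat_diff[symmetric])
        then have "(norm (sigma_mat (m1 (snd z) (fst z)) - sigma_mat (m2 (snd z) (fst z))))\<^sup>2 \<le> K\<^sup>2 * (norm (\<Delta> z))\<^sup>2"
          unfolding power_mult_distrib[symmetric] by (intro power_mono) auto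
        then show ?thesis using True by simp
    qed simp
    note J = ito_lim_square[OF il integrable_mult_right[OF iq] Yq]
    have AEi: "AE \<omega> in P. integrable lborel (\<lambda>r. indicat_real {t<..s} r *\<^sub>R S1.\<gamma> (\<omega>, r))" "AE \<omega> in P. integrable lborel (\<lambda>r. indicat_real {t<..s} r *\<^sub>R S2.\<gamma> (\<omega>, r))"
      using PL.AE_integrable_fst'[OF S1.integrable_\<gamma>[OF ts(1,3)]] PL.AE_integrable_fst'[OF S2.integrable_\<gamma>[OF ts(1,3)]] by simp_all
    have [measurable]: "m1 s \<in> borel_measurable P" "m2 s \<in> borel_measurable P" using S1.m_meas S2.m_meas s by auto
    have "\<phi> s = expectation (\<lambda>\<omega>. (norm (m1 s \<omega> - m2 s \<omega>))\<^sup>2)" using s by (simp add: \<phi>_def \<Delta>_def S1.mm_eq S2.mm_eq)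
    also have "\<dots> \<le> expectation (\<lambda>\<omega>. 2 * (norm (drift ?d t s \<omega>))\<^sup>2 + 2 * \<nu>\<^sup>2 * (norm (I1 s \<omega> - I2 s \<omega>))\<^sup>2)"
    proof (rule integral_mono_AE)
      show "integrable P (\<lambda>\<omega>. 2 * (norm (drift ?d t s \<omega>))\<^sup>2 + 2 * \<nu>\<^sup>2 * (norm (I1 s \<omega> - I2 s \<omega>))\<^sup>2)"
        using D(1) J(1) by simp
      show "AE \<omega> in P. (norm (m1 s \<omega> - m2 s \<omega>))\<^sup>2 \<le> 2 * (norm (drift ?d t s \<omega>))\<^sup>2 + 2 * \<nu>\<^sup>2 * (norm (I1 s \<omega> - I2 s \<omega>))\<^sup>2"
        using S1.increment[OF ts(1-3)] S2.increment[OF ts(1-3)] S1.ito_start S2.ito_start S1.initial_value S2.initial_value AEi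
      proof eventually_elim
        case (elim \<omega>)
        have "drift ?d t s \<omega> = drift S1.\<gamma> t s \<omega> - drift S2.\<gamma> t s \<omega>"
          unfolding drift_def scaleR_diff_right by (rule Bochner_Integration.integral_diff[OF elim(7,8)])
        moreover have "m1 s \<omega> = m0 + (drift S1.\<gamma> t s \<omega> + \<nu> *\<^sub>R I1 s \<omega>)"
          using elim(1,3,5) by (simp add: algebra_simps)
        moreover have "m2 s \<omega> = m0 + (drift S2.\<gamma> t s \<omega> + \<nu> *\<^sub>R I2 s \<omega>)"
          using elim(2,4,6) by (simp add: algebra_simps)
        ultimately have e: "m1 s \<omega> - m2 s \<omega> = drift ?d t s \<omega> + \<nu> *\<^sub>R (I1 s \<omega> - I2 s \<omega>)" by (simp add: scaleR_diff_right)
        have "(norm (m1 s \<omega> - m2 s \<omega>))\<^sup>2 \<le> (norm (drift ?d t s \<omega>) + norm (\<nu> *\<^sub>R (I1 s \<omega> - I2 s \<omega>)))\<^sup>2"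
          unfolding e by (intro power_mono norm_triangle_ineq) auto
        also have "\<dots> \<le> 2 * (norm (drift ?d t s \<omega>))\<^sup>2 + 2 * (norm (\<nu> *\<^sub>R (I1 s \<omega> - I2 s \<omega>)))\<^sup>2"
          using zero_le_power2[of "norm (drift ?d t s \<omega>) - norm (\<nu> *\<^sub>R (I1 s \<omega> - I2 s \<omega>))"] unfolding power2_sum power2_diff by linarith
        also have "\<dots> = 2 * (norm (drift ?d t s \<omega>))\<^sup>2 + 2 * \<nu>\<^sup>2 * (norm (I1 s \<omega> - I2 s \<omega>))\<^sup>2" by (simp add: power_mult_distrib)
        finally show ?case .
      qed
      show "integrable P (\<lambda>\<omega>. (norm (m1 s \<omega> - m2 s \<omega>))\<^sup>2)"
      proof (rule integrable_const_bound[of _ "(2 * real CARD('n))\<^sup>2"])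
        show "AE \<omega> in P. norm ((norm (m1 s \<omega> - m2 s \<omega>))\<^sup>2) \<le> (2 * real CARD('n))\<^sup>2"
          using \<Delta>N[of "(_, s)"] s by (intro AE_I2) (simp add: \<Delta>_def S1.mm_eq S2.mm_eq)
      qed measurable
    qed
    also have "\<dots> = 2 * expectation (\<lambda>\<omega>. (norm (drift ?d t s \<omega>))\<^sup>2) + 2 * \<nu>\<^sup>2 * expectation (\<lambda>\<omega>. (norm (I1 s \<omega> - I2 s \<omega>))\<^sup>2)"
      using D(1) J(1) by simp
    also have "\<dots> \<le> 2 * (T * (L\<^sup>2 * integral\<^sup>L PL (?q s))) + 2 * \<nu>\<^sup>2 * (4 * (K\<^sup>2 * integral\<^sup>L PL (?q s)))"
      using D' J(2) by (intro add_mono mult_left_mono) auto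
    also have "\<dots> \<le> c * integral\<^sup>L PL (?q s)"
    proof -
      have "0 \<le> integral\<^sup>L PL (?q s)" by simp
      then show ?thesis by (simp add: c_def algebra_simps)
    qed
    finally show ?thesis unfolding \<phi>q(2) .
  qed
  have \<phi>M: "0 \<le> \<phi> r" "\<phi> r \<le> (2 * real CARD('n))\<^sup>2" for r
  proof -
    show "0 \<le> \<phi> r" by (simp add: \<phi>_def)
    have [measurable]: "(\<lambda>\<omega>. \<Delta> (\<omega>, r)) \<in> borel_measurable P"
      by (rule measurable_compose[OF measurable_Pair2'[of r lborel]]) auto
    have b: "(norm (\<Delta> (\<omega>, r)))\<^sup>2 \<le> (2 * real CARD('n))\<^sup>2" if "\<omega> \<in> space P" for \<omega> using \<Delta>N[of "(\<omega>, r)"] that by simp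
    have "integrable P (\<lambda>\<omega>. (norm (\<Delta> (\<omega>, r)))\<^sup>2)"
      by (rule integrable_const_bound[of _ "(2 * real CARD('n))\<^sup>2"]) (use b in auto)
    then have "\<phi> r \<le> expectation (\<lambda>\<omega>. (2 * real CARD('n))\<^sup>2)" unfolding \<phi>_def using b by (intro integral_mono) auto
    then show "\<phi> r \<le> (2 * real CARD('n))\<^sup>2" by (simp add: prob_space)
  qed
  have \<phi>0: "\<phi> r = 0" if "r \<in> {t..T}" for r
    by (rule gronwall_zero[OF c \<phi>M \<phi>q(1) \<phi>_le that])
  have "integral\<^sup>L PL (?q T) = (\<integral>r. 0 \<partial>(lborel :: real measure))"
    unfolding \<phi>q(2)[symmetric] using \<phi>0 by (intro Bochner_Integration.integral_cong refl) (auto simp: indicator_def)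
  then have "AE z in PL. ?q T z = 0"
    using integral_nonneg_eq_0_iff_AE[OF iq[of T]] by simp
  then show ?thesis
    using AE_PL_neq[of t]
  proof eventually_elim
    case (elim z)
    show ?case
    proof
      assume z: "snd z \<in> {t..T}"
      then have "snd z \<in> {t<..T}" using elim(2) by auto
      then have "\<Delta> z = 0" using elim(1) by simp
      then show "m1 (snd z) (fst z) = m2 (snd z) (fst z)" using z by (simp add: \<Delta>_def S1.mm_eq S2.mm_eq)
    qed
  qed
qed

section \<open>Optimality of the feedback pair\<close>

context controlled_pair
begin

context
  fixes \<delta> lam :: real and mt :: "real \<Rightarrow> 'n spins" and h :: "'n spins \<Rightarrow> real" and W :: "real \<Rightarrow> 'n spins \<Rightarrow> real"
  assumes hjb: "hjb_solution T \<alpha> Cext Q \<nu> \<delta> lam mt h W" and lam: "lam > 0" and mt: "C2_curve T mt"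
begin

lemma cost_ge: "W t m0 \<le> cost P T \<delta> lam mt h t (m, u)"
  unfolding cost_formula(2)[OF hjb lam mt] using lam by (simp add: integral_nonneg)

lemma cost_feedback:
  assumes "AE \<omega> in P. AE s in lborel. s \<in> {t..T} \<longrightarrow> u s \<omega> = feedback \<alpha> Cext lam W s (m s \<omega>)"
  shows "cost P T \<delta> lam mt h t (m, u) = W t m0"
proof -
  let ?d = "\<lambda>z. indicat_real {t<..T} (snd z) * (norm (uu z - feedback \<alpha> Cext lam W (rr z) (mm z)))\<^sup>2"
  note i = cost_formula(1)[OF hjb lam mt]
  \<comment> \<open>The hypothesis is almost sure in \<open>\<omega>\<close> and then almost
    everywhere in time, so the integral is evaluated in this order instead of through a null set of
    the product.\<close>
  have "integral\<^sup>L PL ?d = expectation (\<lambda>\<omega>. \<integral>r. ?d (\<omega>, r) \<partial>lborel)" by (rule PL.integral_fst'[OF i, symmetric])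
  also have "\<dots> = expectation (\<lambda>\<omega>. 0)"
  proof (rule integral_cong_AE)
    show "AE \<omega> in P. (\<integral>r. ?d (\<omega>, r) \<partial>lborel) = 0"
      using assms AE_space
    proof eventually_elim
      case (elim \<omega>)
      have "AE r in lborel. ?d (\<omega>, r) = 0"
        using elim(1)
      proof eventually_elim
        case (elim r)
        then show ?case using \<open>\<omega> \<in> space P\<close> by (cases "r \<in> {t<..T}") (auto simp: uu_eq rr_eq mm_eq)
      qed
      then show ?case by (rule integral_eq_zero_AE)
    qed
    show "(\<lambda>\<omega>. \<integral>r. ?d (\<omega>, r) \<partial>lborel) \<in> borel_measurable P" using PL.integrable_fst'[OF i] by blast
  qed simp
  finally show ?thesis unfolding cost_formula(2)[OF hjb lam mt] by simp
qed

text \<open>The excess over \<open>W t m0\<close> is the integral of a nonnegative function. If it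
  vanishes, the control is the feedback law almost everywhere, and the state then solves the closed
  loop equation.\<close>

lemma cost_minimal_feedback:
  assumes "cost P T \<delta> lam mt h t (m, u) = W t m0"
  shows "AE z in PL. snd z \<in> {t..T} \<longrightarrow> u (snd z) (fst z) = feedback \<alpha> Cext lam W (snd z) (m (snd z) (fst z))"
    "AE z in PL. snd z \<in> {t..T} \<longrightarrow> \<beta> z = closed_loop \<alpha> Cext Q lam W (snd z) (m (snd z) (fst z))"
proof -
  let ?d = "\<lambda>z. indicat_real {t<..T} (snd z) * (norm (uu z - feedback \<alpha> Cext lam W (rr z) (mm z)))\<^sup>2"
  have "integral\<^sup>L PL ?d = 0" using assms lam unfolding cost_formula(2)[OF hjb lam mt] by simp
  then have "AE z in PL. ?d z = 0"
    using integral_nonneg_eq_0_iff_AE[OF cost_formula(1)[OF hjb lam mt]] by simp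
  then show fb: "AE z in PL. snd z \<in> {t..T} \<longrightarrow> u (snd z) (fst z) = feedback \<alpha> Cext lam W (snd z) (m (snd z) (fst z))"
    using AE_PL_neq[of t] AE_space
  proof eventually_elim
    case (elim z)
    show ?case
    proof
      assume z: "snd z \<in> {t..T}"
      then have "snd z \<in> {t<..T}" using elim(2) by auto
      then have "uu z = feedback \<alpha> Cext lam W (rr z) (mm z)" using elim(1) by simp
      moreover have "uu z = u (snd z) (fst z)" using z elim(3) uu_eq[of "fst z" "snd z"] by (auto simp: space_pair_measure)
      ultimately show "u (snd z) (fst z) = feedback \<alpha> Cext lam W (snd z) (m (snd z) (fst z))" using z by (simp add: rr_eq mm_eq)
    qed
  qed
  show "AE z in PL. snd z \<in> {t..T} \<longrightarrow> \<beta> z = closed_loop \<alpha> Cext Q lam W (snd z) (m (snd z) (fst z))"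
    using fb AE_space
  proof eventually_elim
    case (elim z)
    then show ?case using \<beta>_eq[of "fst z" "snd z"] by (auto simp: closed_loop_def space_pair_measure)
  qed
qed

end
end

theorem theorem3p3:
  fixes P :: "'a measure" and F :: "real \<Rightarrow> 'a measure"
    and B :: "real \<Rightarrow> 'a \<Rightarrow> 'n::finite spins"
    and T lam \<nu> \<alpha> \<delta> Cext :: real
    and J D Q :: "'n spin_mat"
    and h :: "'n spins \<Rightarrow> real" and mt :: "real \<Rightarrow> 'n spins"
    and W :: "real \<Rightarrow> 'n spins \<Rightarrow> real"
    and t :: real and m0 :: "'n spins"
    and mS uS :: "real \<Rightarrow> 'a \<Rightarrow> 'n spins"
  assumes "T > 0" and "lam > 0" and "\<nu> \<ge> 0" and "\<alpha> \<ge> 0" and "\<delta> \<ge> 0"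
    and "symmetric_psd J" and "diagonal_mat D" and "Q = J + D"
    and "C2_M h" and "C2_curve T mt"
    and "prob_space P" and "usual_filtration P F T" and "wiener_process P F T B"
    and "hjb_solution T \<alpha> Cext Q \<nu> \<delta> lam mt h W"
    and "t \<in> {0..T}" and "m0 \<in> sphere_prod"
    and "(mS, uS) \<in> admissible_pairs P F B T \<alpha> Cext Q \<nu> t m0"
    and "solves_sllg P F B T \<alpha> Cext Q \<nu> t m0 (\<lambda>s \<omega>. feedback \<alpha> Cext lam W s (mS s \<omega>)) mS"
    and "AE \<omega> in P. AE s in lborel. s \<in> {t..T} \<longrightarrow> uS s \<omega> = feedback \<alpha> Cext lam W s (mS s \<omega>)"
  shows "optimal_pair (cost P T \<delta> lam mt h t) (admissible_pairs P F B T \<alpha> Cext Q \<nu> t m0) (mS, uS) \<and>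
    (\<forall>m1 u1. optimal_pair (cost P T \<delta> lam mt h t)
        (admissible_pairs P F B T \<alpha> Cext Q \<nu> t m0) (m1, u1) \<longrightarrow>
      (AE \<omega> in P. AE s in lborel. s \<in> {t..T} \<longrightarrow> mS s \<omega> = m1 s \<omega> \<and> uS s \<omega> = u1 s \<omega>))"
proof -
  note lam = assms(2) and nu = assms(3) and mt = assms(10) and hjb = assms(14) and t = assms(15)
  have fw: "filtered_wiener P F B T"
    using assms(11-13) by (simp add: filtered_wiener_def filtered_wiener_axioms_def)
  interpret filtered_wiener P F B T by (rule fw)
  let ?U = "admissible_pairs P F B T \<alpha> Cext Q \<nu> t m0" and ?J = "cost P T \<delta> lam mt h t"
  note pair = controlled_pair_of_admissible[OF fw t nu]
  obtain IS \<beta>S CS where S: "controlled_pair P F B T t mS IS \<nu> m0 \<beta>S CS \<alpha> Cext Q uS"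
    using pair[OF assms(17)] by (elim exE)
  have costS: "?J (mS, uS) = W t m0"
    by (rule controlled_pair.cost_feedback[OF S hjb lam mt assms(19)])
  have ge: "W t m0 \<le> ?J p" if p: "p \<in> ?U" for p
  proof -
    obtain m u where mu: "p = (m, u)" by (cases p)
    obtain I \<beta> C where "controlled_pair P F B T t m I \<nu> m0 \<beta> C \<alpha> Cext Q u"
      using pair[OF p[unfolded mu]] by (elim exE)
    from controlled_pair.cost_ge[OF this hjb lam mt] show ?thesis by (simp add: mu)
  qed
  have opt: "optimal_pair ?J ?U (mS, uS)"
    using assms(17) ge costS by (simp add: optimal_pair_def)
  have "AE \<omega> in P. AE s in lborel. s \<in> {t..T} \<longrightarrow> mS s \<omega> = m1 s \<omega> \<and> uS s \<omega> = u1 s \<omega>"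
    if "optimal_pair ?J ?U (m1, u1)" for m1 u1
  proof -
    have 1: "(m1, u1) \<in> ?U" using that by (simp add: optimal_pair_def)
    have "?J (m1, u1) \<le> ?J (mS, uS)" using that assms(17) by (simp add: optimal_pair_def)
    \<comment> \<open>The feedback pair attains the lower bound \<open>W t m0\<close>, so any other
      optimal pair attains it too.\<close>
    with ge[OF 1] costS have c1: "?J (m1, u1) = W t m0" by simp
    obtain I1 \<beta>1 C1 where P1: "controlled_pair P F B T t m1 I1 \<nu> m0 \<beta>1 C1 \<alpha> Cext Q u1"
      using pair[OF 1] by (elim exE)
    note fS = controlled_pair.cost_minimal_feedback[OF S hjb lam mt costS]
      and f1 = controlled_pair.cost_minimal_feedback[OF P1 hjb lam mt c1]
    have W: "C12_M T W" using hjb by (simp add: hjb_solution_def)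
    have "AE z in P \<Otimes>\<^sub>M lborel. snd z \<in> {t..T} \<longrightarrow> mS (snd z) (fst z) = m1 (snd z) (fst z)"
      \<comment> \<open>Both states solve the closed loop equation with the same noise and the same
        initial value.\<close>
      by (rule pathwise_uniqueness[OF controlled_pair.axioms(1)[OF S] controlled_pair.axioms(1)[OF P1]
            bounded_lipschitz_closed_loop[OF W] fS(2) f1(2)])
    then have "AE z in P \<Otimes>\<^sub>M lborel. snd z \<in> {t..T} \<longrightarrow> mS (snd z) (fst z) = m1 (snd z) (fst z) \<and> uS (snd z) (fst z) = u1 (snd z) (fst z)"
      using fS(1) f1(1) by eventually_elim simp
    \<comment> \<open>Almost everywhere slices of a null set of the product are null sets, which
      restores the iterated form of the claim.\<close>
    from PL.AE_pair[OF this] show ?thesis by simp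
  qed
  with opt show ?thesis by blast
qed

end
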